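(* Let $\mathcal{G}$ be an $SU(3)$ $\mathcal{ADE}$ graph with adjacency matrix $\Delta_{\mathcal{G}}$ and Coxeter number $h=k+3$, let $W$ be a cell system on $\mathcal{G}$, and let $H_A(t)$ be the (matrix-valued) Hilbert series of the algebra $A=A(\mathcal{G},W)$. Then $$H_A(t)=\frac{1-Pt^h}{1-\Delta_{\mathcal{G}}t+\Delta_{\mathcal{G}}^Tt^2-t^3},$$ where $P$ is the permutation matrix corresponding to a $\mathbb{Z}_3$ symmetry of the graph. It is the identity for $\mathcal{D}^{(n)}$ and $\mathcal{A}^{(n)\ast}$ ($n\geq 5$), $\mathcal{E}^{(8)\ast}$, $\mathcal{E}_l^{(12)}$ ($l=1,2,4,5$) and $\mathcal{E}^{(24)}$. For the remaining graphs $\mathcal{A}^{(n)}$, $\mathcal{D}^{(n)\ast}$ and $\mathcal{E}^{(8)}$, let $V$ be the permutation matrix corresponding to the rotation $\mathbf{r}$ of the graph by $2\pi/3$ specified in the context. Then $P=V^2$ for $\mathcal{A}^{(n)}$, $n\geq 4$; $P=V$ for $\mathcal{E}^{(8)}$; and $P=V^{2n}$ for $\mathcal{D}^{(n)\ast}$, $n\geq 5$.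
   Context: Graphs. All graphs are finite directed graphs; $\mathcal{G}_0$, $\mathcal{G}_1$ are the sets of vertices and edges, and $s(a)$, $r(a)$ are the source and range of an edge $a$. Edges listed below are single unless marked double. The $SU(3)$ $\mathcal{ADE}$ graphs, with Coxeter number $h$, are: (1) $\mathcal{A}^{(n)}$, $n\ge 4$, $h=n$: vertices $(p,l)$ with integers $p,l\ge0$, $p+l\le n-3$; edges $(p,l)\to(p+1,l)$, $(p,l)\to(p-1,l+1)$, $(p,l)\to(p,l-1)$ whenever the target is a vertex. (2) $\mathcal{D}^{(n)}$, $n\ge5$, $h=n$: the $\mathbb{Z}_3$ orbifold of $\mathcal{A}^{(n)}$ under $\mathbf{r}(p,l)=(n-3-p-l,p)$. The vertices are the $\mathbf{r}$-orbits of size 3, together with, if $n=3k'+3$, three vertices $(k',k')_1,(k',k')_2,(k',k')_3$ replacing the fixed point $(k',k')$. The number of edges from an orbit $[x]$ to an orbit $[y]$ (both of size 3) is the number of edges of $\mathcal{A}^{(n)}$ from $x$ to elements of $[y]$; there is one edge from $[x]$ to each $(k',k')_m$ if some element of $[x]$ has an edge to $(k',k')$, and one edge from each $(k',k')_m$ to $[x]$ if $(k',k')$ has an edge to some element of $[x]$. (3) $\mathcal{A}^{(n)\ast}$, $n\ge5$, $h=n$: vertices $1,\dots,p$ with $p=\lfloor (n-1)/2\rfloor$; edges $a\to a+1$ and $a+1\to a$ for $1\le a\le p-1$; one loop at each vertex if $n$ is even, and one loop at each vertex except $p$ if $n$ is odd. (4) $\mathcal{D}^{(n)\ast}$, $n\ge5$,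 $h=n$: vertices $m_c$ with $m$ a vertex of $\mathcal{A}^{(n)\ast}$ and $c\in\mathbb{Z}/3$; an edge $m_c\to m'_{c+1}$ for each edge $m\to m'$ of $\mathcal{A}^{(n)\ast}$ and each $c$. (5) $\mathcal{E}^{(8)\ast}$, $h=8$: vertices $1,2,3,4$; edges $1\to2$; $2\to2,3,4$; $3\to1,2,3$; $4\to3$. (6) $\mathcal{E}^{(8)}$, $h=8$: vertices $x_c$, $x\in\{1,2,3,4\}$, $c\in\mathbb{Z}/3$; an edge $x_c\to y_{c+1}$ for each edge $x\to y$ of $\mathcal{E}^{(8)\ast}$. (7) $\mathcal{E}_1^{(12)}$, $h=12$: vertices $i_s,j_s,k_s$ ($s=1,2,3$), $p,q,r$; edges $i_s\to j_s$, $j_s\to k_s$, $k_s\to i_s$, $j_s\to r$, $p\to j_s$, $q\to k_s$, $k_s\to p$, $q\to r$, a double edge $r\to p$ and a double edge $p\to q$. (8) $\mathcal{E}_2^{(12)}$, $h=12$: vertices $i,j,k$, $p_s,q_s,r_s$ ($s=1,2,3$); edges $i\to j$, $j\to k$, $k\to i$; $j\to r_s$, $p_s\to j$, $q_s\to k$, $k\to p_s$ for all $s$; $r_1\to p_1,p_3$; $r_2\to p_1,p_2$; $r_3\to p_2,p_3$; $p_1\to q_1,q_3$; $p_2\to q_1,q_2$; $p_3\to q_2,q_3$; $q_1\to r_2$; $q_2\to r_3$; $q_3\to r_1$. (9) $\mathcal{E}_4^{(12)}$, $h=12$: vertices $x_1,\dots,x_5$, $a,b,c$, $a',b',c'$;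 edges $x_m\to a$ ($1\le m\le5$), $x_1,x_2,x_3\to b$, $x_1\to c$; a double edge $a\to a'$, edges $a\to b'$, $b\to a'$, $b\to b'$, $b\to c'$, $c\to b'$; $a'\to x_m$ ($1\le m\le 5$), $b'\to x_1,x_2,x_3$, $c'\to x_1$. (10) $\mathcal{E}_5^{(12)}$, $h=12$: vertices $1,\dots,17$; edges $1\to6,7,8$; $2\to6,7,9$; $3\to7,8,11$; $4\to7,10$; $5\to8,9$; $6\to12,13$; $7\to12,13,14,15$; $8\to13,14,17$; $9\to13,16$; $10\to15$; $11\to14$; $12\to1,2$; $13\to1,2,3,5$; $14\to1,3,4$; $15\to2,4$; $16\to5$; $17\to3$. (11) $\mathcal{E}^{(24)}$, $h=24$: vertices $1,\dots,24$; edges $1\to9$; $2\to9,10,11$; $3\to10,12,14$; $4\to11,12,14$; $5\to11,13,14$; $6\to11,13,15$; $7\to14,15,16$; $8\to16$; $9\to17,18$; $10\to17,19$; $11\to18,19,20,22$; $12\to19,21$; $13\to20,22$; $14\to19,21,22,23$; $15\to22,24$; $16\to23,24$; $17\to1,2$; $18\to2,6$; $19\to2,3,4,5$; $20\to5,6$; $21\to3,4$; $22\to4,5,6,7$; $23\to3,7$; $24\to7,8$. Rotations: $\mathbf{r}(p,l)=(n-3-p-l,p)$ for $\mathcal{A}^{(n)}$; $\mathbf{r}(m_c)=m_{c+1}$ for $\mathcal{D}^{(n)\ast}$; $\mathbf{r}(x_c)=x_{c+1}$ for $\mathcal{E}^{(8)}$. Cell systems. Let $[2]=2\cos(\pi/h)$,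 $[3]=1+2\cos(2\pi/h)$, and let $(\phi_i)_{i\in\mathcal{G}_0}$ be a Perron-Frobenius eigenvector of $\mathcal{G}$ (eigenvalue $[3]$, all $\phi_i>0$). A cell system $W$ on $\mathcal{G}$ assigns a complex number $W_{i,j,k}^{(a,b,c)}$ to each closed path $i\stackrel{a}{\to}j\stackrel{b}{\to}k\stackrel{c}{\to}i$ of length 3, invariant under cyclic permutation of $(a,b,c)$, such that: (I) for all edges $a,a'$ from $i$ to $j$, $\sum_{k,b,c}W_{i,j,k}^{(a,b,c)}\overline{W_{i,j,k}^{(a',b,c)}}=\delta_{a,a'}[2]\phi_i\phi_j$; (II) for all vertices $i_1,i_2,i_3,i_4$ and edges $a_1:i_1\to i_2$, $a_2:i_3\to i_2$, $a_3:i_3\to i_4$, $a_4:i_1\to i_4$, $$\sum_{k,b_1,b_2,b_3,b_4}\phi_k^{-1}W_{i_1,i_2,k}^{(a_1,b_2,b_1)}\overline{W_{i_3,i_2,k}^{(a_2,b_2,b_3)}}W_{i_3,i_4,k}^{(a_3,b_4,b_3)}\overline{W_{i_1,i_4,k}^{(a_4,b_4,b_1)}}=\delta_{a_1,a_4}\delta_{a_2,a_3}\phi_{i_1}\phi_{i_2}\phi_{i_3}+\delta_{a_1,a_2}\delta_{a_3,a_4}\phi_{i_1}\phi_{i_2}\phi_{i_4},$$ the sum being over all vertices $k$ and edges $b_2:i_2\to k$, $b_4:i_4\to k$, $b_1:k\to i_1$, $b_3:k\to i_3$. The algebra. $\mathbb{C}\mathcal{G}$ is the path algebra of $\mathcal{G}$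 graded by path length, with multiplication by concatenation ($xy=0$ unless $r(x)=s(y)$; vertices are the paths of length 0). For $a\in\mathcal{G}_1$ put $\rho_a=\sum_{b,b'}W_{s(a),r(a),r(b)}^{(a,b,b')}\,bb'$, summed over all $b,b'\in\mathcal{G}_1$ such that $abb'$ is a closed path of length 3. Then $A(\mathcal{G},W)=\mathbb{C}\mathcal{G}/\langle\rho_a:a\in\mathcal{G}_1\rangle$ (quotient by the two-sided ideal), with the induced grading $A=\bigoplus_pA_p$. Matrix conventions. $H_A(t)=\sum_{p\ge0}H^pt^p$, where $H^p$ is the matrix indexed by $\mathcal{G}_0$ with entries $H^p_{ji}=\dim(i\cdot A_p\cdot j)$; the entry $(\Delta_{\mathcal{G}})_{ji}$ is the number of edges from $i$ to $j$; $V$ has entries $V_{i,\mathbf{r}(i)}=1$ and all other entries $0$. The quotient denotes multiplication by the inverse matrix power series (numerator and denominator commute), and $1$ denotes the identity matrix. *)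

theory Defs
  imports
    "HOL-Algebra.Embedded_Algebras"
    "HOL-Algebra.QuotRing"
    "HOL-Library.Poly_Mapping"
    "HOL-Computational_Algebra.Formal_Power_Series"
    "Graph_Theory.Arc_Walk"
    "Jordan_Normal_Form.Matrix"
    Complex_Main
begin

section \<open>Finite directed multigraphs\<close>

text \<open>The graph on \<open>V\<close> with \<open>m u v\<close> parallel arcs from \<open>u\<close> to \<open>v\<close>; the third component
  of an arc tells parallel arcs apart.\<close>

definition multigraph :: "'v set \<Rightarrow> ('v \<Rightarrow> 'v \<Rightarrow> nat) \<Rightarrow> ('v, 'v \<times> 'v \<times> nat) pre_digraph" where
  "multigraph V m =
     \<lparr>verts = V, arcs = {(u, v, t). u \<in> V \<and> v \<in> V \<and> t < m u v},
      tail = (\<lambda>(u, v, t). u), head = (\<lambda>(u, v, t). v)\<rparr>"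

definition arcs_from_to :: "('v, 'e) pre_digraph \<Rightarrow> 'v \<Rightarrow> 'v \<Rightarrow> 'e set" where
  "arcs_from_to G u v = {a \<in> arcs G. tail G a = u \<and> head G a = v}"

definition num_arcs :: "('v, 'e) pre_digraph \<Rightarrow> 'v \<Rightarrow> 'v \<Rightarrow> nat" where
  "num_arcs G u v = card (arcs_from_to G u v)"

definition triangles :: "('v, 'e) pre_digraph \<Rightarrow> ('e \<times> 'e \<times> 'e) set" where
  "triangles G = {(a, b, c). a \<in> arcs G \<and> b \<in> arcs G \<and> c \<in> arcs G \<and>
     head G a = tail G b \<and> head G b = tail G c \<and> head G c = tail G a}"

section \<open>The $SU(3)$ $\mathcal{ADE}$ graphs\<close>

datatype letter = L_i | L_j | L_k | L_p | L_q | L_r | L_x | L_a | L_b | L_c | L_a' | L_b' | L_c'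

text \<open>One vertex type for all the graphs: \<open>Lat p l\<close> is $(p,l)$, \<open>Orb X\<close> the rotation orbit \<open>X\<close>,
  \<open>Split k m\<close> is $(k,k)_m$, \<open>Num m\<close> is $m$, \<open>Col m c\<close> is $m_c$ with \<open>c < 3\<close> representing an
  element of $\mathbb{Z}/3$, \<open>Sym x\<close> is the vertex named $x$ and \<open>Sub x s\<close> is $x_s$.\<close>

datatype su3_vertex =
    Lat nat nat
  | Orb "(nat \<times> nat) set"
  | Split nat nat
  | Num nat
  | Col nat nat
  | Sym letter
  | Sub letter nat

type_synonym su3_arc = "su3_vertex \<times> su3_vertex \<times> nat"
type_synonym su3_digraph = "(su3_vertex, su3_arc) pre_digraph"

subsection \<open>$\mathcal{A}^{(n)}$ and $\mathcal{D}^{(n)}$\<close>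

definition lattice_points :: "nat \<Rightarrow> (nat \<times> nat) set" where
  "lattice_points n = {(p, l). p + l \<le> n - 3}"

text \<open>The steps are $(1,0)$, $(-1,1)$ and $(0,-1)$, written without subtraction.\<close>

fun lattice_edge :: "nat \<times> nat \<Rightarrow> nat \<times> nat \<Rightarrow> bool" where
  "lattice_edge (p, l) (p', l') \<longleftrightarrow>
     p' = p + 1 \<and> l' = l \<or> p = p' + 1 \<and> l' = l + 1 \<or> p' = p \<and> l = l' + 1"

fun lattice_rotation :: "nat \<Rightarrow> nat \<times> nat \<Rightarrow> nat \<times> nat" where
  "lattice_rotation n (p, l) = (n - 3 - p - l, p)"

definition rotation_orbit :: "nat \<Rightarrow> nat \<times> nat \<Rightarrow> (nat \<times> nat) set" where
  "rotation_orbit n x =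
     {x, lattice_rotation n x, lattice_rotation n (lattice_rotation n x)}"

fun A_mult :: "su3_vertex \<Rightarrow> su3_vertex \<Rightarrow> nat" where
  "A_mult (Lat p l) (Lat p' l') = (if lattice_edge (p, l) (p', l') then 1 else 0)"
| "A_mult _ _ = 0"

definition A_graph :: "nat \<Rightarrow> su3_digraph" where
  "A_graph n = multigraph {Lat p l |p l. (p, l) \<in> lattice_points n} A_mult"

text \<open>The number of arcs between two orbits does not depend on the choice of the element of the
  first one.\<close>

fun D_mult :: "su3_vertex \<Rightarrow> su3_vertex \<Rightarrow> nat" where
  "D_mult (Orb X) (Orb Y) = card {y \<in> Y. lattice_edge (SOME x. x \<in> X) y}"
| "D_mult (Orb X) (Split k m) = (if \<exists>x\<in>X. lattice_edge x (k, k) then 1 else 0)"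
| "D_mult (Split k m) (Orb X) = (if \<exists>x\<in>X. lattice_edge (k, k) x then 1 else 0)"
| "D_mult _ _ = 0"

definition D_graph :: "nat \<Rightarrow> su3_digraph" where
  "D_graph n = multigraph
     ({Orb (rotation_orbit n x) |x. x \<in> lattice_points n \<and> card (rotation_orbit n x) = 3} \<union>
      {Split k m |k m. n = 3 * k + 3 \<and> m \<in> {1, 2, 3}})
     D_mult"

subsection \<open>Graphs on numbered vertices and their three-colourings\<close>

fun num_mult :: "(nat \<Rightarrow> nat \<Rightarrow> nat) \<Rightarrow> su3_vertex \<Rightarrow> su3_vertex \<Rightarrow> nat" where
  "num_mult m (Num x) (Num y) = m x y"
| "num_mult m _ _ = 0"

fun col_mult :: "(nat \<Rightarrow> nat \<Rightarrow> nat) \<Rightarrow> su3_vertex \<Rightarrow> su3_vertex \<Rightarrow> nat" where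
  "col_mult m (Col x c) (Col y d) = (if d = (c + 1) mod 3 then m x y else 0)"
| "col_mult m _ _ = 0"

definition numbered :: "nat set \<Rightarrow> (nat \<Rightarrow> nat \<Rightarrow> nat) \<Rightarrow> su3_digraph" where
  "numbered V m = multigraph (Num ` V) (num_mult m)"

definition coloured :: "nat set \<Rightarrow> (nat \<Rightarrow> nat \<Rightarrow> nat) \<Rightarrow> su3_digraph" where
  "coloured V m = multigraph {Col x c |x c. x \<in> V \<and> c < 3} (col_mult m)"

definition Astar_size :: "nat \<Rightarrow> nat" where
  "Astar_size n = (n - 1) div 2"

definition Astar_mult :: "nat \<Rightarrow> nat \<Rightarrow> nat \<Rightarrow> nat" where
  "Astar_mult n x y =
     (if x = y then (if even n \<or> x \<noteq> Astar_size n then 1 else 0)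
      else if y = x + 1 \<or> x = y + 1 then 1 else 0)"

text \<open>An adjacency list pairs each vertex with the list of the ranges of its outgoing arcs; a
  double arc is listed twice.\<close>

definition adj_mult :: "('v \<times> 'v list) list \<Rightarrow> 'v \<Rightarrow> 'v \<Rightarrow> nat" where
  "adj_mult xs u v = (\<Sum>(x, ys)\<leftarrow>xs. if x = u then count_list ys v else 0)"

definition adj_verts :: "('v \<times> 'v list) list \<Rightarrow> 'v set" where
  "adj_verts xs = fst ` set xs \<union> (\<Union>(x, ys)\<in>set xs. set ys)"

definition adj_graph :: "('v \<times> 'v list) list \<Rightarrow> ('v, 'v \<times> 'v \<times> nat) pre_digraph" where
  "adj_graph xs = multigraph (adj_verts xs) (adj_mult xs)"

definition E8star_adj :: "(nat \<times> nat list) list" where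
  "E8star_adj = [(1, [2]), (2, [2, 3, 4]), (3, [1, 2, 3]), (4, [3])]"

definition E12_1_adj :: "(su3_vertex \<times> su3_vertex list) list" where
  "E12_1_adj =
     map (\<lambda>s. (Sub L_i s, [Sub L_j s])) [1, 2, 3] @
     map (\<lambda>s. (Sub L_j s, [Sub L_k s, Sym L_r])) [1, 2, 3] @
     map (\<lambda>s. (Sub L_k s, [Sub L_i s, Sym L_p])) [1, 2, 3] @
     [(Sym L_p, [Sub L_j 1, Sub L_j 2, Sub L_j 3, Sym L_q, Sym L_q]),
      (Sym L_q, [Sub L_k 1, Sub L_k 2, Sub L_k 3, Sym L_r]),
      (Sym L_r, [Sym L_p, Sym L_p])]"

definition E12_2_adj :: "(su3_vertex \<times> su3_vertex list) list" where
  "E12_2_adj =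
     [(Sym L_i, [Sym L_j]),
      (Sym L_j, [Sym L_k, Sub L_r 1, Sub L_r 2, Sub L_r 3]),
      (Sym L_k, [Sym L_i, Sub L_p 1, Sub L_p 2, Sub L_p 3]),
      (Sub L_p 1, [Sym L_j, Sub L_q 1, Sub L_q 3]),
      (Sub L_p 2, [Sym L_j, Sub L_q 1, Sub L_q 2]),
      (Sub L_p 3, [Sym L_j, Sub L_q 2, Sub L_q 3]),
      (Sub L_q 1, [Sym L_k, Sub L_r 2]),
      (Sub L_q 2, [Sym L_k, Sub L_r 3]),
      (Sub L_q 3, [Sym L_k, Sub L_r 1]),
      (Sub L_r 1, [Sub L_p 1, Sub L_p 3]),
      (Sub L_r 2, [Sub L_p 1, Sub L_p 2]),
      (Sub L_r 3, [Sub L_p 2, Sub L_p 3])]"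

definition E12_4_adj :: "(su3_vertex \<times> su3_vertex list) list" where
  "E12_4_adj =
     [(Sub L_x 1, [Sym L_a, Sym L_b, Sym L_c]),
      (Sub L_x 2, [Sym L_a, Sym L_b]),
      (Sub L_x 3, [Sym L_a, Sym L_b]),
      (Sub L_x 4, [Sym L_a]),
      (Sub L_x 5, [Sym L_a]),
      (Sym L_a, [Sym L_a', Sym L_a', Sym L_b']),
      (Sym L_b, [Sym L_a', Sym L_b', Sym L_c']),
      (Sym L_c, [Sym L_b']),
      (Sym L_a', [Sub L_x 1, Sub L_x 2, Sub L_x 3, Sub L_x 4, Sub L_x 5]),
      (Sym L_b', [Sub L_x 1, Sub L_x 2, Sub L_x 3]),
      (Sym L_c', [Sub L_x 1])]"

definition E12_5_adj :: "(nat \<times> nat list) list" where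
  "E12_5_adj =
     [(1, [6, 7, 8]), (2, [6, 7, 9]), (3, [7, 8, 11]), (4, [7, 10]), (5, [8, 9]),
      (6, [12, 13]), (7, [12, 13, 14, 15]), (8, [13, 14, 17]), (9, [13, 16]), (10, [15]),
      (11, [14]), (12, [1, 2]), (13, [1, 2, 3, 5]), (14, [1, 3, 4]), (15, [2, 4]),
      (16, [5]), (17, [3])]"

definition E24_adj :: "(nat \<times> nat list) list" where
  "E24_adj =
     [(1, [9]), (2, [9, 10, 11]), (3, [10, 12, 14]), (4, [11, 12, 14]), (5, [11, 13, 14]),
      (6, [11, 13, 15]), (7, [14, 15, 16]), (8, [16]),
      (9, [17, 18]), (10, [17, 19]), (11, [18, 19, 20, 22]), (12, [19, 21]), (13, [20, 22]),
      (14, [19, 21, 22, 23]), (15, [22, 24]), (16, [23, 24]),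
      (17, [1, 2]), (18, [2, 6]), (19, [2, 3, 4, 5]), (20, [5, 6]), (21, [3, 4]),
      (22, [4, 5, 6, 7]), (23, [3, 7]), (24, [7, 8])]"

definition numbered_adj :: "(nat \<times> nat list) list \<Rightarrow> su3_digraph" where
  "numbered_adj xs = numbered (adj_verts xs) (adj_mult xs)"

subsection \<open>The list of graphs\<close>

datatype su3_ade =
    SU3_A nat | SU3_D nat | SU3_Astar nat | SU3_Dstar nat
  | SU3_E8star | SU3_E8 | SU3_E12_1 | SU3_E12_2 | SU3_E12_4 | SU3_E12_5 | SU3_E24

fun admissible :: "su3_ade \<Rightarrow> bool" where
  "admissible (SU3_A n) \<longleftrightarrow> n \<ge> 4"
| "admissible (SU3_D n) \<longleftrightarrow> n \<ge> 5"
| "admissible (SU3_Astar n) \<longleftrightarrow> n \<ge> 5"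
| "admissible (SU3_Dstar n) \<longleftrightarrow> n \<ge> 5"
| "admissible _ \<longleftrightarrow> True"

fun su3_graph :: "su3_ade \<Rightarrow> su3_digraph" where
  "su3_graph (SU3_A n) = A_graph n"
| "su3_graph (SU3_D n) = D_graph n"
| "su3_graph (SU3_Astar n) = numbered {1..Astar_size n} (Astar_mult n)"
| "su3_graph (SU3_Dstar n) = coloured {1..Astar_size n} (Astar_mult n)"
| "su3_graph SU3_E8star = numbered_adj E8star_adj"
| "su3_graph SU3_E8 = coloured (adj_verts E8star_adj) (adj_mult E8star_adj)"
| "su3_graph SU3_E12_1 = adj_graph E12_1_adj"
| "su3_graph SU3_E12_2 = adj_graph E12_2_adj"
| "su3_graph SU3_E12_4 = adj_graph E12_4_adj"
| "su3_graph SU3_E12_5 = numbered_adj E12_5_adj"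
| "su3_graph SU3_E24 = numbered_adj E24_adj"

fun coxeter_number :: "su3_ade \<Rightarrow> nat" where
  "coxeter_number (SU3_A n) = n"
| "coxeter_number (SU3_D n) = n"
| "coxeter_number (SU3_Astar n) = n"
| "coxeter_number (SU3_Dstar n) = n"
| "coxeter_number SU3_E8star = 8"
| "coxeter_number SU3_E8 = 8"
| "coxeter_number SU3_E12_1 = 12"
| "coxeter_number SU3_E12_2 = 12"
| "coxeter_number SU3_E12_4 = 12"
| "coxeter_number SU3_E12_5 = 12"
| "coxeter_number SU3_E24 = 24"

text \<open>The rotations of $\mathcal{A}^{(n)}$ and of the three-coloured graphs; the values on vertices
  of other graphs play no role.\<close>

fun A_rotation :: "nat \<Rightarrow> su3_vertex \<Rightarrow> su3_vertex" where
  "A_rotation n (Lat p l) = (case lattice_rotation n (p, l) of (p', l') \<Rightarrow> Lat p' l')"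
| "A_rotation n v = v"

fun colour_rotation :: "su3_vertex \<Rightarrow> su3_vertex" where
  "colour_rotation (Col x c) = Col x ((c + 1) mod 3)"
| "colour_rotation v = v"

definition z3_symmetry :: "('v, 'e) pre_digraph \<Rightarrow> ('v \<Rightarrow> 'v) \<Rightarrow> bool" where
  "z3_symmetry G \<sigma> \<longleftrightarrow>
     bij_betw \<sigma> (verts G) (verts G) \<and>
     (\<forall>u\<in>verts G. \<forall>v\<in>verts G. num_arcs G (\<sigma> u) (\<sigma> v) = num_arcs G u v) \<and>
     (\<forall>v\<in>verts G. \<sigma> (\<sigma> (\<sigma> v)) = v)"

section \<open>Cell systems\<close>

definition quantum2 :: "nat \<Rightarrow> real" where
  "quantum2 h = 2 * cos (pi / real h)"

definition quantum3 :: "nat \<Rightarrow> real" where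
  "quantum3 h = 1 + 2 * cos (2 * pi / real h)"

text \<open>The eigenvector equation is that of the adjacency matrix whose entry with index $(j,i)$ is the
  number of arcs from $i$ to $j$.\<close>

definition perron_frobenius :: "('v, 'e) pre_digraph \<Rightarrow> nat \<Rightarrow> ('v \<Rightarrow> real) \<Rightarrow> bool" where
  "perron_frobenius G h \<phi> \<longleftrightarrow>
     (\<forall>i\<in>verts G. \<phi> i > 0) \<and>
     (\<forall>j\<in>verts G. (\<Sum>i\<in>verts G. real (num_arcs G i j) * \<phi> i) = quantum3 h * \<phi> j)"

text \<open>The vertices of a closed path are determined by its arcs, so the value
  $W_{i,j,k}^{(a,b,c)}$ is written \<open>W a b c\<close>; only values on triangles are ever used.\<close>

definition cell_system ::
  "('v, 'e) pre_digraph \<Rightarrow> nat \<Rightarrow> ('v \<Rightarrow> real) \<Rightarrow> ('e \<Rightarrow> 'e \<Rightarrow> 'e \<Rightarrow> complex) \<Rightarrow> bool" where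
  "cell_system G h \<phi> W \<longleftrightarrow>
     (\<forall>(a, b, c)\<in>triangles G. W a b c = W b c a) \<and>
     (\<forall>i\<in>verts G. \<forall>j\<in>verts G. \<forall>a\<in>arcs_from_to G i j. \<forall>a'\<in>arcs_from_to G i j.
        (\<Sum>k\<in>verts G. \<Sum>b\<in>arcs_from_to G j k. \<Sum>c\<in>arcs_from_to G k i.
           W a b c * cnj (W a' b c)) =
        of_real ((if a = a' then 1 else 0) * quantum2 h * \<phi> i * \<phi> j)) \<and>
     (\<forall>i1\<in>verts G. \<forall>i2\<in>verts G. \<forall>i3\<in>verts G. \<forall>i4\<in>verts G.
      \<forall>a1\<in>arcs_from_to G i1 i2. \<forall>a2\<in>arcs_from_to G i3 i2.
      \<forall>a3\<in>arcs_from_to G i3 i4. \<forall>a4\<in>arcs_from_to G i1 i4.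
        (\<Sum>k\<in>verts G. \<Sum>b1\<in>arcs_from_to G k i1. \<Sum>b2\<in>arcs_from_to G i2 k.
         \<Sum>b3\<in>arcs_from_to G k i3. \<Sum>b4\<in>arcs_from_to G i4 k.
           of_real (inverse (\<phi> k)) *
           W a1 b2 b1 * cnj (W a2 b2 b3) * W a3 b4 b3 * cnj (W a4 b4 b1)) =
        of_real ((if a1 = a4 \<and> a2 = a3 then 1 else 0) * \<phi> i1 * \<phi> i2 * \<phi> i3 +
                 (if a1 = a2 \<and> a3 = a4 then 1 else 0) * \<phi> i1 * \<phi> i2 * \<phi> i4))"

section \<open>The algebra of a cell system\<close>

text \<open>A path is its source together with the list of its arcs, so that \<open>(v, [])\<close> is the path of
  length 0 at \<open>v\<close>.\<close>

type_synonym ('v, 'e) path = "'v \<times> 'e list"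

definition path_range :: "('v, 'e) pre_digraph \<Rightarrow> ('v, 'e) path \<Rightarrow> 'v" where
  "path_range G x = pre_digraph.awlast G (fst x) (snd x)"

definition paths :: "('v, 'e) pre_digraph \<Rightarrow> ('v, 'e) path set" where
  "paths G = {x. pre_digraph.awalk G (fst x) (snd x) (path_range G x)}"

definition path_mult ::
  "('v, 'e) pre_digraph \<Rightarrow> (('v, 'e) path \<Rightarrow>\<^sub>0 complex) \<Rightarrow> (('v, 'e) path \<Rightarrow>\<^sub>0 complex) \<Rightarrow>
   (('v, 'e) path \<Rightarrow>\<^sub>0 complex)" where
  "path_mult G f g =
     (\<Sum>x\<in>Poly_Mapping.keys f. \<Sum>y\<in>Poly_Mapping.keys g.
        if path_range G x = fst y
        then Poly_Mapping.single (fst x, snd x @ snd y)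
               (Poly_Mapping.lookup f x * Poly_Mapping.lookup g y)
        else 0)"

definition path_scalar :: "('v, 'e) pre_digraph \<Rightarrow> complex \<Rightarrow> (('v, 'e) path \<Rightarrow>\<^sub>0 complex)" where
  "path_scalar G z = (\<Sum>v\<in>verts G. Poly_Mapping.single (v, []) z)"

definition path_algebra :: "('v, 'e) pre_digraph \<Rightarrow> (('v, 'e) path \<Rightarrow>\<^sub>0 complex) ring" where
  "path_algebra G =
     \<lparr>carrier = {f. Poly_Mapping.keys f \<subseteq> paths G}, monoid.mult = path_mult G,
      one = path_scalar G 1, zero = 0, add = (+)\<rparr>"

definition cell_relation ::
  "('v, 'e) pre_digraph \<Rightarrow> ('e \<Rightarrow> 'e \<Rightarrow> 'e \<Rightarrow> complex) \<Rightarrow> 'e \<Rightarrow> (('v, 'e) path \<Rightarrow>\<^sub>0 complex)" where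
  "cell_relation G W a =
     (\<Sum>(b, b')\<in>{(b, b'). (a, b, b') \<in> triangles G}.
        Poly_Mapping.single (head G a, [b, b']) (W a b b'))"

definition cell_ideal ::
  "('v, 'e) pre_digraph \<Rightarrow> ('e \<Rightarrow> 'e \<Rightarrow> 'e \<Rightarrow> complex) \<Rightarrow> (('v, 'e) path \<Rightarrow>\<^sub>0 complex) set" where
  "cell_ideal G W = genideal (path_algebra G) (cell_relation G W ` arcs G)"

definition cell_algebra ::
  "('v, 'e) pre_digraph \<Rightarrow> ('e \<Rightarrow> 'e \<Rightarrow> 'e \<Rightarrow> complex) \<Rightarrow> (('v, 'e) path \<Rightarrow>\<^sub>0 complex) set ring" where
  "cell_algebra G W = path_algebra G Quot cell_ideal G W"

definition cell_class ::
  "('v, 'e) pre_digraph \<Rightarrow> ('e \<Rightarrow> 'e \<Rightarrow> 'e \<Rightarrow> complex) \<Rightarrow> (('v, 'e) path \<Rightarrow>\<^sub>0 complex) \<Rightarrow>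
   (('v, 'e) path \<Rightarrow>\<^sub>0 complex) set" where
  "cell_class G W f = cell_ideal G W +>\<^bsub>path_algebra G\<^esub> f"

text \<open>The image of $\mathbb{C}\cdot 1$, over which dimensions are taken.\<close>

definition cell_scalars ::
  "('v, 'e) pre_digraph \<Rightarrow> ('e \<Rightarrow> 'e \<Rightarrow> 'e \<Rightarrow> complex) \<Rightarrow> (('v, 'e) path \<Rightarrow>\<^sub>0 complex) set set" where
  "cell_scalars G W = range (\<lambda>z. cell_class G W (path_scalar G z))"

definition cell_graded ::
  "('v, 'e) pre_digraph \<Rightarrow> ('e \<Rightarrow> 'e \<Rightarrow> 'e \<Rightarrow> complex) \<Rightarrow> nat \<Rightarrow>
   (('v, 'e) path \<Rightarrow>\<^sub>0 complex) set set" where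
  "cell_graded G W p =
     cell_class G W ` {f. Poly_Mapping.keys f \<subseteq> {x \<in> paths G. length (snd x) = p}}"

definition cell_corner ::
  "('v, 'e) pre_digraph \<Rightarrow> ('e \<Rightarrow> 'e \<Rightarrow> 'e \<Rightarrow> complex) \<Rightarrow> nat \<Rightarrow> 'v \<Rightarrow> 'v \<Rightarrow>
   (('v, 'e) path \<Rightarrow>\<^sub>0 complex) set set" where
  "cell_corner G W p i j =
     {cell_class G W (Poly_Mapping.single (i, []) 1) \<otimes>\<^bsub>cell_algebra G W\<^esub> x
        \<otimes>\<^bsub>cell_algebra G W\<^esub> cell_class G W (Poly_Mapping.single (j, []) 1)
      |x. x \<in> cell_graded G W p}"

definition corner_dim ::
  "('v, 'e) pre_digraph \<Rightarrow> ('e \<Rightarrow> 'e \<Rightarrow> 'e \<Rightarrow> complex) \<Rightarrow> nat \<Rightarrow> 'v \<Rightarrow> 'v \<Rightarrow> nat" where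
  "corner_dim G W p i j =
     ring.dim (cell_algebra G W) (cell_scalars G W) (cell_corner G W p i j)"

section \<open>Matrices of power series indexed by the vertices\<close>

text \<open>A matrix indexed by the vertices is written with respect to an enumeration \<open>vs\<close> of them:
  the entry with index $(v,w)$ sits in row \<open>r\<close> and column \<open>c\<close> when \<open>vs ! r = v\<close> and \<open>vs ! c = w\<close>.\<close>

definition vertex_mat :: "'v list \<Rightarrow> ('v \<Rightarrow> 'v \<Rightarrow> int fps) \<Rightarrow> int fps mat" where
  "vertex_mat vs f = mat (length vs) (length vs) (\<lambda>(r, c). f (vs ! r) (vs ! c))"

definition adjacency_mat :: "('v, 'e) pre_digraph \<Rightarrow> 'v list \<Rightarrow> int fps mat" where
  "adjacency_mat G vs = vertex_mat vs (\<lambda>j i. of_nat (num_arcs G i j))"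

definition perm_mat :: "'v list \<Rightarrow> ('v \<Rightarrow> 'v) \<Rightarrow> int fps mat" where
  "perm_mat vs \<sigma> = vertex_mat vs (\<lambda>i j. if j = \<sigma> i then 1 else 0)"

definition hilbert_series ::
  "('v, 'e) pre_digraph \<Rightarrow> ('e \<Rightarrow> 'e \<Rightarrow> 'e \<Rightarrow> complex) \<Rightarrow> 'v list \<Rightarrow> int fps mat" where
  "hilbert_series G W vs =
     vertex_mat vs (\<lambda>j i. Abs_fps (\<lambda>p. int (corner_dim G W p i j)))"

text \<open>\<open>H\<close> is the quotient of \<open>N\<close> by \<open>D\<close>: the latter is invertible and commutes with \<open>N\<close>, so the
  side on which its inverse multiplies does not matter.\<close>

definition is_mat_quotient :: "int fps mat \<Rightarrow> int fps mat \<Rightarrow> int fps mat \<Rightarrow> bool" where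
  "is_mat_quotient H N D \<longleftrightarrow>
     N * D = D * N \<and> (\<exists>D'. inverts_mat D D' \<and> inverts_mat D' D \<and> H = N * D')"

end

theory Submission
  imports Defs "HOL-Library.Function_Algebras" "HOL-Number_Theory.Cong" "Jordan_Normal_Form.Determinant"
begin

text \<open>Dually, let \<open>S p i j\<close> be the space of functions on the paths of length \<open>p\<close> from \<open>i\<close> to \<open>j\<close> that
  annihilate the ideal of relations, so that its dimension is the entry of the Hilbert series. Splitting off
  the last one, two or three arcs gives a complex
  \<open>0 \<rightarrow> S (p + 2) \<rightarrow> \<Oplus> S (p + 1) \<rightarrow> \<Oplus> S p \<rightarrow> S (p - 1) \<rightarrow> 0\<close>. Conditions (I) and (II) make adjoint
  operators \<open>N e\<close> of the restrictions \<open>M e\<close> into a contracting homotopy up to the quantum numbers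
  \<open>[p + 1]\<close>, \<open>[p + 2]\<close>, which do not vanish for \<open>p + 2 < h\<close>. Hence the dimensions obey the recursion with
  characteristic polynomial \<open>1 - \<Delta> t + \<Delta>\<^sup>T t\<^sup>2 - t\<^sup>3\<close> up to degree \<open>h - 1\<close>. Pairing with the
  Perron-Frobenius vector gives \<open>[p + 1] [p + 2] / [2]\<close> times that vector, so everything vanishes from degree
  \<open>h - 2\<close> on, and multiplying the series by the polynomial leaves \<open>1 - H t\<^sup>h\<close> with \<open>H\<close> the component of
  degree \<open>h - 3\<close>. For each graph the recursion shows that \<open>H\<close> is the stated permutation matrix.\<close>

section \<open>Spaces of complex functions\<close>

text \<open>An ideal given by generators offers no test for membership, while its annihilator is cut
  out by linear equations; this is why the dimensions are computed for \<open>S\<close>. The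
  difficulty is to build \<open>N\<close>: a function on paths with one more arc must annihilate the
  relations again. \<open>N\<close> is defined by the rule that moves \<open>M\<close> past
  \<open>N\<close>, a deformed product rule whose correction term is the Hecke generator
  \<open>U\<close> of the cells. Relations (I) and (II) evaluate the products of weights that arise,
  and the arithmetic left over is \<open>[2] [q + 1] - [q] = [q + 2]\<close>. The top component is
  then found without the algebra, since it is an expression in \<Delta> and its transpose. Where
  these commute it commutes with both, so one corner vertex decides it for the families A and A*. In
  a three-colouring the degree only shifts the colour; D is compared with A through the orbits; for
  the E12 and E24 graphs the trajectory of one weight vector suffices, because dimensions are
  nonnegative integers and cannot cancel.\<close>

interpretation fun_space: vector_space "\<lambda>(c::complex) (f::'a \<Rightarrow> complex) x. c * f x"
  by unfold_locales (auto simp: fun_eq_iff algebra_simps)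

abbreviation fun_linear :: "(('a \<Rightarrow> complex) \<Rightarrow> ('b \<Rightarrow> complex)) \<Rightarrow> bool" where
  "fun_linear \<equiv> Vector_Spaces.linear (\<lambda>c f x. c * f x) (\<lambda>c f x. c * f x)"

definition supported_on :: "'a set \<Rightarrow> ('a \<Rightarrow> complex) set" where
  "supported_on X = {f. \<forall>x. x \<notin> X \<longrightarrow> f x = 0}"

lemma sum_apply: "sum F I x = (\<Sum>i\<in>I. F i x)"
  for F :: "'i \<Rightarrow> 'a \<Rightarrow> 'b::comm_monoid_add"
  by (induction I rule: infinite_finite_induct) auto

lemma supported_on_span:
  assumes "finite X"
  shows "supported_on X \<subseteq> fun_space.span ((\<lambda>y x. if x = y then 1 else 0) ` X)"
proof
  fix f :: "'a \<Rightarrow> complex"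
  assume "f \<in> supported_on X"
  then have f: "f x = (\<Sum>y\<in>X. f y * (if x = y then 1 else 0))" for x
  proof -
    have "(\<Sum>y\<in>X. f y * (if x = y then 1 else 0)) = (\<Sum>y\<in>X. if y = x then f y else 0)"
      by (rule sum.cong) auto
    then show ?thesis using assms \<open>f \<in> supported_on X\<close> by (simp add: supported_on_def)
  qed
  have "(\<Sum>y\<in>X. (\<lambda>x. f y * (if x = y then 1 else 0)))
      \<in> fun_space.span ((\<lambda>y x. if x = y then 1 else 0) ` X)"
    by (intro fun_space.span_sum fun_space.span_scale fun_space.span_base) auto
  moreover have "(\<Sum>y\<in>X. (\<lambda>x. f y * (if x = y then 1 else 0))) = f"
    by (rule ext) (subst f, simp add: sum_apply)
  ultimately show "f \<in> fun_space.span ((\<lambda>y x. if x = y then 1 else 0) ` X)" by simp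
qed

lemma finite_basis_supported:
  assumes "finite X" "S \<subseteq> supported_on X" "fun_space.independent B" "B \<subseteq> S"
  shows "finite B"
proof -
  have "B \<subseteq> fun_space.span ((\<lambda>y x. if x = y then 1 else 0) ` X)"
    using supported_on_span[OF assms(1)] assms by blast
  then show ?thesis
    using fun_space.independent_span_bound[OF _ assms(3)] assms(1) by blast
qed

text \<open>Rank and nullity inside a function space that may be infinite-dimensional: the finite
  support makes every basis of \<open>S\<close> finite. A basis \<open>B0\<close> of the kernel is
  extended to \<open>B\<close>, and the added vectors map to a basis of the image.\<close>

lemma dim_kernel_image:
  fixes T :: "('a \<Rightarrow> complex) \<Rightarrow> ('b \<Rightarrow> complex)"
  assumes T: "fun_linear T" and S: "fun_space.subspace S"
    and fin: "finite X" "S \<subseteq> supported_on X"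
  shows "fun_space.dim S = fun_space.dim {f \<in> S. T f = 0} + fun_space.dim (T ` S)"
proof -
  interpret T: Vector_Spaces.linear "\<lambda>c (f::'a \<Rightarrow> complex) x. c * f x" "\<lambda>c (f::'b \<Rightarrow> complex) x. c * f x" T by (rule T)
  let ?K = "{f \<in> S. T f = 0}"
  obtain B0 where B0: "B0 \<subseteq> ?K" "fun_space.independent B0" "?K \<subseteq> fun_space.span B0" "card B0 = fun_space.dim ?K"
    by (rule fun_space.basis_exists)
  have "B0 \<subseteq> S" using B0(1) by blast
  then obtain B where B: "B0 \<subseteq> B" "B \<subseteq> S" "fun_space.independent B" "S \<subseteq> fun_space.span B"
    using fun_space.maximal_independent_subset_extend[OF _ B0(2)] by blast
  have finB: "finite B" by (rule finite_basis_supported[OF fin B(3,2)])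
  define C where "C = B - B0"
  have spanC: "fun_space.span C \<subseteq> S"
    using B(2) S unfolding C_def by (intro fun_space.span_minimal) auto
  \<comment> \<open>A kernel vector in the span of \<open>C\<close> also lies in the span of
    \<open>B0\<close>. Its coordinates in \<open>B\<close> then vanish off \<open>C\<close> and off
    \<open>B0\<close>, and these are disjoint.\<close>
  have inj0: "v = 0" if v: "v \<in> fun_space.span C" and Tv: "T v = 0" for v
  proof -
    have v0: "v \<in> fun_space.span B0" using v Tv spanC B0(3) by blast
    have eq: "fun_space.representation B v = fun_space.representation B0 v"
      by (rule fun_space.representation_extend[OF B(3) v0 B(1)])
    have eq': "fun_space.representation B v = fun_space.representation C v"
      by (rule fun_space.representation_extend[OF B(3) v]) (auto simp: C_def)
    have "fun_space.representation B v b = 0" for b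
      using fun_space.representation_ne_zero[of B0 v b] fun_space.representation_ne_zero[of C v b] eq eq'
      by (force simp: C_def)
    then have "fun_space.representation B0 v = (\<lambda>_. 0)" using eq by auto
    then show "v = 0"
      using fun_space.sum_nonzero_representation_eq[OF B0(2) v0] by simp
  qed
  have indC: "fun_space.independent C"
    using B(3) fun_space.independent_mono unfolding C_def by blast
  have inj: "inj_on T (fun_space.span C)"
    using T.inj_on_iff_eq_0[OF fun_space.subspace_span] inj0 by blast
  have indTC: "fun_space.independent (T ` C)"
    by (rule T.independent_injective_image[OF indC inj])
  have "T ` S \<subseteq> T ` fun_space.span B" using B(4) by blast
  also have "\<dots> = fun_space.span (T ` B)" by (rule T.span_image[symmetric])
  also have "\<dots> \<subseteq> fun_space.span (T ` C)"
  proof (rule fun_space.span_minimal)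
    have "T b \<in> fun_space.span (T ` C)" if "b \<in> B" for b
      using that B0(1) by (cases "b \<in> B0") (auto simp: C_def fun_space.span_zero intro: fun_space.span_base)
    then show "T ` B \<subseteq> fun_space.span (T ` C)" by blast
  qed auto
  finally have TS: "T ` S \<subseteq> fun_space.span (T ` C)" .
  have "fun_space.dim (T ` S) = card (T ` C)"
    using B(2) by (intro fun_space.dim_unique[OF _ TS indTC]) (auto simp: C_def)
  also have "\<dots> = card C"
    by (rule card_image[OF inj_on_subset[OF inj fun_space.span_superset]])
  finally have "fun_space.dim (T ` S) = card C" .
  moreover have "fun_space.dim S = card B"
    by (rule fun_space.dim_unique[OF B(2,4,3) refl])
  moreover have "card B = card B0 + card C"
    using card_Un_disjoint[of B0 C] finB B(1) finite_subset[OF B(1) finB]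
    by (simp add: C_def Un_absorb1)
  ultimately show ?thesis using B0(4) by simp
qed

lemma dim_zero [simp]: "fun_space.dim {0 :: 'a \<Rightarrow> complex} = 0"
  by (rule fun_space.dim_unique[of "{}"]) (simp_all add: fun_space.independent_empty)

lemma dim_inj_image:
  assumes T: "fun_linear T" and S: "fun_space.subspace S"
    and fin: "finite X" "S \<subseteq> supported_on X"
    and inj: "\<And>f. f \<in> S \<Longrightarrow> T f = 0 \<Longrightarrow> f = 0"
  shows "fun_space.dim (T ` S) = fun_space.dim S"
proof -
  interpret T: Vector_Spaces.linear "\<lambda>c f x. c * f x" "\<lambda>c f x. c * f x" T by (rule T)
  have "{f \<in> S. T f = 0} = {0}"
    using inj fun_space.subspace_0[OF S] T.zero by auto
  then show ?thesis using dim_kernel_image[OF T S fin] by simp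
qed

lemma fun_linearI:
  assumes "\<And>f g. T (\<lambda>x. f x + g x) = (\<lambda>x. T f x + T g x)"
    and "\<And>c f. T (\<lambda>x. c * f x) = (\<lambda>x. c * T f x)"
  shows "fun_linear T"
  using assms by unfold_locales (auto simp: plus_fun_def)

text \<open>The direct sum of the spaces \<open>S e\<close>, encoded as functions on pairs so that
  it is again a space of complex functions and \<open>dim_kernel_image\<close> applies to maps
  between direct sums.\<close>

definition family_space :: "'e set \<Rightarrow> ('e \<Rightarrow> ('x \<Rightarrow> complex) set) \<Rightarrow> ('e \<times> 'x \<Rightarrow> complex) set" where
  "family_space A S = {F. \<forall>e. (e \<in> A \<longrightarrow> (\<lambda>x. F (e, x)) \<in> S e) \<and> (e \<notin> A \<longrightarrow> (\<forall>x. F (e, x) = 0))}"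

lemma subspace_family_space:
  assumes "\<And>e. e \<in> A \<Longrightarrow> fun_space.subspace (S e)"
  shows "fun_space.subspace (family_space A S)"
proof (rule fun_space.subspaceI)
  show "0 \<in> family_space A S"
    using fun_space.subspace_0[OF assms] by (auto simp: family_space_def zero_fun_def)
  show "F + H \<in> family_space A S" if "F \<in> family_space A S" "H \<in> family_space A S" for F H
    using that fun_space.subspace_add[OF assms] by (force simp: family_space_def plus_fun_def)
  show "(\<lambda>x. c * F x) \<in> family_space A S" if "F \<in> family_space A S" for c F
    using that fun_space.subspace_scale[OF assms] by (force simp: family_space_def)
qed

lemma family_space_supported:
  assumes "\<And>e. e \<in> A \<Longrightarrow> S e \<subseteq> supported_on (X e)"
  shows "family_space A S \<subseteq> supported_on (Sigma A X)"
proof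
  fix F assume F: "F \<in> family_space A S"
  have "F (e, x) = 0" if "e \<notin> A \<or> x \<notin> X e" for e x
  proof (cases "e \<in> A")
    case True
    then have "(\<lambda>x. F (e, x)) \<in> supported_on (X e)"
      using F assms[OF True] unfolding family_space_def by blast
    then show ?thesis using True that by (simp add: supported_on_def)
  qed (use F in \<open>simp add: family_space_def\<close>)
  then show "F \<in> supported_on (Sigma A X)" by (auto simp: supported_on_def)
qed

lemma dim_family_space:
  assumes A: "finite A" and S: "\<And>e. e \<in> A \<Longrightarrow> fun_space.subspace (S e)"
    and X: "\<And>e. e \<in> A \<Longrightarrow> finite (X e)" "\<And>e. e \<in> A \<Longrightarrow> S e \<subseteq> supported_on (X e)"
  shows "fun_space.dim (family_space A S) = (\<Sum>e\<in>A. fun_space.dim (S e))"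
  using assms
proof (induction A rule: finite_induct)
  case empty
  have "family_space {} S = {0}" by (auto simp: family_space_def fun_eq_iff)
  then show ?case by simp
next
  case (insert a A)
  \<comment> \<open>Projection to the new summand: its image is \<open>S a\<close> and its kernel is
    the direct sum over the old indices.\<close>
  define T :: "('a \<times> 'b \<Rightarrow> complex) \<Rightarrow> 'b \<Rightarrow> complex" where "T F = (\<lambda>x. F (a, x))" for F
  have T: "fun_linear T" by (rule fun_linearI) (auto simp: T_def)
  have 1: "{F \<in> family_space (insert a A) S. T F = 0} = family_space A S"
    using insert.hyps(2) fun_space.subspace_0[OF insert.prems(1)[of a]]
    by (auto simp: family_space_def T_def fun_eq_iff zero_fun_def)
  have 2: "T ` family_space (insert a A) S = S a"
  proof
    show "T ` family_space (insert a A) S \<subseteq> S a" by (auto simp: family_space_def T_def)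
    show "S a \<subseteq> T ` family_space (insert a A) S"
    proof
      fix f assume f: "f \<in> S a"
      define F where "F p = (if fst p = a then f (snd p) else 0)" for p :: "'a \<times> 'b"
      have "(\<lambda>x. F (e, x)) \<in> S e" if "e \<in> insert a A" for e
        using f fun_space.subspace_0[OF insert.prems(1)[OF that]]
        by (cases "e = a") (simp_all add: F_def zero_fun_def)
      moreover have "F (e, x) = 0" if "e \<notin> insert a A" for e x
        using that by (simp add: F_def)
      ultimately have "F \<in> family_space (insert a A) S"
        by (simp add: family_space_def)
      moreover have "T F = f" by (simp add: T_def F_def)
      ultimately show "f \<in> T ` family_space (insert a A) S" by blast
    qed
  qed
  have "fun_space.dim (family_space (insert a A) S) =
      fun_space.dim {F \<in> family_space (insert a A) S. T F = 0} + fun_space.dim (T ` family_space (insert a A) S)"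
  proof (rule dim_kernel_image[OF T])
    show "fun_space.subspace (family_space (insert a A) S)"
      by (rule subspace_family_space) (rule insert.prems(1))
    show "finite (Sigma (insert a A) X)" using insert.hyps(1) insert.prems(2) by (intro finite_SigmaI) auto
    show "family_space (insert a A) S \<subseteq> supported_on (Sigma (insert a A) X)"
      by (rule family_space_supported) (rule insert.prems(3))
  qed
  also have "\<dots> = (\<Sum>e\<in>A. fun_space.dim (S e)) + fun_space.dim (S a)"
    unfolding 1 2 using insert.IH insert.prems by simp
  finally show ?case using insert.hyps by simp
qed

text \<open>\<open>P\<close> is a set of pivots for \<open>S\<close>: a function in \<open>S\<close>
  is determined by its values on \<open>P\<close>, which are arbitrary, and \<open>g\<close> is the
  basis dual to these evaluations. Read the other way round, the points of \<open>P\<close> give a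
  basis of the quotient dual to \<open>S\<close>.\<close>

definition dual_system :: "('x \<Rightarrow> complex) set \<Rightarrow> 'x set \<Rightarrow> ('x \<Rightarrow> 'x \<Rightarrow> complex) \<Rightarrow> bool" where
  "dual_system S P g \<longleftrightarrow> finite P \<and> (\<forall>y\<in>P. g y \<in> S) \<and>
     (\<forall>y\<in>P. \<forall>x\<in>P. g y x = (if x = y then 1 else 0)) \<and>
     (\<forall>f\<in>S. \<forall>x. f x = (\<Sum>y\<in>P. f y * g y x))"

text \<open>Gaussian elimination, one point at a time. The functions of \<open>S\<close> that vanish
  at the new point \<open>a\<close> have a dual system by induction; if some function does not
  vanish at \<open>a\<close>, then \<open>a\<close> becomes one more pivot.\<close>

lemma ex_dual_system:
  assumes "finite X" "fun_space.subspace S" "S \<subseteq> supported_on X"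
  shows "\<exists>P g. P \<subseteq> X \<and> dual_system S P g"
  using assms
proof (induction X arbitrary: S rule: finite_induct)
  case empty
  then have "dual_system S {} (\<lambda>_ _. 0)" by (auto simp: dual_system_def supported_on_def)
  then show ?case by blast
next
  case (insert a X)
  let ?S = "{f \<in> S. f a = 0}"
  have "fun_space.subspace ?S"
    using insert.prems(1) by (auto simp: fun_space.subspace_def)
  moreover have "?S \<subseteq> supported_on X"
    using insert.prems(2) by (auto simp: supported_on_def)
  ultimately obtain P g where P: "P \<subseteq> X" "dual_system ?S P g" using insert.IH by blast
  note d = P(2)[unfolded dual_system_def]
  show ?case
  proof (cases "S = ?S")
    case True
    then show ?thesis using P by (metis subset_insertI2)
  next
    case False
    then obtain f where f: "f \<in> S" "f a \<noteq> 0" by blast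
    define f1 where "f1 = (\<lambda>x. inverse (f a) * f x)"
    have f1: "f1 \<in> S" "f1 a = 1"
      using f fun_space.subspace_scale[OF insert.prems(1)] by (auto simp: f1_def)
    \<comment> \<open>The new pivot function, cleared at the old pivots. The old \<open>g y\<close>
      need no correction, since they already vanish at \<open>a\<close>.\<close>
    define f2 where "f2 = f1 - (\<Sum>y\<in>P. (\<lambda>x. f1 y * g y x))"
    have gS: "g y \<in> S" "g y a = 0" if "y \<in> P" for y using d that by auto
    have f2S: "f2 \<in> S" unfolding f2_def
      using insert.prems(1) gS f1
      by (intro fun_space.subspace_diff fun_space.subspace_sum fun_space.subspace_scale) auto
    have f2: "f2 x = f1 x - (\<Sum>y\<in>P. f1 y * g y x)" for x by (simp add: f2_def sum_apply)
    have f2a: "f2 a = 1" by (simp add: f2 f1 gS)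
    have f2P: "f2 x = 0" if "x \<in> P" for x
    proof -
      have "(\<Sum>y\<in>P. f1 y * g y x) = (\<Sum>y\<in>P. if y = x then f1 y else 0)"
        using d that by (intro sum.cong) auto
      then show ?thesis using d that by (simp add: f2)
    qed
    have aP: "a \<notin> P" using P insert.hyps by auto
    define g' where "g' = g(a := f2)"
    have "dual_system S (insert a P) g'"
      unfolding dual_system_def
    proof (intro conjI ballI allI)
      show "finite (insert a P)" using d by simp
      show "g' y \<in> S" if "y \<in> insert a P" for y using that f2S gS by (auto simp: g'_def)
      show "g' y x = (if x = y then 1 else 0)" if "y \<in> insert a P" "x \<in> insert a P" for x y
        using that d aP f2a f2P gS(2) by (auto simp: g'_def)
      fix u x assume u: "u \<in> S"
      define u' where "u' = (\<lambda>x. u x - u a * f2 x)"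
      have "u' \<in> S" using fun_space.subspace_diff[OF insert.prems(1) u
            fun_space.subspace_scale[OF insert.prems(1) f2S, of "u a"]]
        by (simp add: u'_def fun_diff_def)
      moreover have "u' a = 0" by (simp add: u'_def f2a)
      ultimately have "u' x = (\<Sum>y\<in>P. u' y * g y x)" using d by blast
      also have "\<dots> = (\<Sum>y\<in>P. u y * g' y x)"
        using aP by (intro sum.cong) (auto simp: u'_def f2P g'_def)
      finally show "u x = (\<Sum>y\<in>insert a P. u y * g' y x)"
        using d aP by (simp add: u'_def g'_def algebra_simps)
    qed
    then show ?thesis using P by (metis insert_mono)
  qed
qed

lemma dual_system_dim:
  assumes "dual_system S P g"
  shows "fun_space.dim S = card P"
proof -
  note d = assms[unfolded dual_system_def]
  have inj: "inj_on g P"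
    by (rule inj_onI) (metis d zero_neq_one)
  have "S \<subseteq> fun_space.span (g ` P)"
  proof
    fix f assume "f \<in> S"
    then have "f = (\<Sum>y\<in>P. (\<lambda>x. f y * g y x))" using d by (simp add: fun_eq_iff sum_apply)
    moreover have "(\<Sum>y\<in>P. (\<lambda>x. f y * g y x)) \<in> fun_space.span (g ` P)"
      by (intro fun_space.span_sum fun_space.span_scale fun_space.span_base) auto
    ultimately show "f \<in> fun_space.span (g ` P)" by simp
  qed
  moreover have "fun_space.independent (g ` P)"
  proof (rule fun_space.independent_if_scalars_zero)
    show "finite (g ` P)" using d by simp
    fix c v assume *: "(\<Sum>v\<in>g ` P. (\<lambda>x. c v * v x)) = 0" and "v \<in> g ` P"
    then obtain y where y: "y \<in> P" "v = g y" by auto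
    have "(\<Sum>z\<in>P. c (g z) * g z y) = 0"
      using fun_cong[OF *, of y] by (simp add: sum.reindex[OF inj] sum_apply)
    moreover have "(\<Sum>z\<in>P. c (g z) * g z y) = (\<Sum>z\<in>P. if z = y then c (g z) else 0)"
      using d y by (intro sum.cong) auto
    ultimately show "c v = 0" using y d by simp
  qed
  ultimately have "fun_space.dim S = card (g ` P)"
    using d by (intro fun_space.dim_unique) auto
  then show ?thesis by (simp add: card_image[OF inj])
qed

text \<open>The functional is the interpolation error at a point \<open>z\<close>: the value there
  minus the value predicted from the pivots. It vanishes on \<open>S\<close>, and \<open>z\<close>
  is a point where the prediction fails for \<open>f\<close>.\<close>

lemma ex_separating_functional:
  assumes "finite X" "fun_space.subspace S" "S \<subseteq> supported_on X" "f \<in> supported_on X" "f \<notin> S"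
  shows "\<exists>u. (\<forall>v\<in>S. (\<Sum>x\<in>X. u x * v x) = 0) \<and> (\<Sum>x\<in>X. u x * f x) \<noteq> 0"
proof -
  obtain P g where P: "P \<subseteq> X" "dual_system S P g" using ex_dual_system[OF assms(1-3)] by blast
  note d = P(2)[unfolded dual_system_def]
  have "(\<Sum>y\<in>P. (\<lambda>x. f y * g y x)) \<in> S"
    using d by (intro fun_space.subspace_sum fun_space.subspace_scale assms(2)) auto
  then obtain z where z: "f z \<noteq> (\<Sum>y\<in>P. f y * g y z)"
    using assms(5) by (metis (no_types, lifting) ext sum_apply)
  have zX: "z \<in> X"
  proof (rule ccontr)
    assume nz: "z \<notin> X"
    then have "g y z = 0" if "y \<in> P" for y using that d assms(3) by (auto simp: supported_on_def)
    then show False using z nz assms(4) by (simp add: supported_on_def)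
  qed
  define u where "u x = (if x = z then 1 else 0) - (if x \<in> P then g x z else 0)" for x
  have u: "(\<Sum>x\<in>X. u x * v x) = v z - (\<Sum>y\<in>P. v y * g y z)" for v
  proof -
    have "(\<Sum>x\<in>X. u x * v x) = (\<Sum>x\<in>X. (if x = z then v x else 0)) - (\<Sum>x\<in>X. if x \<in> P then v x * g x z else 0)"
      unfolding sum_subtractf[symmetric] by (intro sum.cong) (auto simp: u_def algebra_simps)
    also have "(\<Sum>x\<in>X. if x \<in> P then v x * g x z else 0) = (\<Sum>y\<in>P. v y * g y z)"
      using assms(1) P(1) by (simp add: sum.inter_restrict[symmetric] Int_absorb1)
    finally show ?thesis using assms(1) zX by simp
  qed
  show ?thesis
    using u z d by (intro exI[of _ u]) auto
qed

section \<open>Cell systems\<close>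

definition quantum_num :: "nat \<Rightarrow> nat \<Rightarrow> complex" where
  "quantum_num h p = of_real (sin (real p * pi / real h) / sin (pi / real h))"

lemma quantum_num_0 [simp]: "quantum_num h 0 = 0"
  by (simp add: quantum_num_def)

lemma sin_pi_div_pos: "h \<ge> 2 \<Longrightarrow> sin (pi / real h) > 0"
  by (rule sin_gt_zero) (auto simp: field_simps)

lemma quantum_num_1 [simp]: "h \<ge> 2 \<Longrightarrow> quantum_num h (Suc 0) = 1"
  using sin_pi_div_pos[of h] by (simp add: quantum_num_def)

lemma quantum_num_Suc_Suc:
  "quantum_num h (Suc (Suc p)) = of_real (quantum2 h) * quantum_num h (Suc p) - quantum_num h p"
proof -
  define t where "t = pi / real h"
  have "sin (real (Suc (Suc p)) * t) + sin (real p * t) = 2 * cos t * sin (real (Suc p) * t)"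
  proof -
    have "sin (real (Suc (Suc p)) * t) = sin (real (Suc p) * t + t)"
      "sin (real p * t) = sin (real (Suc p) * t - t)"
      by (auto simp: algebra_simps)
    then show ?thesis by (simp add: sin_add sin_diff)
  qed
  then have "sin (real (Suc (Suc p)) * t) / sin t = 2 * cos t * (sin (real (Suc p) * t) / sin t) - sin (real p * t) / sin t"
    by (simp add: field_simps add_divide_distrib[symmetric] diff_divide_distrib[symmetric])
  then show ?thesis
    unfolding quantum_num_def quantum2_def t_def of_real_mult[symmetric] of_real_diff[symmetric] of_real_eq_iff
    by simp
qed

lemma quantum3_eq: "quantum3 h = quantum2 h ^ 2 - 1"
proof -
  have "cos (2 * (pi / real h)) = 2 * cos (pi / real h) ^ 2 - 1" by (rule cos_double_cos)
  then show ?thesis by (simp add: quantum3_def quantum2_def power_mult_distrib)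
qed

lemma quantum_num_nonzero:
  assumes "0 < p" "p < h"
  shows "quantum_num h p \<noteq> 0"
proof -
  have "sin (real p * pi / real h) > 0"
    using assms by (intro sin_gt_zero) (auto simp: field_simps)
  moreover have "sin (pi / real h) > 0" using assms by (intro sin_pi_div_pos) auto
  ultimately show ?thesis by (simp add: quantum_num_def)
qed

lemma quantum_num_h: "h > 0 \<Longrightarrow> quantum_num h h = 0"
  by (simp add: quantum_num_def)

lemma sum_if_subset:
  "finite E \<Longrightarrow> A \<subseteq> E \<Longrightarrow> (\<Sum>b\<in>A. F b) = (\<Sum>b\<in>E. if b \<in> A then F b else 0)"
  by (rule sum.mono_neutral_cong_left) auto

lemma sum_if_out: "(\<Sum>x\<in>A. if P then F x else 0) = (if P then \<Sum>x\<in>A. F x else 0)"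
  by simp

section \<open>Relations (I) and (II) as sums over all arcs\<close>

locale cell_setting = fin_digraph G
  for G :: "('v, 'e) pre_digraph" +
  fixes h :: nat and \<phi> :: "'v \<Rightarrow> real" and W :: "'e \<Rightarrow> 'e \<Rightarrow> 'e \<Rightarrow> complex"
  assumes h4: "h \<ge> 4" and pf: "perron_frobenius G h \<phi>" and cells: "cell_system G h \<phi> W"
begin

abbreviation "E \<equiv> arcs G"
abbreviation "s \<equiv> tail G"
abbreviation "r \<equiv> head G"
abbreviation "Q \<equiv> quantum_num h"
abbreviation "f\<phi> v \<equiv> complex_of_real (\<phi> v)"

text \<open>Extending the weights by zero lets every sum run over all of \<open>E\<close>: the
  incidence conditions are carried by the vanishing of \<open>w\<close>, and sums can be exchanged
  freely.\<close>

definition w :: "'e \<Rightarrow> 'e \<Rightarrow> 'e \<Rightarrow> complex" where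
  "w a b c = (if (a, b, c) \<in> triangles G then W a b c else 0)"

lemma finE [simp]: "finite E" by (rule finite_arcs)

lemma phi_pos: "v \<in> verts G \<Longrightarrow> \<phi> v > 0"
  using pf by (auto simp: perron_frobenius_def)

lemma phi_nz [simp]: "a \<in> E \<Longrightarrow> \<phi> (s a) \<noteq> 0" "a \<in> E \<Longrightarrow> \<phi> (r a) \<noteq> 0"
  using phi_pos[of "s a"] phi_pos[of "r a"] by auto

lemma Q2: "Q 2 = of_real (quantum2 h)"
  using quantum_num_Suc_Suc[of h 0] h4 by (simp add: numeral_2_eq_2)

lemma Q_rec: "Q (p + 2) = Q 2 * Q (p + 1) - Q p"
  using quantum_num_Suc_Suc[of h p] by (simp add: Q2)

lemma w_cyc: "w a b c = w b c a"
  using cells unfolding cell_system_def w_def triangles_def by auto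

lemma w_nz:
  assumes "w a b c \<noteq> 0"
  shows "a \<in> E" "b \<in> E" "c \<in> E" "r a = s b" "r b = s c" "r c = s a"
  using assms by (auto simp: w_def triangles_def split: if_splits)

lemma sum2_if:
  assumes "A1 \<subseteq> E" "A2 \<subseteq> E"
  shows "(\<Sum>b1\<in>A1. \<Sum>b2\<in>A2. F b1 b2) =
    (\<Sum>b1\<in>E. \<Sum>b2\<in>E. if b1 \<in> A1 \<and> b2 \<in> A2 then F b1 b2 else (0::complex))"
proof -
  have 2: "(\<Sum>b2\<in>A2. F b1 b2) = (\<Sum>b2\<in>E. if b2 \<in> A2 then F b1 b2 else 0)" for b1
    using assms by (intro sum_if_subset) auto
  have 1: "(\<Sum>b1\<in>A1. F b1) = (\<Sum>b1\<in>E. if b1 \<in> A1 then F b1 else 0)" for F :: "'e \<Rightarrow> complex"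
    using assms by (intro sum_if_subset) auto
  show ?thesis
    unfolding 1 2 sum_if_out[symmetric] by (intro sum.cong refl) auto
qed

text \<open>For parallel arcs this is (I). If the ends of \<open>a\<close> and \<open>a'\<close>
  differ, no pair \<open>b, c\<close> completes both to a triangle, and both sides are zero.\<close>

lemma typeI:
  assumes "a \<in> E" "a' \<in> E"
  shows "(\<Sum>b\<in>E. \<Sum>c\<in>E. w a b c * cnj (w a' b c)) =
    (if a = a' then Q 2 * f\<phi> (s a) * f\<phi> (r a) else 0)"
proof (cases "s a = s a' \<and> r a = r a'")
  case False
  have z: "w a b c * cnj (w a' b c) = 0" for b c
    using False w_nz[of a b c] w_nz[of a' b c]
    by (cases "w a b c = 0"; cases "w a' b c = 0") simp_all
  show ?thesis unfolding z using False by auto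
next
  case True
  let ?i = "s a" and ?j = "r a"
  define F where "F b c = W a b c * cnj (W a' b c)" for b c
  have "a \<in> arcs_from_to G ?i ?j" "a' \<in> arcs_from_to G ?i ?j"
    using assms True by (auto simp: arcs_from_to_def)
  then have 1: "(\<Sum>k\<in>verts G. \<Sum>b\<in>arcs_from_to G ?j k. \<Sum>c\<in>arcs_from_to G k ?i. F b c) =
      of_real ((if a = a' then 1 else 0) * quantum2 h * \<phi> ?i * \<phi> ?j)"
    using conjunct1[OF conjunct2[OF cells[unfolded cell_system_def]], rule_format, of ?i ?j a a'] assms
    unfolding F_def by simp
  have "(\<Sum>k\<in>verts G. \<Sum>b\<in>arcs_from_to G ?j k. \<Sum>c\<in>arcs_from_to G k ?i. F b c)
     = (\<Sum>k\<in>verts G. \<Sum>b\<in>E. \<Sum>c\<in>E. if b \<in> arcs_from_to G ?j k \<and> c \<in> arcs_from_to G k ?i then F b c else 0)"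
    by (rule sum.cong[OF refl], rule sum2_if) (auto simp: arcs_from_to_def)
  also have "\<dots> = (\<Sum>b\<in>E. \<Sum>c\<in>E. \<Sum>k\<in>verts G. if b \<in> arcs_from_to G ?j k \<and> c \<in> arcs_from_to G k ?i then F b c else 0)"
    by (rule trans[OF sum.swap], rule sum.cong[OF refl], rule sum.swap)
  also have "\<dots> = (\<Sum>b\<in>E. \<Sum>c\<in>E. w a b c * cnj (w a' b c))"
  proof (intro sum.cong refl)
    fix b c assume bc: "b \<in> E" "c \<in> E"
    \<comment> \<open>The vertex \<open>k\<close> of (I) is the range of \<open>b\<close>, so
      summing over it only selects one term.\<close>
    have "(\<Sum>k\<in>verts G. if b \<in> arcs_from_to G ?j k \<and> c \<in> arcs_from_to G k ?i then F b c else 0)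
      = (\<Sum>k\<in>verts G. if k = r b then (if s b = ?j \<and> s c = r b \<and> r c = ?i then F b c else 0) else 0)"
      using bc by (intro sum.cong) (auto simp: arcs_from_to_def)
    also have "\<dots> = (if s b = ?j \<and> s c = r b \<and> r c = ?i then F b c else 0)"
      using bc by simp
    also have "\<dots> = w a b c * cnj (w a' b c)"
      using True bc assms by (auto simp: w_def triangles_def F_def)
    finally show "(\<Sum>k\<in>verts G. if b \<in> arcs_from_to G ?j k \<and> c \<in> arcs_from_to G k ?i then F b c else 0) = w a b c * cnj (w a' b c)" .
  qed
  finally show ?thesis using 1 True by (auto simp: Q2)
qed

lemma sum4_if:
  assumes "A1 \<subseteq> E" "A2 \<subseteq> E" "A3 \<subseteq> E" "A4 \<subseteq> E"
  shows "(\<Sum>b1\<in>A1. \<Sum>b2\<in>A2. \<Sum>b3\<in>A3. \<Sum>b4\<in>A4. F b1 b2 b3 b4) =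
    (\<Sum>b1\<in>E. \<Sum>b2\<in>E. \<Sum>b3\<in>E. \<Sum>b4\<in>E.
       if b1 \<in> A1 \<and> b2 \<in> A2 \<and> b3 \<in> A3 \<and> b4 \<in> A4 then F b1 b2 b3 b4 else (0::complex))"
proof -
  have 4: "(\<Sum>b4\<in>A4. F b1 b2 b3 b4) = (\<Sum>b4\<in>E. if b4 \<in> A4 then F b1 b2 b3 b4 else 0)" for b1 b2 b3
    using assms by (intro sum_if_subset) auto
  have 3: "(\<Sum>b3\<in>A3. F b3) = (\<Sum>b3\<in>E. if b3 \<in> A3 then F b3 else 0)" for F :: "'e \<Rightarrow> complex"
    using assms by (intro sum_if_subset) auto
  have 2: "(\<Sum>b3\<in>A2. F b3) = (\<Sum>b3\<in>E. if b3 \<in> A2 then F b3 else 0)" for F :: "'e \<Rightarrow> complex"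
    using assms by (intro sum_if_subset) auto
  have 1: "(\<Sum>b3\<in>A1. F b3) = (\<Sum>b3\<in>E. if b3 \<in> A1 then F b3 else 0)" for F :: "'e \<Rightarrow> complex"
    using assms by (intro sum_if_subset) auto
  show ?thesis
    unfolding 1 2 3 4 sum_if_out[symmetric]
    by (intro sum.cong refl) auto
qed

lemma w4_nz:
  assumes "w a1 b2 b1 * cnj (w a2 b2 b3) * w a3 b4 b3 * cnj (w a4 b4 b1) \<noteq> 0"
  shows "r a1 = s b2" "r b2 = s b1" "r b1 = s a1" "r a2 = s b2" "r b2 = s b3" "r b3 = s a2"
    "r a3 = s b4" "r b4 = s b3" "r b3 = s a3" "r a4 = s b4" "r b4 = s b1" "r b1 = s a4"
proof -
  have "w a1 b2 b1 \<noteq> 0" "w a2 b2 b3 \<noteq> 0" "w a3 b4 b3 \<noteq> 0" "w a4 b4 b1 \<noteq> 0"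
    using assms by auto
  note * = this[THEN w_nz(4)] this[THEN w_nz(5)] this[THEN w_nz(6)]
  show "r a1 = s b2" "r b2 = s b1" "r b1 = s a1" "r a2 = s b2" "r b2 = s b3" "r b3 = s a2"
    "r a3 = s b4" "r b4 = s b3" "r b3 = s a3" "r a4 = s b4" "r b4 = s b1" "r b1 = s a4"
    by (fact *)+
qed

text \<open>Four arcs that do not close up to a square make every product on the left vanish; the
  incidence conditions added to the deltas on the right make it vanish as well, so no assumption on
  the ends is left.\<close>

lemma typeII:
  assumes "a1 \<in> E" "a2 \<in> E" "a3 \<in> E" "a4 \<in> E"
  shows "(\<Sum>b1\<in>E. \<Sum>b2\<in>E. \<Sum>b3\<in>E. \<Sum>b4\<in>E.
       inverse (f\<phi> (r b2)) * (w a1 b2 b1 * cnj (w a2 b2 b3) * w a3 b4 b3 * cnj (w a4 b4 b1))) =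
    (if a1 = a4 \<and> a2 = a3 \<and> r a1 = r a2 then f\<phi> (s a1) * f\<phi> (r a1) * f\<phi> (s a2) else 0) +
    (if a1 = a2 \<and> a3 = a4 \<and> s a1 = s a4 then f\<phi> (s a1) * f\<phi> (r a1) * f\<phi> (r a4) else 0)"
proof (cases "r a1 = r a2 \<and> r a3 = r a4 \<and> s a1 = s a4 \<and> s a2 = s a3")
  case False
  have z: "w a1 b2 b1 * cnj (w a2 b2 b3) * w a3 b4 b3 * cnj (w a4 b4 b1) = 0" for b1 b2 b3 b4
    using False w4_nz[of a1 b2 b1 a2 b3 a3 b4 a4] by metis
  have "\<not> (a1 = a4 \<and> a2 = a3 \<and> r a1 = r a2)" "\<not> (a1 = a2 \<and> a3 = a4 \<and> s a1 = s a4)"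
    using False by metis+
  then show ?thesis unfolding z by (simp only: if_False sum.neutral_const mult_zero_right add_0)
next
  case True
  let ?i1 = "s a1" and ?i2 = "r a1" and ?i3 = "s a2" and ?i4 = "r a4"
  define F where "F k b1 b2 b3 b4 = of_real (inverse (\<phi> k)) *
           W a1 b2 b1 * cnj (W a2 b2 b3) * W a3 b4 b3 * cnj (W a4 b4 b1)" for k b1 b2 b3 b4
  let ?C = "\<lambda>k b1 b2 b3 b4. b1 \<in> arcs_from_to G k ?i1 \<and> b2 \<in> arcs_from_to G ?i2 k \<and>
     b3 \<in> arcs_from_to G k ?i3 \<and> b4 \<in> arcs_from_to G ?i4 k"
  have v: "?i1 \<in> verts G" "?i2 \<in> verts G" "?i3 \<in> verts G" "?i4 \<in> verts G" using assms by auto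
  have a: "a1 \<in> arcs_from_to G ?i1 ?i2" "a2 \<in> arcs_from_to G ?i3 ?i2"
    "a3 \<in> arcs_from_to G ?i3 ?i4" "a4 \<in> arcs_from_to G ?i1 ?i4"
    using assms True by (auto simp: arcs_from_to_def)
  have 1: "(\<Sum>k\<in>verts G. \<Sum>b1\<in>arcs_from_to G k ?i1. \<Sum>b2\<in>arcs_from_to G ?i2 k.
         \<Sum>b3\<in>arcs_from_to G k ?i3. \<Sum>b4\<in>arcs_from_to G ?i4 k. F k b1 b2 b3 b4) =
       of_real ((if a1 = a4 \<and> a2 = a3 then 1 else 0) * \<phi> ?i1 * \<phi> ?i2 * \<phi> ?i3 +
                 (if a1 = a2 \<and> a3 = a4 then 1 else 0) * \<phi> ?i1 * \<phi> ?i2 * \<phi> ?i4)"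
    using conjunct2[OF conjunct2[OF cells[unfolded cell_system_def]], rule_format, OF v a]
    unfolding F_def .
  have "(\<Sum>k\<in>verts G. \<Sum>b1\<in>arcs_from_to G k ?i1. \<Sum>b2\<in>arcs_from_to G ?i2 k.
         \<Sum>b3\<in>arcs_from_to G k ?i3. \<Sum>b4\<in>arcs_from_to G ?i4 k. F k b1 b2 b3 b4) =
      (\<Sum>k\<in>verts G. \<Sum>b1\<in>E. \<Sum>b2\<in>E. \<Sum>b3\<in>E. \<Sum>b4\<in>E.
         if ?C k b1 b2 b3 b4 then F k b1 b2 b3 b4 else 0)"
    by (rule sum.cong[OF refl], rule sum4_if) (auto simp: arcs_from_to_def)
  also have "\<dots> = (\<Sum>b1\<in>E. \<Sum>b2\<in>E. \<Sum>b3\<in>E. \<Sum>b4\<in>E. \<Sum>k\<in>verts G.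
         if ?C k b1 b2 b3 b4 then F k b1 b2 b3 b4 else 0)"
    by (rule trans[OF sum.swap], rule sum.cong[OF refl], rule trans[OF sum.swap], rule sum.cong[OF refl],
        rule trans[OF sum.swap], rule sum.cong[OF refl], rule sum.swap)
  also have "\<dots> = (\<Sum>b1\<in>E. \<Sum>b2\<in>E. \<Sum>b3\<in>E. \<Sum>b4\<in>E.
       inverse (f\<phi> (r b2)) * (w a1 b2 b1 * cnj (w a2 b2 b3) * w a3 b4 b3 * cnj (w a4 b4 b1)))"
  proof (intro sum.cong refl)
    fix b1 b2 b3 b4 assume b: "b1 \<in> E" "b2 \<in> E" "b3 \<in> E" "b4 \<in> E"
    let ?D = "s b1 = r b2 \<and> r b1 = ?i1 \<and> s b2 = ?i2 \<and> s b3 = r b2 \<and> r b3 = ?i3 \<and> s b4 = ?i4 \<and> r b4 = r b2"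
    have "(\<Sum>k\<in>verts G. if ?C k b1 b2 b3 b4 then F k b1 b2 b3 b4 else 0)
      = (\<Sum>k\<in>verts G. if k = r b2 then (if ?D then F (r b2) b1 b2 b3 b4 else 0) else 0)"
      using b by (intro sum.cong) (auto simp: arcs_from_to_def)
    also have "\<dots> = (if ?D then F (r b2) b1 b2 b3 b4 else 0)"
      using b by simp
    also have "\<dots> = inverse (f\<phi> (r b2)) * (w a1 b2 b1 * cnj (w a2 b2 b3) * w a3 b4 b3 * cnj (w a4 b4 b1))"
    proof (cases ?D)
      case D: True
      then have "(a1, b2, b1) \<in> triangles G" "(a2, b2, b3) \<in> triangles G"
        "(a3, b4, b3) \<in> triangles G" "(a4, b4, b1) \<in> triangles G"
        using True b assms by (auto simp: triangles_def)
      then show ?thesis using D by (simp add: w_def F_def)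
    next
      case D: False
      have "w a1 b2 b1 * cnj (w a2 b2 b3) * w a3 b4 b3 * cnj (w a4 b4 b1) = 0"
        using D True w4_nz[of a1 b2 b1 a2 b3 a3 b4 a4] by metis
      then show ?thesis using D by auto
    qed
    finally show "(\<Sum>k\<in>verts G. if ?C k b1 b2 b3 b4 then F k b1 b2 b3 b4 else 0) =
      inverse (f\<phi> (r b2)) * (w a1 b2 b1 * cnj (w a2 b2 b3) * w a3 b4 b3 * cnj (w a4 b4 b1))" .
  qed
  finally have 2: "(\<Sum>b1\<in>E. \<Sum>b2\<in>E. \<Sum>b3\<in>E. \<Sum>b4\<in>E.
       inverse (f\<phi> (r b2)) * (w a1 b2 b1 * cnj (w a2 b2 b3) * w a3 b4 b3 * cnj (w a4 b4 b1))) =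
     of_real ((if a1 = a4 \<and> a2 = a3 then 1 else 0) * \<phi> ?i1 * \<phi> ?i2 * \<phi> ?i3 +
                 (if a1 = a2 \<and> a3 = a4 then 1 else 0) * \<phi> ?i1 * \<phi> ?i2 * \<phi> ?i4)"
    unfolding 1 by (rule sym)
  have "r a1 = r a2 \<longleftrightarrow> HOL.True" "s a1 = s a4 \<longleftrightarrow> HOL.True" using True by simp_all
  then show ?thesis unfolding 2
    by (cases "a1 = a4 \<and> a2 = a3"; cases "a1 = a2 \<and> a3 = a4")
      (simp_all only: simp_thms if_True if_False of_real_add of_real_mult of_real_0 mult_1 mult_zero_left
        add_0 add_0_right mult_ac)
qed

text \<open>The form in which relation (II) is used: \<open>b, b', d, c\<close> are summed over.\<close>

lemma typeII_normalised:
  assumes "a0 \<in> E" "g \<in> E" "f' \<in> E" "a \<in> E"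
  shows "(\<Sum>b\<in>E. \<Sum>b'\<in>E. \<Sum>d\<in>E. \<Sum>c\<in>E.
       w a0 b b' * (cnj (w a d b') / (f\<phi> (s d) * f\<phi> (r b'))) *
       (cnj (w c g b) * w c f' d / (f\<phi> (s g) * f\<phi> (r b)))) =
    (if a0 = a \<and> g = f' \<and> r a0 = r g then 1 else 0) +
    (if a0 = g \<and> f' = a \<and> s a0 = s a then f\<phi> (r a0) / f\<phi> (s a0) else 0)"
proof -
  \<comment> \<open>The denominators without \<open>f\<phi> (r b)\<close>, which is the weight
    already present in (II). Where the weights do not vanish, \<open>s d = r a\<close> and
    \<open>r b' = s a0\<close>.\<close>
  let ?k = "f\<phi> (r a) * f\<phi> (s a0) * f\<phi> (s g)"
  have nz: "?k \<noteq> 0" using assms by simp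
  have "(\<Sum>b\<in>E. \<Sum>b'\<in>E. \<Sum>d\<in>E. \<Sum>c\<in>E.
       w a0 b b' * (cnj (w a d b') / (f\<phi> (s d) * f\<phi> (r b'))) *
       (cnj (w c g b) * w c f' d / (f\<phi> (s g) * f\<phi> (r b)))) =
     (\<Sum>b\<in>E. \<Sum>b'\<in>E. \<Sum>d\<in>E. \<Sum>c\<in>E. inverse ?k * (inverse (f\<phi> (r b)) *
       (w a0 b b' * cnj (w g b c) * w f' d c * cnj (w a d b'))))"
  proof (intro sum.cong refl)
    fix b b' d c assume "b \<in> E" "b' \<in> E" "d \<in> E" "c \<in> E"
    \<comment> \<open>Cyclic rotation brings the product into the shape of (II) with
      \<open>a1, a2, a3, a4 = a0, g, f', a\<close> and
      \<open>b1, b2, b3, b4 = b', b, c, d\<close>.\<close>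
    have 1: "w g b c = w c g b" "w f' d c = w c f' d" using w_cyc by metis+
    show "w a0 b b' * (cnj (w a d b') / (f\<phi> (s d) * f\<phi> (r b'))) *
       (cnj (w c g b) * w c f' d / (f\<phi> (s g) * f\<phi> (r b))) =
       inverse ?k * (inverse (f\<phi> (r b)) * (w a0 b b' * cnj (w g b c) * w f' d c * cnj (w a d b')))"
    proof (cases "w a0 b b' = 0 \<or> w a d b' = 0")
      case False
      then have "s d = r a" "r b' = s a0" using w_nz[of a0 b b'] w_nz[of a d b'] by auto
      then show ?thesis unfolding 1 by (simp add: field_simps)
    qed auto
  qed
  also have "\<dots> = inverse ?k * (\<Sum>b\<in>E. \<Sum>b'\<in>E. \<Sum>d\<in>E. \<Sum>c\<in>E. inverse (f\<phi> (r b)) *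
       (w a0 b b' * cnj (w g b c) * w f' d c * cnj (w a d b')))"
    by (simp add: sum_distrib_left)
  also have "(\<Sum>b\<in>E. \<Sum>b'\<in>E. \<Sum>d\<in>E. \<Sum>c\<in>E. inverse (f\<phi> (r b)) *
       (w a0 b b' * cnj (w g b c) * w f' d c * cnj (w a d b'))) =
      (\<Sum>b'\<in>E. \<Sum>b\<in>E. \<Sum>c\<in>E. \<Sum>d\<in>E. inverse (f\<phi> (r b)) *
       (w a0 b b' * cnj (w g b c) * w f' d c * cnj (w a d b')))"
    by (rule trans[OF sum.swap], rule sum.cong[OF refl], rule sum.cong[OF refl], rule sum.swap)
  also have "\<dots> =
    (if a0 = a \<and> g = f' \<and> r a0 = r g then f\<phi> (s a0) * f\<phi> (r a0) * f\<phi> (s g) else 0) +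
    (if a0 = g \<and> f' = a \<and> s a0 = s a then f\<phi> (s a0) * f\<phi> (r a0) * f\<phi> (r a) else 0)"
    by (rule typeII[OF assms])
  also have "inverse ?k * ((if a0 = a \<and> g = f' \<and> r a0 = r g then f\<phi> (s a0) * f\<phi> (r a0) * f\<phi> (s g) else 0) +
    (if a0 = g \<and> f' = a \<and> s a0 = s a then f\<phi> (s a0) * f\<phi> (r a0) * f\<phi> (r a) else 0)) =
    (if a0 = a \<and> g = f' \<and> r a0 = r g then 1 else 0) +
    (if a0 = g \<and> f' = a \<and> s a0 = s a then f\<phi> (r a0) / f\<phi> (s a0) else 0)" (is "_ * ((if ?P then _ else _) + (if ?R then _ else _)) = _")
  proof -
    have "inverse ?k * (if ?P then f\<phi> (s a0) * f\<phi> (r a0) * f\<phi> (s g) else 0) = (if ?P then 1 else 0)"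
    proof (cases ?P)
      case True
      then have "r a = r a0" by simp
      then show ?thesis using True nz by (simp only: if_True) (simp add: field_simps)
    qed (simp only: if_False mult_zero_right)
    moreover have "inverse ?k * (if ?R then f\<phi> (s a0) * f\<phi> (r a0) * f\<phi> (r a) else 0) =
       (if ?R then f\<phi> (r a0) / f\<phi> (s a0) else 0)"
    proof (cases ?R)
      case True
      then have "s g = s a0" by simp
      then show ?thesis using True nz by (simp only: if_True) (simp add: field_simps)
    qed (simp only: if_False mult_zero_right)
    ultimately show ?thesis by (simp only: distrib_left)
  qed
  finally show ?thesis .
qed

text \<open>The Perron-Frobenius equation is given for incoming arcs only; the one for outgoing arcs
  follows from the cells. For an arc \<open>b\<close> starting in \<open>i\<close>, summing (II)
  over squares with sides \<open>a, a, b, b\<close> produces the outgoing sum, while two uses of (I)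
  evaluate the same expression as \<open>[2]\<close> squared.\<close>

lemma sum_phi_out:
  assumes "i \<in> verts G"
  shows "(\<Sum>a\<in>E. if s a = i then f\<phi> (r a) else 0) = (Q 2 * Q 2 - 1) * f\<phi> i"
proof -
  have q2: "Q 2 \<noteq> 0" using h4 by (intro quantum_num_nonzero) auto
  have "(\<Sum>u\<in>verts G. real (num_arcs G u i) * \<phi> u) = quantum3 h * \<phi> i"
    using pf assms by (auto simp: perron_frobenius_def)
  moreover have "quantum3 h \<noteq> 0"
  proof -
    have "0 \<le> 2 * pi / real h" "2 * pi / real h \<le> pi / 2" using h4 by (auto simp: field_simps)
    then have "cos (2 * pi / real h) \<ge> 0" using pi_ge_zero by (intro cos_ge_zero) linarith+
    then show ?thesis by (simp add: quantum3_def)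
  qed
  \<comment> \<open>An arc starting in \<open>i\<close> has to be found first. The eigenvector
    equation gives an arc into \<open>i\<close>, and (I) for that arc gives a triangle through
    it.\<close>
  ultimately have "\<exists>u\<in>verts G. num_arcs G u i \<noteq> 0"
    using phi_pos[OF assms] by (metis (no_types, lifting) mult_eq_0_iff mult_zero_left of_nat_0 order_less_irrefl sum.neutral)
  then obtain u where "num_arcs G u i \<noteq> 0" by blast
  then obtain c0 where c0: "c0 \<in> E" "r c0 = i"
    unfolding num_arcs_def arcs_from_to_def by (metis (mono_tags, lifting) card.empty empty_Collect_eq)
  have "(\<Sum>b\<in>E. \<Sum>c\<in>E. w c0 b c * cnj (w c0 b c)) \<noteq> 0"
    using typeI[OF c0(1,1)] c0 q2 phi_nz[OF c0(1)] by simp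
  then obtain b c where "w c0 b c * cnj (w c0 b c) \<noteq> 0" by (metis (no_types, lifting) sum.neutral)
  then have a4: "b \<in> E" "s b = i" using w_nz[of c0 b c] c0 by auto
  \<comment> \<open>The first delta of (II) survives only for \<open>a = b\<close>, the second for
    every arc \<open>a\<close> out of \<open>i\<close>.\<close>
  have T: "(\<Sum>a\<in>E. \<Sum>b1\<in>E. \<Sum>b2\<in>E. \<Sum>b3\<in>E. \<Sum>b4\<in>E.
       inverse (f\<phi> (r b2)) * (w a b2 b1 * cnj (w a b2 b3) * w b b4 b3 * cnj (w b b4 b1))) =
      f\<phi> i * f\<phi> (r b) * (f\<phi> i + (\<Sum>a\<in>E. if s a = i then f\<phi> (r a) else 0))"
  proof -
    have "(\<Sum>a\<in>E. \<Sum>b1\<in>E. \<Sum>b2\<in>E. \<Sum>b3\<in>E. \<Sum>b4\<in>E.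
       inverse (f\<phi> (r b2)) * (w a b2 b1 * cnj (w a b2 b3) * w b b4 b3 * cnj (w b b4 b1))) =
      (\<Sum>a\<in>E. (if a = b then f\<phi> i * f\<phi> (r b) * f\<phi> i else 0) +
         (f\<phi> i * f\<phi> (r b)) * (if s a = i then f\<phi> (r a) else 0))"
      using a4 by (intro sum.cong refl, subst typeII) auto
    then show ?thesis using a4
      by (simp add: sum.distrib sum_distrib_left[symmetric] algebra_simps)
  qed
  let ?t = "\<lambda>a b1 b2 b3 b4. inverse (f\<phi> (r b2)) * (w a b2 b1 * cnj (w a b2 b3) * w b b4 b3 * cnj (w b b4 b1))"
  have "(\<Sum>a\<in>E. \<Sum>b1\<in>E. \<Sum>b2\<in>E. \<Sum>b3\<in>E. \<Sum>b4\<in>E. ?t a b1 b2 b3 b4) =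
     (\<Sum>b1\<in>E. \<Sum>a\<in>E. \<Sum>b2\<in>E. \<Sum>b3\<in>E. \<Sum>b4\<in>E. ?t a b1 b2 b3 b4)"
    by (rule sum.swap)
  also have "\<dots> = (\<Sum>b1\<in>E. \<Sum>b3\<in>E. \<Sum>a\<in>E. \<Sum>b2\<in>E. \<Sum>b4\<in>E. ?t a b1 b2 b3 b4)"
  proof (rule sum.cong[OF refl])
    fix b1
    have "(\<Sum>a\<in>E. \<Sum>b2\<in>E. \<Sum>b3\<in>E. \<Sum>b4\<in>E. ?t a b1 b2 b3 b4) =
      (\<Sum>a\<in>E. \<Sum>b3\<in>E. \<Sum>b2\<in>E. \<Sum>b4\<in>E. ?t a b1 b2 b3 b4)"
      by (rule sum.cong[OF refl], rule sum.swap)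
    also have "\<dots> = (\<Sum>b3\<in>E. \<Sum>a\<in>E. \<Sum>b2\<in>E. \<Sum>b4\<in>E. ?t a b1 b2 b3 b4)"
      by (rule sum.swap)
    finally show "(\<Sum>a\<in>E. \<Sum>b2\<in>E. \<Sum>b3\<in>E. \<Sum>b4\<in>E. ?t a b1 b2 b3 b4) =
      (\<Sum>b3\<in>E. \<Sum>a\<in>E. \<Sum>b2\<in>E. \<Sum>b4\<in>E. ?t a b1 b2 b3 b4)" .
  qed
  \<comment> \<open>Now the inner sum over \<open>a, b2\<close> is (I) for the arcs
    \<open>b1, b3\<close>. It forces them to be equal, and what remains is (I) for
    \<open>b\<close>.\<close>
  also have "\<dots> = (\<Sum>b1\<in>E. \<Sum>b3\<in>E. \<Sum>b4\<in>E. w b b4 b3 * cnj (w b b4 b1) *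
      (inverse (f\<phi> (s b1)) * (\<Sum>a\<in>E. \<Sum>b2\<in>E. w b1 a b2 * cnj (w b3 a b2))))"
  proof (rule sum.cong[OF refl], rule sum.cong[OF refl])
    fix b1 b3 assume b: "b1 \<in> E" "b3 \<in> E"
    have t: "?t a b1 b2 b3 b4 = w b b4 b3 * cnj (w b b4 b1) * (inverse (f\<phi> (s b1)) * (w b1 a b2 * cnj (w b3 a b2)))" for a b2 b4
    proof -
      have 1: "w a b2 b1 = w b1 a b2" "w a b2 b3 = w b3 a b2" using w_cyc by metis+
      show ?thesis
      proof (cases "w b1 a b2 = 0")
        case False
        then have "r b2 = s b1" using w_nz[of b1 a b2] by simp
        then show ?thesis unfolding 1 by (simp add: mult_ac)
      qed (simp add: 1)
    qed
    have "(\<Sum>a\<in>E. \<Sum>b2\<in>E. \<Sum>b4\<in>E. ?t a b1 b2 b3 b4) =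
       (\<Sum>a\<in>E. \<Sum>b2\<in>E. \<Sum>b4\<in>E. w b b4 b3 * cnj (w b b4 b1) * (inverse (f\<phi> (s b1)) * (w b1 a b2 * cnj (w b3 a b2))))"
      unfolding t ..
    also have "\<dots> = (\<Sum>a\<in>E. \<Sum>b4\<in>E. \<Sum>b2\<in>E. w b b4 b3 * cnj (w b b4 b1) * (inverse (f\<phi> (s b1)) * (w b1 a b2 * cnj (w b3 a b2))))"
      by (rule sum.cong[OF refl], rule sum.swap)
    also have "\<dots> = (\<Sum>b4\<in>E. \<Sum>a\<in>E. \<Sum>b2\<in>E. w b b4 b3 * cnj (w b b4 b1) * (inverse (f\<phi> (s b1)) * (w b1 a b2 * cnj (w b3 a b2))))"
      by (rule sum.swap)
    finally show "(\<Sum>a\<in>E. \<Sum>b2\<in>E. \<Sum>b4\<in>E. ?t a b1 b2 b3 b4) =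
      (\<Sum>b4\<in>E. w b b4 b3 * cnj (w b b4 b1) *
      (inverse (f\<phi> (s b1)) * (\<Sum>a\<in>E. \<Sum>b2\<in>E. w b1 a b2 * cnj (w b3 a b2))))"
      by (simp only: sum_distrib_left)
  qed
  also have "\<dots> = (\<Sum>b1\<in>E. \<Sum>b3\<in>E. if b3 = b1 then \<Sum>b4\<in>E. w b b4 b1 * cnj (w b b4 b1) * (Q 2 * f\<phi> i) else 0)"
  proof (intro sum.cong refl)
    fix b1 b3 assume b: "b1 \<in> E" "b3 \<in> E"
    have *: "w b b4 b1 * cnj (w b b4 b1) * (Q 2 * f\<phi> (r b1)) = w b b4 b1 * cnj (w b b4 b1) * (Q 2 * f\<phi> i)" for b4
      using w_nz[of b b4 b1] a4 by (cases "w b b4 b1 = 0") auto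
    show "(\<Sum>b4\<in>E. w b b4 b3 * cnj (w b b4 b1) *
      (inverse (f\<phi> (s b1)) * (\<Sum>a\<in>E. \<Sum>b2\<in>E. w b1 a b2 * cnj (w b3 a b2)))) =
      (if b3 = b1 then \<Sum>b4\<in>E. w b b4 b1 * cnj (w b b4 b1) * (Q 2 * f\<phi> i) else 0)"
      unfolding typeI[OF b] using b by (auto simp: *[symmetric] intro!: sum.cong)
  qed
  also have "\<dots> = (\<Sum>b1\<in>E. \<Sum>b4\<in>E. w b b4 b1 * cnj (w b b4 b1)) * (Q 2 * f\<phi> i)"
    by (simp add: sum_distrib_right)
  also have "(\<Sum>b1\<in>E. \<Sum>b4\<in>E. w b b4 b1 * cnj (w b b4 b1)) = Q 2 * f\<phi> i * f\<phi> (r b)"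
    by (subst sum.swap) (simp add: typeI a4)
  finally have "f\<phi> i * f\<phi> (r b) * (f\<phi> i + (\<Sum>a\<in>E. if s a = i then f\<phi> (r a) else 0)) =
     f\<phi> i * f\<phi> (r b) * (Q 2 * Q 2 * f\<phi> i)"
    unfolding T by (simp add: mult_ac)
  then have "f\<phi> i + (\<Sum>a\<in>E. if s a = i then f\<phi> (r a) else 0) = Q 2 * Q 2 * f\<phi> i"
    using phi_pos[OF assms] a4 by auto
  then show ?thesis by (simp add: algebra_simps)
qed

end

section \<open>Exactness\<close>

context cell_setting
begin

section \<open>Restriction operators, their adjoints, and the functions that annihilate the
  relations\<close>

abbreviation M :: "'e \<Rightarrow> ('e list \<Rightarrow> complex) \<Rightarrow> 'e list \<Rightarrow> complex" where
  "M e f \<equiv> (\<lambda>x. f (e # x))"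

text \<open>The Hecke generator of the cell system, as a matrix from functions of
  \<open>c, e\<close> to functions of \<open>b, e'\<close>. By (I) it is \<open>[2]\<close> times a
  projection, and its kernel consists of the functions on two-arc paths that annihilate all
  relations.\<close>

definition U :: "'e \<Rightarrow> 'e \<Rightarrow> 'e \<Rightarrow> 'e \<Rightarrow> complex" where
  "U b e' c e = (\<Sum>a\<in>E. cnj (w a b e') / (f\<phi> (s b) * f\<phi> (r e')) * w a c e)"

text \<open>A deformed creation operator: \<open>N e f\<close> is a function on paths with one more
  arc, fixed by what remains after splitting off the head \<open>e'\<close>. The recursion is the
  product rule \<open>M e' N e = [p + 1] - U N M\<close>, with the first term only for
  \<open>e = e'\<close>; the path comes first as an argument because it drives the
  recursion.\<close>

primrec Nl :: "'e list \<Rightarrow> 'e \<Rightarrow> ('e list \<Rightarrow> complex) \<Rightarrow> complex" where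
  "Nl [] e f = 0"
| "Nl (e' # x) e f = (if e = e' then Q (Suc (length x)) * f x else 0) -
     (\<Sum>b\<in>E. \<Sum>c\<in>E. U b e' c e * Nl x b (M c f))"

definition N :: "'e \<Rightarrow> ('e list \<Rightarrow> complex) \<Rightarrow> 'e list \<Rightarrow> complex" where
  "N e f = (\<lambda>x. Nl x e f)"

lemma N_Nil [simp]: "N e f [] = 0"
  by (simp add: N_def)

lemma N_Cons: "N e f (e' # x) = (if e = e' then Q (Suc (length x)) * f x else 0) -
     (\<Sum>b\<in>E. \<Sum>c\<in>E. U b e' c e * N b (M c f) x)"
  by (simp add: N_def)

lemma N_lincomb: "N e (\<lambda>x. \<Sum>i\<in>I. k i * F i x) x = (\<Sum>i\<in>I. k i * N e (F i) x)"
proof (induction x arbitrary: e F)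
  case (Cons e' x)
  have "N e (\<lambda>x. \<Sum>i\<in>I. k i * F i x) (e' # x) =
     (if e = e' then Q (Suc (length x)) * (\<Sum>i\<in>I. k i * F i x) else 0) -
       (\<Sum>b\<in>E. \<Sum>c\<in>E. U b e' c e * (\<Sum>i\<in>I. k i * N b (M c (F i)) x))"
    unfolding N_Cons Cons.IH[of _ "\<lambda>i. M _ (F i)"] ..
  also have "(\<Sum>b\<in>E. \<Sum>c\<in>E. U b e' c e * (\<Sum>i\<in>I. k i * N b (M c (F i)) x)) =
      (\<Sum>b\<in>E. \<Sum>c\<in>E. \<Sum>i\<in>I. k i * (U b e' c e * N b (M c (F i)) x))"
    by (simp add: sum_distrib_left mult.left_commute)
  also have "\<dots> = (\<Sum>b\<in>E. \<Sum>i\<in>I. \<Sum>c\<in>E. k i * (U b e' c e * N b (M c (F i)) x))"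
    by (rule sum.cong[OF refl], rule sum.swap)
  also have "\<dots> = (\<Sum>i\<in>I. \<Sum>b\<in>E. \<Sum>c\<in>E. k i * (U b e' c e * N b (M c (F i)) x))"
    by (rule sum.swap)
  also have "\<dots> = (\<Sum>i\<in>I. k i * (\<Sum>b\<in>E. \<Sum>c\<in>E. U b e' c e * N b (M c (F i)) x))"
    by (simp only: sum_distrib_left)
  finally show ?case
    by (simp add: N_Cons right_diff_distrib sum_subtractf sum_distrib_left mult_ac
        del: fun_space.scale_right_diff_distrib)
qed simp

lemma N_zero: "N e (\<lambda>x. 0) x = 0"
  using N_lincomb[of e "\<lambda>_. 0" "\<lambda>_ _. 0" "{}" x] by simp

text \<open>Paths are written backwards: the head of the list is the last arc, which ends in \<open>j\<close>.\<close>

primrec S :: "nat \<Rightarrow> 'v \<Rightarrow> 'v \<Rightarrow> ('e list \<Rightarrow> complex) set" where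
  "S 0 i j = {f. \<forall>x. x \<noteq> [] \<or> i \<noteq> j \<longrightarrow> f x = 0}"
| "S (Suc p) i j = {f. f [] = 0 \<and>
     (\<forall>e. if e \<in> E \<and> r e = j then M e f \<in> S p i (s e) else M e f = (\<lambda>x. 0)) \<and>
     (\<forall>a\<in>E. \<forall>x. (\<Sum>b\<in>E. \<Sum>b'\<in>E. w a b b' * f (b' # b # x)) = 0)}"

lemma S_zero: "(\<lambda>x. 0) \<in> S p i j"
  by (induction p arbitrary: j) auto

lemma S_lincomb:
  assumes "\<And>t. t \<in> I \<Longrightarrow> F t \<in> S p i j"
  shows "(\<lambda>x. \<Sum>t\<in>I. k t * F t x) \<in> S p i j"
  using assms
proof (induction p arbitrary: j F)
  case (Suc p)
  note F = Suc.prems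
  show ?case
  proof (simp only: S.simps mem_Collect_eq, intro conjI allI ballI)
    show "(\<Sum>t\<in>I. k t * F t []) = 0" using F by (auto intro!: sum.neutral)
    show "if e \<in> E \<and> r e = j then M e (\<lambda>x. \<Sum>t\<in>I. k t * F t x) \<in> S p i (s e)
      else M e (\<lambda>x. \<Sum>t\<in>I. k t * F t x) = (\<lambda>x. 0)" for e
    proof (cases "e \<in> E \<and> r e = j")
      case True
      then show ?thesis using F Suc.IH[of "\<lambda>t. M e (F t)" "s e"] by auto
    next
      case False
      have "F t (e # x) = 0" if "t \<in> I" for t x
      proof -
        have "if e \<in> E \<and> r e = j then M e (F t) \<in> S p i (s e) else M e (F t) = (\<lambda>x. 0)"
          using F[OF that] by simp
        then have "M e (F t) = (\<lambda>x. 0)" unfolding if_not_P[OF False] .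
        then show ?thesis by (rule fun_cong)
      qed
      then show ?thesis using False by (auto intro!: sum.neutral)
    qed
    fix a x assume a: "a \<in> E"
    have "(\<Sum>b\<in>E. \<Sum>b'\<in>E. w a b b' * (\<Sum>t\<in>I. k t * F t (b' # b # x))) =
      (\<Sum>b\<in>E. \<Sum>b'\<in>E. \<Sum>t\<in>I. k t * (w a b b' * F t (b' # b # x)))"
      by (simp add: sum_distrib_left mult.left_commute)
    also have "\<dots> = (\<Sum>b\<in>E. \<Sum>t\<in>I. \<Sum>b'\<in>E. k t * (w a b b' * F t (b' # b # x)))"
      by (rule sum.cong[OF refl], rule sum.swap)
    also have "\<dots> = (\<Sum>t\<in>I. \<Sum>b\<in>E. \<Sum>b'\<in>E. k t * (w a b b' * F t (b' # b # x)))"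
      by (rule sum.swap)
    also have "\<dots> = (\<Sum>t\<in>I. k t * (\<Sum>b\<in>E. \<Sum>b'\<in>E. w a b b' * F t (b' # b # x)))"
      by (simp only: sum_distrib_left)
    also have "\<dots> = 0" using F a by (intro sum.neutral) auto
    finally show "(\<Sum>b\<in>E. \<Sum>b'\<in>E. w a b b' * (\<Sum>t\<in>I. k t * F t (b' # b # x))) = 0" .
  qed
qed (auto intro!: sum.neutral)

lemma S_add: "f \<in> S p i j \<Longrightarrow> g \<in> S p i j \<Longrightarrow> (\<lambda>x. f x + g x) \<in> S p i j"
  using S_lincomb[of "{True, False}" "\<lambda>t. if t then f else g" p i j "\<lambda>_. 1"] by simp

lemma S_scale: "f \<in> S p i j \<Longrightarrow> (\<lambda>x. k * f x) \<in> S p i j"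
  using S_lincomb[of "{()}" "\<lambda>_. f" p i j "\<lambda>_. k"] by simp

lemma S_diff: "f \<in> S p i j \<Longrightarrow> g \<in> S p i j \<Longrightarrow> (\<lambda>x. f x - g x) \<in> S p i j"
  using S_add[of f p i j "\<lambda>x. (-1) * g x"] S_scale[of g p i j "-1"] by simp

lemma subspace_S: "fun_space.subspace (S p i j)"
  by (rule fun_space.subspaceI) (auto simp: zero_fun_def plus_fun_def S_zero S_add S_scale)

lemma S_awalk:
  assumes "f \<in> S p i j" "f x \<noteq> 0" "j \<in> verts G"
  shows "length x = p \<and> awalk i (rev x) j"
  using assms
proof (induction p arbitrary: j f x)
  case 0
  then show ?case by (cases "x = [] \<and> i = j") (auto simp: awalk_Nil_iff)
next
  case (Suc p)
  then obtain e y where x: "x = e # y" by (cases x) auto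
  have e: "e \<in> E \<and> r e = j" using Suc.prems x by (auto split: if_splits dest: fun_cong)
  then have "M e f \<in> S p i (s e)" using Suc.prems(1) by auto
  then have "length y = p \<and> awalk i (rev y) (s e)"
    using Suc.IH[of "M e f" "s e" y] Suc.prems(2) x e by auto
  then show ?case using e x by (auto simp: awalk_simps arc_implies_awalk)
qed

lemma S_sum: "(\<And>t. t \<in> I \<Longrightarrow> F t \<in> S p i j) \<Longrightarrow> (\<lambda>x. \<Sum>t\<in>I. F t x) \<in> S p i j"
  using S_lincomb[of I F p i j "\<lambda>_. 1"] by simp

lemma S_arcs: "f \<in> S p i j \<Longrightarrow> f x \<noteq> 0 \<Longrightarrow> set x \<subseteq> E \<and> length x = p"
proof (induction p arbitrary: j f x)
  case 0
  then show ?case by (cases "x = [] \<and> i = j") auto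
next
  case (Suc p)
  then obtain e y where x: "x = e # y" by (cases x) auto
  have e: "e \<in> E \<and> r e = j" using Suc.prems x by (auto split: if_splits dest: fun_cong)
  then have "M e f \<in> S p i (s e)" using Suc.prems(1) by auto
  then show ?case using Suc.IH[of "M e f" "s e" y] Suc.prems(2) x e by auto
qed

lemma S_length: "f \<in> S p i j \<Longrightarrow> f x \<noteq> 0 \<Longrightarrow> length x = p"
  using S_arcs by blast

lemma S_supported: "S p i j \<subseteq> supported_on {x. set x \<subseteq> E \<and> length x = p}"
proof
  fix f assume "f \<in> S p i j"
  then show "f \<in> supported_on {x. set x \<subseteq> E \<and> length x = p}"
    using S_arcs[of f p i j] unfolding supported_on_def by blast
qed

lemma finite_arc_lists: "finite {x. set x \<subseteq> E \<and> length x = p}"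
  by (rule finite_lists_length_eq) simp

lemma M_S: "f \<in> S (Suc p) i j \<Longrightarrow> M e f \<in> S p i (s e)"
  using S_zero[of p i "s e"] by (auto split: if_splits dest: spec[of _ e])

lemma M_S_0:
  assumes "f \<in> S p i j" "e \<notin> E \<or> r e \<noteq> j \<or> p = 0"
  shows "f (e # x) = 0"
  using assms by (cases p) (auto split: if_splits dest: spec[of _ e] fun_cong)

declare S.simps(2) [simp del]

lemma S_rel:
  assumes "f \<in> S p i j"
  shows "(\<Sum>b\<in>E. \<Sum>b'\<in>E. w a b b' * f (b' # b # x)) = 0"
proof (cases "p = 0 \<or> a \<notin> E")
  case True
  then have "w a b b' * f (b' # b # x) = 0" for b b'
    using M_S_0[OF assms] w_nz[of a b b'] by (cases "w a b b' = 0") auto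
  then show ?thesis by (simp only: sum.neutral_const)
next
  case False
  then show ?thesis using assms by (cases p) (auto simp: S.simps(2))
qed

text \<open>The coefficient in \<open>Nl\<close> depends on the length of the argument. On
  \<open>S p i j\<close> the degree can take its place, because \<open>f x\<close> is zero at every
  other length.\<close>

lemma MN:
  assumes "f \<in> S p i j"
  shows "N e f (e' # x) = (if e = e' then Q (Suc p) * f x else 0) -
     (\<Sum>b\<in>E. \<Sum>c\<in>E. U b e' c e * N b (M c f) x)"
  using S_length[OF assms, of x] by (auto simp: N_Cons)

text \<open>Euler's identity: \<open>N\<close> and \<open>M\<close> play the roles of multiplication and differentiation
  by the arcs.\<close>

lemma euler:
  assumes f: "f \<in> S p i j"
  shows "(\<Sum>b\<in>E. N b (M b f) x) = Q p * f x"
proof (cases x)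
  case Nil
  then show ?thesis using f by (cases p) (auto simp: S.simps(2))
next
  case (Cons e' y)
  have "(\<Sum>b\<in>E. \<Sum>d\<in>E. \<Sum>c\<in>E. U d e' c b * N d (M c (M b f)) y) =
     (\<Sum>b\<in>E. \<Sum>d\<in>E. \<Sum>c\<in>E. \<Sum>a\<in>E. cnj (w a d e') / (f\<phi> (s d) * f\<phi> (r e')) * (w a c b * N d (M c (M b f)) y))"
    by (simp add: U_def sum_distrib_right mult.assoc)
  also have "\<dots> = (\<Sum>d\<in>E. \<Sum>b\<in>E. \<Sum>c\<in>E. \<Sum>a\<in>E. cnj (w a d e') / (f\<phi> (s d) * f\<phi> (r e')) * (w a c b * N d (M c (M b f)) y))"
    by (rule sum.swap)
  also have "\<dots> = (\<Sum>d\<in>E. \<Sum>c\<in>E. \<Sum>b\<in>E. \<Sum>a\<in>E. cnj (w a d e') / (f\<phi> (s d) * f\<phi> (r e')) * (w a c b * N d (M c (M b f)) y))"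
    by (rule sum.cong[OF refl], rule sum.swap)
  also have "\<dots> = (\<Sum>d\<in>E. \<Sum>c\<in>E. \<Sum>a\<in>E. \<Sum>b\<in>E. cnj (w a d e') / (f\<phi> (s d) * f\<phi> (r e')) * (w a c b * N d (M c (M b f)) y))"
    by (rule sum.cong[OF refl], rule sum.cong[OF refl], rule sum.swap)
  also have "\<dots> = (\<Sum>d\<in>E. \<Sum>a\<in>E. \<Sum>c\<in>E. \<Sum>b\<in>E. cnj (w a d e') / (f\<phi> (s d) * f\<phi> (r e')) * (w a c b * N d (M c (M b f)) y))"
    by (rule sum.cong[OF refl], rule sum.swap)
  also have "\<dots> = (\<Sum>d\<in>E. \<Sum>a\<in>E. cnj (w a d e') / (f\<phi> (s d) * f\<phi> (r e')) *
       (\<Sum>c\<in>E. \<Sum>b\<in>E. w a c b * N d (M c (M b f)) y))"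
    by (simp only: sum_distrib_left)
  also have "\<dots> = 0"
  proof -
    \<comment> \<open>By linearity this is \<open>N d\<close> applied to a function that is zero
      because \<open>f\<close> satisfies the relation of \<open>a\<close>. So the correction by
      \<open>U\<close> drops out of the Euler sum.\<close>
    have "(\<Sum>c\<in>E. \<Sum>b\<in>E. w a c b * N d (M c (M b f)) y) = 0" for a d
    proof -
      have "(\<Sum>c\<in>E. \<Sum>b\<in>E. w a c b * N d (M c (M b f)) y) =
        (\<Sum>c\<in>E. 1 * N d (\<lambda>z. \<Sum>b\<in>E. w a c b * M c (M b f) z) y)"
        by (simp only: N_lincomb mult_1)
      also have "\<dots> = N d (\<lambda>z. \<Sum>c\<in>E. 1 * (\<Sum>b\<in>E. w a c b * M c (M b f) z)) y"
        by (simp only: N_lincomb)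
      also have "\<dots> = 0" by (simp add: S_rel[OF f] N_zero)
      finally show ?thesis .
    qed
    then show ?thesis by simp
  qed
  finally have 1: "(\<Sum>b\<in>E. \<Sum>d\<in>E. \<Sum>c\<in>E. U d e' c b * N d (M c (M b f)) y) = 0" .
  have "(\<Sum>b\<in>E. N b (M b f) x) = (\<Sum>b\<in>E. if b = e' then Q (Suc (length y)) * f (e' # y) else 0) -
      (\<Sum>b\<in>E. \<Sum>d\<in>E. \<Sum>c\<in>E. U d e' c b * N d (M c (M b f)) y)"
    unfolding Cons sum_subtractf[symmetric] by (rule sum.cong) (auto simp: N_Cons)
  also have "\<dots> = Q p * f x"
    using 1 Cons S_length[OF f, of x] M_S_0[OF f, of e' y] by (cases "f x = 0") auto
  finally show ?thesis .
qed

text \<open>The contracting homotopy before division by a quantum integer: it raises a family over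
  the arcs \<open>a\<close> by one degree, with the conjugate weights of the adjoint of
  \<open>TK\<close>. The same expression, for a suitable family, is the correction term in
  \<open>N e f\<close>, so one computation serves exactness and \<open>N_S\<close>.\<close>

definition KN :: "('e \<Rightarrow> 'e list \<Rightarrow> complex) \<Rightarrow> 'e \<Rightarrow> 'e list \<Rightarrow> complex" where
  "KN H b' = (\<lambda>x. \<Sum>a\<in>E. \<Sum>d\<in>E. cnj (w a d b') / (f\<phi> (s d) * f\<phi> (r b')) * N d (H a) x)"

lemma sum7_rearrange:
  fixes F :: "'e \<Rightarrow> 'e \<Rightarrow> 'e \<Rightarrow> 'e \<Rightarrow> 'e \<Rightarrow> 'e \<Rightarrow> 'e \<Rightarrow> complex"
  shows "(\<Sum>b\<in>E. \<Sum>b'\<in>E. \<Sum>a\<in>E. \<Sum>d\<in>E. \<Sum>g\<in>E. \<Sum>f'\<in>E. \<Sum>c\<in>E. F b b' a d g f' c) =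
    (\<Sum>a\<in>E. \<Sum>g\<in>E. \<Sum>f'\<in>E. \<Sum>b\<in>E. \<Sum>b'\<in>E. \<Sum>d\<in>E. \<Sum>c\<in>E. F b b' a d g f' c)"
  unfolding sum.cartesian_product
  by (rule sum.reindex_bij_witness[where
      i = "\<lambda>(a, g, f', b, b', d, c). (b, b', a, d, g, f', c)" and
      j = "\<lambda>(b, b', a, d, g, f', c). (a, g, f', b, b', d, c)"]) auto

text \<open>The product rule splits each \<open>N d (H a)\<close> in two. Its diagonal part is
  evaluated by (I) and gives \<open>[2] [q + 1] H a0\<close>. Its \<open>U\<close> part is evaluated
  by (II): one delta leaves an Euler sum, hence \<open>[q] H a0\<close>, the other leaves the term
  with \<open>N a0\<close>. Finally \<open>[2] [q + 1] - [q] = [q + 2]\<close>.\<close>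

lemma homotopy:
  assumes H: "\<And>a. a \<in> E \<Longrightarrow> H a \<in> S q i (r a)" and a0: "a0 \<in> E"
  shows "(\<Sum>b\<in>E. \<Sum>b'\<in>E. w a0 b b' * KN H b' (b # x)) =
    Q (q + 2) * H a0 x - f\<phi> (r a0) / f\<phi> (s a0) *
      N a0 (\<lambda>y. \<Sum>a\<in>E. (if s a = s a0 then 1 else 0) * H a (a # y)) x"
proof -
  let ?u = "\<lambda>a d b'. cnj (w a d b') / (f\<phi> (s d) * f\<phi> (r b'))"
  let ?X = "\<Sum>b\<in>E. \<Sum>b'\<in>E. \<Sum>a\<in>E. \<Sum>d\<in>E. w a0 b b' * ?u a d b' * (if d = b then Q (Suc q) * H a x else 0)"
  let ?Y = "\<Sum>b\<in>E. \<Sum>b'\<in>E. \<Sum>a\<in>E. \<Sum>d\<in>E. w a0 b b' * ?u a d b' * (\<Sum>g\<in>E. \<Sum>f'\<in>E. U g b f' d * N g (M f' (H a)) x)"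
  have "(\<Sum>b\<in>E. \<Sum>b'\<in>E. w a0 b b' * KN H b' (b # x)) =
    (\<Sum>b\<in>E. \<Sum>b'\<in>E. \<Sum>a\<in>E. \<Sum>d\<in>E. w a0 b b' * ?u a d b' * (if d = b then Q (Suc q) * H a x else 0) -
       w a0 b b' * ?u a d b' * (\<Sum>g\<in>E. \<Sum>f'\<in>E. U g b f' d * N g (M f' (H a)) x))"
    unfolding KN_def sum_distrib_left
  proof (rule sum.cong[OF refl], rule sum.cong[OF refl], rule sum.cong[OF refl], rule sum.cong[OF refl])
    fix b b' a d assume "a \<in> E"
    show "w a0 b b' * (?u a d b' * N d (H a) (b # x)) =
      w a0 b b' * ?u a d b' * (if d = b then Q (Suc q) * H a x else 0) -
       (\<Sum>g\<in>E. \<Sum>f'\<in>E. w a0 b b' * ?u a d b' * (U g b f' d * N g (M f' (H a)) x))"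
      unfolding MN[OF H[OF \<open>a \<in> E\<close>]] sum_distrib_left[symmetric]
      by (simp add: right_diff_distrib mult.assoc del: fun_space.scale_right_diff_distrib)
  qed
  also have "\<dots> = ?X - ?Y" by (simp only: sum_subtractf)
  also have "?X = Q 2 * Q (Suc q) * H a0 x"
  proof -
    have "?X = (\<Sum>b\<in>E. \<Sum>b'\<in>E. \<Sum>a\<in>E. (w a0 b b' * cnj (w a b b')) * (inverse (f\<phi> (s a0) * f\<phi> (r a0)) * Q (Suc q) * H a x))"
    proof (rule sum.cong[OF refl], rule sum.cong[OF refl], rule sum.cong[OF refl])
      fix b b' a assume "b \<in> E"
      have "(\<Sum>d\<in>E. w a0 b b' * ?u a d b' * (if d = b then Q (Suc q) * H a x else 0)) =
        (\<Sum>d\<in>E. if d = b then w a0 b b' * ?u a b b' * (Q (Suc q) * H a x) else 0)"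
        by (rule sum.cong) auto
      also have "\<dots> = w a0 b b' * ?u a b b' * (Q (Suc q) * H a x)"
        using \<open>b \<in> E\<close> by simp
      also have "\<dots> = (w a0 b b' * cnj (w a b b')) * (inverse (f\<phi> (s a0) * f\<phi> (r a0)) * Q (Suc q) * H a x)"
        using w_nz[of a0 b b'] by (cases "w a0 b b' = 0") (auto simp: divide_inverse mult_ac)
      finally show "(\<Sum>d\<in>E. w a0 b b' * ?u a d b' * (if d = b then Q (Suc q) * H a x else 0)) =
        (w a0 b b' * cnj (w a b b')) * (inverse (f\<phi> (s a0) * f\<phi> (r a0)) * Q (Suc q) * H a x)" .
    qed
    also have "\<dots> = (\<Sum>b\<in>E. \<Sum>a\<in>E. \<Sum>b'\<in>E. (w a0 b b' * cnj (w a b b')) * (inverse (f\<phi> (s a0) * f\<phi> (r a0)) * Q (Suc q) * H a x))"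
      by (rule sum.cong[OF refl], rule sum.swap)
    also have "\<dots> = (\<Sum>a\<in>E. \<Sum>b\<in>E. \<Sum>b'\<in>E. (w a0 b b' * cnj (w a b b')) * (inverse (f\<phi> (s a0) * f\<phi> (r a0)) * Q (Suc q) * H a x))"
      by (rule sum.swap)
    also have "\<dots> = (\<Sum>a\<in>E. (\<Sum>b\<in>E. \<Sum>b'\<in>E. w a0 b b' * cnj (w a b b')) * (inverse (f\<phi> (s a0) * f\<phi> (r a0)) * Q (Suc q) * H a x))"
      by (simp only: sum_distrib_right)
    also have "\<dots> = (\<Sum>a\<in>E. if a = a0 then Q 2 * Q (Suc q) * H a0 x else 0)"
    proof (rule sum.cong[OF refl])
      fix a assume "a \<in> E"
      then show "(\<Sum>b\<in>E. \<Sum>b'\<in>E. w a0 b b' * cnj (w a b b')) * (inverse (f\<phi> (s a0) * f\<phi> (r a0)) * Q (Suc q) * H a x) =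
        (if a = a0 then Q 2 * Q (Suc q) * H a0 x else 0)"
        unfolding typeI[OF a0 \<open>a \<in> E\<close>] using a0 by (cases "a = a0") (simp_all add: field_simps)
    qed
    finally show ?thesis using a0 by simp
  qed
  also have "?Y = Q q * H a0 x + f\<phi> (r a0) / f\<phi> (s a0) *
      N a0 (\<lambda>y. \<Sum>a\<in>E. (if s a = s a0 then 1 else 0) * H a (a # y)) x"
  proof -
    have "?Y = (\<Sum>b\<in>E. \<Sum>b'\<in>E. \<Sum>a\<in>E. \<Sum>d\<in>E. \<Sum>g\<in>E. \<Sum>f'\<in>E. \<Sum>c\<in>E.
       w a0 b b' * ?u a d b' * (cnj (w c g b) * w c f' d / (f\<phi> (s g) * f\<phi> (r b))) * N g (M f' (H a)) x)"
      by (simp add: U_def sum_distrib_left sum_distrib_right mult_ac)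
    also have "\<dots> = (\<Sum>a\<in>E. \<Sum>g\<in>E. \<Sum>f'\<in>E. \<Sum>b\<in>E. \<Sum>b'\<in>E. \<Sum>d\<in>E. \<Sum>c\<in>E.
       w a0 b b' * ?u a d b' * (cnj (w c g b) * w c f' d / (f\<phi> (s g) * f\<phi> (r b))) * N g (M f' (H a)) x)"
      by (rule sum7_rearrange)
    also have "\<dots> = (\<Sum>a\<in>E. \<Sum>g\<in>E. \<Sum>f'\<in>E. (\<Sum>b\<in>E. \<Sum>b'\<in>E. \<Sum>d\<in>E. \<Sum>c\<in>E.
       w a0 b b' * ?u a d b' * (cnj (w c g b) * w c f' d / (f\<phi> (s g) * f\<phi> (r b)))) * N g (M f' (H a)) x)"
      by (simp only: sum_distrib_right)
    also have "\<dots> = (\<Sum>a\<in>E. \<Sum>g\<in>E. \<Sum>f'\<in>E.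
        (if f' = g then (if a = a0 then N g (M g (H a0)) x else 0) else 0) +
        (if f' = a then (if g = a0 then f\<phi> (r a0) / f\<phi> (s a0) * ((if s a = s a0 then 1 else 0) * N a0 (M a (H a)) x) else 0) else 0))"
    proof (rule sum.cong[OF refl], rule sum.cong[OF refl], rule sum.cong[OF refl])
      fix a g f' assume e: "a \<in> E" "g \<in> E" "f' \<in> E"
      \<comment> \<open>The incidence condition in the first delta may be dropped:
        \<open>H a0\<close> is carried by paths that end in \<open>r a0\<close>, so the other
        \<open>g\<close> contribute nothing.\<close>
      have "N g (M g (H a0)) x = 0" if "r a0 \<noteq> r g"
        using M_S_0[OF H[OF a0], of g] that by (simp add: N_zero)
      then have A: "(if a0 = a \<and> g = f' \<and> r a0 = r g then 1 else 0) * N g (M f' (H a)) x =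
        (if f' = g then (if a = a0 then N g (M g (H a0)) x else 0) else 0)"
        by (cases "f' = g \<and> a = a0") auto
      have B: "(if a0 = g \<and> f' = a \<and> s a0 = s a then f\<phi> (r a0) / f\<phi> (s a0) else 0) * N g (M f' (H a)) x =
        (if f' = a then (if g = a0 then f\<phi> (r a0) / f\<phi> (s a0) * ((if s a = s a0 then 1 else 0) * N a0 (M a (H a)) x) else 0) else 0)"
        by (cases "f' = a \<and> g = a0") auto
      show "(\<Sum>b\<in>E. \<Sum>b'\<in>E. \<Sum>d\<in>E. \<Sum>c\<in>E.
       w a0 b b' * ?u a d b' * (cnj (w c g b) * w c f' d / (f\<phi> (s g) * f\<phi> (r b)))) * N g (M f' (H a)) x =
        (if f' = g then (if a = a0 then N g (M g (H a0)) x else 0) else 0) +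
        (if f' = a then (if g = a0 then f\<phi> (r a0) / f\<phi> (s a0) * ((if s a = s a0 then 1 else 0) * N a0 (M a (H a)) x) else 0) else 0)"
        unfolding typeII_normalised[OF a0 e(2,3,1)] distrib_right A B ..
    qed
    also have "\<dots> = (\<Sum>a\<in>E. \<Sum>g\<in>E. (if a = a0 then N g (M g (H a0)) x else 0) +
       (if g = a0 then f\<phi> (r a0) / f\<phi> (s a0) * ((if s a = s a0 then 1 else 0) * N a0 (M a (H a)) x) else 0))"
      by (intro sum.cong refl) (simp add: sum.distrib)
    also have "\<dots> = (\<Sum>a\<in>E. if a = a0 then \<Sum>g\<in>E. N g (M g (H a0)) x else 0) +
       f\<phi> (r a0) / f\<phi> (s a0) * (\<Sum>a\<in>E. (if s a = s a0 then 1 else 0) * N a0 (M a (H a)) x)"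
      using a0 by (simp add: sum.distrib sum_distrib_left sum_if_out)
    also have "(\<Sum>a\<in>E. if a = a0 then \<Sum>g\<in>E. N g (M g (H a0)) x else 0) = Q q * H a0 x"
      using a0 euler[OF H[OF a0]] by simp
    also have "(\<Sum>a\<in>E. (if s a = s a0 then 1 else 0) * N a0 (M a (H a)) x) =
      N a0 (\<lambda>y. \<Sum>a\<in>E. (if s a = s a0 then 1 else 0) * H a (a # y)) x"
      by (rule N_lincomb[symmetric])
    finally show ?thesis .
  qed
  finally show ?thesis
    unfolding Q_rec Suc_eq_plus1 by (simp add: algebra_simps)
qed

lemma U_nz:
  assumes "U b e' c e \<noteq> 0"
  shows "b \<in> E" "e' \<in> E" "s b = s c" "r b = s e'" "r e' = r e"
proof -
  obtain a where "cnj (w a b e') / (f\<phi> (s b) * f\<phi> (r e')) * w a c e \<noteq> 0"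
    using assms unfolding U_def by (meson sum.neutral)
  then have "w a b e' \<noteq> 0" "w a c e \<noteq> 0" by auto
  note * = w_nz[OF this(1)] w_nz[OF this(2)]
  show "b \<in> E" "e' \<in> E" "s b = s c" "r b = s e'" "r e' = r e"
    using * by simp_all
qed

text \<open>After one arc is split off, membership follows by induction from the product rule. The
  new relation at the end of the path follows from \<open>homotopy\<close>: the diagonal part of
  \<open>N e f\<close> contributes \<open>[q + 2] H a0\<close>, which is exactly what the homotopy
  identity gives for the correction term.\<close>

lemma N_S:
  assumes "f \<in> S p i (s e)" "e \<in> E"
  shows "N e f \<in> S (Suc p) i (r e)"
  using assms
proof (induction p arbitrary: f e)
  case 0
  have Nf: "N e f (e' # x) = (if e = e' then Q 1 * f x else 0)" for e' x
    using MN[OF 0(1), of e e' x] M_S_0[OF 0(1)] by (simp add: N_zero)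
  have "f (b # x) = 0" for b x using M_S_0[OF 0(1)] by simp
  then have NN: "N e f (b' # b # x) = 0" for b b' x by (simp add: Nf)
  have "M e (N e f) \<in> S 0 i (s e)"
    using S_scale[OF 0(1), of "Q 1"] by (simp add: Nf)
  moreover have "M e' (N e f) = (\<lambda>x. 0)" if "e' \<noteq> e" for e' using that by (simp add: Nf)
  ultimately have if_S: "if e' \<in> E \<and> r e' = r e then M e' (N e f) \<in> S 0 i (s e') else M e' (N e f) = (\<lambda>x. 0)" for e'
    using 0(2) S_zero[of 0 i "s e'"] by (cases "e' = e") (simp_all only: simp_thms if_True if_cancel)
  have "(\<Sum>b\<in>E. \<Sum>b'\<in>E. w a b b' * N e f (b' # b # x)) = 0" for a x
    by (simp only: NN mult_zero_right sum.neutral_const)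
  then show ?case unfolding S.simps(2) mem_Collect_eq using if_S by (simp del: S.simps)
next
  case (Suc q)
  note f = Suc.prems(1) and e = Suc.prems(2)
  \<comment> \<open>Chosen so that \<open>KN H\<close> is the whole correction term of
    \<open>N e f\<close>.\<close>
  define H where "H a = (\<lambda>x. \<Sum>c\<in>E. w a c e * M c f x)" for a
  have H: "H a \<in> S q i (r a)" for a
    unfolding H_def
  proof (rule S_sum)
    fix c
    show "(\<lambda>x. w a c e * M c f x) \<in> S q i (r a)"
      using S_scale[OF M_S[OF f, of c], of "w a c e"] w_nz(4)[of a c e]
      by (cases "w a c e = 0") (simp_all add: S_zero)
  qed
  have KN: "(\<Sum>b\<in>E. \<Sum>c\<in>E. U b e' c e * N b (M c f) y) = KN H e' y" for e' y
  proof -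
    have "KN H e' y = (\<Sum>a\<in>E. \<Sum>d\<in>E. \<Sum>c\<in>E. cnj (w a d e') / (f\<phi> (s d) * f\<phi> (r e')) * w a c e * N d (M c f) y)"
      unfolding KN_def H_def N_lincomb by (simp only: sum_distrib_left mult.assoc)
    also have "\<dots> = (\<Sum>d\<in>E. \<Sum>a\<in>E. \<Sum>c\<in>E. cnj (w a d e') / (f\<phi> (s d) * f\<phi> (r e')) * w a c e * N d (M c f) y)"
      by (rule sum.swap)
    also have "\<dots> = (\<Sum>d\<in>E. \<Sum>c\<in>E. \<Sum>a\<in>E. cnj (w a d e') / (f\<phi> (s d) * f\<phi> (r e')) * w a c e * N d (M c f) y)"
      by (rule sum.cong[OF refl], rule sum.swap)
    also have "\<dots> = (\<Sum>b\<in>E. \<Sum>c\<in>E. U b e' c e * N b (M c f) y)"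
      by (simp only: U_def sum_distrib_right)
    finally show ?thesis ..
  qed
  have Nf: "N e f (e' # y) = (if e = e' then Q (q + 2) * f y else 0) - KN H e' y" for e' y
    unfolding MN[OF f] KN by simp
  show ?case
  proof (simp only: S.simps(2)[of "Suc q"] mem_Collect_eq, intro conjI allI ballI)
    show "N e f [] = 0" by simp
    fix e'
    show "if e' \<in> E \<and> r e' = r e then M e' (N e f) \<in> S (Suc q) i (s e') else M e' (N e f) = (\<lambda>x. 0)"
    proof (cases "e' \<in> E \<and> r e' = r e")
      case True
      have "(\<lambda>y. (if e = e' then Q (q + 2) * f y else 0) - (\<Sum>b\<in>E. \<Sum>c\<in>E. U b e' c e * N b (M c f) y))
        \<in> S (Suc q) i (s e')"
      proof (intro S_diff S_sum)
        show "(\<lambda>y. if e = e' then Q (q + 2) * f y else 0) \<in> S (Suc q) i (s e')"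
          using S_scale[OF f] by (cases "e = e'") (simp_all only: simp_thms if_True if_False S_zero)
        fix b c
        show "(\<lambda>y. U b e' c e * N b (M c f) y) \<in> S (Suc q) i (s e')"
        proof (cases "U b e' c e = 0")
          case False
          note nz = U_nz[OF False]
          have "M c f \<in> S q i (s b)" using M_S[OF f, of c] nz by simp
          then have "N b (M c f) \<in> S (Suc q) i (s e')"
            using Suc.IH nz by metis
          then show ?thesis by (rule S_scale)
        qed (simp only: mult_zero_left S_zero)
      qed
      then show ?thesis using True by (simp only: Nf KN simp_thms if_True)
    next
      case False
      have U0: "U b e' c e = 0" for b c
        using U_nz[of b e' c e] False by (cases "U b e' c e = 0") auto
      have "KN H e' y = 0" for y unfolding KN[symmetric] U0 by simp
      moreover have "e \<noteq> e'" using False e by auto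
      ultimately show ?thesis using False by (simp only: Nf if_False diff_self)
    qed
  next
    fix a0 x assume a0: "a0 \<in> E"
    \<comment> \<open>The remaining term of \<open>homotopy\<close> vanishes: by cyclic invariance
      the divergence of \<open>H\<close> is the relation of \<open>e\<close> evaluated on
      \<open>f\<close>.\<close>
    have rel: "(\<Sum>a\<in>E. (if s a = s a0 then 1 else 0) * H a (a # y)) = 0" for y
    proof -
      have "(\<Sum>a\<in>E. (if s a = s a0 then 1 else 0) * H a (a # y)) =
        (\<Sum>a\<in>E. \<Sum>c\<in>E. (if r e = s a0 then 1 else 0) * (w e a c * f (c # a # y)))"
        unfolding H_def sum_distrib_left
      proof (rule sum.cong[OF refl], rule sum.cong[OF refl])
        fix a c
        have "w e a c = w a c e" using w_cyc by metis
        then show "(if s a = s a0 then 1 else 0) * (w a c e * f (c # a # y)) =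
           (if r e = s a0 then 1 else 0) * (w e a c * f (c # a # y))"
          using w_nz(4)[of e a c] by (cases "w a c e = 0") (simp_all only: simp_thms mult_zero_left mult_zero_right)
      qed
      also have "\<dots> = (if r e = s a0 then 1 else 0) * (\<Sum>a\<in>E. \<Sum>c\<in>E. w e a c * f (c # a # y))"
        by (simp only: sum_distrib_left)
      also have "\<dots> = 0" by (simp only: S_rel[OF f] mult_zero_right)
      finally show ?thesis .
    qed
    have "(\<Sum>b\<in>E. \<Sum>b'\<in>E. w a0 b b' * N e f (b' # b # x)) =
      (\<Sum>b\<in>E. \<Sum>b'\<in>E. (if b' = e then Q (q + 2) * (w a0 b e * f (b # x)) else 0) - w a0 b b' * KN H b' (b # x))"
      by (rule sum.cong[OF refl], rule sum.cong[OF refl])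
        (simp add: Nf right_diff_distrib mult_ac del: fun_space.scale_right_diff_distrib)
    also have "\<dots> = Q (q + 2) * H a0 x - (\<Sum>b\<in>E. \<Sum>b'\<in>E. w a0 b b' * KN H b' (b # x))"
      using e by (simp add: sum_subtractf sum_distrib_left[symmetric] H_def)
    also have "\<dots> = 0"
      unfolding homotopy[OF H a0] rel by (simp add: N_zero)
    finally show "(\<Sum>b\<in>E. \<Sum>b'\<in>E. w a0 b b' * N e f (b' # b # x)) = 0" .
  qed
qed

text \<open>A right inverse of the divergence up to \<open>[p + 3]\<close>. The diagonal part gives
  \<open>[3] [p + 1]\<close> by \<open>sum_phi_out\<close>; the partial trace of \<open>U\<close> is
  \<open>[2]\<close> by (I), so the correction is \<open>[2] [p]\<close> by Euler's identity, and
  \<open>[3] [p + 1] - [2] [p] = [p + 3]\<close>.\<close>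

lemma trace_identity:
  assumes g: "g \<in> S p i j" and j: "j \<in> verts G"
  shows "(\<Sum>a\<in>E. (if s a = j then f\<phi> (r a) / f\<phi> j else 0) * N a g (a # x)) = Q (p + 3) * g x"
proof -
  let ?k = "\<lambda>a. if s a = j then f\<phi> (r a) / f\<phi> j else 0"
  have pj: "f\<phi> j \<noteq> 0" using phi_pos[OF j] by simp
  have k: "(\<Sum>a\<in>E. ?k a) = Q 2 * Q 2 - 1"
  proof -
    have "(\<Sum>a\<in>E. ?k a) = (\<Sum>a\<in>E. if s a = j then f\<phi> (r a) else 0) / f\<phi> j"
      unfolding sum_divide_distrib by (rule sum.cong) auto
    then show ?thesis using pj by (simp add: sum_phi_out[OF j])
  qed
  \<comment> \<open>The factor \<open>f\<phi> (r a)\<close> cancels one denominator of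
    \<open>U\<close>, and cyclic rotation of the weights turns the trace into the left side of (I)
    for \<open>c\<close> and \<open>b\<close>.\<close>
  have kU: "(\<Sum>a\<in>E. ?k a * U b a c a) = (if b = c then Q 2 else 0)"
    if b: "b \<in> E" and c: "c \<in> E" "r c = j" for b c
  proof -
    have "(\<Sum>a\<in>E. ?k a * U b a c a) = (\<Sum>a\<in>E. \<Sum>a'\<in>E. w c a a' * cnj (w b a a') * inverse (f\<phi> (s b) * f\<phi> j))"
      unfolding U_def sum_distrib_left
    proof (rule sum.cong[OF refl], rule sum.cong[OF refl])
      fix a a' assume a: "a \<in> E"
      have 1: "w a' c a = w c a a'" "w a' b a = w b a a'" using w_cyc by metis+
      show "?k a * (cnj (w a' b a) / (f\<phi> (s b) * f\<phi> (r a)) * w a' c a) =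
        w c a a' * cnj (w b a a') * inverse (f\<phi> (s b) * f\<phi> j)"
      proof (cases "w c a a' = 0")
        case False
        then have "s a = j" using w_nz(4) c by metis
        then show ?thesis unfolding 1 using a b pj by (simp add: field_simps)
      qed (simp add: 1)
    qed
    also have "\<dots> = (\<Sum>a\<in>E. \<Sum>a'\<in>E. w c a a' * cnj (w b a a')) * inverse (f\<phi> (s b) * f\<phi> j)"
      by (simp only: sum_distrib_right)
    also have "\<dots> = (if b = c then Q 2 else 0)"
      using typeI[OF c(1) b] c b pj by (auto simp: field_simps)
    finally show ?thesis .
  qed
  have "(\<Sum>a\<in>E. ?k a * (\<Sum>b\<in>E. \<Sum>c\<in>E. U b a c a * N b (M c g) x)) =
     (\<Sum>a\<in>E. \<Sum>b\<in>E. \<Sum>c\<in>E. ?k a * U b a c a * N b (M c g) x)"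
    by (simp only: sum_distrib_left mult.assoc)
  also have "\<dots> = (\<Sum>b\<in>E. \<Sum>a\<in>E. \<Sum>c\<in>E. ?k a * U b a c a * N b (M c g) x)"
    by (rule sum.swap)
  also have "\<dots> = (\<Sum>b\<in>E. \<Sum>c\<in>E. \<Sum>a\<in>E. ?k a * U b a c a * N b (M c g) x)"
    by (rule sum.cong[OF refl], rule sum.swap)
  also have "\<dots> = (\<Sum>b\<in>E. \<Sum>c\<in>E. (\<Sum>a\<in>E. ?k a * U b a c a) * N b (M c g) x)"
    by (simp only: sum_distrib_right)
  also have "\<dots> = (\<Sum>b\<in>E. \<Sum>c\<in>E. if c = b then Q 2 * N b (M b g) x else 0)"
  proof (rule sum.cong[OF refl], rule sum.cong[OF refl])
    fix b c assume b: "b \<in> E" and c: "c \<in> E"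
    show "(\<Sum>a\<in>E. ?k a * U b a c a) * N b (M c g) x = (if c = b then Q 2 * N b (M b g) x else 0)"
    proof (cases "r c = j")
      case True
      then show ?thesis unfolding kU[OF b c True] by simp
    next
      case False
      then have "N b (M c g) x = 0" using M_S_0[OF g, of c] by (simp add: N_zero)
      then show ?thesis by auto
    qed
  qed
  also have "\<dots> = Q 2 * (\<Sum>b\<in>E. N b (M b g) x)"
    by (simp add: sum_distrib_left)
  also have "\<dots> = Q 2 * (Q p * g x)" unfolding euler[OF g] ..
  finally have 1: "(\<Sum>a\<in>E. ?k a * (\<Sum>b\<in>E. \<Sum>c\<in>E. U b a c a * N b (M c g) x)) = Q 2 * (Q p * g x)" .
  have "(\<Sum>a\<in>E. ?k a * N a g (a # x)) =
     (\<Sum>a\<in>E. ?k a * (Q (Suc p) * g x) - ?k a * (\<Sum>b\<in>E. \<Sum>c\<in>E. U b a c a * N b (M c g) x))"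
    by (rule sum.cong[OF refl]) (simp only: MN[OF g] simp_thms if_True right_diff_distrib)
  also have "\<dots> = (\<Sum>a\<in>E. ?k a) * (Q (Suc p) * g x) - Q 2 * (Q p * g x)"
    by (simp only: sum_subtractf 1 sum_distrib_right)
  also have "\<dots> = Q (p + 3) * g x"
  proof -
    have "p + 1 + 2 = p + 3" "p + 1 + 1 = p + 2" by auto
    with Q_rec[of "p + 1"] have "Q (p + 3) = Q 2 * Q (p + 2) - Q (p + 1)" by (simp only:)
    then have e: "Q (p + 3) = Q 2 * (Q 2 * Q (Suc p) - Q p) - Q (Suc p)" using Q_rec[of p] by simp
    show ?thesis unfolding k e by (simp add: algebra_simps)
  qed
  finally show ?thesis .
qed


section \<open>The exact sequence and the recursion for the dimensions\<close>

definition arc_dim :: "nat \<Rightarrow> 'v \<Rightarrow> 'v \<Rightarrow> nat" where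
  "arc_dim p i j = fun_space.dim (S p i j)"

text \<open>\<open>T1\<close>, \<open>TK\<close> and \<open>TD\<close> are the three differentials
  of the complex. Consecutive ones compose to zero, by the relations themselves and by their cyclic
  symmetry.\<close>

definition T1 :: "('e list \<Rightarrow> complex) \<Rightarrow> 'e \<times> 'e list \<Rightarrow> complex" where
  "T1 f = (\<lambda>z. f (fst z # snd z))"

definition TK :: "('e \<times> 'e list \<Rightarrow> complex) \<Rightarrow> 'e \<times> 'e list \<Rightarrow> complex" where
  "TK F = (\<lambda>z. \<Sum>b\<in>E. \<Sum>b'\<in>E. w (fst z) b b' * F (b', b # snd z))"

definition TD :: "('e \<times> 'e list \<Rightarrow> complex) \<Rightarrow> 'e list \<Rightarrow> complex" where
  "TD F = (\<lambda>x. \<Sum>a\<in>E. F (a, a # x))"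

lemma linear_T1: "fun_linear T1"
  by (rule fun_linearI) (auto simp: T1_def)

lemma linear_TK: "fun_linear TK"
  by (rule fun_linearI) (auto simp: TK_def fun_eq_iff sum.distrib distrib_left sum_distrib_left mult_ac
    simp del: fun_space.scale_right_distrib)

lemma linear_TD: "fun_linear TD"
  by (rule fun_linearI) (auto simp: TD_def fun_eq_iff sum.distrib sum_distrib_left)

definition B1 :: "nat \<Rightarrow> 'v \<Rightarrow> 'v \<Rightarrow> ('e \<times> 'e list \<Rightarrow> complex) set" where
  "B1 p i j = family_space {b \<in> E. r b = j} (\<lambda>b. S p i (s b))"

definition B2 :: "nat \<Rightarrow> 'v \<Rightarrow> 'v \<Rightarrow> ('e \<times> 'e list \<Rightarrow> complex) set" where
  "B2 p i j = family_space {a \<in> E. s a = j} (\<lambda>a. S p i (r a))"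

lemma B1_D:
  assumes "F \<in> B1 p i j"
  shows "(\<lambda>x. F (b, x)) \<in> S p i (s b)" "b \<notin> E \<or> r b \<noteq> j \<Longrightarrow> F (b, x) = 0"
  using assms S_zero[of p i "s b"] unfolding B1_def family_space_def
  by (cases "b \<in> E \<and> r b = j"; simp)+

lemma B2_D:
  assumes "F \<in> B2 p i j"
  shows "(\<lambda>x. F (a, x)) \<in> S p i (r a)" "a \<notin> E \<or> s a \<noteq> j \<Longrightarrow> F (a, x) = 0"
  using assms S_zero[of p i "r a"] unfolding B2_def family_space_def
  by (cases "a \<in> E \<and> s a = j"; simp)+

lemma B1_supported: "\<exists>X. finite X \<and> B1 p i j \<subseteq> supported_on X"
proof (intro exI conjI)
  show "finite ({b \<in> E. r b = j} \<times> {x. set x \<subseteq> E \<and> length x = p})"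
    by (intro finite_cartesian_product finite_arc_lists) simp
  show "B1 p i j \<subseteq> supported_on ({b \<in> E. r b = j} \<times> {x. set x \<subseteq> E \<and> length x = p})"
    unfolding B1_def by (rule family_space_supported) (rule S_supported)
qed

lemma B2_supported: "\<exists>X. finite X \<and> B2 p i j \<subseteq> supported_on X"
proof (intro exI conjI)
  show "finite ({a \<in> E. s a = j} \<times> {x. set x \<subseteq> E \<and> length x = p})"
    by (intro finite_cartesian_product finite_arc_lists) simp
  show "B2 p i j \<subseteq> supported_on ({a \<in> E. s a = j} \<times> {x. set x \<subseteq> E \<and> length x = p})"
    unfolding B2_def by (rule family_space_supported) (rule S_supported)
qed

lemma dim_B1: "fun_space.dim (B1 p i j) = (\<Sum>b | b \<in> E \<and> r b = j. arc_dim p i (s b))"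
  unfolding B1_def arc_dim_def
  by (rule dim_family_space[where X = "\<lambda>_. {x. set x \<subseteq> E \<and> length x = p}"])
    (auto intro: subspace_S finite_arc_lists S_supported[THEN subsetD])

lemma dim_B2: "fun_space.dim (B2 p i j) = (\<Sum>a | a \<in> E \<and> s a = j. arc_dim p i (r a))"
  unfolding B2_def arc_dim_def
  by (rule dim_family_space[where X = "\<lambda>_. {x. set x \<subseteq> E \<and> length x = p}"])
    (auto intro: subspace_S finite_arc_lists S_supported[THEN subsetD])

text \<open>Exactness at \<open>B1\<close> is built into the recursive definition of
  \<open>S\<close> and holds in every degree, with no quantum integer to invert. This is what later
  carries vanishing into all higher degrees.\<close>

lemma T1_image: "T1 ` S (Suc p) i j = {F \<in> B1 p i j. TK F = 0}"
proof
  show "T1 ` S (Suc p) i j \<subseteq> {F \<in> B1 p i j. TK F = 0}"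
  proof
    fix F assume "F \<in> T1 ` S (Suc p) i j"
    then obtain f where f: "f \<in> S (Suc p) i j" and F: "F = T1 f" by blast
    have "T1 f \<in> B1 p i j"
      using M_S[OF f] M_S_0[OF f] by (simp add: B1_def family_space_def T1_def)
    moreover have "TK (T1 f) = 0"
      using S_rel[OF f] by (simp add: TK_def T1_def fun_eq_iff)
    ultimately show "F \<in> {F \<in> B1 p i j. TK F = 0}" using F by simp
  qed
  show "{F \<in> B1 p i j. TK F = 0} \<subseteq> T1 ` S (Suc p) i j"
  proof
    fix F assume "F \<in> {F \<in> B1 p i j. TK F = 0}"
    then have F: "F \<in> B1 p i j" and K: "TK F = 0" by auto
    define f where "f x = (case x of [] \<Rightarrow> 0 | e # y \<Rightarrow> F (e, y))" for x
    have "f \<in> S (Suc p) i j"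
      unfolding S.simps(2) mem_Collect_eq
    proof (intro conjI allI ballI)
      show "f [] = 0" by (simp add: f_def)
      show "if e \<in> E \<and> r e = j then M e f \<in> S p i (s e) else M e f = (\<lambda>x. 0)" for e
        using B1_D[OF F, of e] by (simp add: f_def)
      show "(\<Sum>b\<in>E. \<Sum>b'\<in>E. w a b b' * f (b' # b # x)) = 0" for a x
        using fun_cong[OF K, of "(a, x)"] by (simp add: TK_def f_def)
    qed
    moreover have "T1 f = F" by (simp add: T1_def f_def)
    ultimately show "F \<in> T1 ` S (Suc p) i j" by blast
  qed
qed

lemma dim_S_Suc: "arc_dim (Suc p) i j = fun_space.dim {F \<in> B1 p i j. TK F = 0}"
proof -
  have "f = 0" if "f \<in> S (Suc p) i j" "T1 f = 0" for f
  proof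
    fix x show "f x = 0 x"
      using that(1) fun_cong[OF that(2), of "(hd x, tl x)"] by (cases x) (auto simp: T1_def S.simps(2))
  qed
  then have "fun_space.dim (T1 ` S (Suc p) i j) = arc_dim (Suc p) i j"
    unfolding arc_dim_def by (intro dim_inj_image[OF linear_T1 subspace_S finite_arc_lists S_supported])
  then show ?thesis by (simp add: T1_image)
qed

text \<open>That the image is killed by \<open>TD\<close> is the relation of the arc
  \<open>b'\<close> after rotating the weights. Conversely, on the kernel of \<open>TD\<close> the
  last term of \<open>homotopy\<close> disappears, so \<open>KN\<close> divided by
  \<open>[q + 2]\<close> is a preimage; the bound on \<open>q\<close> keeps this number
  nonzero.\<close>

lemma TK_image:
  assumes q: "q + 2 < h"
  shows "TK ` B1 (Suc q) i j = {F \<in> B2 q i j. TD F = 0}"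
proof
  show "TK ` B1 (Suc q) i j \<subseteq> {F \<in> B2 q i j. TD F = 0}"
  proof
    fix H assume "H \<in> TK ` B1 (Suc q) i j"
    then obtain F where F: "F \<in> B1 (Suc q) i j" and H: "H = TK F" by blast
    have "(\<lambda>x. \<Sum>b\<in>E. \<Sum>b'\<in>E. w a b b' * F (b', b # x)) \<in> S q i (r a)" for a
    proof (intro S_sum)
      fix b b'
      show "(\<lambda>x. w a b b' * F (b', b # x)) \<in> S q i (r a)"
        using S_scale[OF M_S[OF B1_D(1)[OF F, of b'], of b], of "w a b b'"] w_nz(4)[of a b b']
        by (cases "w a b b' = 0") (simp_all add: S_zero)
    qed
    moreover have "(\<Sum>b\<in>E. \<Sum>b'\<in>E. w a b b' * F (b', b # x)) = 0" if "a \<notin> E \<or> s a \<noteq> j" for a x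
    proof -
      have "w a b b' * F (b', b # x) = 0" for b b'
        using that w_nz[of a b b'] B1_D(2)[OF F, of b'] by (cases "w a b b' = 0") auto
      then show ?thesis by (simp only: sum.neutral_const)
    qed
    ultimately have 1: "TK F \<in> B2 q i j" by (simp add: B2_def family_space_def TK_def)
    have "TD (TK F) x = 0" for x
    proof -
      have "TD (TK F) x = (\<Sum>a\<in>E. \<Sum>b'\<in>E. \<Sum>b\<in>E. w b' a b * F (b', b # a # x))"
        unfolding TD_def TK_def fst_conv snd_conv
        by (rule sum.cong[OF refl], rule trans[OF sum.swap], rule sum.cong[OF refl], rule sum.cong[OF refl])
          (metis w_cyc)
      also have "\<dots> = (\<Sum>b'\<in>E. \<Sum>a\<in>E. \<Sum>b\<in>E. w b' a b * F (b', b # a # x))"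
        by (rule sum.swap)
      also have "\<dots> = 0"
        by (simp only: S_rel[OF B1_D(1)[OF F]] sum.neutral_const)
      finally show ?thesis .
    qed
    then have "TD (TK F) = 0" by (simp add: fun_eq_iff)
    with 1 H show "H \<in> {F \<in> B2 q i j. TD F = 0}" by simp
  qed
  show "{F \<in> B2 q i j. TD F = 0} \<subseteq> TK ` B1 (Suc q) i j"
  proof
    fix K assume "K \<in> {F \<in> B2 q i j. TD F = 0}"
    then have K: "K \<in> B2 q i j" and D: "TD K = 0" by auto
    define H where "H a = (\<lambda>x. K (a, x))" for a
    have H: "H a \<in> S q i (r a)" for a unfolding H_def by (rule B2_D(1)[OF K])
    have Q: "Q (q + 2) \<noteq> 0" using q by (intro quantum_num_nonzero) auto
    \<comment> \<open>The cut-off to arcs ending in \<open>j\<close> puts the family into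
      \<open>B1\<close>. It loses nothing, since a triangle through an arc out of \<open>j\<close>
      has its last arc ending in \<open>j\<close>.\<close>
    define F where "F z = (if fst z \<in> E \<and> r (fst z) = j then inverse (Q (q + 2)) * KN H (fst z) (snd z) else 0)" for z
    have KNS: "KN H b' \<in> S (Suc q) i (s b')" for b'
      unfolding KN_def
    proof (intro S_sum)
      fix a d assume "a \<in> E" "d \<in> E"
      show "(\<lambda>x. cnj (w a d b') / (f\<phi> (s d) * f\<phi> (r b')) * N d (H a) x) \<in> S (Suc q) i (s b')"
      proof (cases "w a d b' = 0")
        case True
        then show ?thesis by (simp add: S_zero)
      next
        case False
        then have "r a = s d" "r d = s b'" using w_nz by blast+
        then have "N d (H a) \<in> S (Suc q) i (s b')" using N_S[of "H a" q i d] H[of a] \<open>d \<in> E\<close> by simp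
        then show ?thesis by (rule S_scale)
      qed
    qed
    have F: "F \<in> B1 (Suc q) i j"
      unfolding B1_def family_space_def
    proof (intro CollectI allI conjI impI)
      fix b assume "b \<in> {b \<in> E. r b = j}"
      then show "(\<lambda>x. F (b, x)) \<in> S (Suc q) i (s b)"
        using S_scale[OF KNS[of b], of "inverse (Q (q + 2))"] by (simp add: F_def)
    qed (auto simp: F_def)
    have "TK F (a0, x) = K (a0, x)" for a0 x
    proof (cases "a0 \<in> E \<and> s a0 = j")
      case False
      then have z: "w a0 b b' * F (b', b # x) = 0" for b b'
        using w_nz[of a0 b b'] by (cases "w a0 b b' = 0") (auto simp: F_def)
      have "TK F (a0, x) = 0" by (simp only: TK_def fst_conv snd_conv z sum.neutral_const)
      then show ?thesis using B2_D(2)[OF K, of a0] False by simp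
    next
      case True
      have "TK F (a0, x) = (\<Sum>b\<in>E. \<Sum>b'\<in>E. inverse (Q (q + 2)) * (w a0 b b' * KN H b' (b # x)))"
        unfolding TK_def fst_conv snd_conv
      proof (rule sum.cong[OF refl], rule sum.cong[OF refl])
        fix b b'
        show "w a0 b b' * F (b', b # x) = inverse (Q (q + 2)) * (w a0 b b' * KN H b' (b # x))"
          using w_nz[of a0 b b'] True by (cases "w a0 b b' = 0") (auto simp: F_def)
      qed
      also have "\<dots> = inverse (Q (q + 2)) * (\<Sum>b\<in>E. \<Sum>b'\<in>E. w a0 b b' * KN H b' (b # x))"
        by (simp only: sum_distrib_left)
      also have "(\<Sum>b\<in>E. \<Sum>b'\<in>E. w a0 b b' * KN H b' (b # x)) = Q (q + 2) * H a0 x"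
      proof -
        have "(\<Sum>a\<in>E. (if s a = s a0 then 1 else 0) * H a (a # y)) = 0" for y
        proof -
          have "(\<Sum>a\<in>E. (if s a = s a0 then 1 else 0) * H a (a # y)) = TD K y"
            unfolding TD_def using B2_D(2)[OF K] True by (intro sum.cong) (auto simp: H_def)
          then show ?thesis by (simp add: D)
        qed
        then show ?thesis using homotopy[OF H, of a0 x] True by (simp add: N_zero)
      qed
      finally show ?thesis using Q by (simp add: H_def)
    qed
    then have "TK F = K" by auto
    with F show "K \<in> TK ` B1 (Suc q) i j" by blast
  qed
qed

lemma TD_image_0: "TD ` B2 0 i j = {0}"
proof -
  have "TD F = 0" if "F \<in> B2 0 i j" for F
    using M_S_0[OF B2_D(1)[OF that]] by (simp add: TD_def fun_eq_iff)
  moreover have "0 \<in> B2 0 i j"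
    using S_zero by (simp add: B2_def family_space_def zero_fun_def)
  ultimately show ?thesis by force
qed

text \<open>Surjectivity comes from \<open>trace_identity\<close>: the family of all
  \<open>N a g\<close>, weighted by ratios of \<open>\<phi>\<close> and divided by
  \<open>[q + 3]\<close>, has divergence \<open>g\<close>.\<close>

lemma TD_image_Suc:
  assumes q: "Suc q + 2 < h" and j: "j \<in> verts G"
  shows "TD ` B2 (Suc q) i j = S q i j"
proof
  show "TD ` B2 (Suc q) i j \<subseteq> S q i j"
  proof
    fix f assume "f \<in> TD ` B2 (Suc q) i j"
    then obtain F where F: "F \<in> B2 (Suc q) i j" and f: "f = TD F" by blast
    have "(\<lambda>x. \<Sum>a\<in>E. F (a, a # x)) \<in> S q i j"
    proof (rule S_sum)
      fix a
      show "(\<lambda>x. F (a, a # x)) \<in> S q i j"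
        using M_S[OF B2_D(1)[OF F, of a], of a] B2_D(2)[OF F, of a]
        by (cases "s a = j") (simp_all add: S_zero)
    qed
    then show "f \<in> S q i j" by (simp add: f TD_def)
  qed
  show "S q i j \<subseteq> TD ` B2 (Suc q) i j"
  proof
    fix g assume g: "g \<in> S q i j"
    have Q: "Q (q + 3) \<noteq> 0" using q by (intro quantum_num_nonzero) auto
    define F where "F z = (if fst z \<in> E \<and> s (fst z) = j
      then inverse (Q (q + 3)) * (f\<phi> (r (fst z)) / f\<phi> j) * N (fst z) g (snd z) else 0)" for z
    have "F \<in> B2 (Suc q) i j"
      unfolding B2_def family_space_def
    proof (intro CollectI allI conjI impI)
      fix a assume "a \<in> {a \<in> E. s a = j}"
      then show "(\<lambda>x. F (a, x)) \<in> S (Suc q) i (r a)"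
        using S_scale[OF N_S[of g q i a], of "inverse (Q (q + 3)) * (f\<phi> (r a) / f\<phi> j)"] g
        by (simp add: F_def)
    qed (auto simp: F_def)
    moreover have "TD F x = g x" for x
    proof -
      have "TD F x = (\<Sum>a\<in>E. inverse (Q (q + 3)) * ((if s a = j then f\<phi> (r a) / f\<phi> j else 0) * N a g (a # x)))"
        unfolding TD_def by (rule sum.cong) (auto simp: F_def)
      also have "\<dots> = inverse (Q (q + 3)) * (Q (q + 3) * g x)"
        by (simp only: sum_distrib_left[symmetric] trace_identity[OF g j])
      finally show ?thesis using Q by simp
    qed
    ultimately show "g \<in> TD ` B2 (Suc q) i j" by (metis ext image_eqI)
  qed
qed

lemma subspace_B1: "fun_space.subspace (B1 p i j)" and subspace_B2: "fun_space.subspace (B2 p i j)"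
  unfolding B1_def B2_def by (rule subspace_family_space, rule subspace_S)+

text \<open>The Euler characteristic of the exact sequence
  \<open>0 \<rightarrow> S (q+2) \<rightarrow> B1 (q+1) \<rightarrow> B2 q \<rightarrow> S (q-1) \<rightarrow> 0\<close>.\<close>

lemma dim_recursion:
  assumes q: "q + 2 < h" and j: "j \<in> verts G"
  shows "arc_dim (q + 2) i j + (\<Sum>a | a \<in> E \<and> s a = j. arc_dim q i (r a)) =
    (\<Sum>b | b \<in> E \<and> r b = j. arc_dim (q + 1) i (s b)) + (if q = 0 then 0 else arc_dim (q - 1) i j)"
proof -
  obtain X1 where X1: "finite X1" "B1 (Suc q) i j \<subseteq> supported_on X1" using B1_supported by blast
  obtain X2 where X2: "finite X2" "B2 q i j \<subseteq> supported_on X2" using B2_supported by blast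
  have 1: "fun_space.dim (B1 (Suc q) i j) = arc_dim (q + 2) i j + fun_space.dim {F \<in> B2 q i j. TD F = 0}"
    using dim_kernel_image[OF linear_TK subspace_B1 X1] dim_S_Suc[of "Suc q" i j] TK_image[OF q] by simp
  have 2: "fun_space.dim (B2 q i j) = fun_space.dim {F \<in> B2 q i j. TD F = 0} + (if q = 0 then 0 else arc_dim (q - 1) i j)"
    using dim_kernel_image[OF linear_TD subspace_B2 X2] q
    by (cases q) (simp_all add: TD_image_0 TD_image_Suc[OF _ j] arc_dim_def)
  show ?thesis using 1 2 unfolding dim_B1 dim_B2 by simp
qed

lemma dim_0: "arc_dim 0 i j = (if i = j then 1 else 0)"
proof (cases "i = j")
  case True
  have "dual_system (S 0 i j) {[]} (\<lambda>_ x. if x = [] then 1 else 0)"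
    unfolding dual_system_def using True by auto
  from dual_system_dim[OF this] show ?thesis using True by (simp add: arc_dim_def)
next
  case False
  then have "S 0 i j = {0}" by (auto simp: fun_eq_iff)
  then show ?thesis using False by (simp only: arc_dim_def dim_zero if_False)
qed

text \<open>Relations start in degree two, so \<open>TK\<close> vanishes on \<open>B1 0\<close> and
  every arc counts.\<close>

lemma dim_1: "arc_dim 1 i j = (\<Sum>b | b \<in> E \<and> r b = j. arc_dim 0 i (s b))"
proof -
  have "TK F = 0" if "F \<in> B1 0 i j" for F
    using M_S_0[OF B1_D(1)[OF that]] by (simp add: TK_def fun_eq_iff)
  then have "{F \<in> B1 0 i j. TK F = 0} = B1 0 i j" by blast
  then show ?thesis using dim_S_Suc[of 0 i j] dim_B1 by simp
qed

lemma sum_arcs_head: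
  fixes f :: "'v \<Rightarrow> 'a::comm_semiring_1"
  shows "(\<Sum>b | b \<in> E \<and> r b = j. f (s b)) = (\<Sum>u\<in>verts G. of_nat (num_arcs G u j) * f u)"
proof -
  have "(\<Sum>b | b \<in> E \<and> r b = j. f (s b)) = (\<Sum>u\<in>verts G. \<Sum>b | b \<in> {b. b \<in> E \<and> r b = j} \<and> s b = u. f (s b))"
    by (rule sum.group[symmetric]) auto
  also have "\<dots> = (\<Sum>u\<in>verts G. of_nat (num_arcs G u j) * f u)"
  proof (rule sum.cong[OF refl])
    fix u
    have "(\<Sum>b | b \<in> {b. b \<in> E \<and> r b = j} \<and> s b = u. f (s b)) = (\<Sum>b\<in>arcs_from_to G u j. f u)"
      by (rule sum.cong) (auto simp: arcs_from_to_def)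
    then show "(\<Sum>b | b \<in> {b. b \<in> E \<and> r b = j} \<and> s b = u. f (s b)) = of_nat (num_arcs G u j) * f u"
      by (simp add: num_arcs_def)
  qed
  finally show ?thesis .
qed

lemma sum_arcs_tail:
  fixes f :: "'v \<Rightarrow> 'a::comm_semiring_1"
  shows "(\<Sum>b | b \<in> E \<and> s b = j. f (r b)) = (\<Sum>u\<in>verts G. of_nat (num_arcs G j u) * f u)"
proof -
  have "(\<Sum>b | b \<in> E \<and> s b = j. f (r b)) = (\<Sum>u\<in>verts G. \<Sum>b | b \<in> {b. b \<in> E \<and> s b = j} \<and> r b = u. f (r b))"
    by (rule sum.group[symmetric]) auto
  also have "\<dots> = (\<Sum>u\<in>verts G. of_nat (num_arcs G j u) * f u)"
  proof (rule sum.cong[OF refl])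
    fix u
    have "(\<Sum>b | b \<in> {b. b \<in> E \<and> s b = j} \<and> r b = u. f (r b)) = (\<Sum>b\<in>arcs_from_to G j u. f u)"
      by (rule sum.cong) (auto simp: arcs_from_to_def)
    then show "(\<Sum>b | b \<in> {b. b \<in> E \<and> s b = j} \<and> r b = u. f (r b)) = of_nat (num_arcs G j u) * f u"
      by (simp add: num_arcs_def)
  qed
  finally show ?thesis .
qed

lemma arc_dim_1:
  "int (arc_dim 1 i j) = (\<Sum>u\<in>verts G. int (num_arcs G u j) * int (arc_dim 0 i u))"
  using sum_arcs_head[of "\<lambda>u. int (arc_dim 0 i u)" j] by (simp add: dim_1[simplified])

lemma arc_dim_rec:
  assumes "q + 2 < h" "j \<in> verts G"
  shows "int (arc_dim (q + 2) i j) =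
    (\<Sum>u\<in>verts G. int (num_arcs G u j) * int (arc_dim (q + 1) i u)) -
    (\<Sum>u\<in>verts G. int (num_arcs G j u) * int (arc_dim q i u)) +
    (if q = 0 then 0 else int (arc_dim (q - 1) i j))"
proof -
  have "int (arc_dim (q + 2) i j) + (\<Sum>a | a \<in> E \<and> s a = j. int (arc_dim q i (r a))) =
    (\<Sum>b | b \<in> E \<and> r b = j. int (arc_dim (q + 1) i (s b))) + (if q = 0 then 0 else int (arc_dim (q - 1) i j))"
    using arg_cong[OF dim_recursion[OF assms, of i], of int] by (simp split: if_splits)
  then show ?thesis
    unfolding sum_arcs_tail[of "\<lambda>u. int (arc_dim q i u)" j] sum_arcs_head[of "\<lambda>u. int (arc_dim (q + 1) i u)" j]
    by simp
qed

section \<open>Perron-Frobenius weights and vanishing in high degree\<close>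

lemma pf_head: "u \<in> verts G \<Longrightarrow> (\<Sum>j\<in>verts G. of_nat (num_arcs G j u) * f\<phi> j) = (Q 2 * Q 2 - 1) * f\<phi> u"
proof -
  assume "u \<in> verts G"
  then have "(\<Sum>j\<in>verts G. real (num_arcs G j u) * \<phi> j) = quantum3 h * \<phi> u"
    using pf by (simp add: perron_frobenius_def)
  then have "complex_of_real (\<Sum>j\<in>verts G. real (num_arcs G j u) * \<phi> j) = of_real (quantum3 h * \<phi> u)"
    by (simp only:)
  then show ?thesis by (simp add: quantum3_eq Q2 power2_eq_square)
qed

lemma pf_tail: "u \<in> verts G \<Longrightarrow> (\<Sum>j\<in>verts G. of_nat (num_arcs G u j) * f\<phi> j) = (Q 2 * Q 2 - 1) * f\<phi> u"
  using sum_phi_out[of u] sum_arcs_tail[of f\<phi> u] by (simp add: sum.inter_filter)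

text \<open>Pairing with \<open>\<phi>\<close> turns both adjacency terms of the recursion into the
  scalar \<open>[3] = [2] [2] - 1\<close>. The resulting scalar recursion is solved by
  \<open>[p + 1] [p + 2] / [2]\<close>, the quantum dimension of the p-th symmetric power for
  SU(3).\<close>

lemma weighted_dim:
  assumes "i \<in> verts G" "p < h"
  shows "Q 2 * (\<Sum>j\<in>verts G. f\<phi> j * of_nat (arc_dim p i j)) = Q (p + 1) * Q (p + 2) * f\<phi> i"
  using assms(2)
proof (induction p rule: less_induct)
  case (less p)
  let ?v = "\<lambda>p. \<Sum>j\<in>verts G. f\<phi> j * of_nat (arc_dim p i j)"
  have q1: "Q (Suc 0) = 1" "Q 1 = 1" using h4 by auto
  have head: "(\<Sum>j\<in>verts G. f\<phi> j * (\<Sum>u\<in>verts G. of_nat (num_arcs G u j) * of_nat (arc_dim p i u))) = (Q 2 * Q 2 - 1) * ?v p" for p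
  proof -
    have "(\<Sum>j\<in>verts G. f\<phi> j * (\<Sum>u\<in>verts G. of_nat (num_arcs G u j) * of_nat (arc_dim p i u))) =
      (\<Sum>j\<in>verts G. \<Sum>u\<in>verts G. of_nat (arc_dim p i u) * (of_nat (num_arcs G u j) * f\<phi> j))"
      by (simp add: sum_distrib_left mult_ac)
    also have "\<dots> = (\<Sum>u\<in>verts G. of_nat (arc_dim p i u) * (\<Sum>j\<in>verts G. of_nat (num_arcs G u j) * f\<phi> j))"
      by (subst sum.swap) (simp add: sum_distrib_left)
    also have "\<dots> = (\<Sum>u\<in>verts G. of_nat (arc_dim p i u) * ((Q 2 * Q 2 - 1) * f\<phi> u))"
      by (rule sum.cong[OF refl]) (simp only: pf_tail)
    finally show ?thesis by (simp add: sum_distrib_left mult_ac)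
  qed
  have tail: "(\<Sum>j\<in>verts G. f\<phi> j * (\<Sum>u\<in>verts G. of_nat (num_arcs G j u) * of_nat (arc_dim p i u))) = (Q 2 * Q 2 - 1) * ?v p" for p
  proof -
    have "(\<Sum>j\<in>verts G. f\<phi> j * (\<Sum>u\<in>verts G. of_nat (num_arcs G j u) * of_nat (arc_dim p i u))) =
      (\<Sum>j\<in>verts G. \<Sum>u\<in>verts G. of_nat (arc_dim p i u) * (of_nat (num_arcs G j u) * f\<phi> j))"
      by (simp add: sum_distrib_left mult_ac)
    also have "\<dots> = (\<Sum>u\<in>verts G. of_nat (arc_dim p i u) * (\<Sum>j\<in>verts G. of_nat (num_arcs G j u) * f\<phi> j))"
      by (subst sum.swap) (simp add: sum_distrib_left)
    also have "\<dots> = (\<Sum>u\<in>verts G. of_nat (arc_dim p i u) * ((Q 2 * Q 2 - 1) * f\<phi> u))"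
      by (rule sum.cong[OF refl]) (simp only: pf_head)
    finally show ?thesis by (simp add: sum_distrib_left mult_ac)
  qed
  have v0: "?v 0 = f\<phi> i"
  proof -
    have "?v 0 = (\<Sum>j\<in>verts G. if j = i then f\<phi> i else 0)"
      by (rule sum.cong) (auto simp: dim_0)
    then show ?thesis using assms(1) by simp
  qed
  consider "p = 0" | "p = 1" | q where "p = q + 2" by (metis add_2_eq_Suc' not0_implies_Suc One_nat_def)
  then show ?case
  proof cases
    case 1
    then show ?thesis using v0 q1 by (simp add: numeral_2_eq_2)
  next
    case 2
    have c: "of_nat (arc_dim 1 i j) = (\<Sum>u\<in>verts G. of_nat (num_arcs G u j) * (of_nat (arc_dim 0 i u) :: complex))" for j
      using arg_cong[OF arc_dim_1[of i j], of of_int] by simp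
    have "?v 1 = (Q 2 * Q 2 - 1) * f\<phi> i"
      unfolding c head v0 ..
    moreover have "Q (1 + 2) = Q 2 * Q 2 - 1" using Q_rec[of 1] q1 by (simp add: numeral_2_eq_2)
    ultimately show ?thesis unfolding 2 by (simp add: numeral_2_eq_2)
  next
    case (3 q)
    have q: "q + 2 < h" using less.prems 3 by simp
    have c: "of_nat (arc_dim (q + 2) i j) =
      (\<Sum>u\<in>verts G. of_nat (num_arcs G u j) * (of_nat (arc_dim (q + 1) i u) :: complex)) -
      (\<Sum>u\<in>verts G. of_nat (num_arcs G j u) * of_nat (arc_dim q i u)) +
      (if q = 0 then 0 else of_nat (arc_dim (q - 1) i j))" if "j \<in> verts G" for j
      using arg_cong[OF arc_dim_rec[OF q that, of i], of of_int] by (simp split: if_splits)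
    have "?v (q + 2) = (\<Sum>j\<in>verts G. f\<phi> j * (\<Sum>u\<in>verts G. of_nat (num_arcs G u j) * of_nat (arc_dim (q + 1) i u)) -
      f\<phi> j * (\<Sum>u\<in>verts G. of_nat (num_arcs G j u) * of_nat (arc_dim q i u)) +
      f\<phi> j * (if q = 0 then 0 else of_nat (arc_dim (q - 1) i j)))"
      by (rule sum.cong[OF refl]) (simp only: c distrib_left right_diff_distrib)
    also have "\<dots> = (Q 2 * Q 2 - 1) * ?v (q + 1) - (Q 2 * Q 2 - 1) * ?v q + (if q = 0 then 0 else ?v (q - 1))"
      by (simp only: sum.distrib sum_subtractf head tail) simp
    finally have vv: "?v (q + 2) = (Q 2 * Q 2 - 1) * ?v (q + 1) - (Q 2 * Q 2 - 1) * ?v q + (if q = 0 then 0 else ?v (q - 1))" .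
    have dist: "Q 2 * (A * x - A * y + z) = A * (Q 2 * x) - A * (Q 2 * y) + Q 2 * z" for A x y z
      by (simp add: algebra_simps)
    have "Q 2 * (if q = 0 then 0 else ?v (q - 1)) = (if q = 0 then 0 else Q 2 * ?v (q - 1))"
      by (cases "q = 0") (simp_all only: simp_thms if_True if_False mult_zero_right)
    then have v: "Q 2 * ?v (q + 2) = (Q 2 * Q 2 - 1) * (Q 2 * ?v (q + 1)) - (Q 2 * Q 2 - 1) * (Q 2 * ?v q) +
      (if q = 0 then 0 else Q 2 * ?v (q - 1))"
      unfolding vv dist by (simp only:)
    have v1: "Q 2 * ?v (q + 1) = Q (q + 2) * Q (q + 3) * f\<phi> i"
      using less.IH[of "q + 1"] 3 less.prems by (simp add: numeral_2_eq_2 numeral_3_eq_3)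
    have v2: "Q 2 * ?v q = Q (q + 1) * Q (q + 2) * f\<phi> i"
      using less.IH[of q] 3 less.prems by simp
    \<comment> \<open>For \<open>q = 0\<close> the missing term agrees with the formula because
      \<open>[0] = 0\<close>.\<close>
    have v3: "(if q = 0 then 0 else Q 2 * ?v (q - 1)) = Q q * Q (q + 1) * f\<phi> i"
      using less.IH[of "q - 1"] 3 less.prems by (cases q) auto
    have e2: "Q (q + 2) = Q 2 * Q (q + 1) - Q q" by (rule Q_rec)
    have e3: "Q (q + 3) = Q 2 * Q (q + 2) - Q (q + 1)"
      using Q_rec[of "q + 1"] by (simp add: numeral_2_eq_2 numeral_3_eq_3)
    have e4: "Q (q + 4) = Q 2 * Q (q + 3) - Q (q + 2)"
      using Q_rec[of "q + 2"] by (simp add: numeral_2_eq_2 numeral_3_eq_3 eval_nat_numeral)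
    have "Q 2 * ?v (q + 2) = Q (q + 3) * Q (q + 4) * f\<phi> i"
      unfolding v v1 v2 v3 e4 e3 e2 by (simp add: algebra_simps)
    then show ?thesis unfolding 3 by (simp add: eval_nat_numeral)
  qed
qed

text \<open>At \<open>p = h - 2\<close> the factor \<open>[p + 2] = [h]\<close> is zero, so a sum of
  nonnegative dimensions with positive weights vanishes. Beyond that, \<open>S (p + 1)\<close>
  embeds in a direct sum of spaces \<open>S p\<close>.\<close>

lemma arc_dim_vanishes:
  assumes i: "i \<in> verts G" and "j \<in> verts G" "h - 2 \<le> p"
  shows "arc_dim p i j = 0"
  using assms(3,2)
proof (induction p arbitrary: j rule: dec_induct)
  case base
  have "h - 2 + 2 = h" "h - 2 < h" using h4 by auto
  then have "Q 2 * (\<Sum>j\<in>verts G. f\<phi> j * of_nat (arc_dim (h - 2) i j)) = 0"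
    using weighted_dim[OF i, of "h - 2"] h4 quantum_num_h[of h] by simp
  moreover have "Q 2 \<noteq> 0" using h4 by (intro quantum_num_nonzero) auto
  ultimately have "(\<Sum>j\<in>verts G. f\<phi> j * of_nat (arc_dim (h - 2) i j)) = 0" by simp
  then have "complex_of_real (\<Sum>j\<in>verts G. \<phi> j * real (arc_dim (h - 2) i j)) = 0" by simp
  then have "(\<Sum>j\<in>verts G. \<phi> j * real (arc_dim (h - 2) i j)) = 0" by (simp only: of_real_eq_0_iff)
  moreover have "0 \<le> \<phi> u * real (arc_dim (h - 2) i u)" if "u \<in> verts G" for u
    using phi_pos[OF that] by simp
  ultimately have "\<phi> j * real (arc_dim (h - 2) i j) = 0"
    using base by (subst (asm) sum_nonneg_eq_0_iff) auto
  then show ?case using phi_pos[OF base] by simp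
next
  case (step p)
  obtain X where X: "finite X" "B1 p i j \<subseteq> supported_on X" using B1_supported by blast
  have "fun_space.dim (B1 p i j) = 0" using step.IH by (simp add: dim_B1)
  then show ?case
    using dim_kernel_image[OF linear_TK subspace_B1 X] by (simp add: dim_S_Suc)
qed

end

section \<open>The path algebra\<close>

lemma poly_mapping_decomp: "(\<Sum>x\<in>Poly_Mapping.keys f. Poly_Mapping.single x (Poly_Mapping.lookup f x)) = f"
proof (rule poly_mapping_eqI)
  fix k
  have "Poly_Mapping.lookup (\<Sum>x\<in>Poly_Mapping.keys f. Poly_Mapping.single x (Poly_Mapping.lookup f x)) k =
    (\<Sum>x\<in>Poly_Mapping.keys f. if x = k then Poly_Mapping.lookup f k else 0)"
    unfolding Poly_Mapping.lookup_sum by (rule sum.cong) (auto simp: lookup_single when_def)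
  then show "Poly_Mapping.lookup (\<Sum>x\<in>Poly_Mapping.keys f. Poly_Mapping.single x (Poly_Mapping.lookup f x)) k =
    Poly_Mapping.lookup f k"
    by (simp add: in_keys_iff)
qed

lemma poly_mapping_additive_induct [case_names zero single add]:
  fixes f :: "'x \<Rightarrow>\<^sub>0 'b::comm_monoid_add"
  assumes "P 0" "\<And>x a. P (Poly_Mapping.single x a)" "\<And>f g. P f \<Longrightarrow> P g \<Longrightarrow> P (f + g)"
  shows "P f"
proof -
  have "P (\<Sum>x\<in>A. Poly_Mapping.single x (Poly_Mapping.lookup f x))" for A
    by (induction A rule: infinite_finite_induct) (auto intro: assms)
  then show ?thesis by (metis poly_mapping_decomp)
qed

context
  fixes G :: "('v, 'e) pre_digraph"
begin

lemma path_range_Nil [simp]: "path_range G (u, []) = u"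
  by (simp add: path_range_def pre_digraph.awalk_verts.simps)

lemma path_range_Cons [simp]: "path_range G (u, e # es) = path_range G (head G e, es)"
  by (simp add: path_range_def pre_digraph.awalk_verts.simps pre_digraph.awalk_verts_non_Nil)

lemma path_range_append [simp]: "path_range G (u, xs @ ys) = path_range G (path_range G (u, xs), ys)"
  by (induction xs arbitrary: u) auto

lemma path_mult_0 [simp]: "path_mult G 0 f = 0" "path_mult G f 0 = 0"
  by (simp_all add: path_mult_def)

lemma path_mult_add_left: "path_mult G (f + f') g = path_mult G f g + path_mult G f' g"
  unfolding path_mult_def
  by (rule setsum_keys_plus_distrib[where f = "\<lambda>x a. \<Sum>y\<in>Poly_Mapping.keys g. if path_range G x = fst y
        then Poly_Mapping.single (fst x, snd x @ snd y) (a * Poly_Mapping.lookup g y) else 0"])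
    (auto simp: distrib_right single_add sum.distrib[symmetric] intro!: sum.cong sum.neutral)

lemma path_mult_add_right: "path_mult G f (g + g') = path_mult G f g + path_mult G f g'"
  unfolding path_mult_def sum.distrib[symmetric]
proof (rule sum.cong[OF refl])
  fix x
  show "(\<Sum>y\<in>Poly_Mapping.keys (g + g'). if path_range G x = fst y
        then Poly_Mapping.single (fst x, snd x @ snd y) (Poly_Mapping.lookup f x * Poly_Mapping.lookup (g + g') y) else 0) =
    (\<Sum>y\<in>Poly_Mapping.keys g. if path_range G x = fst y
        then Poly_Mapping.single (fst x, snd x @ snd y) (Poly_Mapping.lookup f x * Poly_Mapping.lookup g y) else 0) +
    (\<Sum>y\<in>Poly_Mapping.keys g'. if path_range G x = fst y
        then Poly_Mapping.single (fst x, snd x @ snd y) (Poly_Mapping.lookup f x * Poly_Mapping.lookup g' y) else 0)"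
    by (rule setsum_keys_plus_distrib[where f = "\<lambda>y a. if path_range G x = fst y
        then Poly_Mapping.single (fst x, snd x @ snd y) (Poly_Mapping.lookup f x * a) else 0"])
      (auto simp: distrib_left single_add)
qed

lemma path_mult_sum_left: "path_mult G (sum F A) g = (\<Sum>t\<in>A. path_mult G (F t) g)"
  by (induction A rule: infinite_finite_induct) (auto simp: path_mult_add_left)

lemma path_mult_sum_right: "path_mult G f (sum F A) = (\<Sum>t\<in>A. path_mult G f (F t))"
  by (induction A rule: infinite_finite_induct) (auto simp: path_mult_add_right)

lemma path_mult_single:
  "path_mult G (Poly_Mapping.single x a) (Poly_Mapping.single y b) =
    (if path_range G x = fst y then Poly_Mapping.single (fst x, snd x @ snd y) (a * b) else 0)"
  by (cases "a = 0"; cases "b = 0") (auto simp: path_mult_def)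

lemma path_mult_assoc: "path_mult G (path_mult G f g) k = path_mult G f (path_mult G g k)"
proof (induction f rule: poly_mapping_additive_induct)
  case (single x a)
  show ?case
  proof (induction g rule: poly_mapping_additive_induct)
    case (single y b)
    show ?case
    proof (induction k rule: poly_mapping_additive_induct)
      case (single z c)
      show ?case
        by (cases x; cases y; cases z) (auto simp: path_mult_single mult.assoc)
    qed (simp_all add: path_mult_add_left path_mult_add_right)
  qed (simp_all add: path_mult_add_left path_mult_add_right)
qed (simp_all add: path_mult_add_left path_mult_add_right)

text \<open>Functions in \<open>S\<close> see the arcs in reverse order and do not record the source
  of a path, hence the \<open>rev\<close> and the extra argument \<open>i\<close>.\<close>

definition pair :: "('e list \<Rightarrow> complex) \<Rightarrow> 'v \<Rightarrow> (('v, 'e) path \<Rightarrow>\<^sub>0 complex) \<Rightarrow> complex" where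
  "pair g i f = (\<Sum>x\<in>Poly_Mapping.keys f. if fst x = i then g (rev (snd x)) * Poly_Mapping.lookup f x else 0)"

lemma pair_zero [simp]: "pair g i 0 = 0"
  by (simp add: pair_def)

lemma pair_zero_fun [simp]: "pair (\<lambda>_. 0) i f = 0"
  unfolding pair_def by (rule sum.neutral) auto

lemma pair_add: "pair g i (f + f') = pair g i f + pair g i f'"
  unfolding pair_def
  by (rule setsum_keys_plus_distrib[where f = "\<lambda>x a. if fst x = i then g (rev (snd x)) * a else 0"])
    (auto simp: distrib_left)

lemma pair_sum: "pair g i (sum F A) = (\<Sum>t\<in>A. pair g i (F t))"
  by (induction A rule: infinite_finite_induct) (auto simp: pair_add)

lemma pair_single [simp]: "pair g i (Poly_Mapping.single x c) = (if fst x = i then g (rev (snd x)) * c else 0)"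
  by (cases "c = 0") (auto simp: pair_def)

lemma pair_minus: "pair g i (- f) = - pair g i f"
  using pair_add[of g i f "- f"] by (simp add: eq_neg_iff_add_eq_0 add.commute)

text \<open>Multiplication by a path is adjoint to shifting the test function; the condition on the
  range records that paths which do not meet have product zero. With \<open>pair_mult_left\<close>
  this reduces ideal properties to properties of \<open>S\<close>.\<close>

lemma pair_mult_right:
  "pair g i (path_mult G f (Poly_Mapping.single y c)) =
    c * pair (\<lambda>x. if path_range G (i, rev x) = fst y then g (rev (snd y) @ x) else 0) i f"
proof (induction f rule: poly_mapping_additive_induct)
  case (single x a)
  then show ?case by (cases x) (auto simp: path_mult_single)
qed (simp_all add: path_mult_add_left pair_add distrib_left)

lemma pair_mult_left:
  "pair g i (path_mult G (Poly_Mapping.single y c) f) =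
    (if fst y = i then c * pair (\<lambda>x. g (x @ rev (snd y))) (path_range G y) f else 0)"
proof (induction f rule: poly_mapping_additive_induct)
  case (single x a)
  then show ?case by (cases x) (auto simp: path_mult_single)
qed (simp_all add: path_mult_add_right pair_add distrib_left)

end

section \<open>The ideal of relations as an annihilator\<close>

context cell_setting
begin

text \<open>The recursive definition imposes the relations only at the head of the list, and the
  recursion moves them inwards. So \<open>S\<close> consists of the functions on walks that kill
  every product path, relation, path; this form is symmetric in the two sides.\<close>

lemma S_iff:
  assumes "j \<in> verts G"
  shows "f \<in> S p i j \<longleftrightarrow> (\<forall>x. f x \<noteq> 0 \<longrightarrow> length x = p \<and> awalk i (rev x) j) \<and>
    (\<forall>a\<in>E. \<forall>x y. (\<Sum>b\<in>E. \<Sum>b'\<in>E. w a b b' * f (y @ b' # b # x)) = 0)" (is "_ \<longleftrightarrow> ?R p f j")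
proof
  assume f: "f \<in> S p i j"
  have "(\<Sum>b\<in>E. \<Sum>b'\<in>E. w a b b' * f (y @ b' # b # x)) = 0" for a x y
    using f
  proof (induction y arbitrary: f p j)
    case Nil
    then show ?case using S_rel by simp
  next
    case (Cons e y)
    show ?case
    proof (cases p)
      case 0
      then have "f (e # z) = 0" for z using Cons.prems M_S_0 by blast
      then show ?thesis by simp
    next
      case (Suc q)
      then show ?thesis using Cons.IH[of "M e f" q "s e"] M_S Cons.prems by simp
    qed
  qed
  then show "?R p f j" using S_awalk[OF f _ assms] by blast
next
  assume "?R p f j"
  then show "f \<in> S p i j" using assms
  proof (induction p arbitrary: f j)
    case 0
    have "f x = 0" if "x \<noteq> [] \<or> i \<noteq> j" for x
      using 0 that by (cases "f x = 0") (auto simp: awalk_Nil_iff)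
    then show ?case by auto
  next
    case (Suc p)
    note supp = Suc.prems(1)[THEN conjunct1, rule_format] and rel = Suc.prems(1)[THEN conjunct2, rule_format]
    have walk: "e \<in> E \<and> r e = j \<and> awalk i (rev x) (s e) \<and> length x = p" if "f (e # x) \<noteq> 0" for e x
    proof -
      have "awalk i (rev x @ [e]) j" "length (e # x) = Suc p" using supp[OF that] by auto
      then have "awalk i (rev x) (awlast i (rev x))" "awalk (awlast i (rev x)) [e] j" by auto
      then show ?thesis using \<open>length (e # x) = Suc p\<close> by (auto simp: awalk_simps)
    qed
    show ?case unfolding S.simps(2) mem_Collect_eq
    proof (intro conjI allI ballI)
      show "f [] = 0" using supp[of "[]"] by auto
      show "(\<Sum>b\<in>E. \<Sum>b'\<in>E. w a b b' * f (b' # b # x)) = 0" if "a \<in> E" for a x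
        using rel[OF that, of "[]" x] by simp
      fix e
      show "if e \<in> E \<and> r e = j then M e f \<in> S p i (s e) else M e f = (\<lambda>x. 0)"
      proof (cases "e \<in> E \<and> r e = j")
        case True
        have "M e f \<in> S p i (s e)"
        proof (rule Suc.IH)
          show "(\<forall>x. M e f x \<noteq> 0 \<longrightarrow> length x = p \<and> awalk i (rev x) (s e)) \<and>
            (\<forall>a\<in>E. \<forall>x y. (\<Sum>b\<in>E. \<Sum>b'\<in>E. w a b b' * M e f (y @ b' # b # x)) = 0)"
            using walk[of e] rel[of _ "e # _"] by simp
        qed (use True in auto)
        then show ?thesis using True by simp
      next
        case False
        then have "M e f = (\<lambda>x. 0)" using walk[of e] by blast
        then show ?thesis unfolding if_not_P[OF False] .
      qed
    qed
  qed
qed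

lemma awalk_path_range: "awalk u es v \<Longrightarrow> path_range G (u, es) = v"
  by (auto simp: path_range_def)

lemma paths_iff: "(u, es) \<in> paths G \<longleftrightarrow> awalk u es (path_range G (u, es))"
  by (simp add: paths_def)

lemma awalk_paths: "awalk u es v \<Longrightarrow> (u, es) \<in> paths G"
  using awalk_path_range by (simp add: paths_iff)

lemma S_left_shift:
  assumes g: "g \<in> S p i j" and j: "j \<in> verts G" and y: "(i, es) \<in> paths G"
  shows "(\<lambda>x. g (x @ rev es)) \<in> S (p - length es) (path_range G (i, es)) j"
  unfolding S_iff[OF j]
proof (intro conjI allI impI ballI)
  fix x assume "g (x @ rev es) \<noteq> 0"
  then have *: "length (x @ rev es) = p" "awalk i (es @ rev x) j" using g unfolding S_iff[OF j] by fastforce+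
  then show "length x = p - length es" by auto
  show "awalk (path_range G (i, es)) (rev x) j" using *(2) by (simp add: path_range_def)
next
  fix a x y assume "a \<in> E"
  then show "(\<Sum>b\<in>E. \<Sum>b'\<in>E. w a b b' * g ((y @ b' # b # x) @ rev es)) = 0"
    using g unfolding S_iff[OF j] by simp
qed

lemma S_right_shift:
  assumes g: "g \<in> S p i j" and j: "j \<in> verts G" and y: "(u, es) \<in> paths G"
  shows "(\<lambda>x. if path_range G (i, rev x) = u then g (rev es @ x) else 0) \<in> S (p - length es) i u"
proof -
  have u: "u \<in> verts G" using y by (auto simp: paths_iff)
  show ?thesis
    unfolding S_iff[OF u]
  proof (intro conjI allI impI ballI)
    fix x assume nz: "(if path_range G (i, rev x) = u then g (rev es @ x) else 0) \<noteq> 0"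
    then have pr: "path_range G (i, rev x) = u" and "g (rev es @ x) \<noteq> 0" by (auto split: if_splits)
    then have *: "length (rev es @ x) = p" "awalk i (rev x @ es) j" using g unfolding S_iff[OF j] by fastforce+
    then show "length x = p - length es" by auto
    show "awalk i (rev x) u" using *(2) pr by (simp add: path_range_def)
  next
    fix a x y assume a: "a \<in> E"
    have rel: "(\<Sum>b\<in>E. \<Sum>b'\<in>E. w a b b' * g (rev es @ y @ b' # b # x)) = 0"
      using g[unfolded S_iff[OF j], THEN conjunct2, rule_format, OF a, of "rev es @ y" x]
      by (simp only: append_assoc)
    \<comment> \<open>The range condition on the whole walk is the same for all \<open>b, b'\<close>
      with nonzero weight, as it only involves the last arc of \<open>y\<close> or, for empty
      \<open>y\<close>, the common range \<open>s a\<close>. So it can be pulled out of the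
      relation.\<close>
    define C where "C \<longleftrightarrow> (if y = [] then s a = u else r (hd y) = u)"
    have "(\<Sum>b\<in>E. \<Sum>b'\<in>E. w a b b' * (if path_range G (i, rev (y @ b' # b # x)) = u then g (rev es @ y @ b' # b # x) else 0)) =
      (\<Sum>b\<in>E. \<Sum>b'\<in>E. (if C then 1 else 0) * (w a b b' * g (rev es @ y @ b' # b # x)))"
    proof (rule sum.cong[OF refl], rule sum.cong[OF refl])
      fix b b'
      show "w a b b' * (if path_range G (i, rev (y @ b' # b # x)) = u then g (rev es @ y @ b' # b # x) else 0) =
         (if C then 1 else 0) * (w a b b' * g (rev es @ y @ b' # b # x))"
      proof (cases "w a b b' = 0")
        case False
        then have "r b' = s a" using w_nz by blast
        then have "path_range G (i, rev (y @ b' # b # x)) = u \<longleftrightarrow> C"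
          by (cases y) (auto simp: C_def)
        then show ?thesis by simp
      qed simp
    qed
    also have "\<dots> = 0" by (simp only: sum_distrib_left[symmetric] rel mult_zero_right)
    finally show "(\<Sum>b\<in>E. \<Sum>b'\<in>E. w a b b' * (if path_range G (i, rev (y @ b' # b # x)) = u then g (rev es @ y @ b' # b # x) else 0)) = 0" .
  qed
qed

abbreviation R :: "(('v, 'e) path \<Rightarrow>\<^sub>0 complex) ring" where "R \<equiv> path_algebra G"

lemma carrier_R: "f \<in> carrier R \<longleftrightarrow> Poly_Mapping.keys f \<subseteq> paths G"
  by (simp add: path_algebra_def)

lemma mult_R [simp]: "monoid.mult R = path_mult G" and add_R [simp]: "add R = (+)"
  and zero_R [simp]: "zero R = 0" and one_R [simp]: "one R = path_scalar G 1"
  by (simp_all add: path_algebra_def)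

lemma single_carrier: "x \<in> paths G \<Longrightarrow> Poly_Mapping.single x c \<in> carrier R"
  by (simp add: carrier_R)

lemma zero_carrier: "0 \<in> carrier R" by (simp add: carrier_R)

lemma add_carrier: "f \<in> carrier R \<Longrightarrow> g \<in> carrier R \<Longrightarrow> f + g \<in> carrier R"
  unfolding carrier_R by (rule order_trans[OF keys_add]) (rule Un_least)

lemma uminus_carrier: "f \<in> carrier R \<Longrightarrow> - f \<in> carrier R"
  by (simp add: carrier_R)

lemma sum_carrier: "(\<And>t. t \<in> A \<Longrightarrow> F t \<in> carrier R) \<Longrightarrow> sum F A \<in> carrier R"
  by (induction A rule: infinite_finite_induct) (auto simp: zero_carrier add_carrier)

lemma path_append:
  assumes "x \<in> paths G" "y \<in> paths G" "path_range G x = fst y"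
  shows "(fst x, snd x @ snd y) \<in> paths G"
  using assms by (cases x; cases y) (auto simp: paths_iff path_range_def awlast_append)

lemma mult_carrier:
  assumes "f \<in> carrier R" "g \<in> carrier R"
  shows "path_mult G f g \<in> carrier R"
  unfolding path_mult_def
proof (intro sum_carrier)
  fix x y assume "x \<in> Poly_Mapping.keys f" "y \<in> Poly_Mapping.keys g"
  then show "(if path_range G x = fst y then Poly_Mapping.single (fst x, snd x @ snd y)
        (Poly_Mapping.lookup f x * Poly_Mapping.lookup g y) else 0) \<in> carrier R"
    using assms path_append[of x y] by (auto simp: carrier_R)
qed

lemma vertex_path: "v \<in> verts G \<Longrightarrow> (v, []) \<in> paths G"
  by (simp add: paths_iff awalk_Nil_iff)

lemma path_scalar_carrier: "path_scalar G z \<in> carrier R"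
  unfolding path_scalar_def by (intro sum_carrier single_carrier vertex_path)

lemma path_ends:
  assumes "x \<in> paths G" shows "fst x \<in> verts G" "path_range G x \<in> verts G"
  using assms by (cases x; auto simp: paths_iff)+

lemma scalar_mult_single:
  assumes "x \<in> paths G"
  shows "path_mult G (path_scalar G z) (Poly_Mapping.single x c) = Poly_Mapping.single x (z * c)"
    and "path_mult G (Poly_Mapping.single x c) (path_scalar G z) = Poly_Mapping.single x (c * z)"
proof -
  have "path_mult G (path_scalar G z) (Poly_Mapping.single x c) =
    (\<Sum>v\<in>verts G. if v = fst x then Poly_Mapping.single x (z * c) else 0)"
    unfolding path_scalar_def path_mult_sum_left by (rule sum.cong) (auto simp: path_mult_single)
  then show "path_mult G (path_scalar G z) (Poly_Mapping.single x c) = Poly_Mapping.single x (z * c)"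
    using path_ends[OF assms] by simp
  have "path_mult G (Poly_Mapping.single x c) (path_scalar G z) =
    (\<Sum>v\<in>verts G. if v = path_range G x then Poly_Mapping.single x (c * z) else 0)"
    unfolding path_scalar_def path_mult_sum_right by (rule sum.cong) (auto simp: path_mult_single)
  then show "path_mult G (Poly_Mapping.single x c) (path_scalar G z) = Poly_Mapping.single x (c * z)"
    using path_ends[OF assms] by simp
qed

lemma carrier_sum_singles:
  assumes "f \<in> carrier R"
  obtains A c where "finite A" "A \<subseteq> paths G" "f = (\<Sum>x\<in>A. Poly_Mapping.single x (c x))"
  using assms poly_mapping_decomp[of f] that[of "Poly_Mapping.keys f" "Poly_Mapping.lookup f"]
  unfolding carrier_R by auto

lemma one_mult:
  assumes "f \<in> carrier R"
  shows "path_mult G (path_scalar G 1) f = f" "path_mult G f (path_scalar G 1) = f"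
proof -
  obtain A c where "finite A" and A: "A \<subseteq> paths G" and f: "f = (\<Sum>x\<in>A. Poly_Mapping.single x (c x))"
    by (rule carrier_sum_singles[OF assms])
  show "path_mult G (path_scalar G 1) f = f"
    unfolding f path_mult_sum_right using A by (intro sum.cong refl) (auto simp: scalar_mult_single)
  show "path_mult G f (path_scalar G 1) = f"
    unfolding f path_mult_sum_left using A by (intro sum.cong refl) (auto simp: scalar_mult_single)
qed

lemma ring_R: "ring R"
proof (rule ringI)
  show "abelian_group R"
  proof (rule abelian_groupI)
    fix x assume "x \<in> carrier R"
    then show "\<exists>y\<in>carrier R. y \<oplus>\<^bsub>R\<^esub> x = \<zero>\<^bsub>R\<^esub>" using uminus_carrier[of x] by (intro bexI[of _ "- x"]) auto
  qed (auto simp: add_carrier zero_carrier add.assoc add.commute)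
  show "monoid R"
    by (rule monoidI) (auto simp: mult_carrier path_scalar_carrier path_mult_assoc one_mult)
qed (auto simp: path_mult_add_left path_mult_add_right)

sublocale R: ring R by (rule ring_R)

text \<open>The relation ideal described by tests instead of generators;
  \<open>cell_ideal_eq\<close> identifies the two.\<close>

definition ann :: "(('v, 'e) path \<Rightarrow>\<^sub>0 complex) set" where
  "ann = {f \<in> carrier R. \<forall>p. \<forall>i\<in>verts G. \<forall>j\<in>verts G. \<forall>g\<in>S p i j. pair g i f = 0}"

lemma a_inv_R: "f \<in> carrier R \<Longrightarrow> a_inv R f = - f"
  by (rule R.minus_equality) (auto simp: uminus_carrier)

lemma ideal_ann: "ideal ann R"
proof (rule idealI[OF ring_R])
  show "subgroup ann (add_monoid R)"
  proof (rule R.add.subgroupI)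
    have "0 \<in> ann" unfolding ann_def using zero_carrier by simp
    then show "ann \<noteq> {}" by blast
    show "ann \<subseteq> carrier R" by (auto simp: ann_def)
    show "a_inv R f \<in> ann" if f: "f \<in> ann" for f
    proof -
      have "f \<in> carrier R" using f by (simp add: ann_def)
      then have "a_inv R f = - f" by (rule a_inv_R)
      then show ?thesis using f by (simp add: ann_def uminus_carrier pair_minus)
    qed
    show "f \<oplus>\<^bsub>R\<^esub> g \<in> ann" if "f \<in> ann" "g \<in> ann" for f g
      using that by (simp add: ann_def add_carrier pair_add)
  qed
next
  fix f x assume f: "f \<in> ann" and x: "x \<in> carrier R"
  obtain A c where "finite A" and A: "A \<subseteq> paths G" and x': "x = (\<Sum>x\<in>A. Poly_Mapping.single x (c x))"
    by (rule carrier_sum_singles[OF x])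
  have f': "f \<in> carrier R" and pf: "\<And>p i j g. i \<in> verts G \<Longrightarrow> j \<in> verts G \<Longrightarrow> g \<in> S p i j \<Longrightarrow> pair g i f = 0"
    using f by (auto simp: ann_def)
  have "pair g i (path_mult G x f) = 0" if "i \<in> verts G" "j \<in> verts G" "g \<in> S p i j" for g i j p
    unfolding x' path_mult_sum_left pair_sum
  proof (rule sum.neutral, rule ballI)
    fix y assume "y \<in> A"
    then have y: "y \<in> paths G" using A by blast
    show "pair g i (path_mult G (Poly_Mapping.single y (c y)) f) = 0"
    proof (cases "fst y = i")
      case True
      then have yi: "(i, snd y) = y" by (cases y) auto
      have "pair (\<lambda>x. g (x @ rev (snd y))) (path_range G y) f = 0"
        using pf[OF path_ends(2)[OF y] that(2)] S_left_shift[OF that(3,2), of "snd y"] y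
        unfolding yi by blast
      then show ?thesis by (simp add: pair_mult_left)
    qed (simp add: pair_mult_left)
  qed
  then show "x \<otimes>\<^bsub>R\<^esub> f \<in> ann" using mult_carrier[OF x f'] by (simp add: ann_def)
  have "pair g i (path_mult G f x) = 0" if "i \<in> verts G" "j \<in> verts G" "g \<in> S p i j" for g i j p
    unfolding x' path_mult_sum_right pair_sum
  proof (rule sum.neutral, rule ballI)
    fix y assume "y \<in> A"
    then have y: "y \<in> paths G" using A by blast
    have "pair (\<lambda>x. if path_range G (i, rev x) = fst y then g (rev (snd y) @ x) else 0) i f = 0"
      using pf[OF that(1) path_ends(1)[OF y] S_right_shift[OF that(3,2), of "fst y" "snd y"]] y by simp
    then show "pair g i (path_mult G f (Poly_Mapping.single y (c y))) = 0"
      by (simp add: pair_mult_right)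
  qed
  then show "f \<otimes>\<^bsub>R\<^esub> x \<in> ann" using mult_carrier[OF f' x] by (simp add: ann_def)
qed

lemma cell_relation_eq:
  "cell_relation G W a = (\<Sum>b\<in>E. \<Sum>b'\<in>E. Poly_Mapping.single (r a, [b, b']) (w a b b'))"
proof -
  have "cell_relation G W a = (\<Sum>z\<in>{(b, b'). (a, b, b') \<in> triangles G}. Poly_Mapping.single (r a, [fst z, snd z]) (w a (fst z) (snd z)))"
    unfolding cell_relation_def by (rule sum.cong) (auto simp: w_def)
  also have "\<dots> = (\<Sum>z\<in>E \<times> E. Poly_Mapping.single (r a, [fst z, snd z]) (w a (fst z) (snd z)))"
    by (rule sum.mono_neutral_left) (auto simp: w_def triangles_def)
  finally show ?thesis by (simp add: sum.cartesian_product case_prod_unfold)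
qed

lemma cell_relation_carrier:
  assumes "a \<in> E" shows "cell_relation G W a \<in> carrier R"
  unfolding cell_relation_eq
proof (intro sum_carrier)
  fix b b' assume "b \<in> E" "b' \<in> E"
  show "Poly_Mapping.single (r a, [b, b']) (w a b b') \<in> carrier R"
  proof (cases "w a b b' = 0")
    case False
    then have "awalk (r a) [b, b'] (r b')" using w_nz[OF False] by (simp add: awalk_simps)
    then show ?thesis by (intro single_carrier awalk_paths)
  qed (simp add: zero_carrier)
qed

lemma cell_relation_ann:
  assumes "a \<in> E" shows "cell_relation G W a \<in> ann"
proof -
  have "pair g i (cell_relation G W a) = 0" if "i \<in> verts G" "j \<in> verts G" "g \<in> S p i j" for g i j p
  proof -
    have "pair g i (cell_relation G W a) = (if r a = i then 1 else 0) * (\<Sum>b\<in>E. \<Sum>b'\<in>E. w a b b' * g (b' # b # []))"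
      unfolding cell_relation_eq pair_sum sum_distrib_left by (intro sum.cong refl) auto
    then show ?thesis using S_rel[OF that(3)] by simp
  qed
  then show ?thesis using cell_relation_carrier[OF assms] by (simp add: ann_def)
qed

lemma ideal_sum: "ideal I R \<Longrightarrow> (\<And>t. t \<in> A \<Longrightarrow> F t \<in> I) \<Longrightarrow> sum F A \<in> I"
proof (induction A rule: infinite_finite_induct)
  case (insert x A)
  then show ?case using additive_subgroup.a_closed[OF ideal.axioms(1)[OF insert.prems(1)]] by fastforce
qed (use additive_subgroup.zero_closed[OF ideal.axioms(1)] in \<open>fastforce\<close>)+


definition walk_lists :: "nat \<Rightarrow> 'v \<Rightarrow> 'v \<Rightarrow> 'e list set" where
  "walk_lists p i j = {x. length x = p \<and> awalk i (rev x) j}"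

lemma finite_walk_lists: "finite (walk_lists p i j)"
  by (rule finite_subset[OF _ finite_arc_lists[of p]]) (auto simp: walk_lists_def awalk_def)

lemma S_supported_walk: "j \<in> verts G \<Longrightarrow> S p i j \<subseteq> supported_on (walk_lists p i j)"
  using S_awalk unfolding supported_on_def walk_lists_def by blast

lemma pair_supported:
  assumes "finite X" "u \<in> supported_on X"
  shows "pair u i f = (\<Sum>z\<in>X. u z * Poly_Mapping.lookup f (i, rev z))"
proof (induction f rule: poly_mapping_additive_induct)
  case (single x c)
  have "(\<Sum>z\<in>X. u z * Poly_Mapping.lookup (Poly_Mapping.single x c) (i, rev z)) =
    (\<Sum>z\<in>X. if z = rev (snd x) then (if fst x = i then u (rev (snd x)) * c else 0) else 0)"
    by (rule sum.cong) (auto simp: lookup_single when_def prod_eq_iff)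
  also have "\<dots> = (if fst x = i then u (rev (snd x)) * c else 0)"
    using assms by (simp add: supported_on_def)
  finally show ?case by simp
qed (simp_all add: pair_add lookup_add distrib_left sum.distrib)

definition from_vector :: "'e list set \<Rightarrow> 'v \<Rightarrow> ('e list \<Rightarrow> complex) \<Rightarrow> (('v, 'e) path \<Rightarrow>\<^sub>0 complex)" where
  "from_vector X i v = (\<Sum>z\<in>X. Poly_Mapping.single (i, rev z) (v z))"

lemma from_vector_lookup:
  assumes "finite X" "Poly_Mapping.keys f \<subseteq> (\<lambda>z. (i, rev z)) ` X"
  shows "from_vector X i (\<lambda>z. Poly_Mapping.lookup f (i, rev z)) = f"
proof -
  have inj: "inj_on (\<lambda>z. (i, rev z)) X" by (auto simp: inj_on_def)
  have "f = (\<Sum>x\<in>Poly_Mapping.keys f. Poly_Mapping.single x (Poly_Mapping.lookup f x))"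
    by (simp add: poly_mapping_decomp)
  also have "\<dots> = (\<Sum>x\<in>(\<lambda>z. (i, rev z)) ` X. Poly_Mapping.single x (Poly_Mapping.lookup f x))"
    using assms by (intro sum.mono_neutral_left) (auto simp: in_keys_iff)
  finally show ?thesis by (simp add: from_vector_def sum.reindex[OF inj])
qed

lemma from_vector_add: "from_vector X i (\<lambda>z. u z + v z) = from_vector X i u + from_vector X i v"
  by (simp add: from_vector_def single_add sum.distrib)

lemma from_vector_scale:
  "X \<subseteq> walk_lists p i j \<Longrightarrow> path_mult G (path_scalar G c) (from_vector X i v) = from_vector X i (\<lambda>z. c * v z)"
  unfolding from_vector_def path_mult_sum_right
  by (intro sum.cong refl scalar_mult_single) (auto simp: walk_lists_def intro: awalk_paths)

text \<open>A functional that vanishes on the ideal lies in \<open>S\<close>, so by duality \<open>ann\<close> is contained in every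
  ideal containing the relations.\<close>

lemma component_in_ideal:
  assumes I: "ideal I R" and rels: "cell_relation G W ` E \<subseteq> I" and f: "f \<in> ann"
    and i: "i \<in> verts G" and j: "j \<in> verts G"
  shows "from_vector (walk_lists p i j) i (\<lambda>z. Poly_Mapping.lookup f (i, rev z)) \<in> I"
proof (rule ccontr)
  let ?X = "walk_lists p i j"
  let ?f = "\<lambda>z. if z \<in> ?X then Poly_Mapping.lookup f (i, rev z) else 0"
  interpret I: ideal I R by (rule I)
  assume "from_vector ?X i (\<lambda>z. Poly_Mapping.lookup f (i, rev z)) \<notin> I"
  moreover have "from_vector ?X i (\<lambda>z. Poly_Mapping.lookup f (i, rev z)) = from_vector ?X i ?f"
    unfolding from_vector_def by (rule sum.cong) auto
  ultimately have nI: "from_vector ?X i ?f \<notin> I" by simp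
  \<comment> \<open>The part of \<open>I\<close> in one degree and one corner, as a space of
    coefficient vectors. A functional separating it from \<open>f\<close> will be a member of
    \<open>S\<close> that does not annihilate \<open>f\<close>.\<close>
  define I' where "I' = {v \<in> supported_on ?X. from_vector ?X i v \<in> I}"
  have "fun_space.subspace I'"
  proof (rule fun_space.subspaceI)
    have "from_vector ?X i 0 = 0" by (simp add: from_vector_def)
    then show "0 \<in> I'" using I.zero_closed by (simp add: I'_def supported_on_def)
    show "u + v \<in> I'" if "u \<in> I'" "v \<in> I'" for u v
      using that I.a_closed[of "from_vector ?X i u" "from_vector ?X i v"]
      by (simp add: I'_def supported_on_def plus_fun_def from_vector_add)
    show "(\<lambda>x. c * u x) \<in> I'" if "u \<in> I'" for c u
      using that I.I_l_closed[of "from_vector ?X i u" "path_scalar G c"] path_scalar_carrier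
      by (simp add: I'_def supported_on_def from_vector_scale[OF order_refl])
  qed
  moreover have "?f \<in> supported_on ?X" by (simp add: supported_on_def)
  ultimately obtain u where u: "\<And>v. v \<in> I' \<Longrightarrow> (\<Sum>x\<in>?X. u x * v x) = 0" and uf: "(\<Sum>x\<in>?X. u x * ?f x) \<noteq> 0"
    using ex_separating_functional[OF finite_walk_lists, of I' p i j ?f] nI by (auto simp: I'_def)
  define u' where "u' x = (if x \<in> ?X then u x else 0)" for x
  have u's: "u' \<in> supported_on ?X" by (simp add: u'_def supported_on_def)
  have "u' \<in> S p i j"
    unfolding S_iff[OF j]
  proof (intro conjI allI impI ballI)
    show "length x = p" "awalk i (rev x) j" if "u' x \<noteq> 0" for x
      using that by (auto simp: u'_def walk_lists_def split: if_splits)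
    fix a x y assume a: "a \<in> E"
    show "(\<Sum>b\<in>E. \<Sum>b'\<in>E. w a b b' * u' (y @ b' # b # x)) = 0"
    \<comment> \<open>A surviving term shows that the walk given by \<open>x\<close> ends in
      \<open>r a\<close> and the one given by \<open>y\<close> starts in \<open>s a\<close>, so that
      both can be multiplied onto the relation.\<close>
    proof (cases "\<exists>b b'. w a b b' * u' (y @ b' # b # x) \<noteq> 0")
      case False
      then have z: "w a b b' * u' (y @ b' # b # x) = 0" for b b' by blast
      show ?thesis by (simp only: z sum.neutral_const)
    next
      case True
      then obtain b0 b0' where b0: "w a b0 b0' \<noteq> 0" "u' (y @ b0' # b0 # x) \<noteq> 0" by auto
      have wl: "length x + length y + 2 = p" "awalk i (rev x @ [b0, b0'] @ rev y) j"
        using b0(2) by (auto simp: u'_def walk_lists_def split: if_splits)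
      have "awalk i (rev x) (awlast i (rev x))" "awalk (awlast i (rev x)) ([b0, b0'] @ rev y) j"
        using wl(2) by (simp_all only: awalk_append_iff)
      moreover have "s b0 = r a" "r b0' = s a" using w_nz[OF b0(1)] by auto
      ultimately have ax: "awalk i (rev x) (r a)" and ay: "awalk (s a) (rev y) j"
        by (auto simp: awalk_simps)
      \<comment> \<open>An element of \<open>I\<close> whose coefficients are those of the relation
        to be checked; the functional vanishes on it by construction.\<close>
      define \<Psi> where "\<Psi> = path_mult G (path_mult G (Poly_Mapping.single (i, rev x) 1) (cell_relation G W a))
         (Poly_Mapping.single (s a, rev y) 1)"
      have "\<Psi> \<in> I"
        using I.I_r_closed[OF I.I_l_closed[of "cell_relation G W a" "Poly_Mapping.single (i, rev x) 1"],
            of "Poly_Mapping.single (s a, rev y) 1"] rels a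
          single_carrier[OF awalk_paths[OF ax]] single_carrier[OF awalk_paths[OF ay]]
        by (auto simp: \<Psi>_def)
      have \<Psi>: "\<Psi> = (\<Sum>b\<in>E. \<Sum>b'\<in>E. Poly_Mapping.single (i, rev (y @ b' # b # x)) (w a b b'))"
        unfolding \<Psi>_def cell_relation_eq path_mult_sum_left path_mult_sum_right
      proof (rule sum.cong[OF refl], rule sum.cong[OF refl])
        fix b b'
        have "r b' = s a" if "w a b b' \<noteq> 0" using w_nz[OF that] by simp
        then show "path_mult G (path_mult G (Poly_Mapping.single (i, rev x) 1) (Poly_Mapping.single (r a, [b, b']) (w a b b')))
             (Poly_Mapping.single (s a, rev y) 1) = Poly_Mapping.single (i, rev (y @ b' # b # x)) (w a b b')"
          by (cases "w a b b' = 0") (simp_all add: path_mult_single awalk_path_range[OF ax])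
      qed
      have "Poly_Mapping.keys \<Psi> \<subseteq> (\<lambda>z. (i, rev z)) ` ?X"
      proof -
        have "Poly_Mapping.keys (Poly_Mapping.single (i, rev (y @ b' # b # x)) (w a b b')) \<subseteq> (\<lambda>z. (i, rev z)) ` ?X" for b b'
        proof (cases "w a b b' = 0")
          case False
          have "awalk i (rev x @ [b, b'] @ rev y) j"
            using w_nz[OF False] ax ay by (auto simp: awalk_simps)
          then have "y @ b' # b # x \<in> ?X" using wl(1) by (simp add: walk_lists_def)
          then have "(i, rev (y @ b' # b # x)) \<in> (\<lambda>z. (i, rev z)) ` ?X" by (rule imageI)
          then show ?thesis by (simp only: keys_single False if_False insert_subset empty_subsetI simp_thms)
        qed simp
        then show ?thesis unfolding \<Psi> by (intro order_trans[OF keys_sum] UN_least) auto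
      qed
      then have fv: "from_vector ?X i (\<lambda>z. Poly_Mapping.lookup \<Psi> (i, rev z)) = \<Psi>"
        by (rule from_vector_lookup[OF finite_walk_lists])
      let ?v = "\<lambda>z. if z \<in> ?X then Poly_Mapping.lookup \<Psi> (i, rev z) else 0"
      have "from_vector ?X i ?v = from_vector ?X i (\<lambda>z. Poly_Mapping.lookup \<Psi> (i, rev z))"
        unfolding from_vector_def by (rule sum.cong) auto
      then have "?v \<in> I'" using \<open>\<Psi> \<in> I\<close> fv by (simp add: I'_def supported_on_def)
      then have "(\<Sum>x\<in>?X. u x * ?v x) = 0" by (rule u)
      moreover have "pair u' i \<Psi> = (\<Sum>x\<in>?X. u x * ?v x)"
        unfolding pair_supported[OF finite_walk_lists u's] by (rule sum.cong) (auto simp: u'_def)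
      ultimately have "pair u' i \<Psi> = 0" by simp
      then show ?thesis by (simp add: \<Psi> pair_sum mult.commute)
    qed
  qed
  then have "pair u' i f = 0" using f i j by (auto simp: ann_def)
  moreover have "pair u' i f = (\<Sum>x\<in>?X. u x * ?f x)"
    unfolding pair_supported[OF finite_walk_lists u's] by (rule sum.cong) (auto simp: u'_def)
  ultimately show False using uf by simp
qed

lemma ann_subset:
  assumes I: "ideal I R" and rels: "cell_relation G W ` E \<subseteq> I"
  shows "ann \<subseteq> I"
proof
  fix f assume f: "f \<in> ann"
  then have fc: "Poly_Mapping.keys f \<subseteq> paths G" by (simp add: ann_def carrier_R)
  \<comment> \<open>Source, range and length split \<open>f\<close> into finitely many components,
    each of which is in \<open>I\<close> by \<open>component_in_ideal\<close>.\<close>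
  define t where "t x = (fst x, path_range G x, length (snd x))" for x :: "('v, 'e) path"
  let ?K = "Poly_Mapping.keys f"
  have "f = (\<Sum>x\<in>?K. Poly_Mapping.single x (Poly_Mapping.lookup f x))" by (simp add: poly_mapping_decomp)
  also have "\<dots> = (\<Sum>c\<in>t ` ?K. \<Sum>x | x \<in> ?K \<and> t x = c. Poly_Mapping.single x (Poly_Mapping.lookup f x))"
    by (rule sum.image_gen) simp
  also have "\<dots> \<in> I"
  proof (rule ideal_sum[OF I])
    fix c assume "c \<in> t ` ?K"
    then obtain x where x: "x \<in> ?K" "c = t x" by blast
    define i where "i = fst x" define j where "j = path_range G x" define p where "p = length (snd x)"
    have ij: "i \<in> verts G" "j \<in> verts G" using path_ends[of x] x fc by (auto simp: i_def j_def)
    have inj: "inj_on (\<lambda>z. (i, rev z)) (walk_lists p i j)" by (auto simp: inj_on_def)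
    have "from_vector (walk_lists p i j) i (\<lambda>z. Poly_Mapping.lookup f (i, rev z)) =
      (\<Sum>y\<in>(\<lambda>z. (i, rev z)) ` walk_lists p i j. Poly_Mapping.single y (Poly_Mapping.lookup f y))"
      by (simp add: from_vector_def sum.reindex[OF inj])
    also have "\<dots> = (\<Sum>y | y \<in> ?K \<and> t y = c. Poly_Mapping.single y (Poly_Mapping.lookup f y))"
    proof (rule sum.mono_neutral_right)
      show "finite ((\<lambda>z. (i, rev z)) ` walk_lists p i j)" by (simp add: finite_walk_lists)
      show "{y. y \<in> ?K \<and> t y = c} \<subseteq> (\<lambda>z. (i, rev z)) ` walk_lists p i j"
      proof
        fix y assume y: "y \<in> {y. y \<in> ?K \<and> t y = c}"
        then have "awalk i (snd y) j" "length (snd y) = p" "fst y = i"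
          using fc x by (cases y; auto simp: t_def i_def j_def p_def paths_iff)+
        then have "rev (snd y) \<in> walk_lists p i j" "y = (i, rev (rev (snd y)))"
          by (auto simp: walk_lists_def)
        then show "y \<in> (\<lambda>z. (i, rev z)) ` walk_lists p i j" by blast
      qed
      show "\<forall>y\<in>(\<lambda>z. (i, rev z)) ` walk_lists p i j - {y. y \<in> ?K \<and> t y = c}. Poly_Mapping.single y (Poly_Mapping.lookup f y) = 0"
      proof
        fix y assume y: "y \<in> (\<lambda>z. (i, rev z)) ` walk_lists p i j - {y. y \<in> ?K \<and> t y = c}"
        then obtain z where z: "z \<in> walk_lists p i j" "y = (i, rev z)" by blast
        then have "t y = c" using x awalk_path_range[of i "rev z" j]
          by (simp add: t_def walk_lists_def i_def j_def p_def)
        then have "y \<notin> ?K" using y by blast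
        then show "Poly_Mapping.single y (Poly_Mapping.lookup f y) = 0" by (simp add: in_keys_iff)
      qed
    qed
    finally show "(\<Sum>x | x \<in> ?K \<and> t x = c. Poly_Mapping.single x (Poly_Mapping.lookup f x)) \<in> I"
      using component_in_ideal[OF I rels f ij, of p] by simp
  qed
  finally show "f \<in> I" .
qed

lemma cell_ideal_eq: "cell_ideal G W = ann"
proof
  have c: "cell_relation G W ` E \<subseteq> carrier R" using cell_relation_carrier by blast
  show "cell_ideal G W \<subseteq> ann"
    unfolding cell_ideal_def using cell_relation_ann by (intro R.genideal_minimal[OF ideal_ann]) blast
  show "ann \<subseteq> cell_ideal G W"
    unfolding cell_ideal_def by (rule ann_subset[OF R.genideal_ideal[OF c] R.genideal_self[OF c]])
qed


section \<open>The quotient algebra and bases of its corners\<close>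

abbreviation cls :: "(('v, 'e) path \<Rightarrow>\<^sub>0 complex) \<Rightarrow> (('v, 'e) path \<Rightarrow>\<^sub>0 complex) set" where
  "cls \<equiv> cell_class G W"

abbreviation A :: "(('v, 'e) path \<Rightarrow>\<^sub>0 complex) set ring" where
  "A \<equiv> cell_algebra G W"

lemma cls_eq: "cls = (+>\<^bsub>R\<^esub>) ann" and A_eq: "A = R Quot ann"
  by (simp_all add: cell_class_def fun_eq_iff cell_ideal_eq cell_algebra_def)

lemma cls_hom: "ring_hom_ring R A cls"
  unfolding cls_eq A_eq by (rule ideal.rcos_ring_hom_ring[OF ideal_ann])

lemma ring_A: "ring A"
  using cls_hom by (rule ring_hom_ring.axioms)

lemma cls_eq_iff:
  assumes "f \<in> carrier R" "g \<in> carrier R"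
  shows "cls f = cls g \<longleftrightarrow> f - g \<in> ann"
  using R.quotient_eq_iff_same_a_r_cos[OF ideal_ann assms] a_inv_R[OF assms(2)]
  by (simp add: cls_eq a_minus_def)

lemma cls_zero: "cls 0 = \<zero>\<^bsub>A\<^esub>"
  using ring_hom_zero[OF ring_hom_ring.homh[OF cls_hom] ring_R ring_A] by simp

lemma cls_mult: "f \<in> carrier R \<Longrightarrow> g \<in> carrier R \<Longrightarrow> cls f \<otimes>\<^bsub>A\<^esub> cls g = cls (path_mult G f g)"
  using ring_hom_ring.homh[OF cls_hom] ring_hom_mult[of cls R A f g] by simp

lemma cls_add: "f \<in> carrier R \<Longrightarrow> g \<in> carrier R \<Longrightarrow> cls f \<oplus>\<^bsub>A\<^esub> cls g = cls (f + g)"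
  using ring_hom_ring.homh[OF cls_hom] ring_hom_add[of cls R A f g] by simp

lemma cls_carrier: "f \<in> carrier R \<Longrightarrow> cls f \<in> carrier A"
  using ring_hom_ring.homh[OF cls_hom] ring_hom_closed[of cls R A f] by simp

text \<open>The complex numbers as a ring record: \<open>cell_scalars\<close> is a subfield because
  it is the homomorphic image of this field in a nonzero ring.\<close>

definition complex_ring :: "complex ring" where
  "complex_ring = \<lparr>carrier = UNIV, monoid.mult = (*), one = 1, zero = 0, add = (+)\<rparr>"

lemma field_complex_ring: "field complex_ring"
proof -
  have "cring complex_ring"
  proof (rule cringI)
    show "abelian_group complex_ring"
    proof (rule abelian_groupI)
      fix x :: complex
      show "\<exists>y\<in>carrier complex_ring. y \<oplus>\<^bsub>complex_ring\<^esub> x = \<zero>\<^bsub>complex_ring\<^esub>"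
        by (rule bexI[of _ "- x"]) (simp_all add: complex_ring_def)
    qed (simp_all add: complex_ring_def)
    show "comm_monoid complex_ring"
      by (rule comm_monoidI) (simp_all add: complex_ring_def)
  qed (simp_all add: complex_ring_def distrib_right)
  then show ?thesis
  proof (rule cring.cring_fieldI2)
    fix a :: complex assume "a \<noteq> \<zero>\<^bsub>complex_ring\<^esub>"
    then show "\<exists>b\<in>carrier complex_ring. a \<otimes>\<^bsub>complex_ring\<^esub> b = \<one>\<^bsub>complex_ring\<^esub>"
      by (intro bexI[of _ "inverse a"]) (simp_all add: complex_ring_def)
  qed (simp add: complex_ring_def)
qed

lemma path_scalar_mult: "path_mult G (path_scalar G z) (path_scalar G z') = path_scalar G (z * z')"
proof -
  have "path_mult G (path_scalar G z) (path_scalar G z') =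
    (\<Sum>v\<in>verts G. path_mult G (path_scalar G z) (Poly_Mapping.single (v, []) z'))"
    unfolding path_scalar_def[of G z'] path_mult_sum_right ..
  also have "\<dots> = path_scalar G (z * z')"
    unfolding path_scalar_def[of G "z * z'"] using scalar_mult_single(1)[OF vertex_path] by (intro sum.cong) auto
  finally show ?thesis .
qed

lemma path_scalar_add: "path_scalar G (z + z') = path_scalar G z + path_scalar G z'"
  by (simp add: path_scalar_def single_add sum.distrib)

text \<open>The function supported on the empty list belongs to \<open>S 0 v v\<close> and pairs to
  1 with the unit, so the unit is outside the ideal.\<close>

lemma one_not_zero_A:
  assumes "verts G \<noteq> {}" shows "\<one>\<^bsub>A\<^esub> \<noteq> \<zero>\<^bsub>A\<^esub>"
proof -
  obtain v where v: "v \<in> verts G" using assms by blast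
  let ?g = "\<lambda>x::'e list. if x = [] then 1 else (0::complex)"
  have g: "?g \<in> S 0 v v" by simp
  have "pair ?g v (path_scalar G 1) = 1"
  proof -
    have "pair ?g v (path_scalar G 1) = (\<Sum>u\<in>verts G. if u = v then 1 else 0)"
      unfolding path_scalar_def pair_sum by (rule sum.cong) auto
    then show ?thesis using v by simp
  qed
  moreover have "pair ?g v (path_scalar G 1) = 0" if "path_scalar G 1 \<in> ann"
    using that v g unfolding ann_def by blast
  ultimately have "path_scalar G 1 \<notin> ann" by auto
  then have "cls (path_scalar G 1) \<noteq> cls 0"
    using cls_eq_iff[OF path_scalar_carrier zero_carrier] by simp
  moreover have "\<one>\<^bsub>A\<^esub> = cls (path_scalar G 1)"
    using ring_hom_one[OF ring_hom_ring.homh[OF cls_hom]] by simp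
  ultimately show ?thesis by (simp add: cls_zero)
qed

lemma subfield_scalars:
  assumes "verts G \<noteq> {}"
  shows "subfield (cell_scalars G W) A"
proof -
  have "ring_hom_ring complex_ring A (\<lambda>z. cls (path_scalar G z))"
  proof (rule ring_hom_ringI2[OF field.is_ring[OF field_complex_ring] ring_A], rule ring_hom_memI)
    show "cls (path_scalar G \<one>\<^bsub>complex_ring\<^esub>) = \<one>\<^bsub>A\<^esub>"
      using ring_hom_one[OF ring_hom_ring.homh[OF cls_hom]] by (simp add: complex_ring_def)
  qed (simp_all add: complex_ring_def cls_carrier path_scalar_carrier cls_mult cls_add path_scalar_mult path_scalar_add)
  from ring_hom_ring.img_is_subfield(2)[OF this field.carrier_is_subfield[OF field_complex_ring] one_not_zero_A[OF assms]]
  show ?thesis by (simp add: cell_scalars_def complex_ring_def)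
qed

definition walk_space :: "nat \<Rightarrow> 'v \<Rightarrow> 'v \<Rightarrow> (('v, 'e) path \<Rightarrow>\<^sub>0 complex) set" where
  "walk_space p i j = {f. Poly_Mapping.keys f \<subseteq> {x \<in> paths G. length (snd x) = p \<and> fst x = i \<and> path_range G x = j}}"

lemma corner_eq:
  assumes i: "i \<in> verts G" and j: "j \<in> verts G"
  shows "cell_corner G W p i j = cls ` walk_space p i j"
proof -
  let ?e = "\<lambda>v. Poly_Mapping.single (v, []) (1::complex)"
  have e: "?e i \<in> carrier R" "?e j \<in> carrier R" using i j by (auto intro: single_carrier vertex_path)
  have cut: "cls (?e i) \<otimes>\<^bsub>A\<^esub> cls f \<otimes>\<^bsub>A\<^esub> cls (?e j) =
      cls (\<Sum>x\<in>Poly_Mapping.keys f. if fst x = i \<and> path_range G x = j then Poly_Mapping.single x (Poly_Mapping.lookup f x) else 0)"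
    if f: "f \<in> carrier R" for f
  proof -
    have "cls (?e i) \<otimes>\<^bsub>A\<^esub> cls f \<otimes>\<^bsub>A\<^esub> cls (?e j) = cls (path_mult G (path_mult G (?e i) f) (?e j))"
      by (simp add: cls_mult e f mult_carrier)
    also have "path_mult G (path_mult G (?e i) f) (?e j) =
      path_mult G (path_mult G (?e i) (\<Sum>x\<in>Poly_Mapping.keys f. Poly_Mapping.single x (Poly_Mapping.lookup f x))) (?e j)"
      by (simp only: poly_mapping_decomp)
    also have "\<dots> = (\<Sum>x\<in>Poly_Mapping.keys f. if fst x = i \<and> path_range G x = j then Poly_Mapping.single x (Poly_Mapping.lookup f x) else 0)"
      unfolding path_mult_sum_right path_mult_sum_left
      by (intro sum.cong refl) (auto simp: path_mult_single)
    finally show ?thesis .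
  qed
  show ?thesis
  proof
    show "cell_corner G W p i j \<subseteq> cls ` walk_space p i j"
    proof
      fix x assume "x \<in> cell_corner G W p i j"
      then obtain f where x: "x = cls (?e i) \<otimes>\<^bsub>A\<^esub> cls f \<otimes>\<^bsub>A\<^esub> cls (?e j)"
        and f: "Poly_Mapping.keys f \<subseteq> {x \<in> paths G. length (snd x) = p}"
        by (auto simp: cell_corner_def cell_graded_def)
      have fR: "f \<in> carrier R" using f by (auto simp: carrier_R)
      have "(\<Sum>x\<in>Poly_Mapping.keys f. if fst x = i \<and> path_range G x = j then Poly_Mapping.single x (Poly_Mapping.lookup f x) else 0)
        \<in> walk_space p i j"
        unfolding walk_space_def mem_Collect_eq
        using f by (intro order_trans[OF keys_sum] UN_least) auto
      then show "x \<in> cls ` walk_space p i j" unfolding x cut[OF fR] by (rule imageI)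
    qed
    show "cls ` walk_space p i j \<subseteq> cell_corner G W p i j"
    proof
      fix x assume "x \<in> cls ` walk_space p i j"
      then obtain f where f: "f \<in> walk_space p i j" and x: "x = cls f" by blast
      have fR: "f \<in> carrier R" using f by (auto simp: walk_space_def carrier_R)
      have "(\<Sum>x\<in>Poly_Mapping.keys f. if fst x = i \<and> path_range G x = j then Poly_Mapping.single x (Poly_Mapping.lookup f x) else 0) =
        (\<Sum>x\<in>Poly_Mapping.keys f. Poly_Mapping.single x (Poly_Mapping.lookup f x))"
        using f by (intro sum.cong) (auto simp: walk_space_def)
      then have "x = cls (?e i) \<otimes>\<^bsub>A\<^esub> cls f \<otimes>\<^bsub>A\<^esub> cls (?e j)"
        using x cut[OF fR] by (simp add: poly_mapping_decomp)
      moreover have "cls f \<in> cell_graded G W p"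
        using f unfolding walk_space_def cell_graded_def by (intro imageI) blast
      ultimately show "x \<in> cell_corner G W p i j" unfolding cell_corner_def by blast
    qed
  qed
qed

text \<open>The classes of the paths in a set \<open>P\<close> of pivots for \<open>S p i j\<close>
  form a basis of the corner. They are independent because the dual functions \<open>g y\<close>
  annihilate the ideal and read off single coefficients; they span because \<open>f\<close> and its
  expansion with coefficients \<open>pair (g y) i f\<close> are not distinguished by any function in
  \<open>S\<close>.\<close>

theorem corner_dim_eq:
  assumes i: "i \<in> verts G" and j: "j \<in> verts G"
  shows "corner_dim G W p i j = arc_dim p i j"
proof -
  interpret A: ring A by (rule ring_A)
  let ?X = "walk_lists p i j"
  let ?K = "cell_scalars G W"
  have K: "subfield ?K A" using i by (intro subfield_scalars) auto
  obtain P g where P: "P \<subseteq> ?X" and ds: "dual_system (S p i j) P g"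
    using ex_dual_system[OF finite_walk_lists subspace_S S_supported_walk[OF j]] by blast
  note d = ds[unfolded dual_system_def]
  obtain xs where xs: "set xs = P" "distinct xs" using finite_distinct_list[of P] d by blast
  define u where "u x = cls (Poly_Mapping.single (i, rev x) 1)" for x
  have sR: "Poly_Mapping.single (i, rev x) c \<in> carrier R" if "x \<in> P" for x c
    using that P by (intro single_carrier) (auto simp: walk_lists_def intro: awalk_paths)
  have comb: "A.combine (map (\<lambda>z. cls (path_scalar G z)) zs) (map u ys) =
      cls (\<Sum>(z, x)\<leftarrow>zip zs ys. Poly_Mapping.single (i, rev x) z) \<and>
      (\<Sum>(z, x)\<leftarrow>zip zs ys. Poly_Mapping.single (i, rev x) z) \<in> carrier R"
    if "set ys \<subseteq> P" for zs ys
    using that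
  proof (induction ys arbitrary: zs)
    case Nil
    then show ?case by (cases zs) (simp_all add: cls_zero zero_carrier)
  next
    case (Cons y ys)
    show ?case
    proof (cases zs)
      case Nil
      then show ?thesis by (simp add: cls_zero zero_carrier)
    next
      case (Cons z zs')
      have y: "y \<in> P" using Cons.prems by simp
      have "path_mult G (path_scalar G z) (Poly_Mapping.single (i, rev y) 1) = Poly_Mapping.single (i, rev y) z"
        using scalar_mult_single(1)[of "(i, rev y)" z 1] sR[OF y, of 1] by (simp add: carrier_R)
      then have "cls (path_scalar G z) \<otimes>\<^bsub>A\<^esub> u y = cls (Poly_Mapping.single (i, rev y) z)"
        unfolding u_def by (simp add: cls_mult path_scalar_carrier sR[OF y])
      then show ?thesis using Cons.IH[of zs'] Cons.prems Cons sR[OF y]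
        by (simp add: cls_add add_carrier)
    qed
  qed
  have scalars: "\<exists>zs. Ks = map (\<lambda>z. cls (path_scalar G z)) zs" if "set Ks \<subseteq> ?K" for Ks
    using that unfolding cell_scalars_def by (induction Ks) (auto simp: Cons_eq_map_conv)
  have uA: "set (map u xs) \<subseteq> carrier A" using sR xs(1) by (auto simp: u_def cls_carrier)
  have gS: "g y \<in> S p i j" "g y x = (if x = y then 1 else 0)" if "y \<in> P" "x \<in> P" for x y
    using d that by auto
  have ind: "A.independent ?K (map u xs)"
  proof (rule A.trivial_combine_imp_independent[OF K uA])
    fix Ks assume "set Ks \<subseteq> ?K" and 0: "A.combine Ks (map u xs) = \<zero>\<^bsub>A\<^esub>"
    then obtain zs where zs: "Ks = map (\<lambda>z. cls (path_scalar G z)) zs" using scalars by blast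
    let ?s = "\<Sum>(z, x)\<leftarrow>zip zs xs. Poly_Mapping.single (i, rev x) z"
    have "cls ?s = cls 0" "?s \<in> carrier R" using 0 comb[of xs zs] xs(1) by (auto simp: zs cls_zero)
    then have "?s \<in> ann" using cls_eq_iff[OF _ zero_carrier] by simp
    \<comment> \<open>Pairing the combination with the dual function of the n-th path isolates the
      n-th coefficient.\<close>
    have z0: "zs ! n = 0" if n: "n < length zs" "n < length xs" for n
    proof -
      let ?y = "xs ! n"
      have y: "?y \<in> P" using xs(1) n by auto
      have "0 = pair (g ?y) i ?s" using \<open>?s \<in> ann\<close> gS(1)[OF y y] i j by (simp add: ann_def)
      also have "\<dots> = (\<Sum>(z, x)\<leftarrow>zip zs xs. g ?y x * z)"
      proof -
        have "pair (g ?y) i (\<Sum>(z, x)\<leftarrow>l. Poly_Mapping.single (i, rev x) z) = (\<Sum>(z, x)\<leftarrow>l. g ?y x * z)" for l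
          by (induction l) (auto simp: pair_add)
        then show ?thesis .
      qed
      also have "\<dots> = (\<Sum>k<min (length zs) (length xs). g ?y (xs ! k) * zs ! k)"
        by (simp add: sum_list_sum_nth atLeast0LessThan)
      also have "\<dots> = (\<Sum>k<min (length zs) (length xs). if k = n then zs ! n else 0)"
        using gS(2)[OF y] xs n by (intro sum.cong) (auto simp: nth_eq_iff_index_eq)
      also have "\<dots> = zs ! n" using n by simp
      finally show ?thesis by simp
    qed
    have "x = \<zero>\<^bsub>A\<^esub>" if x: "x \<in> set (take (length (map u xs)) Ks)" for x
    proof -
      obtain n where n: "n < length zs" "n < length xs" "x = cls (path_scalar G (zs ! n))"
        using x unfolding zs by (auto simp: in_set_conv_nth)
      then show ?thesis using z0[of n] cls_zero by (simp add: path_scalar_def)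
    qed
    then show "set (take (length (map u xs)) Ks) \<subseteq> {\<zero>\<^bsub>A\<^esub>}" by blast
  qed
  have span: "A.Span ?K (map u xs) = cell_corner G W p i j"
    unfolding A.Span_eq_combine_set_length_version[OF K uA] corner_eq[OF i j]
  proof
    show "{A.combine Ks (map u xs) |Ks. length Ks = length (map u xs) \<and> set Ks \<subseteq> ?K} \<subseteq> cls ` walk_space p i j"
    proof
      fix x assume "x \<in> {A.combine Ks (map u xs) |Ks. length Ks = length (map u xs) \<and> set Ks \<subseteq> ?K}"
      then obtain zs where "x = A.combine (map (\<lambda>z. cls (path_scalar G z)) zs) (map u xs)" using scalars by blast
      then have "x = cls (\<Sum>(z, x)\<leftarrow>zip zs xs. Poly_Mapping.single (i, rev x) z)" using comb[of xs zs] xs(1) by simp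
      moreover have ws: "(\<Sum>(z, x)\<leftarrow>l. Poly_Mapping.single (i, rev x) z) \<in> walk_space p i j" if "snd ` set l \<subseteq> P" for l
        using that
      proof (induction l)
        case (Cons a l)
        then have "snd a \<in> walk_lists p i j" using P by auto
        then have "Poly_Mapping.keys (Poly_Mapping.single (i, rev (snd a)) (fst a)) \<subseteq>
            {x \<in> paths G. length (snd x) = p \<and> fst x = i \<and> path_range G x = j}"
          using awalk_path_range[of i "rev (snd a)" j] by (auto simp: walk_lists_def intro: awalk_paths)
        then show ?case
          using Cons keys_add[of "Poly_Mapping.single (i, rev (snd a)) (fst a)" "\<Sum>(z, x)\<leftarrow>l. Poly_Mapping.single (i, rev x) z"]
          by (simp add: walk_space_def case_prod_unfold) blast
      qed (simp add: walk_space_def)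
      have "snd ` set (zip zs xs) \<subseteq> P" using xs(1) by (auto dest: set_zip_rightD)
      then have "(\<Sum>(z, x)\<leftarrow>zip zs xs. Poly_Mapping.single (i, rev x) z) \<in> walk_space p i j"
        by (rule ws)
      ultimately show "x \<in> cls ` walk_space p i j" by blast
    qed
    show "cls ` walk_space p i j \<subseteq> {A.combine Ks (map u xs) |Ks. length Ks = length (map u xs) \<and> set Ks \<subseteq> ?K}"
    proof
      fix x assume "x \<in> cls ` walk_space p i j"
      then obtain f where f: "f \<in> walk_space p i j" and x: "x = cls f" by blast
      have fR: "f \<in> carrier R" using f by (auto simp: walk_space_def carrier_R)
      define zs where "zs = map (\<lambda>y. pair (g y) i f) xs"
      let ?s = "\<Sum>(z, x)\<leftarrow>zip zs xs. Poly_Mapping.single (i, rev x) z"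
      have s: "?s = (\<Sum>y\<in>P. Poly_Mapping.single (i, rev y) (pair (g y) i f))"
      proof -
        have "zip zs xs = map (\<lambda>y. (pair (g y) i f, y)) xs"
          unfolding zs_def by (induction xs) auto
        then have "?s = sum_list (map (\<lambda>y. Poly_Mapping.single (i, rev y) (pair (g y) i f)) xs)"
          by (simp add: o_def)
        then show ?thesis using xs by (simp add: sum_list_distinct_conv_sum_set)
      qed
      have sR': "?s \<in> carrier R" using comb[of xs zs] xs(1) by simp
      have "f - ?s \<in> ann"
      proof -
        have c: "f - ?s \<in> carrier R" using add_carrier[OF fR uminus_carrier[OF sR']] by simp
        have "pair v i' (f - ?s) = 0" if i': "i' \<in> verts G" "j' \<in> verts G" and v: "v \<in> S p' i' j'" for v p' i' j'
        proof -
          have fs: "f - ?s \<in> walk_space p i j"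
          proof -
            have "Poly_Mapping.keys ?s \<subseteq> {x \<in> paths G. length (snd x) = p \<and> fst x = i \<and> path_range G x = j}"
              unfolding s
            proof (intro order_trans[OF keys_sum] UN_least)
              fix y assume "y \<in> P"
              then have "y \<in> walk_lists p i j" using P by blast
              then show "Poly_Mapping.keys (Poly_Mapping.single (i, rev y) (pair (g y) i f)) \<subseteq>
                {x \<in> paths G. length (snd x) = p \<and> fst x = i \<and> path_range G x = j}"
                using awalk_path_range[of i "rev y" j] by (auto simp: walk_lists_def intro: awalk_paths)
            qed
            then show ?thesis using f keys_diff[of f ?s] unfolding walk_space_def by blast
          qed
          show ?thesis
          \<comment> \<open>Test functions of the same corner and degree are expanded in the dual
            basis; all others are supported on different paths.\<close>
          proof (cases "i' = i \<and> j' = j \<and> p' = p")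
            case True
            then have vS: "v \<in> S p i j" using v by simp
            have vz: "v z = (\<Sum>y\<in>P. v y * g y z)" for z using d vS by blast
            have "pair v i f = (\<Sum>y\<in>P. v y * pair (g y) i f)"
            proof -
              have "pair v i f = (\<Sum>z\<in>?X. v z * Poly_Mapping.lookup f (i, rev z))"
                by (rule pair_supported[OF finite_walk_lists subsetD[OF S_supported_walk[OF j] vS]])
              also have "\<dots> = (\<Sum>z\<in>?X. \<Sum>y\<in>P. v y * (g y z * Poly_Mapping.lookup f (i, rev z)))"
              proof (rule sum.cong[OF refl])
                fix z
                have "v z * Poly_Mapping.lookup f (i, rev z) = (\<Sum>y\<in>P. v y * g y z) * Poly_Mapping.lookup f (i, rev z)"
                  using vz[of z] by (rule arg_cong)
                then show "v z * Poly_Mapping.lookup f (i, rev z) = (\<Sum>y\<in>P. v y * (g y z * Poly_Mapping.lookup f (i, rev z)))"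
                  by (simp only: sum_distrib_right mult.assoc)
              qed
              also have "\<dots> = (\<Sum>y\<in>P. \<Sum>z\<in>?X. v y * (g y z * Poly_Mapping.lookup f (i, rev z)))"
                by (rule sum.swap)
              also have "\<dots> = (\<Sum>y\<in>P. v y * pair (g y) i f)"
              proof (rule sum.cong[OF refl])
                fix y assume "y \<in> P"
                then have "g y \<in> supported_on ?X" using gS(1) S_supported_walk[OF j] by blast
                then show "(\<Sum>z\<in>?X. v y * (g y z * Poly_Mapping.lookup f (i, rev z))) = v y * pair (g y) i f"
                  by (simp add: pair_supported[OF finite_walk_lists] sum_distrib_left)
              qed
              finally show ?thesis .
            qed
            moreover have "pair v i ?s = (\<Sum>y\<in>P. v y * pair (g y) i f)"
              unfolding s pair_sum by simp
            ultimately show ?thesis using True pair_add[of v i f "- ?s"] by (simp add: pair_minus)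
          next
            case False
            show ?thesis unfolding pair_def
            proof (rule sum.neutral, rule ballI)
              fix x assume "x \<in> Poly_Mapping.keys (f - ?s)"
              then have x: "x \<in> paths G" "length (snd x) = p" "fst x = i" "path_range G x = j"
                using fs unfolding walk_space_def by blast+
              have "v (rev (snd x)) = 0" if "fst x = i'"
              proof (rule ccontr)
                assume "v (rev (snd x)) \<noteq> 0"
                then have "length (snd x) = p'" "awalk i' (snd x) j'" using S_awalk[OF v _ i'(2)] by fastforce+
                moreover then have "path_range G (i', snd x) = j'" by (intro awalk_path_range)
                ultimately show False using False x that by (cases x) auto
              qed
              then show "(if fst x = i' then v (rev (snd x)) * Poly_Mapping.lookup (f - ?s) x else 0) = 0" by simp
            qed
          qed
        qed
        then show ?thesis using c by (simp add: ann_def)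
      qed
      then have "x = cls ?s" using cls_eq_iff[OF fR sR'] x by simp
      then have "x = A.combine (map (\<lambda>z. cls (path_scalar G z)) zs) (map u xs)" using comb[of xs zs] xs(1) by simp
      moreover have "set (map (\<lambda>z. cls (path_scalar G z)) zs) \<subseteq> ?K" by (auto simp: cell_scalars_def)
      ultimately show "x \<in> {A.combine Ks (map u xs) |Ks. length Ks = length (map u xs) \<and> set Ks \<subseteq> ?K}"
        by (intro CollectI exI[of _ "map (\<lambda>z. cls (path_scalar G z)) zs"]) (simp add: zs_def)
    qed
  qed
  have "A.dimension (length (map u xs)) ?K (cell_corner G W p i j)"
    using A.dimension_independent[OF ind] unfolding span .
  then have "corner_dim G W p i j = length xs"
    using A.dimI[OF K] by (simp add: corner_dim_def over_def)
  also have "\<dots> = card P" using xs distinct_card by metis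
  finally show ?thesis using dual_system_dim[OF ds] by (simp add: arc_dim_def)
qed

end

section \<open>Matrices of power series\<close>

text \<open>The determinant of \<open>D\<close> has constant coefficient 1 and is therefore a unit
  among the power series, so the adjugate gives the inverse. Commutation moves this inverse to the
  right of \<open>N\<close>.\<close>

lemma is_mat_quotientI:
  fixes D :: "int fps mat"
  assumes D: "D \<in> carrier_mat n n" and N: "N \<in> carrier_mat n n" and H: "H \<in> carrier_mat n n"
    and D0: "map_mat (\<lambda>f. fps_nth f 0) D = 1\<^sub>m n"
    and DH: "D * H = N" and comm: "N * D = D * N"
  shows "is_mat_quotient H N D"
proof -
  interpret const: comm_ring_hom "\<lambda>f :: int fps. fps_nth f 0"
    by unfold_locales auto
  have "fps_nth (det D) 0 = 1"
    using const.hom_det[of D] unfolding D0 by simp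
  then obtain u where u: "u * det D = 1"
    using fps_left_inverse[of 1 "det D"] by auto
  define D' where "D' = u \<cdot>\<^sub>m adj_mat D"
  note adj = adj_mat[OF D]
  have D': "D' \<in> carrier_mat n n" using adj(1) by (simp add: D'_def)
  have u1: "u \<cdot>\<^sub>m (det D \<cdot>\<^sub>m 1\<^sub>m n) = 1\<^sub>m n"
    by (rule eq_matI) (auto simp: u)
  have 1: "D * D' = 1\<^sub>m n"
    using u1 adj by (simp add: D'_def mult_smult_distrib[OF D adj(1)])
  have 2: "D' * D = 1\<^sub>m n"
    using u1 adj by (simp add: D'_def mult_smult_assoc_mat[OF adj(1) D])
  have "H = 1\<^sub>m n * H" using H by simp
  also have "\<dots> = D' * (D * H)" unfolding 2[symmetric] by (rule assoc_mult_mat[OF D' D H])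
  also have "\<dots> = D' * N" unfolding DH ..
  also have "\<dots> = D' * (N * (D * D'))" unfolding 1 using N by simp
  also have "\<dots> = D' * ((N * D) * D')" using assoc_mult_mat[OF N D D'] by simp
  also have "\<dots> = D' * (D * (N * D'))" unfolding comm using assoc_mult_mat[OF D N D'] by simp
  also have "\<dots> = (D' * D) * (N * D')" using assoc_mult_mat[OF D' D, of "N * D'" n] N D' by simp
  also have "\<dots> = N * D'" unfolding 2 using N D' by simp
  finally have "H = N * D'" .
  then show ?thesis
    unfolding is_mat_quotient_def inverts_mat_def using 1 2 comm D D' by auto
qed

lemma vertex_mat_carrier [simp]: "vertex_mat vs f \<in> carrier_mat (length vs) (length vs)"
  by (simp add: vertex_mat_def)

lemma sum_nth_distinct:
  assumes "distinct vs"
  shows "(\<Sum>k\<in>{0..<length vs}. f (vs ! k)) = (\<Sum>u\<in>set vs. f u)"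
  using sum_list_distinct_conv_sum_set[OF assms, of f] by (simp add: sum_list_sum_nth)

lemma vertex_mat_mult:
  assumes "distinct vs"
  shows "vertex_mat vs f * vertex_mat vs g = vertex_mat vs (\<lambda>i j. \<Sum>u\<in>set vs. f i u * g u j)"
  by (rule eq_matI) (auto simp: vertex_mat_def scalar_prod_def sum_nth_distinct[OF assms, symmetric])

lemma vertex_mat_one:
  assumes "distinct vs"
  shows "1\<^sub>m (length vs) = vertex_mat vs (\<lambda>i j. if i = j then 1 else 0)"
  by (rule eq_matI) (auto simp: vertex_mat_def nth_eq_iff_index_eq[OF assms])

lemma vertex_mat_smult: "c \<cdot>\<^sub>m vertex_mat vs f = vertex_mat vs (\<lambda>i j. c * f i j)"
  by (rule eq_matI) (auto simp: vertex_mat_def)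

lemma vertex_mat_add: "vertex_mat vs f + vertex_mat vs g = vertex_mat vs (\<lambda>i j. f i j + g i j)"
  by (rule eq_matI) (auto simp: vertex_mat_def)

lemma vertex_mat_minus: "vertex_mat vs f - vertex_mat vs g = vertex_mat vs (\<lambda>i j. f i j - g i j)"
  by (rule eq_matI) (auto simp: vertex_mat_def)

lemma vertex_mat_transpose: "transpose_mat (vertex_mat vs f) = vertex_mat vs (\<lambda>i j. f j i)"
  by (rule eq_matI) (auto simp: vertex_mat_def)

lemma vertex_mat_cong:
  "(\<And>i j. i \<in> set vs \<Longrightarrow> j \<in> set vs \<Longrightarrow> f i j = g i j) \<Longrightarrow> vertex_mat vs f = vertex_mat vs g"
  by (rule eq_matI) (auto simp: vertex_mat_def)

text \<open>Row \<open>i\<close> has its entry in column \<open>\<sigma> i\<close>, so the left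
  factor acts first and the composition appears in reverse.\<close>

lemma perm_mat_mult:
  assumes "distinct vs" "\<sigma> ` set vs \<subseteq> set vs"
  shows "perm_mat vs \<sigma> * perm_mat vs \<tau> = perm_mat vs (\<tau> \<circ> \<sigma>)"
  unfolding perm_mat_def vertex_mat_mult[OF assms(1)]
proof (rule vertex_mat_cong)
  fix i j assume i: "i \<in> set vs"
  have "(\<Sum>u\<in>set vs. (if u = \<sigma> i then 1 else 0) * (if j = \<tau> u then 1 else 0)) =
    (\<Sum>u\<in>set vs. if u = \<sigma> i then (if j = \<tau> (\<sigma> i) then 1 else 0) else (0 :: int fps))"
    by (rule sum.cong) auto
  also have "\<dots> = (if j = (\<tau> \<circ> \<sigma>) i then 1 else 0)"
    using i assms(2) by auto
  finally show "(\<Sum>u\<in>set vs. (if u = \<sigma> i then 1 else 0) * (if j = \<tau> u then 1 else 0)) =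
    (if j = (\<tau> \<circ> \<sigma>) i then 1 else (0 :: int fps))" .
qed

lemma perm_mat_id:
  assumes "distinct vs" "\<And>v. v \<in> set vs \<Longrightarrow> \<sigma> v = v"
  shows "perm_mat vs \<sigma> = 1\<^sub>m (length vs)"
  unfolding perm_mat_def vertex_mat_one[OF assms(1)] by (rule vertex_mat_cong) (auto simp: assms(2))

lemma perm_mat_pow:
  assumes "distinct vs" "\<sigma> ` set vs \<subseteq> set vs"
  shows "perm_mat vs \<sigma> ^\<^sub>m k = perm_mat vs (\<sigma> ^^ k)"
proof (induction k)
  case 0
  then show ?case using perm_mat_id[OF assms(1), of "\<sigma> ^^ 0"] by (simp add: perm_mat_def vertex_mat_def)
next
  case (Suc k)
  have "(\<sigma> ^^ k) ` set vs \<subseteq> set vs"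
    by (induction k) (use assms(2) in auto)
  then show ?case using perm_mat_mult[OF assms(1), of "\<sigma> ^^ k" \<sigma>] by (simp add: Suc o_def)
qed

text \<open>The recursion says that the product of denominator and series has no coefficients in
  degrees 1 to \<open>h - 1\<close>. Row \<open>j\<close> and column \<open>i\<close> belong to
  paths from \<open>i\<close> to \<open>j\<close>, which is why \<open>top\<close> asks for the
  entry 1 at \<open>i = \<sigma> j\<close>: in this convention it is
  \<open>perm_mat vs \<sigma>\<close>.\<close>

lemma hilbert_quotient:
  fixes G :: "('v, 'e) pre_digraph" and vs :: "'v list" and h :: nat
  assumes vs: "distinct vs" "set vs = verts G" and h: "h \<ge> 4"
    and d0: "\<And>i j. i \<in> verts G \<Longrightarrow> j \<in> verts G \<Longrightarrow> corner_dim G W 0 i j = (if i = j then 1 else 0)"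
    and d1: "\<And>i j. i \<in> verts G \<Longrightarrow> j \<in> verts G \<Longrightarrow> int (corner_dim G W 1 i j) =
      (\<Sum>u\<in>verts G. int (num_arcs G u j) * int (corner_dim G W 0 i u))"
    and rec: "\<And>i j q. i \<in> verts G \<Longrightarrow> j \<in> verts G \<Longrightarrow> q + 2 < h \<Longrightarrow> int (corner_dim G W (q + 2) i j) =
      (\<Sum>u\<in>verts G. int (num_arcs G u j) * int (corner_dim G W (q + 1) i u)) -
      (\<Sum>u\<in>verts G. int (num_arcs G j u) * int (corner_dim G W q i u)) +
      (if q = 0 then 0 else int (corner_dim G W (q - 1) i j))"
    and van: "\<And>i j p. i \<in> verts G \<Longrightarrow> j \<in> verts G \<Longrightarrow> h - 2 \<le> p \<Longrightarrow> corner_dim G W p i j = 0"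
    and top: "\<And>i j. i \<in> verts G \<Longrightarrow> j \<in> verts G \<Longrightarrow> corner_dim G W (h - 3) i j = (if i = \<sigma> j then 1 else 0)"
    and \<sigma>: "z3_symmetry G \<sigma>"
  shows "is_mat_quotient (hilbert_series G W vs)
      (1\<^sub>m (length vs) - fps_X ^ h \<cdot>\<^sub>m perm_mat vs \<sigma>)
      (1\<^sub>m (length vs) - fps_X \<cdot>\<^sub>m adjacency_mat G vs
         + fps_X ^ 2 \<cdot>\<^sub>m transpose_mat (adjacency_mat G vs)
         - fps_X ^ 3 \<cdot>\<^sub>m 1\<^sub>m (length vs))"
proof -
  define \<delta> where "\<delta> i j = (if i = j then 1 else 0 :: int fps)" for i j :: 'v
  define num where "num i j = (of_nat (num_arcs G i j) :: int fps)" for i j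
  define D where "D j i = \<delta> j i - fps_X * num i j + fps_X ^ 2 * num j i - fps_X ^ 3 * \<delta> j i" for i j
  define N where "N j i = \<delta> j i - fps_X ^ h * \<delta> i (\<sigma> j)" for i j
  define H where "H j i = Abs_fps (\<lambda>p. int (corner_dim G W p i j))" for i j
  have bij: "bij_betw \<sigma> (verts G) (verts G)"
    and num\<sigma>: "\<And>u v. u \<in> verts G \<Longrightarrow> v \<in> verts G \<Longrightarrow> num (\<sigma> u) (\<sigma> v) = num u v"
    using \<sigma> by (auto simp: z3_symmetry_def num_def)
  have \<sigma>V: "\<sigma> u \<in> verts G" if "u \<in> verts G" for u using bij that by (auto simp: bij_betw_def)
  have \<sigma>inj: "\<sigma> u = \<sigma> v \<longleftrightarrow> u = v" if "u \<in> verts G" "v \<in> verts G" for u v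
    using bij that by (auto simp: bij_betw_def inj_on_def)
  have fin: "finite (verts G)" using vs(2)[symmetric] by simp
  have Deq: "1\<^sub>m (length vs) - fps_X \<cdot>\<^sub>m adjacency_mat G vs
         + fps_X ^ 2 \<cdot>\<^sub>m transpose_mat (adjacency_mat G vs)
         - fps_X ^ 3 \<cdot>\<^sub>m 1\<^sub>m (length vs) = vertex_mat vs D"
    unfolding adjacency_mat_def vertex_mat_one[OF vs(1)] vertex_mat_transpose vertex_mat_smult
      vertex_mat_minus vertex_mat_add
    by (rule vertex_mat_cong) (simp add: D_def \<delta>_def num_def)
  have Neq: "1\<^sub>m (length vs) - fps_X ^ h \<cdot>\<^sub>m perm_mat vs \<sigma> = vertex_mat vs N"
    unfolding perm_mat_def vertex_mat_one[OF vs(1)] vertex_mat_smult vertex_mat_minus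
    by (rule vertex_mat_cong) (simp add: N_def \<delta>_def)
  have Heq: "hilbert_series G W vs = vertex_mat vs H"
    by (simp add: hilbert_series_def H_def[abs_def])
  have \<delta>l: "(\<Sum>u\<in>verts G. \<delta> i u * f u) = f i" if "i \<in> verts G" for i and f :: "'v \<Rightarrow> int fps"
  proof -
    have "(\<Sum>u\<in>verts G. \<delta> i u * f u) = (\<Sum>u\<in>verts G. if u = i then f i else 0)"
      by (rule sum.cong) (auto simp: \<delta>_def)
    then show ?thesis using that fin by simp
  qed
  have "vertex_mat vs D * vertex_mat vs H = vertex_mat vs N"
    unfolding vertex_mat_mult[OF vs(1)] vs(2)
  proof (rule vertex_mat_cong, unfold vs(2))
    fix j i assume j: "j \<in> verts G" and i: "i \<in> verts G"
    let ?c = "\<lambda>p u. int (corner_dim G W p i u)"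
    let ?L = "\<lambda>p. \<Sum>u\<in>verts G. int (num_arcs G u j) * ?c p u"
    let ?L' = "\<lambda>p. \<Sum>u\<in>verts G. int (num_arcs G j u) * ?c p u"
    have "(\<Sum>u\<in>verts G. D j u * H u i) = H j i - fps_X * (\<Sum>u\<in>verts G. num u j * H u i) +
      fps_X ^ 2 * (\<Sum>u\<in>verts G. num j u * H u i) - fps_X ^ 3 * H j i"
    proof -
      have "(\<Sum>u\<in>verts G. D j u * H u i) = (\<Sum>u\<in>verts G. \<delta> j u * H u i - fps_X * (num u j * H u i) +
        fps_X ^ 2 * (num j u * H u i) - fps_X ^ 3 * (\<delta> j u * H u i))"
        by (rule sum.cong) (simp_all add: D_def algebra_simps)
      then show ?thesis
        by (simp only: sum_subtractf sum.distrib sum_distrib_left[symmetric] \<delta>l[OF j])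
    qed
    also have "\<dots> = N j i"
    proof (rule fps_ext)
      fix n
      have L: "fps_nth (\<Sum>u\<in>verts G. num u j * H u i) p = ?L p" for p
        by (simp add: fps_sum_nth num_def H_def fps_of_nat[symmetric])
      have L': "fps_nth (\<Sum>u\<in>verts G. num j u * H u i) p = ?L' p" for p
        by (simp add: fps_sum_nth num_def H_def fps_of_nat[symmetric])
      have l: "fps_nth (H j i - fps_X * (\<Sum>u\<in>verts G. num u j * H u i) +
        fps_X ^ 2 * (\<Sum>u\<in>verts G. num j u * H u i) - fps_X ^ 3 * H j i) n =
        ?c n j - (if n < 1 then 0 else ?L (n - 1)) + (if n < 2 then 0 else ?L' (n - 2)) - (if n < 3 then 0 else ?c (n - 3) j)"
        unfolding fps_sub_nth fps_add_nth fps_X_power_mult_nth fps_X_mult_nth L L' by (simp add: H_def)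
      have r: "fps_nth (N j i) n = (if n = 0 then (if i = j then 1 else 0) else if n = h then - (if i = \<sigma> j then 1 else 0) else 0)"
        using h by (auto simp: N_def \<delta>_def fps_X_power_mult_nth)
      have z: "?L p = 0" "?L' p = 0" "?c p j = 0" if "h - 2 \<le> p" for p
        using van[OF i _ that] j by simp_all
      consider "n = 0" | "n = 1" | q where "n = q + 2" "n < h" | "n = h" | "n > h"
        by (metis One_nat_def add_2_eq_Suc' nat_neq_iff not0_implies_Suc)
      then show "fps_nth (H j i - fps_X * (\<Sum>u\<in>verts G. num u j * H u i) +
        fps_X ^ 2 * (\<Sum>u\<in>verts G. num j u * H u i) - fps_X ^ 3 * H j i) n = fps_nth (N j i) n"
        unfolding l r
      proof cases
        case 1
        then show "?c n j - (if n < 1 then 0 else ?L (n - 1)) + (if n < 2 then 0 else ?L' (n - 2)) - (if n < 3 then 0 else ?c (n - 3) j) =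
          (if n = 0 then (if i = j then 1 else 0) else if n = h then - (if i = \<sigma> j then 1 else 0) else 0)"
          using d0[OF i j] by simp
      next
        case 2
        then show "?c n j - (if n < 1 then 0 else ?L (n - 1)) + (if n < 2 then 0 else ?L' (n - 2)) - (if n < 3 then 0 else ?c (n - 3) j) =
          (if n = 0 then (if i = j then 1 else 0) else if n = h then - (if i = \<sigma> j then 1 else 0) else 0)"
          using d1[OF i j] h by simp
      next
        case (3 q)
        have q: "q + 2 < h" using 3 by simp
        have "?c n j = ?L (n - 1) - ?L' (n - 2) + (if n < 3 then 0 else ?c (n - 3) j)"
          using rec[OF i j q] 3(1) by (cases q) (simp_all add: numeral_3_eq_3)
        then show "?c n j - (if n < 1 then 0 else ?L (n - 1)) + (if n < 2 then 0 else ?L' (n - 2)) - (if n < 3 then 0 else ?c (n - 3) j) =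
          (if n = 0 then (if i = j then 1 else 0) else if n = h then - (if i = \<sigma> j then 1 else 0) else 0)"
          using 3 by simp
      next
        \<comment> \<open>In degree \<open>h\<close> the dimensions of degrees \<open>h\<close>,
          \<open>h - 1\<close> and \<open>h - 2\<close> are zero, and only minus the dimension of
          degree \<open>h - 3\<close> is left.\<close>
        case 4
        then show "?c n j - (if n < 1 then 0 else ?L (n - 1)) + (if n < 2 then 0 else ?L' (n - 2)) - (if n < 3 then 0 else ?c (n - 3) j) =
          (if n = 0 then (if i = j then 1 else 0) else if n = h then - (if i = \<sigma> j then 1 else 0) else 0)"
          using h z(1)[of "n - 1"] z(2)[of "n - 2"] z(3)[of n] top[OF i j] by simp
      next
        case 5
        then show "?c n j - (if n < 1 then 0 else ?L (n - 1)) + (if n < 2 then 0 else ?L' (n - 2)) - (if n < 3 then 0 else ?c (n - 3) j) =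
          (if n = 0 then (if i = j then 1 else 0) else if n = h then - (if i = \<sigma> j then 1 else 0) else 0)"
          using h z(1)[of "n - 1"] z(2)[of "n - 2"] z(3)[of n] z(3)[of "n - 3"] by simp
      qed
    qed
    finally show "(\<Sum>u\<in>verts G. D j u * H u i) = N j i" .
  qed
  moreover have "vertex_mat vs N * vertex_mat vs D = vertex_mat vs D * vertex_mat vs N"
    unfolding vertex_mat_mult[OF vs(1)] vs(2)
  proof (rule vertex_mat_cong, unfold vs(2))
    fix j i assume j: "j \<in> verts G" and i: "i \<in> verts G"
    \<comment> \<open>Numerator and denominator commute because \<open>D\<close> is invariant under
      the automorphism: both products come out as \<open>D j i - fps_X ^ h * D j k\<close>.\<close>
    obtain k where k: "k \<in> verts G" "i = \<sigma> k" using bij i by (auto simp: bij_betw_def)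
    have D\<sigma>: "D (\<sigma> u) (\<sigma> v) = D u v" if "u \<in> verts G" "v \<in> verts G" for u v
      using that by (simp add: D_def num\<sigma> \<delta>_def \<sigma>inj)
    have \<delta>sym: "\<delta> u v = \<delta> v u" for u v by (simp add: \<delta>_def)
    have "(\<Sum>u\<in>verts G. N j u * D u i) = (\<Sum>u\<in>verts G. \<delta> j u * D u i - fps_X ^ h * (\<delta> (\<sigma> j) u * D u i))"
      by (rule sum.cong) (simp_all add: N_def \<delta>sym[of "\<sigma> j"] algebra_simps)
    also have "\<dots> = D j i - fps_X ^ h * D (\<sigma> j) i"
      by (simp only: sum_subtractf sum_distrib_left[symmetric] \<delta>l[OF j] \<delta>l[OF \<sigma>V[OF j]])
    finally have 1: "(\<Sum>u\<in>verts G. N j u * D u i) = D j i - fps_X ^ h * D j k"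
      unfolding k(2) D\<sigma>[OF j k(1)] .
    have "(\<Sum>u\<in>verts G. D j u * N u i) = (\<Sum>u\<in>verts G. \<delta> i u * D j u - fps_X ^ h * (\<delta> k u * D j u))"
      using k by (intro sum.cong) (auto simp: N_def \<delta>_def \<sigma>inj algebra_simps)
    also have "\<dots> = D j i - fps_X ^ h * D j k"
      by (simp only: sum_subtractf sum_distrib_left[symmetric] \<delta>l[OF i] \<delta>l[OF k(1)])
    finally show "(\<Sum>u\<in>verts G. N j u * D u i) = (\<Sum>u\<in>verts G. D j u * N u i)" using 1 by simp
  qed
  moreover have "map_mat (\<lambda>f. fps_nth f 0) (vertex_mat vs D) = 1\<^sub>m (length vs)"
    by (rule eq_matI) (auto simp: vertex_mat_def D_def \<delta>_def nth_eq_iff_index_eq[OF vs(1)])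
  ultimately show ?thesis
    unfolding Deq Neq Heq by (intro is_mat_quotientI[of _ "length vs"]) simp_all
qed

section \<open>The recursion for the dimensions\<close>

definition unit :: "'v \<Rightarrow> 'v \<Rightarrow> int" where
  "unit i = (\<lambda>j. if j = i then 1 else 0)"

definition push :: "'v set \<Rightarrow> ('v \<Rightarrow> 'v \<Rightarrow> nat) \<Rightarrow> ('v \<Rightarrow> int) \<Rightarrow> 'v \<Rightarrow> int" where
  "push V m x = (\<lambda>j. if j \<in> V then \<Sum>u\<in>V. int (m u j) * x u else 0)"

abbreviation pull :: "'v set \<Rightarrow> ('v \<Rightarrow> 'v \<Rightarrow> nat) \<Rightarrow> ('v \<Rightarrow> int) \<Rightarrow> 'v \<Rightarrow> int" where
  "pull V m \<equiv> push V (\<lambda>u v. m v u)"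

lemma push_add: "push V m (x + y) = push V m x + push V m y"
  by (rule ext) (auto simp: push_def distrib_left sum.distrib)

lemma push_diff: "push V m (x - y) = push V m x - push V m y"
  by (rule ext) (auto simp: push_def right_diff_distrib sum_subtractf)

lemma push_minus: "push V m (- x) = - push V m x"
  using push_diff[of V m 0 x] push_diff[of V m 0 0] by simp

lemma push_0 [simp]: "push V m 0 = 0"
  using push_diff[of V m 0 0] by simp

lemma push_unit: "finite V \<Longrightarrow> i \<in> V \<Longrightarrow> push V m (unit i) = (\<lambda>j. if j \<in> V then int (m i j) else 0)"
proof (rule ext)
  fix j assume V: "finite V" "i \<in> V"
  have "(\<Sum>u\<in>V. int (m u j) * unit i u) = (\<Sum>u\<in>V. if u = i then int (m i j) else 0)"
    by (rule sum.cong) (auto simp: unit_def)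
  then show "push V m (unit i) j = (if j \<in> V then int (m i j) else 0)"
    using V by (simp add: push_def)
qed

text \<open>The coefficients of \<open>(1 - \<Delta> t + \<Delta>\<^sup>T t\<^sup>2 - t\<^sup>3)\<^sup>-\<^sup>1\<close>, computed from three consecutive ones.\<close>

primrec hop :: "(('v \<Rightarrow> int) \<Rightarrow> 'v \<Rightarrow> int) \<Rightarrow> (('v \<Rightarrow> int) \<Rightarrow> 'v \<Rightarrow> int) \<Rightarrow> nat \<Rightarrow>
    ('v \<Rightarrow> int) \<Rightarrow> ('v \<Rightarrow> int) \<Rightarrow> ('v \<Rightarrow> int) \<Rightarrow> 'v \<Rightarrow> int" where
  "hop L L' 0 a b c = c"
| "hop L L' (Suc p) a b c = hop L L' p b c (L c - L' b + a)"

text \<open>The means of transport between graphs: it is applied to relabellings, to the map from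
  functions on D to functions on A, and to \<open>push\<close> and \<open>pull\<close> themselves
  when these commute.\<close>

lemma hop_intertwine:
  assumes "\<And>x y. \<Theta> (x + y) = \<Theta> x + \<Theta> y" "\<And>x y. \<Theta> (x - y) = \<Theta> x - \<Theta> y"
    and "\<And>x. \<Theta> (L1 x) = L2 (\<Theta> x)" "\<And>x. \<Theta> (L1' x) = L2' (\<Theta> x)"
  shows "hop L2 L2' p (\<Theta> a) (\<Theta> b) (\<Theta> c) = \<Theta> (hop L1 L1' p a b c)"
  by (induction p arbitrary: a b c) (simp_all add: assms[symmetric])

text \<open>A guessed sequence is checked against the recursion term by term; the seeds are its
  first three members.\<close>

lemma hop_sequence:
  assumes "\<And>k. k < p \<Longrightarrow> L (f (k + 2)) - L' (f (k + 1)) + f k = f (k + 3)"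
  shows "hop L L' p (f 0) (f 1) (f 2) = f (p + 2)"
proof -
  have "hop L L' q (f k) (f (k + 1)) (f (k + 2)) = f (k + q + 2)" if "k + q \<le> p" for q k
    using that
  proof (induction q arbitrary: k)
    case (Suc q)
    have "L (f (k + 2)) - L' (f (k + 1)) + f k = f (k + 1 + 2)"
      using assms[of k] Suc.prems by (simp add: numeral_3_eq_3)
    then show ?case using Suc.IH[of "k + 1"] Suc.prems by (simp add: add.assoc)
  qed simp
  from this[of 0 p] show ?thesis by (simp only: add_0 order_refl)
qed

lemma hop_additive:
  assumes L: "\<And>x y. L (x + y) = L x + L y" "\<And>x y. L (x - y) = L x - L y"
    and L': "\<And>x y. L' (x + y) = L' x + L' y" "\<And>x y. L' (x - y) = L' x - L' y"
  shows "hop L L' p (a + a') (b + b') (c + c') = hop L L' p a b c + hop L L' p a' b' c'"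
    and "hop L L' p (a - a') (b - b') (c - c') = hop L L' p a b c - hop L L' p a' b' c'"
proof -
  show "hop L L' p (a + a') (b + b') (c + c') = hop L L' p a b c + hop L L' p a' b' c'"
  proof (induction p arbitrary: a a' b b' c c')
    case (Suc p)
    have "L (c + c') - L' (b + b') + (a + a') = (L c - L' b + a) + (L c' - L' b' + a')"
      by (simp add: L L')
    then show ?case by (simp only: hop.simps Suc)
  qed simp
  show "hop L L' p (a - a') (b - b') (c - c') = hop L L' p a b c - hop L L' p a' b' c'"
  proof (induction p arbitrary: a a' b b' c c')
    case (Suc p)
    have "L (c - c') - L' (b - b') + (a - a') = (L c - L' b + a) - (L c' - L' b' + a')"
      by (simp add: L L')
    then show ?case by (simp only: hop.simps Suc)
  qed simp
qed

context cell_setting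
begin

lemma arc_dim_hop:
  assumes i: "i \<in> verts G" and j: "j \<in> verts G" and p: "p < h"
  shows "int (arc_dim p i j) =
    hop (push (verts G) (num_arcs G)) (pull (verts G) (num_arcs G)) p 0 0 (unit i) j"
proof -
  define F where "F p = (\<lambda>j. if j \<in> verts G then int (arc_dim p i j) else 0)" for p
  \<comment> \<open>Degrees are shifted by two, so that the seeds \<open>0, 0, unit i\<close> are
    the coefficients of degrees -2, -1 and 0 and the low degrees obey the same recursion as the
    others.\<close>
  define f where "f k = (if k < 2 then 0 else F (k - 2))" for k :: nat
  let ?L = "push (verts G) (num_arcs G)" and ?L' = "pull (verts G) (num_arcs G)"
  have L: "?L (F p) j = (\<Sum>u\<in>verts G. int (num_arcs G u j) * int (arc_dim p i u))" if "j \<in> verts G" for p j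
    using that by (simp add: push_def F_def)
  have L': "?L' (F p) j = (\<Sum>u\<in>verts G. int (num_arcs G j u) * int (arc_dim p i u))" if "j \<in> verts G" for p j
    using that by (simp add: push_def F_def)
  have "hop ?L ?L' p (f 0) (f 1) (f 2) = f (p + 2)"
  proof (rule hop_sequence)
    fix k assume k: "k < p"
    show "?L (f (k + 2)) - ?L' (f (k + 1)) + f k = f (k + 3)"
    proof
      fix j
      show "(?L (f (k + 2)) - ?L' (f (k + 1)) + f k) j = f (k + 3) j"
      proof (cases "j \<in> verts G")
        case False
        then show ?thesis by (simp add: f_def F_def push_def)
      next
        case True
        consider "k = 0" | q where "k = Suc q" by (cases k) auto
        then show ?thesis
        proof cases
          case 1
          then have "f (k + 2) = F 0" "f (k + 1) = 0" "f k = 0" "f (k + 3) = F 1"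
            by (simp_all add: f_def)
          then show ?thesis using L[OF True, of 0] arc_dim_1[of i j] True by (simp add: F_def)
        next
          case (2 q)
          have q: "q + 2 < h" using 2 k p by simp
          have "f (k + 2) = F (q + 1)" "f (k + 1) = F q" "f (k + 3) = F (q + 2)"
            using 2 by (simp_all add: f_def)
          moreover have "f k j = (if q = 0 then 0 else int (arc_dim (q - 1) i j))"
            using 2 True by (simp add: f_def F_def)
          ultimately show ?thesis
            using L[OF True, of "q + 1"] L'[OF True, of q] arc_dim_rec[OF q True, of i] True by (simp add: F_def)
        qed
      qed
    qed
  qed
  moreover have "f 0 = 0" "f 1 = 0" "f 2 = unit i" using i by (auto simp: f_def F_def unit_def dim_0)
  ultimately show ?thesis using j by (simp add: f_def F_def)
qed

end

section \<open>Reduction of the quotient formula to a recursion on vertex functions\<close>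

lemma verts_multigraph [simp]: "verts (multigraph V m) = V"
  by (simp add: multigraph_def)

lemma num_arcs_multigraph:
  assumes "u \<in> V" "v \<in> V" shows "num_arcs (multigraph V m) u v = m u v"
proof -
  have "arcs_from_to (multigraph V m) u v = (\<lambda>t. (u, v, t)) ` {..<m u v}"
    using assms by (auto simp: arcs_from_to_def multigraph_def)
  then show ?thesis by (simp add: num_arcs_def card_image inj_on_def)
qed

lemma fin_digraph_multigraph:
  assumes "finite V" shows "fin_digraph (multigraph V m)"
proof
  have "arcs (multigraph V m) \<subseteq> (\<Union>u\<in>V. \<Union>v\<in>V. (\<lambda>t. (u, v, t)) ` {..<m u v})"
    by (auto simp: multigraph_def)
  then show "finite (arcs (multigraph V m))"
    by (rule finite_subset) (intro finite_UN_I finite_imageI assms finite_lessThan)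
qed (use assms in \<open>auto simp: multigraph_def\<close>)

lemma push_cong:
  "(\<And>u v. u \<in> V \<Longrightarrow> v \<in> V \<Longrightarrow> m u v = m' u v) \<Longrightarrow> push V m = push V m'"
  by (auto simp: push_def fun_eq_iff intro!: sum.cong)

text \<open>The premise \<open>top\<close> may assume that all entries in degree
  \<open>h - 3\<close> are nonnegative, because they are dimensions. This is the only trace of the
  algebra that the later computations use.\<close>

theorem graph_quotient:
  fixes V :: "'v set" and m :: "'v \<Rightarrow> 'v \<Rightarrow> nat"
  assumes V: "finite V" and G: "G = multigraph V m" and h: "h \<ge> 4"
    and pf: "perron_frobenius G h \<phi>" and cells: "cell_system G h \<phi> W"
    and vs: "distinct vs" "set vs = verts G" and \<sigma>: "z3_symmetry G \<sigma>"
    and top: "\<And>i j. i \<in> V \<Longrightarrow> j \<in> V \<Longrightarrow>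
      (\<And>u v. u \<in> V \<Longrightarrow> v \<in> V \<Longrightarrow> 0 \<le> hop (push V m) (pull V m) (h - 3) 0 0 (unit u) v) \<Longrightarrow>
      hop (push V m) (pull V m) (h - 3) 0 0 (unit i) j = (if i = \<sigma> j then 1 else 0)"
  shows "is_mat_quotient (hilbert_series G W vs)
      (1\<^sub>m (length vs) - fps_X ^ h \<cdot>\<^sub>m perm_mat vs \<sigma>)
      (1\<^sub>m (length vs) - fps_X \<cdot>\<^sub>m adjacency_mat G vs
         + fps_X ^ 2 \<cdot>\<^sub>m transpose_mat (adjacency_mat G vs)
         - fps_X ^ 3 \<cdot>\<^sub>m 1\<^sub>m (length vs))"
proof -
  interpret cell_setting G h \<phi> W
    using fin_digraph_multigraph[OF V, of m] h pf cells unfolding G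
    by (intro cell_setting.intro cell_setting_axioms.intro)
  have VG: "verts G = V" by (simp add: G)
  have L: "push V (num_arcs G) = push V m" "pull V (num_arcs G) = pull V m"
    by (rule push_cong, simp add: G num_arcs_multigraph)+
  have dims: "corner_dim G W p i j = arc_dim p i j" if "i \<in> verts G" "j \<in> verts G" for p i j
    by (rule corner_dim_eq[OF that])
  have hop: "int (arc_dim p i j) = hop (push V m) (pull V m) p 0 0 (unit i) j" if "i \<in> verts G" "j \<in> verts G" "p < h" for p i j
    using arc_dim_hop[OF that] unfolding VG L .
  show ?thesis
  proof (rule hilbert_quotient[OF vs h _ _ _ _ _ \<sigma>])
    fix i j assume i: "i \<in> verts G" and j: "j \<in> verts G"
    show "corner_dim G W 0 i j = (if i = j then 1 else 0)" by (simp add: dims i j dim_0)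
    show "int (corner_dim G W 1 i j) = (\<Sum>u\<in>verts G. int (num_arcs G u j) * int (corner_dim G W 0 i u))"
      using arc_dim_1[of i j] i j dims by simp
    have h3: "h - 3 < h" using h by simp
    have "hop (push V m) (pull V m) (h - 3) 0 0 (unit i) j = (if i = \<sigma> j then 1 else 0)"
    proof (rule top)
      show "0 \<le> hop (push V m) (pull V m) (h - 3) 0 0 (unit u) v" if "u \<in> V" "v \<in> V" for u v
        using hop[of u v "h - 3"] that h3 VG by simp
    qed (use i j VG in auto)
    then have "int (corner_dim G W (h - 3) i j) = int (if i = \<sigma> j then 1 else 0)"
      using hop[OF i j h3] dims[OF i j] by simp
    then show "corner_dim G W (h - 3) i j = (if i = \<sigma> j then 1 else 0)" by linarith
  next
    fix i j q assume i: "i \<in> verts G" and j: "j \<in> verts G" and q: "q + 2 < h"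
    show "int (corner_dim G W (q + 2) i j) =
      (\<Sum>u\<in>verts G. int (num_arcs G u j) * int (corner_dim G W (q + 1) i u)) -
      (\<Sum>u\<in>verts G. int (num_arcs G j u) * int (corner_dim G W q i u)) +
      (if q = 0 then 0 else int (corner_dim G W (q - 1) i j))"
      using arc_dim_rec[OF q j, of i] i j dims by simp
  next
    fix i j p assume "i \<in> verts G" "j \<in> verts G" "h - 2 \<le> p"
    then show "corner_dim G W p i j = 0" using dims arc_dim_vanishes by simp
  qed
qed

section \<open>Relabellings and cyclic vectors\<close>

definition relabel :: "'v set \<Rightarrow> ('v \<Rightarrow> 'v) \<Rightarrow> ('v \<Rightarrow> int) \<Rightarrow> 'v \<Rightarrow> int" where
  "relabel V \<sigma> x = (\<lambda>v. if v \<in> V then x (\<sigma> v) else 0)"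

lemma relabel_add: "relabel V \<sigma> (x + y) = relabel V \<sigma> x + relabel V \<sigma> y"
  and relabel_diff: "relabel V \<sigma> (x - y) = relabel V \<sigma> x - relabel V \<sigma> y"
  and relabel_0 [simp]: "relabel V \<sigma> 0 = 0"
  by (auto simp: relabel_def fun_eq_iff)

lemma relabel_push:
  assumes \<sigma>: "bij_betw \<sigma> V V" and m: "\<And>u v. u \<in> V \<Longrightarrow> v \<in> V \<Longrightarrow> m (\<sigma> u) (\<sigma> v) = m u v"
  shows "relabel V \<sigma> (push V m x) = push V m (relabel V \<sigma> x)"
proof
  fix v
  show "relabel V \<sigma> (push V m x) v = push V m (relabel V \<sigma> x) v"
  proof (cases "v \<in> V")
    case True
    then have \<sigma>v: "\<sigma> v \<in> V" using \<sigma> by (auto simp: bij_betw_def)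
    have "(\<Sum>u\<in>V. int (m u (\<sigma> v)) * x u) = (\<Sum>u\<in>V. int (m (\<sigma> u) (\<sigma> v)) * x (\<sigma> u))"
      by (rule sum.reindex_bij_betw[OF \<sigma>, symmetric])
    also have "\<dots> = (\<Sum>u\<in>V. int (m u v) * relabel V \<sigma> x u)"
      using True by (intro sum.cong) (auto simp: m relabel_def)
    finally show ?thesis using True \<sigma>v by (simp add: relabel_def push_def)
  qed (simp add: relabel_def push_def)
qed

lemma push_lincomb: "push V m (\<lambda>j. \<Sum>v\<in>A. c v * F v j) = (\<lambda>j. \<Sum>v\<in>A. c v * push V m (F v) j)"
proof
  fix j
  have "(\<Sum>u\<in>V. int (m u j) * (\<Sum>v\<in>A. c v * F v u)) = (\<Sum>u\<in>V. \<Sum>v\<in>A. c v * (int (m u j) * F v u))"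
    by (simp add: sum_distrib_left mult.left_commute)
  also have "\<dots> = (\<Sum>v\<in>A. \<Sum>u\<in>V. c v * (int (m u j) * F v u))" by (rule sum.swap)
  finally show "push V m (\<lambda>j. \<Sum>v\<in>A. c v * F v j) j = (\<Sum>v\<in>A. c v * push V m (F v) j)"
    by (simp add: push_def sum_distrib_left)
qed

lemma push_expand:
  assumes "finite V"
  shows "push V m x = push V m (\<lambda>j. \<Sum>v\<in>V. x v * unit v j)"
proof -
  have "(\<Sum>v\<in>V. x v * unit v u) = x u" if "u \<in> V" for u
  proof -
    have "(\<Sum>v\<in>V. x v * unit v u) = (\<Sum>v\<in>V. if v = u then x u else 0)"
      by (rule sum.cong) (auto simp: unit_def)
    then show ?thesis using that assms by simp
  qed
  then show ?thesis by (auto simp: push_def fun_eq_iff intro!: sum.cong)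
qed

lemma push_pull_commute:
  assumes V: "finite V" and u: "\<And>v. v \<in> V \<Longrightarrow> push V m (pull V m (unit v)) = pull V m (push V m (unit v))"
  shows "push V m (pull V m x) = pull V m (push V m x)"
  by (subst (1 2) push_expand[OF V, of _ x]) (simp add: push_lincomb u cong: sum.cong)

text \<open>The operator computed by \<open>hop\<close> commutes with \<open>push\<close> and \<open>pull\<close>, so it equals a relabelling
  as soon as the two agree on a cyclic vector.\<close>

lemma cyclic_vector:
  fixes V :: "'v set" and m :: "'v \<Rightarrow> 'v \<Rightarrow> nat" and p :: nat
  assumes \<sigma>: "bij_betw \<sigma> V V" and m: "\<And>u v. u \<in> V \<Longrightarrow> v \<in> V \<Longrightarrow> m (\<sigma> u) (\<sigma> v) = m u v"
    and comm: "\<And>x. push V m (pull V m x) = pull V m (push V m x)"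
  defines "K \<equiv> {x. hop (push V m) (pull V m) p 0 0 x = relabel V \<sigma> x}"
  shows "x \<in> K \<Longrightarrow> push V m x \<in> K" "x \<in> K \<Longrightarrow> pull V m x \<in> K"
    "x \<in> K \<Longrightarrow> y \<in> K \<Longrightarrow> x + y \<in> K" "x \<in> K \<Longrightarrow> y \<in> K \<Longrightarrow> x - y \<in> K" "0 \<in> K"
proof -
  let ?L = "push V m" and ?L' = "pull V m"
  \<comment> \<open>Here \<open>push\<close> is its own intertwiner, since it commutes with
    \<open>pull\<close>.\<close>
  have L: "hop ?L ?L' p 0 0 (?L x) = ?L (hop ?L ?L' p 0 0 x)" for x
    using hop_intertwine[of ?L ?L ?L ?L' ?L' p 0 0 x] comm by (simp add: push_add push_diff)
  have L': "hop ?L ?L' p 0 0 (?L' x) = ?L' (hop ?L ?L' p 0 0 x)" for x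
    using hop_intertwine[of ?L' ?L ?L ?L' ?L' p 0 0 x] comm by (simp add: push_add push_diff)
  show "x \<in> K \<Longrightarrow> ?L x \<in> K" by (simp add: K_def L relabel_push[OF \<sigma>, of m] m)
  show "x \<in> K \<Longrightarrow> ?L' x \<in> K" by (simp add: K_def L' relabel_push[OF \<sigma>, of "\<lambda>u v. m v u"] m)
  show "x \<in> K \<Longrightarrow> y \<in> K \<Longrightarrow> x + y \<in> K"
    using hop_additive(1)[of ?L ?L' p 0 0 0 0 x y] by (simp add: K_def push_add push_diff relabel_add)
  show "x \<in> K \<Longrightarrow> y \<in> K \<Longrightarrow> x - y \<in> K"
    using hop_additive(2)[of ?L ?L' p 0 0 0 0 x y] by (simp add: K_def push_add push_diff relabel_diff)
  show "0 \<in> K"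
    using hop_additive(2)[of ?L ?L' p 0 0 0 0 0 0] by (simp add: K_def push_add push_diff)
qed

lemma z3_symmetry_id: "z3_symmetry G (\<lambda>v. v)"
  by (simp add: z3_symmetry_def bij_betw_def)

lemma z3_symmetry_multigraph:
  assumes "\<And>v. v \<in> V \<Longrightarrow> \<sigma> v \<in> V" "\<And>u v. u \<in> V \<Longrightarrow> v \<in> V \<Longrightarrow> m (\<sigma> u) (\<sigma> v) = m u v"
    and "\<And>v. v \<in> V \<Longrightarrow> \<sigma> (\<sigma> (\<sigma> v)) = v"
  shows "z3_symmetry (multigraph V m) \<sigma>" and "bij_betw \<sigma> V V"
proof -
  show b: "bij_betw \<sigma> V V"
    by (rule bij_betw_byWitness[where f' = "\<lambda>v. \<sigma> (\<sigma> v)"]) (auto simp: assms)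
  show "z3_symmetry (multigraph V m) \<sigma>"
    using b by (simp add: z3_symmetry_def num_arcs_multigraph assms)
qed

section \<open>The graphs \<open>A\<close>\<close>

definition A_verts :: "nat \<Rightarrow> su3_vertex set" where
  "A_verts N = {Lat p l |p l. p + l \<le> N}"

lemma A_graph_eq: "A_graph n = multigraph (A_verts (n - 3)) A_mult"
  by (simp add: A_graph_def A_verts_def lattice_points_def)

lemma finite_A_verts: "finite (A_verts N)"
proof -
  have "A_verts N \<subseteq> (\<lambda>(p, l). Lat p l) ` ({..N} \<times> {..N})" by (auto simp: A_verts_def)
  then show ?thesis by (rule finite_subset) simp
qed

text \<open>Set to zero beyond the wall \<open>p + l = N\<close>, so that neighbours across that
  wall drop out of the formulas for \<open>push\<close> and \<open>pull\<close> by
  themselves.\<close>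

definition A_unit :: "nat \<Rightarrow> nat \<Rightarrow> nat \<Rightarrow> su3_vertex \<Rightarrow> int" where
  "A_unit N p l = (if p + l \<le> N then unit (Lat p l) else 0)"

lemma A_unit_0: "N < p + l \<Longrightarrow> A_unit N p l = 0"
  by (simp add: A_unit_def)

lemma push_A_unit:
  "push (A_verts N) A_mult (A_unit N p l) = (if p + l \<le> N then A_unit N (Suc p) l +
     (case p of 0 \<Rightarrow> 0 | Suc p' \<Rightarrow> A_unit N p' (Suc l)) + (case l of 0 \<Rightarrow> 0 | Suc l' \<Rightarrow> A_unit N p l') else 0)"
proof (cases "p + l \<le> N")
  case True
  have "push (A_verts N) A_mult (A_unit N p l) = (\<lambda>j. if j \<in> A_verts N then int (A_mult (Lat p l) j) else 0)"
  proof -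
    have "Lat p l \<in> A_verts N" using True by (auto simp: A_verts_def)
    then show ?thesis using push_unit[OF finite_A_verts] True by (simp add: A_unit_def)
  qed
  also have "\<dots> = A_unit N (Suc p) l + (case p of 0 \<Rightarrow> 0 | Suc p' \<Rightarrow> A_unit N p' (Suc l)) +
      (case l of 0 \<Rightarrow> 0 | Suc l' \<Rightarrow> A_unit N p l')"
  proof
    fix j
    show "(if j \<in> A_verts N then int (A_mult (Lat p l) j) else 0) = (A_unit N (Suc p) l +
      (case p of 0 \<Rightarrow> 0 | Suc p' \<Rightarrow> A_unit N p' (Suc l)) + (case l of 0 \<Rightarrow> 0 | Suc l' \<Rightarrow> A_unit N p l')) j"
      using True by (cases j) (auto simp: A_unit_def unit_def A_verts_def split: nat.splits)
  qed
  finally show ?thesis using True by simp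
qed (simp add: A_unit_def)

lemma pull_A_unit:
  "pull (A_verts N) A_mult (A_unit N p l) = (if p + l \<le> N then A_unit N p (Suc l) +
     (case l of 0 \<Rightarrow> 0 | Suc l' \<Rightarrow> A_unit N (Suc p) l') + (case p of 0 \<Rightarrow> 0 | Suc p' \<Rightarrow> A_unit N p' l) else 0)"
proof (cases "p + l \<le> N")
  case True
  have "pull (A_verts N) A_mult (A_unit N p l) = (\<lambda>j. if j \<in> A_verts N then int (A_mult j (Lat p l)) else 0)"
  proof -
    have "Lat p l \<in> A_verts N" using True by (auto simp: A_verts_def)
    then show ?thesis using push_unit[OF finite_A_verts] True by (simp add: A_unit_def)
  qed
  also have "\<dots> = A_unit N p (Suc l) + (case l of 0 \<Rightarrow> 0 | Suc l' \<Rightarrow> A_unit N (Suc p) l') +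
      (case p of 0 \<Rightarrow> 0 | Suc p' \<Rightarrow> A_unit N p' l)"
  proof
    fix j
    show "(if j \<in> A_verts N then int (A_mult j (Lat p l)) else 0) = (A_unit N p (Suc l) +
      (case l of 0 \<Rightarrow> 0 | Suc l' \<Rightarrow> A_unit N (Suc p) l') + (case p of 0 \<Rightarrow> 0 | Suc p' \<Rightarrow> A_unit N p' l)) j"
      using True by (cases j) (auto simp: A_unit_def unit_def A_verts_def split: nat.splits)
  qed
  finally show ?thesis using True by simp
qed (simp add: A_unit_def)

lemma A_commute: "push (A_verts N) A_mult (pull (A_verts N) A_mult x) = pull (A_verts N) A_mult (push (A_verts N) A_mult x)"
proof (rule push_pull_commute[OF finite_A_verts])
  fix v assume "v \<in> A_verts N"
  then obtain p l where v: "v = Lat p l" and pl: "p + l \<le> N" by (auto simp: A_verts_def)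
  then have u: "unit v = A_unit N p l" by (simp add: A_unit_def)
  show "push (A_verts N) A_mult (pull (A_verts N) A_mult (unit v)) = pull (A_verts N) A_mult (push (A_verts N) A_mult (unit v))"
  proof (cases "p + l = N")
    case True
    then show ?thesis unfolding u
      by (cases p; cases l; simp add: push_A_unit pull_A_unit push_add A_unit_0 split: nat.split)
  next
    case False
    with pl have "p + l < N" by simp
    then show ?thesis unfolding u
      by (cases p; cases l; simp add: push_A_unit pull_A_unit push_add algebra_simps split: nat.split)
  qed
qed

lemma A_rotation_verts:
  fixes n :: nat
  defines "\<rho> \<equiv> A_rotation n"
  assumes "v \<in> A_verts (n - 3)"
  shows "\<rho> v \<in> A_verts (n - 3)" "\<rho> (\<rho> (\<rho> v)) = v"
  using assms by (auto simp: A_verts_def)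

text \<open>With the third coordinate \<open>q = n - 3 - p - l\<close> the rotation is a cyclic
  permutation of three coordinates, and each of the three kinds of edges moves one unit from a
  coordinate to the next. The permutation therefore permutes the kinds of edges.\<close>

lemma A_rotation_mult:
  assumes "u \<in> A_verts (n - 3)" "v \<in> A_verts (n - 3)"
  shows "A_mult (A_rotation n u) (A_rotation n v) = A_mult u v"
proof -
  obtain p l p' l' where uv: "u = Lat p l" "p + l \<le> n - 3" "v = Lat p' l'" "p' + l' \<le> n - 3"
    using assms unfolding A_verts_def by blast
  obtain q q' where q: "n - 3 - p - l = q" "n - 3 - p' - l' = q'" by blast
  have e: "p + l + q = p' + l' + q'" using uv(2,4) q by linarith
  have "q' = q + 1 \<and> p' = p \<longleftrightarrow> p' = p \<and> l = l' + 1" using e by auto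
  moreover have "q = q' + 1 \<and> p' = p + 1 \<longleftrightarrow> p' = p + 1 \<and> l' = l" using e by auto
  moreover have "q' = q \<and> p = p' + 1 \<longleftrightarrow> p = p' + 1 \<and> l' = l + 1" using e by auto
  ultimately have "lattice_edge (q, p) (q', p') \<longleftrightarrow> lattice_edge (p, l) (p', l')"
    unfolding lattice_edge.simps by blast
  moreover have "A_rotation n u = Lat q p" "A_rotation n v = Lat q' p'"
    by (simp_all only: uv A_rotation.simps lattice_rotation.simps prod.case q)
  ultimately show ?thesis by (simp only: uv A_mult.simps)
qed

text \<open>The corner \<open>(0, 0)\<close> is a cyclic vector, and from it the recursion runs
  along the edge \<open>(k, 0)\<close> of the triangle to the corner \<open>(n - 3, 0)\<close>. The
  square of the rotation takes that corner back to \<open>(0, 0)\<close>, which fixes the exponent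
  2.\<close>

lemma A_hop:
  fixes n :: nat
  defines "V \<equiv> A_verts (n - 3)" and "\<sigma> \<equiv> A_rotation n ^^ 2"
  shows "i \<in> V \<Longrightarrow> hop (push V A_mult) (pull V A_mult) (n - 3) 0 0 (unit i) = relabel V \<sigma> (unit i)"
    and "z3_symmetry (multigraph V A_mult) \<sigma>"
proof -
  let ?N = "n - 3"
  have \<sigma>: "\<sigma> v = A_rotation n (A_rotation n v)" for v by (simp add: \<sigma>_def numeral_2_eq_2)
  have \<sigma>V: "\<sigma> v \<in> V" if "v \<in> V" for v
    using that A_rotation_verts(1) by (simp add: \<sigma> V_def)
  have \<sigma>m: "A_mult (\<sigma> u) (\<sigma> v) = A_mult u v" if "u \<in> V" "v \<in> V" for u v
    using that A_rotation_verts(1) A_rotation_mult by (simp add: \<sigma> V_def)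
  have \<sigma>3: "\<sigma> (\<sigma> (\<sigma> v)) = v" if "v \<in> V" for v
    using that A_rotation_verts by (simp add: \<sigma> V_def)
  note z3 = z3_symmetry_multigraph[of V \<sigma> A_mult, OF \<sigma>V \<sigma>m \<sigma>3]
  then show "z3_symmetry (multigraph V A_mult) \<sigma>" by blast
  define K where "K = {x. hop (push V A_mult) (pull V A_mult) (n - 3) 0 0 x = relabel V \<sigma> x}"
  have comm: "push V A_mult (pull V A_mult x) = pull V A_mult (push V A_mult x)" for x
    unfolding V_def by (rule A_commute)
  note cyc = cyclic_vector[where p = "n - 3", OF z3(2) \<sigma>m comm, folded K_def]
  have K00: "A_unit ?N 0 0 \<in> K"
  proof -
    \<comment> \<open>\<open>push\<close> of \<open>(k, 0)\<close> and \<open>pull\<close> of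
      \<open>(k - 1, 0)\<close> share the vertex \<open>(k - 1, 1)\<close>; the leftover
      \<open>(k - 2, 0)\<close> is restored by the last term, and \<open>(k + 1, 0)\<close>
      remains.\<close>
    define f where "f k = (if k < 2 then 0 else A_unit ?N (k - 2) 0)" for k :: nat
    have "hop (push V A_mult) (pull V A_mult) ?N (f 0) (f 1) (f 2) = f (?N + 2)"
    proof (rule hop_sequence)
      fix k assume k: "k < ?N"
      show "push V A_mult (f (k + 2)) - pull V A_mult (f (k + 1)) + f k = f (k + 3)"
      proof (cases k)
        case 0
        then show ?thesis using k by (simp add: f_def push_A_unit V_def numeral_3_eq_3)
      next
        case (Suc q)
        then show ?thesis using k
          by (cases q) (simp_all add: f_def push_A_unit pull_A_unit V_def numeral_3_eq_3)
      qed
    qed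
    then have "hop (push V A_mult) (pull V A_mult) ?N 0 0 (A_unit ?N 0 0) = A_unit ?N ?N 0"
      by (simp add: f_def)
    moreover have "relabel V \<sigma> (A_unit ?N 0 0) = A_unit ?N ?N 0"
    proof
      fix v
      show "relabel V \<sigma> (A_unit ?N 0 0) v = A_unit ?N ?N 0 v"
        by (cases v) (auto simp: relabel_def A_unit_def unit_def V_def A_verts_def \<sigma>)
    qed
    ultimately show ?thesis by (simp add: K_def)
  qed
  have K: "A_unit ?N p l \<in> K" for p l
  proof (induction "p + l" arbitrary: p l rule: less_induct)
    case less
    \<comment> \<open>\<open>push\<close> of \<open>(a, b)\<close> consists of the wanted vertex and
      of vertices with coordinate sum at most \<open>a + b\<close>. On the edge \<open>p = 0\<close>
      the same is done with \<open>pull\<close>.\<close>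
    have first: "A_unit ?N (Suc a) b \<in> K" if IH: "\<And>p l. p + l \<le> a + b \<Longrightarrow> A_unit ?N p l \<in> K" for a b
    proof (cases "Suc a + b \<le> ?N")
      case True
      have "A_unit ?N (Suc a) b = push V A_mult (A_unit ?N a b) -
        (case a of 0 \<Rightarrow> 0 | Suc p' \<Rightarrow> A_unit ?N p' (Suc b)) - (case b of 0 \<Rightarrow> 0 | Suc l' \<Rightarrow> A_unit ?N a l')"
        using True by (simp add: push_A_unit V_def)
      also have "\<dots> \<in> K"
        by (intro cyc(4) cyc(1)) (auto split: nat.split intro: IH cyc(5))
      finally show ?thesis .
    qed (simp add: A_unit_0 cyc(5))
    show ?case
    proof (cases p)
      case (Suc a)
      then show ?thesis using first[of a l] less by simp
    next
      case 0
      show ?thesis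
      proof (cases l)
        case 0
        then show ?thesis using \<open>p = 0\<close> K00 by simp
      next
        case (Suc b)
        show ?thesis
        proof (cases "Suc b \<le> ?N")
          case True
          have "A_unit ?N 0 (Suc b) = pull V A_mult (A_unit ?N 0 b) - (case b of 0 \<Rightarrow> 0 | Suc l' \<Rightarrow> A_unit ?N 1 l')"
            using True by (simp add: pull_A_unit V_def split: nat.split)
          also have "\<dots> \<in> K"
            using less Suc \<open>p = 0\<close>
            by (intro cyc(4) cyc(2)) (auto split: nat.split intro: cyc(5))
          finally show ?thesis using Suc \<open>p = 0\<close> by simp
        qed (simp add: A_unit_0 cyc(5) Suc \<open>p = 0\<close>)
      qed
    qed
  qed
  show "i \<in> V \<Longrightarrow> hop (push V A_mult) (pull V A_mult) (n - 3) 0 0 (unit i) = relabel V \<sigma> (unit i)"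
  proof -
    assume "i \<in> V"
    then obtain p l where "i = Lat p l" "p + l \<le> ?N" by (auto simp: V_def A_verts_def)
    then show ?thesis using K[of p l] by (simp add: K_def A_unit_def)
  qed
qed

section \<open>The graphs \<open>A\<^sup>*\<close>\<close>

definition Num_unit :: "nat \<Rightarrow> nat \<Rightarrow> su3_vertex \<Rightarrow> int" where
  "Num_unit P a = (if a \<in> {1..P} then unit (Num a) else 0)"

lemma Num_unit_apply:
  "Num_unit P a v = (case v of Num b \<Rightarrow> if b = a \<and> a \<in> {1..P} then 1 else 0 | _ \<Rightarrow> 0)"
  by (simp add: Num_unit_def unit_def split: su3_vertex.split)

lemma Astar_symmetric: "num_mult (Astar_mult n) u v = num_mult (Astar_mult n) v u"
  by (cases u; cases v) (auto simp: Astar_mult_def)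

lemma push_Num_unit:
  assumes "a \<in> {1..Astar_size n}"
  shows "push (Num ` {1..Astar_size n}) (num_mult (Astar_mult n)) (Num_unit (Astar_size n) a) =
    Num_unit (Astar_size n) (a - 1) + Num_unit (Astar_size n) (Suc a) +
    (if even n \<or> a \<noteq> Astar_size n then Num_unit (Astar_size n) a else 0)"
proof -
  have "push (Num ` {1..Astar_size n}) (num_mult (Astar_mult n)) (Num_unit (Astar_size n) a) =
    (\<lambda>j. if j \<in> Num ` {1..Astar_size n} then int (num_mult (Astar_mult n) (Num a) j) else 0)"
    using assms by (simp add: Num_unit_def push_unit)
  also have "\<dots> = Num_unit (Astar_size n) (a - 1) + Num_unit (Astar_size n) (Suc a) +
    (if even n \<or> a \<noteq> Astar_size n then Num_unit (Astar_size n) a else 0)"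
  proof
    fix j
    show "(if j \<in> Num ` {1..Astar_size n} then int (num_mult (Astar_mult n) (Num a) j) else 0) =
      (Num_unit (Astar_size n) (a - 1) + Num_unit (Astar_size n) (Suc a) +
      (if even n \<or> a \<noteq> Astar_size n then Num_unit (Astar_size n) a else 0)) j"
    proof (cases j)
      case (Num b)
      obtain a' where a: "a = Suc a'" using assms by (cases a) auto
      define q where "q \<longleftrightarrow> b \<in> {1..Astar_size n}"
      define c where "c \<longleftrightarrow> even n \<or> a \<noteq> Astar_size n"
      have u: "Num_unit (Astar_size n) d (Num b) = (if b = d \<and> q then 1 else 0)" for d
        by (auto simp: Num_unit_apply q_def)
      have v: "Num b \<in> Num ` {1..Astar_size n} \<longleftrightarrow> q" by (auto simp: q_def)
      have m: "num_mult (Astar_mult n) (Num a) (Num b) =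
        (if a = b then if c then 1 else 0 else if b = a + 1 \<or> a = b + 1 then 1 else 0)"
        by (simp add: Astar_mult_def c_def)
      have "(if q then int (if a = b then if c then 1 else 0 else if b = a + 1 \<or> a = b + 1 then 1 else 0) else 0) =
        (if b = a' \<and> q then 1 else 0) + (if b = Suc a \<and> q then 1 else 0) +
        (if c then if b = a \<and> q then 1 else 0 else 0)"
        unfolding a by (cases q; cases c) auto
      then show ?thesis unfolding Num v m c_def[symmetric]
        by (cases c) (simp_all add: u a)
    qed (auto simp: Num_unit_apply)
  qed
  finally show ?thesis .
qed

text \<open>The differences of consecutive terms of the sequence started at the end point satisfy a Chebyshev
  recursion and are antisymmetric under \<open>a \<mapsto> n - a\<close>.\<close>

lemma Astar_hop:
  fixes n :: nat
  assumes n: "n \<ge> 5"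
  defines "V \<equiv> Num ` {1..Astar_size n}" and "m \<equiv> num_mult (Astar_mult n)"
  assumes i: "i \<in> V"
  shows "hop (push V m) (pull V m) (n - 3) 0 0 (unit i) = unit i"
proof -
  let ?P = "Astar_size n"
  let ?L = "push V m"
  have P: "?P \<ge> 2" using n by (simp add: Astar_size_def)
  have sym: "pull V m = ?L"
    unfolding m_def by (subst Astar_symmetric) (rule refl)
  \<comment> \<open>The vertices continued past \<open>?P\<close> by an antisymmetric reflection.
    For even \<open>n\<close> the continuation is zero at \<open>?P + 1\<close>; for odd
    \<open>n\<close> it is minus the last vertex there, which accounts for the missing loop. Both
    cases then obey one three-term rule.\<close>
  define W where "W a = (if a \<le> ?P then Num_unit ?P a else - Num_unit ?P (n - a))" for a
  have LU: "?L (Num_unit ?P a) = Num_unit ?P (a - 1) + Num_unit ?P (Suc a) +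
    (if even n \<or> a \<noteq> ?P then Num_unit ?P a else 0)" if "a \<in> {1..?P}" for a
    unfolding V_def m_def by (rule push_Num_unit[OF that])
  have U0: "Num_unit ?P 0 = 0" "a > ?P \<Longrightarrow> Num_unit ?P a = 0" for a by (simp_all add: Num_unit_def)
  have parity: "even n \<Longrightarrow> n = 2 * ?P + 2" "odd n \<Longrightarrow> n = 2 * ?P + 1"
    using n by (auto simp: Astar_size_def elim!: evenE oddE)
  have LW: "?L (W (a + 1)) = W a + W (a + 1) + W (a + 2)" if a: "a + 2 \<le> n" for a
  proof -
    consider "a + 1 < ?P" | "a + 1 = ?P" | "a + 1 = ?P + 1" | "a + 1 > ?P + 1" by linarith
    then show ?thesis
    proof cases
      case 1
      then show ?thesis using LU[of "a + 1"] by (simp add: W_def algebra_simps)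
    next
      case 2
      then have "W a = Num_unit ?P (?P - 1)" "W (a + 1) = Num_unit ?P ?P" "W (a + 2) = - Num_unit ?P (n - Suc ?P)"
        by (simp_all add: W_def flip: 2)
      moreover have "?L (W (a + 1)) = Num_unit ?P (?P - 1) + Num_unit ?P (Suc ?P) + (if even n then Num_unit ?P ?P else 0)"
        using LU[of ?P] P 2 by (simp add: W_def)
      moreover have "n - Suc ?P = (if even n then Suc ?P else ?P)" using parity by (cases "even n") simp_all
      ultimately show ?thesis by (cases "even n") (simp_all add: U0)
    next
      case 3
      show ?thesis
      proof (cases "even n")
        case True
        then have "W (a + 1) = 0" "W a = Num_unit ?P ?P" "W (a + 2) = - Num_unit ?P ?P"
        proof -
          have "n - (?P + 1) = ?P + 1" "n - (?P + 2) = ?P" "a = ?P" using parity(1)[OF True] 3 by linarith+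
          then show "W (a + 1) = 0" "W a = Num_unit ?P ?P" "W (a + 2) = - Num_unit ?P ?P"
            by (simp_all add: W_def U0)
        qed
        then show ?thesis by simp
      next
        case False
        have "W (a + 1) = - Num_unit ?P ?P" "W a = Num_unit ?P ?P" "W (a + 2) = - Num_unit ?P (?P - 1)"
        proof -
          have "n - (?P + 1) = ?P" "n - (?P + 2) = ?P - 1" "a = ?P" using parity(2)[OF False] 3 P by linarith+
          then show "W (a + 1) = - Num_unit ?P ?P" "W a = Num_unit ?P ?P" "W (a + 2) = - Num_unit ?P (?P - 1)"
            by (simp_all add: W_def)
        qed
        then show ?thesis using LU[of ?P] P False by (simp add: push_minus U0)
      qed
    next
      case 4
      define b where "b = n - (a + 1)"
      have b: "b \<ge> 1" "b \<le> ?P" "b = ?P \<Longrightarrow> even n \<and> a = ?P + 1" using 4 a parity by (cases "even n"; auto simp: b_def)+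
      have "W (a + 1) = - Num_unit ?P b" "W (a + 2) = - Num_unit ?P (b - 1)"
        using 4 a by (simp_all add: W_def b_def)
      moreover have "W a = - Num_unit ?P (Suc b)"
      proof -
        have "Suc b = n - a" using a by (simp add: b_def)
        then show ?thesis using 4 by (simp add: W_def)
      qed
      moreover have "?L (Num_unit ?P b) = Num_unit ?P (b - 1) + Num_unit ?P (Suc b) + Num_unit ?P b"
        using LU[of b] b by auto
      ultimately show ?thesis by (simp add: push_minus algebra_simps)
    qed
  qed
  \<comment> \<open>The increments of the sequence are the \<open>W k\<close>, and the rule for
    \<open>W\<close> is precisely the recursion for these partial sums.\<close>
  define f where "f k = (\<Sum>a\<in>{1..<k}. W a)" for k
  have fS: "f (Suc k) = f k + (if k = 0 then 0 else W k)" for k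
    by (cases k) (auto simp: f_def)
  have W0: "W 0 = 0" by (simp add: W_def U0)
  have "hop ?L ?L (n - 3) (f 0) (f 1) (f 2) = f (n - 3 + 2)"
  proof (rule hop_sequence)
    fix k assume k: "k < n - 3"
    have 1: "f (k + 2) = f (k + 1) + W (k + 1)" using fS[of "k + 1"] by simp
    have 2: "f (k + 1) = f k + W k" using fS[of k] W0 by auto
    have 3: "f (k + 3) = f (k + 2) + W (k + 2)" using fS[of "k + 2"] by (simp add: numeral_3_eq_3)
    have "?L (f (k + 2)) - ?L (f (k + 1)) + f k = W k + W (k + 1) + W (k + 2) + f k"
      unfolding 1 push_add using LW[of k] k by simp
    also have "\<dots> = f (k + 3)" unfolding 3 1 2 by (simp add: algebra_simps)
    finally show "?L (f (k + 2)) - ?L (f (k + 1)) + f k = f (k + 3)" .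
  qed
  moreover have "f 0 = 0" "f 1 = 0" "f 2 = Num_unit ?P 1"
    using P by (auto simp: f_def W_def numeral_2_eq_2)
  moreover have "f (n - 3 + 2) = Num_unit ?P 1"
  proof -
    \<comment> \<open>The final term is the sum of \<open>W 1\<close> to \<open>W (n - 2)\<close>.
      Everything from index 2 on cancels in pairs, so the sequence returns to its start at vertex
      1.\<close>
    have anti: "W (n - a) = - W a" if "a \<in> {2..<n - 1}" for a
    proof -
      have "n - (n - a) = a" using that by auto
      show ?thesis
      proof (cases "a \<le> ?P")
        case True
        then have "n - a > ?P" using parity by (cases "even n") auto
        then show ?thesis using True \<open>n - (n - a) = a\<close> by (simp add: W_def)
      next
        case False
        show ?thesis
        proof (cases "n - a \<le> ?P")
          case True
          then show ?thesis using False by (simp add: W_def)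
        next
          case F: False
          then have "even n" "a = ?P + 1" "n - a = ?P + 1" using False parity by (cases "even n"; auto)+
          then show ?thesis by (simp add: W_def U0)
        qed
      qed
    qed
    have "(\<Sum>a\<in>{2..<n - 1}. W a) = (\<Sum>a\<in>{2..<n - 1}. W (n - a))"
      by (rule sum.reindex_bij_witness[of _ "\<lambda>a. n - a" "\<lambda>a. n - a"]) auto
    also have "\<dots> = (\<Sum>a\<in>{2..<n - 1}. - W a)" by (rule sum.cong) (simp_all only: anti)
    also have "\<dots> = - (\<Sum>a\<in>{2..<n - 1}. W a)" by (rule sum_negf)
    finally have neg: "(\<Sum>a\<in>{2..<n - 1}. W a) = - (\<Sum>a\<in>{2..<n - 1}. W a)" .
    have "f = 0" if "f = - f" for f :: "su3_vertex \<Rightarrow> int"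
    proof
      fix v
      have "f v = - f v" using fun_cong[OF that, of v] by simp
      then show "f v = 0 v" by simp
    qed
    from this[OF neg] have "(\<Sum>a\<in>{2..<n - 1}. W a) = 0" .
    moreover have "{1..<n - 3 + 2} = insert 1 {2..<n - 1}" using n by auto
    ultimately show ?thesis using P by (simp add: f_def W_def)
  qed
  ultimately have 1: "hop ?L ?L (n - 3) 0 0 (Num_unit ?P 1) = Num_unit ?P 1" by simp
  define K where "K = {x. hop ?L (pull V m) (n - 3) 0 0 x = relabel V (\<lambda>v. v) x}"
  note cyc = cyclic_vector[where \<sigma> = "\<lambda>v. v" and V = V and m = m and p = "n - 3", folded K_def]
  have comm: "?L (pull V m x) = pull V m (?L x)" for x by (simp add: sym)
  have bij: "bij_betw (\<lambda>v. v) V V" by (simp add: bij_betw_def)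
  have rel: "relabel V (\<lambda>v. v) (Num_unit ?P a) = Num_unit ?P a" for a
    by (auto simp: relabel_def Num_unit_def unit_def V_def fun_eq_iff)
  have K1: "Num_unit ?P 1 \<in> K" using 1 by (simp add: K_def sym rel)
  \<comment> \<open>Vertex 1 is a cyclic vector: \<open>push\<close> of one vertex gives the next
    one up to vertices already reached.\<close>
  have "Num_unit ?P a \<in> K \<and> Num_unit ?P (Suc a) \<in> K" for a
  proof (induction a)
    case 0
    show ?case unfolding U0(1) One_nat_def[symmetric] using K1 cyc(5)[OF bij _ comm] by blast
  next
    case (Suc a)
    show ?case
    proof (cases "Suc a < ?P")
      case True
      have "Num_unit ?P (Suc (Suc a)) = ?L (Num_unit ?P (Suc a)) - Num_unit ?P a - Num_unit ?P (Suc a)"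
        using LU[of "Suc a"] True by simp
      also have "\<dots> \<in> K" using Suc by (intro cyc(4)[OF bij _ comm] cyc(1)[OF bij _ comm]) auto
      finally show ?thesis using Suc by blast
    next
      case False
      then have "Num_unit ?P (Suc (Suc a)) = 0" by (intro U0(2)) simp
      then show ?thesis using Suc cyc(5)[OF bij _ comm] by (simp only: simp_thms)
    qed
  qed
  moreover obtain a where "i = Num a" "a \<in> {1..?P}" using i by (auto simp: V_def)
  moreover have "Num_unit ?P a = unit i" using calculation(2,3) by (simp add: Num_unit_def)
  ultimately have "unit i \<in> K" "relabel V (\<lambda>v. v) (unit i) = unit i" using rel[of a] by metis+
  then show ?thesis by (simp only: K_def mem_Collect_eq)
qed

section \<open>Three-colourings\<close>

text \<open>The copy of \<open>y\<close> on one layer of the three-colouring. The colour is reduced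
  modulo 3 here, so that it can be counted along with the degree.\<close>

definition colour :: "nat set \<Rightarrow> nat \<Rightarrow> (su3_vertex \<Rightarrow> int) \<Rightarrow> su3_vertex \<Rightarrow> int" where
  "colour V c y = (\<lambda>v. case v of Col x d \<Rightarrow> if d = c mod 3 \<and> x \<in> V then y (Num x) else 0 | _ \<Rightarrow> 0)"

lemma colour_add: "colour V c (x + y) = colour V c x + colour V c y"
  and colour_diff: "colour V c (x - y) = colour V c x - colour V c y"
  and colour_0 [simp]: "colour V c 0 = 0"
  by (auto simp: colour_def fun_eq_iff split: su3_vertex.splits)

lemma colour_add3: "colour V (c + 3) = colour V c"
proof -
  have "(c + 3) mod 3 = c mod 3" by simp
  then show ?thesis unfolding colour_def by (simp only:)
qed

lemma mod_3_add_cancel: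
  fixes c d k :: nat
  assumes "d < 3"
  shows "(d + k) mod 3 = (c + k) mod 3 \<longleftrightarrow> d = c mod 3"
  using cong_add_rcancel_nat[of d k c 3] assms by (simp only: cong_def mod_less)

abbreviation Col_verts :: "nat set \<Rightarrow> su3_vertex set" where
  "Col_verts V \<equiv> {Col x c |x c. x \<in> V \<and> c < 3}"

lemma sum_Col_verts:
  assumes "finite V"
  shows "(\<Sum>u\<in>Col_verts V. f u) = (\<Sum>x\<in>V. \<Sum>c<3. f (Col x c))"
proof -
  have "Col_verts V = (\<lambda>(x, c). Col x c) ` (V \<times> {..<3})" by auto
  moreover have "inj_on (\<lambda>(x, c). Col x c) (V \<times> {..<3})" by (auto simp: inj_on_def)
  ultimately show ?thesis
    by (simp add: sum.reindex sum.cartesian_product case_prod_unfold)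
qed

lemma finite_Col_verts: "finite V \<Longrightarrow> finite (Col_verts V)"
proof -
  assume "finite V"
  moreover have "Col_verts V = (\<lambda>(x, c). Col x c) ` (V \<times> {..<3})" by auto
  ultimately show ?thesis by simp
qed

lemma push_colour:
  assumes V: "finite V"
  shows "push (Col_verts V) (col_mult m) (colour V c y) = colour V (c + 1) (push (Num ` V) (num_mult m) y)"
    and "pull (Col_verts V) (col_mult m) (colour V (c + 1) y) = colour V c (pull (Num ` V) (num_mult m) y)"
proof -
  have sumN: "(\<Sum>u\<in>Num ` V. f u) = (\<Sum>x\<in>V. f (Num x))" for f :: "su3_vertex \<Rightarrow> int"
    by (simp add: sum.reindex inj_on_def)
  have c3: "c mod 3 < 3" by simp
  show "push (Col_verts V) (col_mult m) (colour V c y) = colour V (c + 1) (push (Num ` V) (num_mult m) y)"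
  proof
    fix v
    show "push (Col_verts V) (col_mult m) (colour V c y) v = colour V (c + 1) (push (Num ` V) (num_mult m) y) v"
    proof (cases "v \<in> Col_verts V")
      case True
      then obtain z d where v: "v = Col z d" "z \<in> V" "d < 3" by blast
      have "(\<Sum>u\<in>Col_verts V. int (col_mult m u v) * colour V c y u) =
        (\<Sum>x\<in>V. \<Sum>e<3. if e = c mod 3 then (if d = (c + 1) mod 3 then int (m x z) * y (Num x) else 0) else 0)"
        unfolding sum_Col_verts[OF V]
        by (intro sum.cong refl) (auto simp: v colour_def mod_Suc_eq)
      also have "\<dots> = (if d = (c + 1) mod 3 then \<Sum>x\<in>V. int (m x z) * y (Num x) else 0)"
        using c3 by simp
      finally show ?thesis using True v by (simp add: push_def colour_def sumN)
    next
      case False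
      then show ?thesis by (cases v) (auto simp: push_def colour_def)
    qed
  qed
  show "pull (Col_verts V) (col_mult m) (colour V (c + 1) y) = colour V c (pull (Num ` V) (num_mult m) y)"
  proof
    fix v
    show "pull (Col_verts V) (col_mult m) (colour V (c + 1) y) v = colour V c (pull (Num ` V) (num_mult m) y) v"
    proof (cases "v \<in> Col_verts V")
      case True
      then obtain z d where v: "v = Col z d" "z \<in> V" "d < 3" by blast
      define f where "f = (d + 1) mod 3"
      define g where "g = (c + 1) mod 3"
      have dc: "d = c mod 3 \<longleftrightarrow> g = f"
        using mod_3_add_cancel[OF v(3), of 1 c] unfolding f_def g_def by (simp only: eq_commute)
      have "(\<Sum>u\<in>Col_verts V. int (col_mult m v u) * colour V (c + 1) y u) =
        (\<Sum>x\<in>V. \<Sum>e<3. if e = g then (if g = f then int (m z x) * y (Num x) else 0) else 0)"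
        unfolding sum_Col_verts[OF V]
      proof (rule sum.cong[OF refl], rule sum.cong[OF refl])
        fix x e assume "x \<in> V"
        then show "int (col_mult m v (Col x e)) * colour V (c + 1) y (Col x e) =
          (if e = g then (if g = f then int (m z x) * y (Num x) else 0) else 0)"
          unfolding v col_mult.simps colour_def su3_vertex.case f_def[symmetric] g_def[symmetric]
          by (cases "e = g"; cases "g = f") simp_all
      qed
      also have "\<dots> = (if d = c mod 3 then \<Sum>x\<in>V. int (m z x) * y (Num x) else 0)"
      proof -
        have "g < 3" by (simp add: g_def)
        then show ?thesis unfolding dc by simp
      qed
      finally show ?thesis using True v by (simp add: push_def colour_def sumN)
    next
      case False
      then show ?thesis by (cases v) (auto simp: push_def colour_def)
    qed
  qed
qed

text \<open>\<open>push\<close> raises the colour by one and \<open>pull\<close> lowers it by one,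
  so the three terms of the recursion carry the colours \<open>c + 3\<close>, \<open>c\<close> and
  \<open>c\<close>, which agree modulo 3. Each degree lives on one layer, where the recursion is
  that of the uncoloured graph.\<close>

lemma hop_colour:
  assumes V: "finite V"
  shows "hop (push (Col_verts V) (col_mult m)) (pull (Col_verts V) (col_mult m)) p
      (colour V c x) (colour V (c + 1) y) (colour V (c + 2) z) =
    colour V (c + 2 + p) (hop (push (Num ` V) (num_mult m)) (pull (Num ` V) (num_mult m)) p x y z)"
proof (induction p arbitrary: c x y z)
  case (Suc p)
  have "push (Col_verts V) (col_mult m) (colour V (c + 2) z) = colour V (c + 3) (push (Num ` V) (num_mult m) z)"
    using push_colour(1)[OF V, of m "c + 2" z] by (simp add: numeral_3_eq_3)
  moreover have "pull (Col_verts V) (col_mult m) (colour V (c + 1) y) = colour V (c + 3) (pull (Num ` V) (num_mult m) y)"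
    using push_colour(2)[OF V, of m c y] colour_add3[of V c] by simp
  moreover have "colour V c x = colour V (c + 3) x" using colour_add3[of V c] by simp
  ultimately have "push (Col_verts V) (col_mult m) (colour V (c + 2) z) - pull (Col_verts V) (col_mult m) (colour V (c + 1) y) + colour V c x =
    colour V (c + 1 + 2) (push (Num ` V) (num_mult m) z - pull (Num ` V) (num_mult m) y + x)"
    by (simp add: colour_add colour_diff numeral_3_eq_3)
  moreover have "c + 1 + 2 + p = c + 2 + Suc p" "c + 1 + 1 = c + 2" by simp_all
  ultimately show ?case using Suc.IH[of "c + 1" y z] by (simp only: hop.simps)
qed simp

lemma hop_coloured:
  assumes V: "finite V" and x: "x \<in> V" and c: "c < 3"
    and id: "hop (push (Num ` V) (num_mult m)) (pull (Num ` V) (num_mult m)) p 0 0 (unit (Num x)) = unit (Num x)"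
  shows "hop (push (Col_verts V) (col_mult m)) (pull (Col_verts V) (col_mult m)) p 0 0 (unit (Col x c)) =
    unit (Col x ((c + p) mod 3))"
proof -
  have u: "colour V d (unit (Num x)) = unit (Col x (d mod 3))" for d
    using x by (auto simp: colour_def unit_def fun_eq_iff split: su3_vertex.splits)
  \<comment> \<open>The third seed needs the colour \<open>c\<close>, written as
    \<open>c + 1 + 2\<close>; the two zero seeds may be given any colour.\<close>
  have "hop (push (Col_verts V) (col_mult m)) (pull (Col_verts V) (col_mult m)) p
      (colour V (c + 1) 0) (colour V (c + 1 + 1) 0) (colour V (c + 1 + 2) (unit (Num x))) =
    colour V (c + 1 + 2 + p) (unit (Num x))"
    unfolding hop_colour[OF V] id ..
  moreover have "(c + 1 + 2) mod 3 = c" "(c + 1 + 2 + p) mod 3 = (c + p) mod 3" using c by presburger+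
  ultimately show ?thesis by (simp only: u colour_0)
qed

lemma colour_rotation_pow: "c < 3 \<Longrightarrow> (colour_rotation ^^ k) (Col x c) = Col x ((c + k) mod 3)"
  by (induction k) (auto simp: mod_Suc_eq)

lemma colour_rotation_z3:
  "z3_symmetry (multigraph (Col_verts V) (col_mult m)) (colour_rotation ^^ k)"
proof (rule z3_symmetry_multigraph(1))
  fix v assume "v \<in> Col_verts V"
  then obtain x c where v: "v = Col x c" "x \<in> V" "c < 3" by blast
  show "(colour_rotation ^^ k) v \<in> Col_verts V"
    using v by (simp add: colour_rotation_pow)
  have "(c + k + k + k) mod 3 = c" using v(3) by presburger
  then show "(colour_rotation ^^ k) ((colour_rotation ^^ k) ((colour_rotation ^^ k) v)) = v"
    using v by (simp add: colour_rotation_pow mod_add_left_eq)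
next
  fix u v assume "u \<in> Col_verts V" "v \<in> Col_verts V"
  then obtain x c y d where v: "u = Col x c" "c < 3" "v = Col y d" "d < 3" by blast
  have "((c + k) mod 3 + 1) mod 3 = (c + 1 + k) mod 3" by (simp only: mod_add_left_eq) (simp only: add_ac)
  then have "(d + k) mod 3 = ((c + k) mod 3 + 1) mod 3 \<longleftrightarrow> d = (c + 1) mod 3"
    using mod_3_add_cancel[OF v(4), of k "c + 1"] by (simp only:)
  then show "col_mult m ((colour_rotation ^^ k) u) ((colour_rotation ^^ k) v) = col_mult m u v"
    by (simp only: v(1,3) colour_rotation_pow[OF v(2)] colour_rotation_pow[OF v(4)] col_mult.simps)
qed

section \<open>Computation on finite graphs\<close>

text \<open>Executable counterpart of \<open>push\<close> and \<open>pull\<close> on lists of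
  coefficients: for \<open>push\<close> the lists hold predecessors, for \<open>pull\<close>
  successors, with repetitions for multiple arcs.\<close>

definition apply_lists :: "nat list list \<Rightarrow> int list \<Rightarrow> int list" where
  "apply_lists ts x = map (\<lambda>t. sum_list (map (\<lambda>k. x ! k) t)) ts"

primrec iter_lists :: "nat list list \<Rightarrow> nat list list \<Rightarrow> nat \<Rightarrow> int list \<Rightarrow> int list \<Rightarrow> int list \<Rightarrow> int list" where
  "iter_lists ps ss 0 x y z = z"
| "iter_lists ps ss (Suc p) x y z = iter_lists ps ss p y z
     (map2 (+) (map2 (-) (apply_lists ps z) (apply_lists ss y)) x)"

text \<open>A non-negative integer combination of the numbers \<open>n, \<dots>, 2 n - 1\<close> that equals one of them has a
  single term. So the trajectory of one weight vector decides a permutation matrix with non-negative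
  entries.\<close>

definition periodic_lists :: "nat list list \<Rightarrow> nat list list \<Rightarrow> nat \<Rightarrow> bool" where
  "periodic_lists ps ss p \<longleftrightarrow>
     iter_lists ps ss p (replicate (length ps) 0) (replicate (length ps) 0) (map int [length ps..<2 * length ps]) =
     map int [length ps..<2 * length ps]"

definition pred_indices :: "nat list list \<Rightarrow> nat list list" where
  "pred_indices N = map (\<lambda>b. concat (map (\<lambda>a. replicate (count_list (N ! a) b) a) [0..<length N])) [0..<length N]"

lemma apply_lists_push:
  assumes ws: "distinct ws" and len: "length ps = length ws"
    and bound: "\<And>b. b < length ws \<Longrightarrow> set (ps ! b) \<subseteq> {..<length ws}"
    and count: "\<And>a b. a < length ws \<Longrightarrow> b < length ws \<Longrightarrow> count_list (ps ! b) a = m (ws ! a) (ws ! b)"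
  shows "apply_lists ps (map x ws) = map (push (set ws) m x) ws"
proof (rule nth_equalityI)
  fix b assume "b < length (apply_lists ps (map x ws))"
  then have b: "b < length ws" by (simp add: apply_lists_def len)
  have sums: "sum_list (map f ks) = (\<Sum>k<length ws. int (count_list ks k) * f k)"
    if "set ks \<subseteq> {..<length ws}" for ks and f :: "nat \<Rightarrow> int"
    using that
  proof (induction ks)
    case (Cons k ks)
    then have k: "k < length ws" by simp
    have "(\<Sum>i<length ws. int (count_list (k # ks) i) * f i) =
      (\<Sum>i<length ws. (if i = k then f k else 0) + int (count_list ks i) * f i)"
      by (rule sum.cong) (auto simp: algebra_simps)
    also have "\<dots> = f k + (\<Sum>i<length ws. int (count_list ks i) * f i)"
      using k by (simp add: sum.distrib)
    finally show ?case using Cons by simp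
  qed simp
  have "apply_lists ps (map x ws) ! b = (\<Sum>k<length ws. int (count_list (ps ! b) k) * map x ws ! k)"
    using b sums[OF bound[OF b], of "\<lambda>k. map x ws ! k"] by (simp add: apply_lists_def len)
  also have "\<dots> = (\<Sum>k<length ws. int (m (ws ! k) (ws ! b)) * x (ws ! k))"
    by (rule sum.cong) (simp_all add: count b)
  also have "\<dots> = (\<Sum>u\<in>set ws. int (m u (ws ! b)) * x u)"
    by (rule sum.reindex_bij_betw) (rule bij_betw_nth[OF ws refl refl])
  finally show "apply_lists ps (map x ws) ! b = map (push (set ws) m x) ws ! b"
    using b by (simp add: push_def)
qed (simp add: apply_lists_def len)

lemma count_pred_indices:
  assumes "a < length N" "b < length N"
  shows "count_list (pred_indices N ! b) a = count_list (N ! a) b"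
proof -
  have c0: "a \<ge> n \<Longrightarrow> count_list (concat (map (\<lambda>a. replicate (c a) a) [0..<n])) a = 0" for a n and c :: "nat \<Rightarrow> nat"
    by (auto simp: count_list_0_iff)
  have rep: "count_list (replicate q x) y = (if x = y then q else 0)" for q and x y :: nat
    by (induction q) auto
  have "a < n \<Longrightarrow> count_list (concat (map (\<lambda>a. replicate (c a) a) [0..<n])) a = c a" for n and c :: "nat \<Rightarrow> nat"
    by (induction n) (auto simp: count_list_append rep c0 less_Suc_eq)
  then show ?thesis using assms by (simp add: pred_indices_def)
qed

lemma hop_outside:
  "v \<notin> V \<Longrightarrow> a v = 0 \<Longrightarrow> b v = 0 \<Longrightarrow> c v = 0 \<Longrightarrow> hop (push V m) (push V m') p a b c v = 0"
  by (induction p arbitrary: a b c) (simp_all add: push_def)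

lemma iter_lists_hop:
  assumes ws: "distinct ws" and len: "length N = length ws"
    and bound: "\<And>a. a < length ws \<Longrightarrow> set (N ! a) \<subseteq> {..<length ws}"
    and count: "\<And>a b. a < length ws \<Longrightarrow> b < length ws \<Longrightarrow> count_list (N ! a) b = m (ws ! a) (ws ! b)"
  shows "iter_lists (pred_indices N) N p (map a ws) (map b ws) (map c ws) =
    map (hop (push (set ws) m) (pull (set ws) m) p a b c) ws"
proof -
  have push: "apply_lists (pred_indices N) (map x ws) = map (push (set ws) m x) ws" for x
  proof (rule apply_lists_push[OF ws])
    show "length (pred_indices N) = length ws" by (simp add: pred_indices_def len)
    show "set (pred_indices N ! b) \<subseteq> {..<length ws}" if "b < length ws" for b
      using that by (auto simp: pred_indices_def len)
  qed (simp add: count_pred_indices len count)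
  have pull: "apply_lists N (map x ws) = map (pull (set ws) m x) ws" for x
    by (rule apply_lists_push[OF ws len bound]) (simp_all add: count)
  show ?thesis
  proof (induction p arbitrary: a b c)
    case (Suc p)
    have "map2 (+) (map2 (-) (map (push (set ws) m c) ws) (map (pull (set ws) m b) ws)) (map a ws) =
      map (push (set ws) m c - pull (set ws) m b + a) ws"
      by (rule nth_equalityI) auto
    then show ?case by (simp only: iter_lists.simps hop.simps push pull Suc)
  qed simp
qed

lemma hop_lincomb:
  "hop (push V m) (push V m') p (\<lambda>j. \<Sum>v\<in>A. c v * x v j) (\<lambda>j. \<Sum>v\<in>A. c v * y v j) (\<lambda>j. \<Sum>v\<in>A. c v * z v j) =
    (\<lambda>j. \<Sum>v\<in>A. c v * hop (push V m) (push V m') p (x v) (y v) (z v) j)"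
proof (induction p arbitrary: x y z)
  case (Suc p)
  have "push V m (\<lambda>j. \<Sum>v\<in>A. c v * z v j) - push V m' (\<lambda>j. \<Sum>v\<in>A. c v * y v j) + (\<lambda>j. \<Sum>v\<in>A. c v * x v j) =
    (\<lambda>j. \<Sum>v\<in>A. c v * (push V m (z v) - push V m' (y v) + x v) j)"
    unfolding push_lincomb by (simp add: fun_eq_iff sum.distrib sum_subtractf algebra_simps)
  then show ?case by (simp only: hop.simps Suc)
qed simp

text \<open>Every weight is at least \<open>n\<close>, so \<open>n\<close> times the sum of the
  \<open>H k\<close> is at most \<open>n + j\<close>, which is below \<open>2 n\<close>. Hence the
  \<open>H k\<close> add up to at most 1, and the one that is not zero is recognised by its
  weight.\<close>

lemma single_term:
  fixes n :: nat and H :: "nat \<Rightarrow> int"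
  assumes H: "\<And>k. k < n \<Longrightarrow> 0 \<le> H k" and sum: "(\<Sum>k<n. int (n + k) * H k) = int (n + j)"
    and j: "j < n" and i: "i < n"
  shows "H i = (if i = j then 1 else 0)"
proof -
  have "(\<Sum>k<n. int n * H k) \<le> (\<Sum>k<n. int (n + k) * H k)"
    by (rule sum_mono) (auto intro!: mult_right_mono H)
  then have "int n * (\<Sum>k<n. H k) < int n * 2" using sum j by (simp add: sum_distrib_left)
  then have le: "(\<Sum>k<n. H k) \<le> 1" using j by (simp add: mult_less_cancel_left)
  have "\<exists>k<n. H k \<noteq> 0"
  proof (rule ccontr)
    assume "\<not> (\<exists>k<n. H k \<noteq> 0)"
    then have "(\<Sum>k<n. int (n + k) * H k) = 0" by (intro sum.neutral) auto
    then show False using sum j by simp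
  qed
  then obtain k where k: "k < n" "H k \<noteq> 0" by blast
  have rest: "H l = 0" if "l < n" "l \<noteq> k" for l
  proof -
    have "sum H {k, l} \<le> sum H {..<n}" using k that H by (intro sum_mono2) auto
    then have "H k + H l \<le> 1" using le that by simp
    then show ?thesis using H[OF k(1)] H[OF that(1)] k(2) by linarith
  qed
  have "H k \<le> sum H {..<n}" using k H by (intro member_le_sum) auto
  then have Hk: "H k = 1" using le H[OF k(1)] k(2) by linarith
  have "(\<Sum>l<n. int (n + l) * H l) = (\<Sum>l<n. if l = k then int (n + k) else 0)"
    by (rule sum.cong) (auto simp: rest Hk)
  then have "j = k" using sum k(1) by simp
  then show ?thesis using Hk rest[OF i] by auto
qed

lemma periodic_hop:
  fixes ws :: "'a list"
  assumes ws: "distinct ws" and len: "length N = length ws"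
    and bound: "\<And>a. a < length ws \<Longrightarrow> set (N ! a) \<subseteq> {..<length ws}"
    and count: "\<And>a b. a < length ws \<Longrightarrow> b < length ws \<Longrightarrow> count_list (N ! a) b = m (ws ! a) (ws ! b)"
    and per: "periodic_lists (pred_indices N) N p"
    and nonneg: "\<And>u v. u \<in> set ws \<Longrightarrow> v \<in> set ws \<Longrightarrow> 0 \<le> hop (push (set ws) m) (pull (set ws) m) p 0 0 (unit u) v"
    and i: "i \<in> set ws" and j: "j \<in> set ws"
  shows "hop (push (set ws) m) (pull (set ws) m) p 0 0 (unit i) j = (if i = j then 1 else 0)"
proof -
  let ?n = "length ws" and ?T = "hop (push (set ws) m) (pull (set ws) m) p 0 0"
  \<comment> \<open>The weight vector as a combination of unit vectors. If it is fixed, each row of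
    the matrix is a nonnegative combination to which \<open>single_term\<close> applies.\<close>
  define w where "w v = (\<Sum>k<?n. int (?n + k) * unit (ws ! k) v)" for v
  have w: "w (ws ! a) = int (?n + a)" if "a < ?n" for a
  proof -
    have "w (ws ! a) = (\<Sum>k<?n. if k = a then int (?n + a) else 0)"
      unfolding w_def using that by (intro sum.cong) (auto simp: unit_def nth_eq_iff_index_eq[OF ws])
    then show ?thesis using that by simp
  qed
  have weights: "map int [?n..<2 * ?n] = map w ws"
    by (rule nth_equalityI) (simp_all add: w)
  have z: "replicate ?n 0 = map (0 :: _ \<Rightarrow> int) ws"
    by (rule nth_equalityI) auto
  have len': "length (pred_indices N) = ?n" by (simp add: pred_indices_def len)
  have "map (?T w) ws = map w ws"
    using per unfolding periodic_lists_def len' weights z iter_lists_hop[OF ws len bound count, simplified] .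
  then have Tw: "?T w (ws ! a) = int (?n + a)" if "a < ?n" for a
    using that w by (simp add: list_eq_iff_nth_eq)
  have z0: "(\<lambda>v. \<Sum>k<?n. int (?n + k) * (0 :: 'a \<Rightarrow> int) v) = 0" by (simp add: fun_eq_iff)
  have lin: "?T w v = (\<Sum>k<?n. int (?n + k) * ?T (unit (ws ! k)) v)" for v
    using fun_cong[OF hop_lincomb[where A = "{..<?n}" and c = "\<lambda>k. int (?n + k)" and x = "\<lambda>_. 0" and y = "\<lambda>_. 0"
      and z = "\<lambda>k. unit (ws ! k)" and V = "set ws" and m = m and m' = "\<lambda>u v. m v u" and p = p], of v]
    unfolding z0 w_def[abs_def] .
  obtain a b where a: "a < ?n" "i = ws ! a" and b: "b < ?n" "j = ws ! b"
    using i j by (auto simp: in_set_conv_nth)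
  have "?T (unit (ws ! a)) (ws ! b) = (if a = b then 1 else 0)"
  proof (rule single_term[of ?n "\<lambda>k. ?T (unit (ws ! k)) (ws ! b)"])
    show "0 \<le> ?T (unit (ws ! k)) (ws ! b)" if "k < ?n" for k
      using nonneg that b(1) by (simp only: nth_mem)
    show "(\<Sum>k<?n. int (?n + k) * ?T (unit (ws ! k)) (ws ! b)) = int (?n + b)"
      using lin Tw[OF b(1)] by (simp only:)
  qed (use a b in auto)
  then show ?thesis using a b by (simp only: nth_eq_iff_index_eq[OF ws])
qed

section \<open>Graphs given by adjacency lists\<close>

definition adj_indices :: "('v \<times> 'v list) list \<Rightarrow> nat list list" where
  "adj_indices xs = map (\<lambda>(x, ys). map (\<lambda>y. length (takeWhile (\<lambda>w. w \<noteq> y) (map fst xs))) ys) xs"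

definition adj_closed :: "('v \<times> 'v list) list \<Rightarrow> bool" where
  "adj_closed xs \<longleftrightarrow> distinct (map fst xs) \<and> list_all (\<lambda>(x, ys). list_all (\<lambda>y. y \<in> set (map fst xs)) ys) xs"

lemma adj_mult_nth:
  assumes "distinct (map fst xs)" "a < length xs"
  shows "adj_mult xs (fst (xs ! a)) v = count_list (snd (xs ! a)) v"
proof -
  have "adj_mult xs (fst (xs ! a)) v =
    (\<Sum>t<length xs. if fst (xs ! t) = fst (xs ! a) then count_list (snd (xs ! t)) v else 0)"
    by (simp add: adj_mult_def sum_list_sum_nth atLeast0LessThan case_prod_unfold)
  also have "\<dots> = (\<Sum>t<length xs. if t = a then count_list (snd (xs ! a)) v else 0)"
  proof (rule sum.cong[OF refl])
    fix t assume "t \<in> {..<length xs}"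
    then have "fst (xs ! t) = fst (xs ! a) \<longleftrightarrow> t = a"
      using nth_eq_iff_index_eq[OF assms(1), of t a] assms(2) by simp
    then show "(if fst (xs ! t) = fst (xs ! a) then count_list (snd (xs ! t)) v else 0) =
      (if t = a then count_list (snd (xs ! a)) v else 0)" by simp
  qed
  finally show ?thesis using assms(2) by simp
qed

lemma position:
  assumes "distinct ws" "y \<in> set ws"
  shows "length (takeWhile (\<lambda>w. w \<noteq> y) ws) < length ws" "ws ! length (takeWhile (\<lambda>w. w \<noteq> y) ws) = y"
proof -
  show "length (takeWhile (\<lambda>w. w \<noteq> y) ws) < length ws"
    using assms(2) by (induction ws) auto
  show "ws ! length (takeWhile (\<lambda>w. w \<noteq> y) ws) = y"
    using assms(2) by (induction ws) auto
qed

lemma adj_props: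
  assumes "adj_closed xs"
  shows "distinct (map fst xs)" and "adj_verts xs = set (map fst xs)"
    and "length (adj_indices xs) = length (map fst xs)"
    and "a < length xs \<Longrightarrow> set (adj_indices xs ! a) \<subseteq> {..<length (map fst xs)}"
    and "a < length xs \<Longrightarrow> b < length xs \<Longrightarrow>
      count_list (adj_indices xs ! a) b = adj_mult xs (map fst xs ! a) (map fst xs ! b)"
proof -
  show ws: "distinct (map fst xs)" using assms by (simp add: adj_closed_def)
  have cl: "y \<in> set (map fst xs)" if "p \<in> set xs" "y \<in> set (snd p)" for p y
    using assms that by (auto simp: adj_closed_def list_all_iff)
  show "adj_verts xs = set (map fst xs)"
  proof -
    have "(\<Union>(x, ys)\<in>set xs. set ys) \<subseteq> set (map fst xs)" using cl by fastforce
    then show ?thesis unfolding adj_verts_def by auto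
  qed
  show "length (adj_indices xs) = length (map fst xs)" by (simp add: adj_indices_def)
  let ?pos = "\<lambda>y. length (takeWhile (\<lambda>w. w \<noteq> y) (map fst xs))"
  have N: "adj_indices xs ! a = map ?pos (snd (xs ! a))" if "a < length xs" for a
    using that by (simp add: adj_indices_def case_prod_unfold)
  show "set (adj_indices xs ! a) \<subseteq> {..<length (map fst xs)}" if "a < length xs"
    using position(1)[OF ws cl[OF nth_mem[OF that]]] by (auto simp only: N[OF that] set_map)
  show "count_list (adj_indices xs ! a) b = adj_mult xs (map fst xs ! a) (map fst xs ! b)"
    if a: "a < length xs" and b: "b < length xs"
  proof -
    have "count_list (map ?pos ys) b = count_list ys (map fst xs ! b)" if "set ys \<subseteq> set (map fst xs)" for ys
      using that
    proof (induction ys)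
      case (Cons y ys)
      then have y: "y \<in> set (map fst xs)" by simp
      have "?pos y = b \<longleftrightarrow> y = map fst xs ! b"
        using position[OF ws y] nth_eq_iff_index_eq[OF ws, of "?pos y" b] b by simp
      then show ?case using Cons by simp
    qed simp
    from this[of "snd (xs ! a)"] show ?thesis
      using cl[OF nth_mem[OF a]] adj_mult_nth[OF ws a] a by (simp only: N[OF a] nth_map) blast
  qed
qed

lemma adj_hop:
  assumes xs: "adj_closed xs" and per: "periodic_lists (pred_indices (adj_indices xs)) (adj_indices xs) p"
    and nonneg: "\<And>u v. u \<in> adj_verts xs \<Longrightarrow> v \<in> adj_verts xs \<Longrightarrow>
      0 \<le> hop (push (adj_verts xs) (adj_mult xs)) (pull (adj_verts xs) (adj_mult xs)) p 0 0 (unit u) v"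
    and i: "i \<in> adj_verts xs" and j: "j \<in> adj_verts xs"
  shows "hop (push (adj_verts xs) (adj_mult xs)) (pull (adj_verts xs) (adj_mult xs)) p 0 0 (unit i) j =
    (if i = j then 1 else 0)"
proof -
  note props = adj_props[OF xs]
  show ?thesis unfolding props(2)
  proof (rule periodic_hop[OF props(1,3) _ _ per])
    fix a b assume "a < length (map fst xs)"
    then show "set (adj_indices xs ! a) \<subseteq> {..<length (map fst xs)}" using props(4) by simp
    assume "b < length (map fst xs)"
    then show "count_list (adj_indices xs ! a) b = adj_mult xs (map fst xs ! a) (map fst xs ! b)"
      using props(5) \<open>a < length (map fst xs)\<close> by simp
  qed (use nonneg i j in \<open>simp_all only: props(2)\<close>)
qed

lemma numbered_indices:
  assumes xs: "adj_closed xs"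
  defines "ws \<equiv> map Num (map fst xs)"
  shows "distinct ws" and "Num ` adj_verts xs = set ws" and "length (adj_indices xs) = length ws"
    and "a < length ws \<Longrightarrow> set (adj_indices xs ! a) \<subseteq> {..<length ws}"
    and "a < length ws \<Longrightarrow> b < length ws \<Longrightarrow>
      count_list (adj_indices xs ! a) b = num_mult (adj_mult xs) (ws ! a) (ws ! b)"
proof -
  note props = adj_props[OF xs]
  show "distinct ws" using props(1) unfolding ws_def by (subst distinct_map) (simp add: inj_on_def)
  show "Num ` adj_verts xs = set ws" unfolding ws_def props(2) by (rule set_map[symmetric])
  show "length (adj_indices xs) = length ws" using props(3) by (simp add: ws_def)
  show "a < length ws \<Longrightarrow> set (adj_indices xs ! a) \<subseteq> {..<length ws}" using props(4) by (simp add: ws_def)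
  show "a < length ws \<Longrightarrow> b < length ws \<Longrightarrow>
      count_list (adj_indices xs ! a) b = num_mult (adj_mult xs) (ws ! a) (ws ! b)"
    using props(5) by (simp add: ws_def)
qed

lemma numbered_adj_hop:
  assumes xs: "adj_closed xs" and per: "periodic_lists (pred_indices (adj_indices xs)) (adj_indices xs) p"
    and nonneg: "\<And>u v. u \<in> Num ` adj_verts xs \<Longrightarrow> v \<in> Num ` adj_verts xs \<Longrightarrow>
      0 \<le> hop (push (Num ` adj_verts xs) (num_mult (adj_mult xs)))
        (pull (Num ` adj_verts xs) (num_mult (adj_mult xs))) p 0 0 (unit u) v"
    and i: "i \<in> Num ` adj_verts xs" and j: "j \<in> Num ` adj_verts xs"
  shows "hop (push (Num ` adj_verts xs) (num_mult (adj_mult xs)))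
    (pull (Num ` adj_verts xs) (num_mult (adj_mult xs))) p 0 0 (unit i) j = (if i = j then 1 else 0)"
proof -
  note ind = numbered_indices[OF xs]
  show ?thesis unfolding ind(2)
    by (rule periodic_hop[OF ind(1,3) _ _ per])
      (use nonneg i j ind(4,5) in \<open>simp_all only: ind(2)\<close>)
qed

lemma finite_adj_verts: "finite (adj_verts xs)"
  by (auto simp: adj_verts_def)

lemma numbered_adj_eq: "numbered_adj xs = multigraph (Num ` adj_verts xs) (num_mult (adj_mult xs))"
  by (simp only: numbered_adj_def numbered_def)

lemma adj_closed_graphs: "adj_closed E8star_adj" "adj_closed E12_1_adj" "adj_closed E12_2_adj"
  "adj_closed E12_4_adj" "adj_closed E12_5_adj" "adj_closed E24_adj"
  by code_simp+

text \<open>Here all four unit vectors are followed instead of one weight vector: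
  \<open>hop_coloured\<close> takes an unconditional equality of functions from the base graph, and
  this serves the three-colouring E8 as well.\<close>

lemma E8star_hop:
  assumes i: "i \<in> Num ` adj_verts E8star_adj"
  shows "hop (push (Num ` adj_verts E8star_adj) (num_mult (adj_mult E8star_adj)))
    (pull (Num ` adj_verts E8star_adj) (num_mult (adj_mult E8star_adj))) 5 0 0 (unit i) = unit i"
proof -
  note ind = numbered_indices[OF adj_closed_graphs(1)]
  let ?ws = "map Num (map fst E8star_adj)" and ?m = "num_mult (adj_mult E8star_adj)"
  have "list_all (\<lambda>i. iter_lists (pred_indices (adj_indices E8star_adj)) (adj_indices E8star_adj) 5
      (map (\<lambda>_. 0) ?ws) (map (\<lambda>_. 0) ?ws) (map (unit i) ?ws) = map (unit i) ?ws) ?ws"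
    by code_simp
  then have "iter_lists (pred_indices (adj_indices E8star_adj)) (adj_indices E8star_adj) 5
      (map 0 ?ws) (map 0 ?ws) (map (unit i) ?ws) = map (unit i) ?ws"
    using i unfolding ind(2) list_all_iff zero_fun_def by (rule bspec)
  then have "map (hop (push (set ?ws) ?m) (pull (set ?ws) ?m) 5 0 0 (unit i)) ?ws = map (unit i) ?ws"
    using iter_lists_hop[where m = ?m, OF ind(1,3,4,5), of 5 0 0 "unit i"] by (simp only:)
  then have on: "hop (push (set ?ws) ?m) (pull (set ?ws) ?m) 5 0 0 (unit i) v = unit i v" if "v \<in> set ?ws" for v
    using that by (simp only: map_eq_conv)
  show ?thesis unfolding ind(2)
  proof
    fix v
    show "hop (push (set ?ws) ?m) (pull (set ?ws) ?m) 5 0 0 (unit i) v = unit i v"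
    proof (cases "v \<in> set ?ws")
      case False
      then have "unit i v = 0" using i unfolding ind(2) unit_def by auto
      then show ?thesis using hop_outside[OF False, of 0 0 "unit i"] by simp
    qed (rule on)
  qed
qed

lemma E12_1_periodic: "periodic_lists (pred_indices (adj_indices E12_1_adj)) (adj_indices E12_1_adj) 9"
  by code_simp

lemma E12_2_periodic: "periodic_lists (pred_indices (adj_indices E12_2_adj)) (adj_indices E12_2_adj) 9"
  by code_simp

lemma E12_4_periodic: "periodic_lists (pred_indices (adj_indices E12_4_adj)) (adj_indices E12_4_adj) 9"
  by code_simp

lemma E12_5_periodic: "periodic_lists (pred_indices (adj_indices E12_5_adj)) (adj_indices E12_5_adj) 9"
  by code_simp

lemma E24_periodic: "periodic_lists (pred_indices (adj_indices E24_adj)) (adj_indices E24_adj) 21"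
  by code_simp

section \<open>The orbifolds \<open>D\<close>\<close>

lemma lattice_rotation_props:
  fixes n :: nat
  defines "r \<equiv> lattice_rotation n"
  assumes x: "x \<in> lattice_points n"
  shows "r x \<in> lattice_points n" and "r (r (r x)) = x"
    and "r x = x \<Longrightarrow> n \<ge> 3 \<Longrightarrow> \<exists>k. x = (k, k) \<and> n = 3 * k + 3"
  using x by (auto simp: r_def lattice_points_def)

lemma lattice_rotation_edge:
  assumes "x \<in> lattice_points n" "y \<in> lattice_points n"
  shows "lattice_edge (lattice_rotation n x) (lattice_rotation n y) = lattice_edge x y"
proof -
  obtain p l p' l' where x: "x = (p, l)" "y = (p', l')" by (cases x, cases y)
  have "Lat p l \<in> A_verts (n - 3)" "Lat p' l' \<in> A_verts (n - 3)"
    using assms by (simp_all add: x A_verts_def lattice_points_def)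
  from A_rotation_mult[OF this] show ?thesis
    by (simp only: x A_rotation.simps lattice_rotation.simps prod.case A_mult.simps split: if_splits)
qed

lemma rotation_orbit_fixed: "lattice_rotation n x = x \<Longrightarrow> rotation_orbit n x = {x}"
  by (simp add: rotation_orbit_def)

lemma sum_rotation_orbit:
  assumes "x \<in> lattice_points n" "lattice_rotation n x \<noteq> x"
  shows "sum f (rotation_orbit n x) =
    f x + f (lattice_rotation n x) + f (lattice_rotation n (lattice_rotation n x))"
proof -
  have "lattice_rotation n (lattice_rotation n x) \<noteq> x"
    "lattice_rotation n (lattice_rotation n x) \<noteq> lattice_rotation n x"
    using assms(2) lattice_rotation_props(2)[OF assms(1)] by metis+
  then show ?thesis using assms(2) unfolding rotation_orbit_def
    by (simp add: add.assoc not_sym)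
qed

lemma card_rotation_orbit:
  assumes "x \<in> lattice_points n"
  shows "card (rotation_orbit n x) = 3 \<longleftrightarrow> lattice_rotation n x \<noteq> x"
proof (cases "lattice_rotation n x = x")
  case False
  then show ?thesis using sum_rotation_orbit[OF assms False, of "\<lambda>_. 1 :: nat"] by simp
qed (simp add: rotation_orbit_fixed)

lemma rotation_orbit_eq:
  assumes "x \<in> lattice_points n" "y \<in> rotation_orbit n x"
  shows "rotation_orbit n y = rotation_orbit n x" "y \<in> lattice_points n"
  using assms(2) lattice_rotation_props[OF assms(1)] lattice_rotation_props(1)[OF lattice_rotation_props(1)[OF assms(1)]] assms(1)
  unfolding rotation_orbit_def by auto

lemma card_filter: "finite A \<Longrightarrow> card {x \<in> A. P x} = (\<Sum>x\<in>A. of_bool (P x))"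
  by (simp add: sum_of_bool_eq Int_def)

lemma finite_rotation_orbit: "finite (rotation_orbit n x)"
  by (simp add: rotation_orbit_def)

text \<open>Rotating both ends of an edge moves a rotation from \<open>x\<close> over to
  \<open>y\<close>, so summing over the orbit of \<open>x\<close> is the same as summing over the
  orbit of \<open>y\<close>. If \<open>y\<close> is fixed, all three members of the orbit behave
  alike and give the factor 3.\<close>

lemma rotation_orbit_edges:
  assumes x: "x \<in> lattice_points n" "lattice_rotation n x \<noteq> x" and y: "y \<in> lattice_points n"
  shows "lattice_rotation n y \<noteq> y \<Longrightarrow>
      card {v \<in> rotation_orbit n y. lattice_edge x v} = (\<Sum>u\<in>rotation_orbit n x. of_bool (lattice_edge u y))"
    and "lattice_rotation n y = y \<Longrightarrow>
      (\<Sum>u\<in>rotation_orbit n x. of_bool (lattice_edge u y)) = 3 * (of_bool (lattice_edge x y) :: nat)"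
    and "lattice_rotation n y = y \<Longrightarrow>
      (\<Sum>u\<in>rotation_orbit n x. of_bool (lattice_edge y u)) = 3 * (of_bool (lattice_edge y x) :: nat)"
    and "lattice_rotation n y = y \<Longrightarrow> (\<exists>u\<in>rotation_orbit n x. lattice_edge u y) \<longleftrightarrow> lattice_edge x y"
    and "lattice_rotation n y = y \<Longrightarrow> (\<exists>u\<in>rotation_orbit n x. lattice_edge y u) \<longleftrightarrow> lattice_edge y x"
proof -
  let ?r = "lattice_rotation n"
  note rx = lattice_rotation_props(1)[OF x(1)] and ry = lattice_rotation_props(1)[OF y]
  note rrx = lattice_rotation_props(1)[OF rx] and rry = lattice_rotation_props(1)[OF ry]
  have 1: "lattice_edge (?r (?r x)) y = lattice_edge x (?r y)"
    using lattice_rotation_edge[OF rrx y] lattice_rotation_props(2)[OF x(1)] by simp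
  have 2: "lattice_edge (?r x) y = lattice_edge x (?r (?r y))"
    using lattice_rotation_edge[OF rx y] lattice_rotation_edge[OF rrx ry] lattice_rotation_props(2)[OF x(1)] by simp
  have 3: "lattice_edge y (?r (?r x)) = lattice_edge (?r y) x"
    using lattice_rotation_edge[OF y rrx] lattice_rotation_props(2)[OF x(1)] by simp
  have 4: "lattice_edge y (?r x) = lattice_edge (?r (?r y)) x"
    using lattice_rotation_edge[OF y rx] lattice_rotation_edge[OF ry rrx] lattice_rotation_props(2)[OF x(1)] by simp
  show "card {v \<in> rotation_orbit n y. lattice_edge x v} = (\<Sum>u\<in>rotation_orbit n x. of_bool (lattice_edge u y))"
    if "?r y \<noteq> y"
    unfolding card_filter[OF finite_rotation_orbit] sum_rotation_orbit[OF y that] sum_rotation_orbit[OF x] 1 2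
    by (simp only: add_ac)
  show "(\<Sum>u\<in>rotation_orbit n x. of_bool (lattice_edge u y)) = 3 * (of_bool (lattice_edge x y) :: nat)" if "?r y = y"
    unfolding sum_rotation_orbit[OF x] 1 2 that by simp
  show "(\<Sum>u\<in>rotation_orbit n x. of_bool (lattice_edge y u)) = 3 * (of_bool (lattice_edge y x) :: nat)" if "?r y = y"
    unfolding sum_rotation_orbit[OF x] 3 4 that by simp
  show "(\<exists>u\<in>rotation_orbit n x. lattice_edge u y) \<longleftrightarrow> lattice_edge x y" if "?r y = y"
    using 1 2 that by (simp add: rotation_orbit_def)
  show "(\<exists>u\<in>rotation_orbit n x. lattice_edge y u) \<longleftrightarrow> lattice_edge y x" if "?r y = y"
    using 3 4 that by (simp add: rotation_orbit_def)
qed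

definition D_verts :: "nat \<Rightarrow> su3_vertex set" where
  "D_verts n = {Orb (rotation_orbit n x) |x. x \<in> lattice_points n \<and> card (rotation_orbit n x) = 3} \<union>
      {Split k m |k m. n = 3 * k + 3 \<and> m \<in> {1, 2, 3}}"

lemma D_graph_eq: "D_graph n = multigraph (D_verts n) D_mult"
  by (simp only: D_graph_def D_verts_def)

text \<open>The correspondence between D and A: an orbit lies over its three members, while the
  three split vertices all lie over the central point. It is a relation and not a covering
  map.\<close>

fun fibre :: "su3_vertex \<Rightarrow> su3_vertex set" where
  "fibre (Orb X) = case_prod Lat ` X"
| "fibre (Split k m) = {Lat k k}"
| "fibre _ = {}"

lemma lattice_verts: "A_verts (n - 3) = case_prod Lat ` lattice_points n"
  by (auto simp: A_verts_def lattice_points_def)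

lemma D_vert_cases:
  assumes "u \<in> D_verts n"
  obtains (Orb) x where "u = Orb (rotation_orbit n x)" "x \<in> lattice_points n" "lattice_rotation n x \<noteq> x"
  | (Split) k m where "u = Split k m" "n = 3 * k + 3" "m \<in> {1, 2, 3}"
  using assms card_rotation_orbit unfolding D_verts_def by blast

lemma finite_D_verts: "finite (D_verts n)"
proof -
  have "lattice_points n \<subseteq> {..n} \<times> {..n}" by (auto simp: lattice_points_def)
  then have L: "finite (lattice_points n)" by (rule finite_subset) simp
  have "D_verts n \<subseteq> (\<lambda>x. Orb (rotation_orbit n x)) ` lattice_points n \<union> (\<lambda>(k, m). Split k m) ` ({..n} \<times> {1, 2, 3})"
    unfolding D_verts_def by force
  then show ?thesis by (rule finite_subset) (use L in simp)
qed

lemma split_point: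
  assumes "n = 3 * k + 3"
  shows "(k, k) \<in> lattice_points n" "lattice_rotation n (k, k) = (k, k)"
  using assms by (simp_all add: lattice_points_def)

lemma fibre_verts: "u \<in> D_verts n \<Longrightarrow> fibre u \<subseteq> A_verts (n - 3)"
proof (erule D_vert_cases)
  fix x assume u: "u = Orb (rotation_orbit n x)" and x: "x \<in> lattice_points n"
  have "rotation_orbit n x \<subseteq> lattice_points n" using rotation_orbit_eq(2)[OF x] by blast
  then show ?thesis unfolding u lattice_verts fibre.simps by (rule image_mono)
next
  fix k m assume "u = Split k m" "n = 3 * k + 3"
  then show ?thesis by (simp add: A_verts_def)
qed

lemma fibre_members:
  assumes n: "n \<ge> 3" and w: "w \<in> lattice_points n"
  shows "lattice_rotation n w \<noteq> w \<Longrightarrow> {v \<in> D_verts n. case_prod Lat w \<in> fibre v} = {Orb (rotation_orbit n w)}"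
    and "w = (k, k) \<Longrightarrow> n = 3 * k + 3 \<Longrightarrow> {v \<in> D_verts n. case_prod Lat w \<in> fibre v} = Split k ` {1, 2, 3}"
proof -
  have inj: "case_prod Lat x = case_prod Lat y \<Longrightarrow> x = y" for x y by (cases x; cases y) simp
  have orb: "rotation_orbit n x = rotation_orbit n w" if x: "x \<in> lattice_points n" and wx: "case_prod Lat w \<in> case_prod Lat ` rotation_orbit n x" for x
  proof -
    obtain y where "y \<in> rotation_orbit n x" "case_prod Lat w = case_prod Lat y" using wx by (rule imageE)
    then have "w \<in> rotation_orbit n x" using inj by metis
    then show ?thesis using rotation_orbit_eq(1)[OF x] by metis
  qed
  have ww: "w \<in> rotation_orbit n w" by (simp add: rotation_orbit_def)
  {
    assume r: "lattice_rotation n w \<noteq> w"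
    show "{v \<in> D_verts n. case_prod Lat w \<in> fibre v} = {Orb (rotation_orbit n w)}"
    proof (intro equalityI subsetI)
      fix v assume "v \<in> {v \<in> D_verts n. case_prod Lat w \<in> fibre v}"
      then have v: "v \<in> D_verts n" "case_prod Lat w \<in> fibre v" by blast+
      from v(1) show "v \<in> {Orb (rotation_orbit n w)}"
      proof (cases rule: D_vert_cases)
        case (Orb x)
        then show ?thesis using orb v(2) by simp
      next
        case (Split k m)
        then have "w = (k, k)" using v(2) inj[of w "(k, k)"] by simp
        then show ?thesis using r split_point(2)[OF Split(2)] by blast
      qed
    next
      have "Orb (rotation_orbit n w) \<in> D_verts n"
        using w r card_rotation_orbit[OF w] unfolding D_verts_def by blast
      moreover have "case_prod Lat w \<in> fibre (Orb (rotation_orbit n w))"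
        unfolding fibre.simps using ww by (rule imageI)
      moreover fix v assume "v \<in> {Orb (rotation_orbit n w)}"
      ultimately show "v \<in> {v \<in> D_verts n. case_prod Lat w \<in> fibre v}" by blast
    qed
  next
    assume wk: "w = (k, k)" and nk: "n = 3 * k + 3"
    show "{v \<in> D_verts n. case_prod Lat w \<in> fibre v} = Split k ` {1, 2, 3}"
    proof (intro equalityI subsetI)
      fix v assume "v \<in> {v \<in> D_verts n. case_prod Lat w \<in> fibre v}"
      then have v: "v \<in> D_verts n" "case_prod Lat w \<in> fibre v" by blast+
      from v(1) show "v \<in> Split k ` {1, 2, 3}"
      proof (cases rule: D_vert_cases)
        case (Orb x)
        have "rotation_orbit n x = {w}"
          using orb[OF Orb(2)] v(2) rotation_orbit_fixed split_point(2)[OF nk] wk unfolding Orb(1) fibre.simps by metis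
        then show ?thesis using card_rotation_orbit[OF Orb(2)] Orb(3) by simp
      next
        case (Split k m)
        then show ?thesis using nk by auto
      qed
    next
      fix v assume "v \<in> Split k ` {1, 2, 3}"
      then show "v \<in> {v \<in> D_verts n. case_prod Lat w \<in> fibre v}"
        using nk unfolding D_verts_def wk by auto
    qed
  }
qed

lemma sum_fibre_Orb: "(\<Sum>x\<in>fibre (Orb X). f x) = (\<Sum>x\<in>X. f (case_prod Lat x))"
  unfolding fibre.simps by (subst sum.reindex) (auto simp: inj_on_def)

lemma A_mult_lattice: "A_mult (case_prod Lat x) (case_prod Lat y) = of_bool (lattice_edge x y)"
  by (cases x; cases y) simp

text \<open>The incidence matrix of \<open>fibre\<close> intertwines the adjacency matrices. Over a
  free orbit this is a rotation of edges. Over the central point, an orbit adjacent to it has three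
  edges there, matched by one arc of D to or from each of the three split vertices.\<close>

lemma D_mult_count:
  assumes n: "n \<ge> 3" and u: "u \<in> D_verts n" and z: "z \<in> A_verts (n - 3)"
  shows "(\<Sum>v\<in>{v \<in> D_verts n. z \<in> fibre v}. D_mult u v) = (\<Sum>x\<in>fibre u. A_mult x z)"
    and "(\<Sum>v\<in>{v \<in> D_verts n. z \<in> fibre v}. D_mult v u) = (\<Sum>x\<in>fibre u. A_mult z x)"
proof -
  obtain w where w: "z = case_prod Lat w" "w \<in> lattice_points n" using z unfolding lattice_verts by blast
  have sums: "(\<Sum>x\<in>fibre (Orb X). A_mult x z) = (\<Sum>x\<in>X. of_bool (lattice_edge x w))"
    "(\<Sum>x\<in>fibre (Orb X). A_mult z x) = (\<Sum>x\<in>X. of_bool (lattice_edge w x))"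
    "(\<Sum>x\<in>fibre (Split k m). A_mult x z) = of_bool (lattice_edge (k, k) w)"
    "(\<Sum>x\<in>fibre (Split k m). A_mult z x) = of_bool (lattice_edge w (k, k))" for X k m
    unfolding sum_fibre_Orb w(1) A_mult_lattice using A_mult_lattice[of "(k, k)" w] A_mult_lattice[of w "(k, k)"] by simp_all
  have some: "(SOME y. y \<in> rotation_orbit n x) \<in> rotation_orbit n x" for x
    by (rule someI[of _ x]) (simp add: rotation_orbit_def)
  have orb_orb: "D_mult (Orb (rotation_orbit n x)) (Orb (rotation_orbit n y)) = (\<Sum>u\<in>rotation_orbit n x. of_bool (lattice_edge u y))"
    if x: "x \<in> lattice_points n" "lattice_rotation n x \<noteq> x" and y: "y \<in> lattice_points n" "lattice_rotation n y \<noteq> y" for x y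
  proof -
    \<comment> \<open>The representative picked by \<open>D_mult\<close> may differ from
      \<open>x\<close>, but it has the same orbit.\<close>
    define x' where "x' = (SOME y. y \<in> rotation_orbit n x)"
    note x' = rotation_orbit_eq[OF x(1) some[of x], folded x'_def]
    have "lattice_rotation n x' \<noteq> x'"
      using x' card_rotation_orbit[OF x(1)] card_rotation_orbit[OF x'(2)] x(2) by simp
    from rotation_orbit_edges(1)[OF x'(2) this y] show ?thesis
      unfolding D_mult.simps x'_def[symmetric] x'(1) .
  qed
  have orb_orb': "D_mult (Orb (rotation_orbit n x)) (Orb (rotation_orbit n y)) = (\<Sum>v\<in>rotation_orbit n y. of_bool (lattice_edge x v))"
    if x: "x \<in> lattice_points n" "lattice_rotation n x \<noteq> x" and y: "y \<in> lattice_points n" "lattice_rotation n y \<noteq> y" for x y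
    unfolding orb_orb[OF that] rotation_orbit_edges(1)[OF x y, symmetric] card_filter[OF finite_rotation_orbit] ..
  have loop: "\<not> lattice_edge x x" for x by (cases x) simp
  have "(\<Sum>v\<in>{v \<in> D_verts n. z \<in> fibre v}. D_mult u v) = (\<Sum>x\<in>fibre u. A_mult x z) \<and>
    (\<Sum>v\<in>{v \<in> D_verts n. z \<in> fibre v}. D_mult v u) = (\<Sum>x\<in>fibre u. A_mult z x)"
  proof (cases "lattice_rotation n w = w")
    case False
    note fib = fibre_members(1)[OF n w(2) False, folded w(1)]
    from u show ?thesis
    proof (cases rule: D_vert_cases)
      case (Orb x)
      then show ?thesis unfolding fib Orb(1) sums
        using orb_orb[OF Orb(2,3) w(2) False] orb_orb'[OF w(2) False Orb(2,3)] by simp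
    next
      case (Split k m)
      note e = rotation_orbit_edges(4,5)[OF w(2) False split_point[OF Split(2)]]
      show ?thesis unfolding fib Split(1) sums using e by simp
    qed
  next
    case True
    then obtain k where k: "w = (k, k)" "n = 3 * k + 3" using lattice_rotation_props(3)[OF w(2) _ n] by blast
    note fib = fibre_members(2)[OF n w(2) k, folded w(1)]
    have S: "sum f (Split k ` {1, 2, 3}) = f (Split k 1) + f (Split k 2) + f (Split k 3)" for f :: "su3_vertex \<Rightarrow> nat"
      by simp
    from u show ?thesis
    proof (cases rule: D_vert_cases)
      case (Orb x)
      note e = rotation_orbit_edges(2-)[OF Orb(2,3) split_point[OF k(2)]]
      show ?thesis unfolding fib Orb(1) sums S D_mult.simps k(1) e by simp
    next
      case (Split k' m)
      then have "k' = k" using k(2) by simp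
      then show ?thesis unfolding fib Split(1) sums S k(1) using loop by simp
    qed
  qed
  then show "(\<Sum>v\<in>{v \<in> D_verts n. z \<in> fibre v}. D_mult u v) = (\<Sum>x\<in>fibre u. A_mult x z)"
    "(\<Sum>v\<in>{v \<in> D_verts n. z \<in> fibre v}. D_mult v u) = (\<Sum>x\<in>fibre u. A_mult z x)" by blast+
qed

definition lift :: "'v set \<Rightarrow> 'w set \<Rightarrow> ('v \<Rightarrow> 'w set) \<Rightarrow> ('v \<Rightarrow> int) \<Rightarrow> 'w \<Rightarrow> int" where
  "lift V V' F y = (\<lambda>z. if z \<in> V' then \<Sum>v\<in>{v \<in> V. z \<in> F v}. y v else 0)"

lemma lift_add: "lift V V' F (x + y) = lift V V' F x + lift V V' F y"
  and lift_diff: "lift V V' F (x - y) = lift V V' F x - lift V V' F y"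
  by (auto simp: lift_def fun_eq_iff sum.distrib sum_subtractf)

text \<open>\<open>count\<close> is the entrywise form of an intertwining relation between
  \<open>m\<close> and \<open>m'\<close>; summing it against \<open>y\<close> gives the relation for
  functions.\<close>

lemma lift_push:
  fixes m :: "'v \<Rightarrow> 'v \<Rightarrow> nat" and m' :: "'w \<Rightarrow> 'w \<Rightarrow> nat"
  assumes V: "finite V" "finite V'" and F: "\<And>u. u \<in> V \<Longrightarrow> F u \<subseteq> V'"
    and count: "\<And>u z. u \<in> V \<Longrightarrow> z \<in> V' \<Longrightarrow> (\<Sum>v\<in>{v \<in> V. z \<in> F v}. m u v) = (\<Sum>x\<in>F u. m' x z)"
  shows "lift V V' F (push V m y) = push V' m' (lift V V' F y)"
proof
  fix z
  show "lift V V' F (push V m y) z = push V' m' (lift V V' F y) z"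
  proof (cases "z \<in> V'")
    case True
    have "(\<Sum>v\<in>{v \<in> V. z \<in> F v}. push V m y v) = (\<Sum>v\<in>{v \<in> V. z \<in> F v}. \<Sum>u\<in>V. int (m u v) * y u)"
      by (rule sum.cong) (auto simp: push_def)
    also have "\<dots> = (\<Sum>u\<in>V. \<Sum>v\<in>{v \<in> V. z \<in> F v}. int (m u v) * y u)" by (rule sum.swap)
    also have "\<dots> = (\<Sum>u\<in>V. int (\<Sum>x\<in>F u. m' x z) * y u)"
      by (rule sum.cong) (simp_all add: count[OF _ True, symmetric] sum_distrib_right)
    also have "\<dots> = (\<Sum>u\<in>V. \<Sum>x\<in>V'. if x \<in> F u then int (m' x z) * y u else 0)"
    proof (rule sum.cong[OF refl])
      fix u assume u: "u \<in> V"
      have "F u = {x \<in> V'. x \<in> F u}" using F[OF u] by blast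
      then have "(\<Sum>x\<in>F u. int (m' x z) * y u) = (\<Sum>x\<in>V'. if x \<in> F u then int (m' x z) * y u else 0)"
        using sum.inter_filter[OF V(2), of "\<lambda>x. int (m' x z) * y u" "\<lambda>x. x \<in> F u"] by simp
      then show "int (\<Sum>x\<in>F u. m' x z) * y u = (\<Sum>x\<in>V'. if x \<in> F u then int (m' x z) * y u else 0)"
        by (simp add: sum_distrib_right)
    qed
    also have "\<dots> = (\<Sum>x\<in>V'. \<Sum>u\<in>V. if x \<in> F u then int (m' x z) * y u else 0)" by (rule sum.swap)
    also have "\<dots> = (\<Sum>x\<in>V'. int (m' x z) * lift V V' F y x)"
    proof (rule sum.cong[OF refl])
      fix x assume "x \<in> V'"
      then show "(\<Sum>u\<in>V. if x \<in> F u then int (m' x z) * y u else 0) = int (m' x z) * lift V V' F y x"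
        unfolding sum.inter_filter[OF V(1), symmetric] by (simp add: lift_def sum_distrib_left)
    qed
    finally show ?thesis using True by (simp add: lift_def push_def)
  qed (simp add: lift_def push_def)
qed

lemma hop_indicator:
  fixes V :: "'v set"
  assumes "finite B" "B \<subseteq> V"
    and hop: "\<And>i. i \<in> V \<Longrightarrow> hop (push V m) (pull V m) p 0 0 (unit i) = relabel V \<sigma> (unit i)"
  shows "hop (push V m) (pull V m) p 0 0 (\<lambda>v. of_bool (v \<in> B)) = relabel V \<sigma> (\<lambda>v. of_bool (v \<in> B))"
  using assms(1,2)
proof (induction B rule: finite_induct)
  case empty
  have e: "(\<lambda>v. of_bool (v \<in> {})) = (0 :: 'v \<Rightarrow> int)" by (simp add: fun_eq_iff)
  have "hop (push V m) (pull V m) p (0 - 0) (0 - 0) (0 - 0) = 0"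
    by (subst hop_additive(2)) (simp_all only: push_add push_diff diff_self)
  then show ?case unfolding e by (simp only: diff_self relabel_0)
next
  case (insert b B)
  have e: "(\<lambda>v. of_bool (v \<in> insert b B)) = unit b + (\<lambda>v. of_bool (v \<in> B) :: int)"
    using insert.hyps by (auto simp: fun_eq_iff unit_def)
  have "hop (push V m) (pull V m) p 0 0 (unit b + (\<lambda>v. of_bool (v \<in> B))) =
    hop (push V m) (pull V m) p 0 0 (unit b) + hop (push V m) (pull V m) p 0 0 (\<lambda>v. of_bool (v \<in> B))"
    using hop_additive(1)[of "push V m" "pull V m" p 0 0 0 0 "unit b" "\<lambda>v. of_bool (v \<in> B)"]
    by (simp only: push_add push_diff add_0)
  also have "\<dots> = relabel V \<sigma> (unit b) + relabel V \<sigma> (\<lambda>v. of_bool (v \<in> B))"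
    using insert.prems by (simp only: hop insert.IH insert_subset)
  finally show ?case unfolding e relabel_add .
qed

text \<open>Transferred to A, a vertex of D becomes the indicator of its fibre. The component of A
  in degree \<open>h - 3\<close> is a rotation, and fibres are invariant under rotations; this is
  why the permutation for D is the identity.\<close>

lemma D_hop_fibre:
  assumes n: "n \<ge> 3" and i: "i \<in> D_verts n" and z: "z \<in> A_verts (n - 3)"
  shows "(\<Sum>v\<in>{v \<in> D_verts n. z \<in> fibre v}. hop (push (D_verts n) D_mult) (pull (D_verts n) D_mult) (n - 3) 0 0 (unit i) v) =
    (\<Sum>v\<in>{v \<in> D_verts n. z \<in> fibre v}. unit i v)"
proof -
  let ?V = "D_verts n" and ?V' = "A_verts (n - 3)" and ?\<sigma> = "A_rotation n ^^ 2"
  let ?F = "lift ?V ?V' fibre"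
  have 1: "?F (push ?V D_mult y) = push ?V' A_mult (?F y)" for y
    by (rule lift_push[OF finite_D_verts finite_A_verts fibre_verts D_mult_count(1)[OF n]])
  have 2: "?F (pull ?V D_mult y) = pull ?V' A_mult (?F y)" for y
    by (rule lift_push[OF finite_D_verts finite_A_verts fibre_verts D_mult_count(2)[OF n]])
  have 0: "?F 0 = 0" using lift_diff[of ?V ?V' fibre 0 0] by simp
  have u: "?F (unit i) = (\<lambda>v. of_bool (v \<in> fibre i))"
  proof
    fix v
    have "(\<Sum>u\<in>{u \<in> ?V. v \<in> fibre u}. unit i u) = of_bool (v \<in> fibre i)"
      using i finite_D_verts[of n] by (simp add: unit_def)
    then show "?F (unit i) v = of_bool (v \<in> fibre i)" using fibre_verts[OF i] by (auto simp: lift_def)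
  qed
  have rot: "?\<sigma> v \<in> fibre i \<longleftrightarrow> v \<in> fibre i" if v: "v \<in> ?V'" for v
  proof -
    obtain w where w: "v = case_prod Lat w" "w \<in> lattice_points n" using v unfolding lattice_verts by (rule imageE)
    let ?r = "lattice_rotation n"
    have \<sigma>: "?\<sigma> v = case_prod Lat (?r (?r w))"
      unfolding w(1) by (cases w) (simp add: numeral_2_eq_2)
    have inj: "case_prod Lat x \<in> case_prod Lat ` X \<longleftrightarrow> x \<in> X" for x X
      by (auto simp: image_iff split: prod.splits)
    note r = lattice_rotation_props[OF w(2)]
    from i show ?thesis
    proof (cases rule: D_vert_cases)
      case (Orb x)
      have "?r y \<in> rotation_orbit n x" if "y \<in> rotation_orbit n x" for y
        using that lattice_rotation_props(2)[OF Orb(2)] unfolding rotation_orbit_def by auto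
      then have "?r (?r w) \<in> rotation_orbit n x \<longleftrightarrow> w \<in> rotation_orbit n x" using r(2) by metis
      then show ?thesis unfolding \<sigma> unfolding w(1) Orb(1) fibre.simps inj .
    next
      case (Split k m)
      have "?r (?r w) = (k, k) \<longleftrightarrow> w = (k, k)" using r(2) split_point(2)[OF Split(2)] by metis
      moreover have "fibre i = case_prod Lat ` {(k, k)}" by (simp add: Split(1))
      ultimately show ?thesis unfolding \<sigma> unfolding w(1) by (simp only: inj singleton_iff)
    qed
  qed
  have "?F (hop (push ?V D_mult) (pull ?V D_mult) (n - 3) 0 0 (unit i)) =
    hop (push ?V' A_mult) (pull ?V' A_mult) (n - 3) (?F 0) (?F 0) (?F (unit i))"
    by (rule hop_intertwine[symmetric]) (rule lift_add lift_diff 1 2)+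
  also have "\<dots> = relabel ?V' ?\<sigma> (\<lambda>v. of_bool (v \<in> fibre i))"
    unfolding 0 u
    by (rule hop_indicator[OF finite_subset[OF fibre_verts[OF i] finite_A_verts] fibre_verts[OF i] A_hop(1)])
  also have "\<dots> = ?F (unit i)"
  proof
    fix v
    show "relabel ?V' ?\<sigma> (\<lambda>v. of_bool (v \<in> fibre i)) v = ?F (unit i) v"
      unfolding u relabel_def using rot[of v] fibre_verts[OF i] by auto
  qed
  finally show ?thesis using z fun_cong[of _ _ z] unfolding lift_def by (metis (no_types, lifting))
qed

text \<open>The fibre over the fixed point only determines the sum over the three vertices above it;
  non-negativity and the symmetry exchanging two of them separate the summands.\<close>

lemma D_hop:
  assumes n: "n \<ge> 3" and i: "i \<in> D_verts n" and j: "j \<in> D_verts n"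
    and nonneg: "\<And>u v. u \<in> D_verts n \<Longrightarrow> v \<in> D_verts n \<Longrightarrow>
      0 \<le> hop (push (D_verts n) D_mult) (pull (D_verts n) D_mult) (n - 3) 0 0 (unit u) v"
  shows "hop (push (D_verts n) D_mult) (pull (D_verts n) D_mult) (n - 3) 0 0 (unit i) j = (if i = j then 1 else 0)"
  using j
proof (cases rule: D_vert_cases)
  case (Orb x)
  have "case_prod Lat x \<in> A_verts (n - 3)" using Orb(2) unfolding lattice_verts by blast
  from D_hop_fibre[OF n i this] show ?thesis
    unfolding fibre_members(1)[OF n Orb(2,3)] Orb(1) by (simp add: unit_def eq_commute)
next
  case (Split k m)
  let ?V = "D_verts n"
  define T where "T = hop (push ?V D_mult) (pull ?V D_mult) (n - 3) 0 0 (unit i)"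
  note pt = split_point(1)[OF Split(2)]
  have "case_prod Lat (k, k) \<in> A_verts (n - 3)" using pt unfolding lattice_verts by blast
  from D_hop_fibre[OF n i this] have sum: "T (Split k 1) + T (Split k 2) + T (Split k 3) =
    unit i (Split k 1) + unit i (Split k 2) + unit i (Split k 3)"
    unfolding fibre_members(2)[OF n pt refl Split(2)] T_def[symmetric] by simp
  have mem: "Split k q \<in> ?V \<longleftrightarrow> q \<in> {1, 2, 3}" for q using Split(2) by (auto simp: D_verts_def)
  have pos: "0 \<le> T (Split k 1)" "0 \<le> T (Split k 2)" "0 \<le> T (Split k 3)"
    using nonneg[OF i] mem unfolding T_def by auto
  have swap: "T (Split k a) = T (Split k b)"
    if i': "i = Split k q" and ab: "a \<in> {1, 2, 3}" "b \<in> {1, 2, 3}" "a \<noteq> q" "b \<noteq> q" for a b q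
  proof -
    \<comment> \<open>Exchanging two split vertices other than \<open>i\<close> is an automorphism
      of D that fixes \<open>i\<close>, so it preserves the function \<open>T\<close>.\<close>
    define s where "s x = (if x = a then b else if x = b then a else x)" for x
    define \<tau> where "\<tau> v = (case v of Split k q \<Rightarrow> Split k (s q) | _ \<Rightarrow> v)" for v
    have ss: "s (s x) = x" "x \<in> {1, 2, 3} \<Longrightarrow> s x \<in> {1, 2, 3}" for x using ab(1,2) by (auto simp: s_def)
    have \<tau>\<tau>: "\<tau> (\<tau> v) = v" for v by (cases v) (simp_all add: \<tau>_def ss)
    have \<tau>V: "\<tau> v \<in> ?V" if "v \<in> ?V" for v
      using that
    proof (cases rule: D_vert_cases)
      case (Orb x)
      then show ?thesis using that by (simp add: \<tau>_def)
    next
      case (Split k' q')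
      then show ?thesis using ss(2)[of q'] unfolding D_verts_def by (simp add: \<tau>_def)
    qed
    have bij: "bij_betw \<tau> ?V ?V" by (rule bij_betw_byWitness[where f' = \<tau>]) (use \<tau>\<tau> \<tau>V in auto)
    have m: "D_mult (\<tau> u) (\<tau> v) = D_mult u v" for u v by (cases u; cases v) (simp_all add: \<tau>_def)
    let ?R = "relabel ?V \<tau>"
    have "?R (unit i) = unit i"
    proof
      fix v
      have "s x = q \<longleftrightarrow> x = q" for x using ab(3,4) by (auto simp: s_def)
      then have "\<tau> v = i \<longleftrightarrow> v = i" unfolding i' by (cases v) (auto simp: \<tau>_def)
      then show "?R (unit i) v = unit i v" using i by (auto simp: relabel_def unit_def)
    qed
    moreover have "hop (push ?V D_mult) (pull ?V D_mult) (n - 3) (?R 0) (?R 0) (?R (unit i)) = ?R T"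
      unfolding T_def
    proof (rule hop_intertwine)
      show "?R (push ?V D_mult x) = push ?V D_mult (?R x)" for x by (rule relabel_push[OF bij]) (rule m)
      show "?R (pull ?V D_mult x) = pull ?V D_mult (?R x)" for x by (rule relabel_push[OF bij]) (rule m)
    qed (rule relabel_add relabel_diff)+
    ultimately have "?R T = T" by (simp only: relabel_0 T_def)
    then have "?R T (Split k a) = T (Split k a)" by (rule fun_cong)
    then show ?thesis using mem[of a] ab(1) by (simp add: relabel_def \<tau>_def s_def)
  qed
  have "T (Split k m) = unit i (Split k m)"
  proof (cases "\<exists>q. i = Split k q")
    case True
    then obtain q where q: "i = Split k q" by blast
    then have q3: "q \<in> {1, 2, 3}" using i mem by blast
    have u: "unit i (Split k a) = (if a = q then 1 else 0)" for a by (simp add: unit_def q)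
    have s1: "T (Split k 1) + T (Split k 2) + T (Split k 3) = 1" using sum q3 unfolding u by auto
    \<comment> \<open>The values at the other two split vertices are equal, nonnegative integers,
      and the three values add up to 1.\<close>
    have lin: "a = 1 \<and> b = 0 \<and> c = 0" if "a + b + c = 1" "b = c" "0 \<le> a" "0 \<le> b" for a b c :: int
      using that by presburger
    consider "q = 1" | "q = 2" | "q = 3" using q3 by blast
    then show ?thesis
    proof cases
      case 1
      then have "T (Split k 2) = T (Split k 3)" using swap[OF q] by simp
      then have "T (Split k 1) = 1" "T (Split k 2) = 0" "T (Split k 3) = 0"
        using lin[of "T (Split k 1)" "T (Split k 2)" "T (Split k 3)"] s1 pos by simp_all
      then show ?thesis using Split(3) 1 unfolding u by auto
    next
      case 2
      then have "T (Split k 1) = T (Split k 3)" using swap[OF q] by simp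
      then have "T (Split k 1) = 0" "T (Split k 2) = 1" "T (Split k 3) = 0"
        using lin[of "T (Split k 2)" "T (Split k 1)" "T (Split k 3)"] s1 pos by simp_all
      then show ?thesis using Split(3) 2 unfolding u by auto
    next
      case 3
      then have "T (Split k 1) = T (Split k 2)" using swap[OF q] by simp
      then have "T (Split k 1) = 0" "T (Split k 2) = 0" "T (Split k 3) = 1"
        using lin[of "T (Split k 3)" "T (Split k 1)" "T (Split k 2)"] s1 pos by simp_all
      then show ?thesis using Split(3) 3 unfolding u by auto
    qed
  next
    case False
    then have u: "unit i (Split k a) = 0" for a by (auto simp: unit_def)
    have "T (Split k 1) = 0" "T (Split k 2) = 0" "T (Split k 3) = 0"
      using sum pos unfolding u by linarith+
    then show ?thesis using Split(3) unfolding u by auto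
  qed
  then show ?thesis unfolding T_def Split(1) by (auto simp: unit_def)
qed

section \<open>The quotient formula\<close>

lemma unit_eq: "unit i j = (if i = j then 1 else 0)"
  by (auto simp: unit_def)

text \<open>From a path of degree \<open>h - 3\<close> the colour has advanced by
  \<open>h - 3\<close>, whereas the permutation leads from the end of the path back to its source.
  So the exponent \<open>k\<close> is one that completes \<open>h - 3\<close> to a multiple of
  3.\<close>

lemma coloured_quotient:
  assumes V: "finite V" and G: "G = coloured V m"
    and hop: "\<And>x. x \<in> V \<Longrightarrow>
      hop (push (Num ` V) (num_mult m)) (pull (Num ` V) (num_mult m)) (h - 3) 0 0 (unit (Num x)) = unit (Num x)"
    and k: "h - 3 + k = 3 * t"
    and h: "h \<ge> 4" and pf: "perron_frobenius G h \<phi>" and cells: "cell_system G h \<phi> W"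
    and vs: "distinct vs" "set vs = verts G"
  shows "is_mat_quotient (hilbert_series G W vs)
      (1\<^sub>m (length vs) - fps_X ^ h \<cdot>\<^sub>m perm_mat vs (colour_rotation ^^ k))
      (1\<^sub>m (length vs) - fps_X \<cdot>\<^sub>m adjacency_mat G vs
         + fps_X ^ 2 \<cdot>\<^sub>m transpose_mat (adjacency_mat G vs)
         - fps_X ^ 3 \<cdot>\<^sub>m 1\<^sub>m (length vs))"
proof -
  have G': "G = multigraph (Col_verts V) (col_mult m)" unfolding G coloured_def ..
  show ?thesis
  proof (rule graph_quotient[OF finite_Col_verts[OF V] G' h pf cells vs])
    show "z3_symmetry G (colour_rotation ^^ k)" unfolding G' by (rule colour_rotation_z3)
    fix i j assume "i \<in> Col_verts V" "j \<in> Col_verts V"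
    then obtain x c y d where i: "i = Col x c" "x \<in> V" "c < 3" and j: "j = Col y d" "d < 3" by blast
    have "(d + k + (h - 3)) mod 3 = d"
    proof -
      have "(d + k + (h - 3)) mod 3 = (d + 3 * t) mod 3" using k by (simp only: add.assoc add.commute[of k])
      also have "\<dots> = d mod 3" by (rule mod_mult_self2)
      also have "\<dots> = d" using j(2) by (rule mod_less)
      finally show ?thesis .
    qed
    then have "d = (c + (h - 3)) mod 3 \<longleftrightarrow> c = (d + k) mod 3"
      using mod_3_add_cancel[OF i(3), of "h - 3" "d + k"] by metis
    then have "Col x ((c + (h - 3)) mod 3) = j \<longleftrightarrow> i = (colour_rotation ^^ k) j"
      unfolding i(1) j(1) colour_rotation_pow[OF j(2)] su3_vertex.inject by metis
    then show "hop (push (Col_verts V) (col_mult m)) (pull (Col_verts V) (col_mult m)) (h - 3) 0 0 (unit i) j =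
      (if i = (colour_rotation ^^ k) j then 1 else 0)"
      unfolding i(1) hop_coloured[OF V i(2,3) hop[OF i(2)]] unit_eq by (simp only:)
  qed
qed

theorem theorem3p1:
  fixes X :: su3_ade and G :: su3_digraph and h :: nat
    and \<phi> :: "su3_vertex \<Rightarrow> real"
    and W :: "su3_arc \<Rightarrow> su3_arc \<Rightarrow> su3_arc \<Rightarrow> complex"
    and vs :: "su3_vertex list"
  assumes "admissible X" and "G = su3_graph X" and "h = coxeter_number X"
    and "perron_frobenius G h \<phi>" and "cell_system G h \<phi> W"
    and "distinct vs" and "set vs = verts G"
  shows "\<exists>P. (\<exists>\<sigma>. z3_symmetry G \<sigma> \<and> P = perm_mat vs \<sigma>) \<and>
    is_mat_quotient (hilbert_series G W vs)
      (1\<^sub>m (length vs) - fps_X ^ h \<cdot>\<^sub>m P)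
      (1\<^sub>m (length vs) - fps_X \<cdot>\<^sub>m adjacency_mat G vs
         + fps_X ^ 2 \<cdot>\<^sub>m transpose_mat (adjacency_mat G vs)
         - fps_X ^ 3 \<cdot>\<^sub>m 1\<^sub>m (length vs)) \<and>
    P = (case X of
           SU3_A n \<Rightarrow> perm_mat vs (A_rotation n) ^\<^sub>m 2
         | SU3_Dstar n \<Rightarrow> perm_mat vs colour_rotation ^\<^sub>m (2 * n)
         | SU3_E8 \<Rightarrow> perm_mat vs colour_rotation
         | _ \<Rightarrow> 1\<^sub>m (length vs))"
  (is "\<exists>P. _ \<and> ?quotient P \<and> P = ?P")
proof -
  note h = assms(3) and pf = assms(4) and cells = assms(5) and vs = assms(6,7)
  have goal: ?thesis if "z3_symmetry G \<sigma>" "?quotient (perm_mat vs \<sigma>)" "perm_mat vs \<sigma> = ?P" for \<sigma>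
    using that by blast
  have id: "perm_mat vs (\<lambda>v. v) = 1\<^sub>m (length vs)" by (rule perm_mat_id[OF vs(1) refl])
  \<comment> \<open>The common form of all cases with trivial permutation; the nonnegativity premise
    is passed on for D and the sporadic graphs.\<close>
  have one: ?thesis
    if V: "finite V" "G = multigraph V m" and h4: "h \<ge> 4"
      and hop: "\<And>i j. i \<in> V \<Longrightarrow> j \<in> V \<Longrightarrow>
        (\<And>u v. u \<in> V \<Longrightarrow> v \<in> V \<Longrightarrow> 0 \<le> hop (push V m) (pull V m) (h - 3) 0 0 (unit u) v) \<Longrightarrow>
        hop (push V m) (pull V m) (h - 3) 0 0 (unit i) j = (if i = j then 1 else 0)"
      and P: "?P = 1\<^sub>m (length vs)" for V m
  proof (rule goal[OF z3_symmetry_id graph_quotient[OF V h4 pf cells vs z3_symmetry_id]])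
    show "perm_mat vs (\<lambda>v. v) = ?P" unfolding P by (rule id)
  qed (rule hop)
  have rot: "colour_rotation ` set vs \<subseteq> set vs" if "G = coloured V m" for V m
    using vs(2) that by (auto simp: coloured_def)
  show ?thesis
  proof (cases X)
    case (SU3_A n)
    have n: "n \<ge> 4" "h = n" using assms(1,3) by (simp_all add: SU3_A)
    have G: "G = multigraph (A_verts (n - 3)) A_mult" using assms(2) by (simp add: SU3_A A_graph_eq)
    let ?\<sigma> = "A_rotation n ^^ 2"
    have z3: "z3_symmetry G ?\<sigma>" unfolding G by (rule A_hop(2))
    show ?thesis
    proof (rule goal[OF z3 graph_quotient[OF finite_A_verts G _ pf cells vs z3]])
      fix i j assume "i \<in> A_verts (n - 3)" "j \<in> A_verts (n - 3)"
      then show "hop (push (A_verts (n - 3)) A_mult) (pull (A_verts (n - 3)) A_mult) (h - 3) 0 0 (unit i) j =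
        (if i = ?\<sigma> j then 1 else 0)"
        by (simp only: n(2) A_hop(1) relabel_def unit_eq if_True)
    next
      have "A_rotation n ` set vs \<subseteq> set vs" using vs(2) A_rotation_verts(1) by (auto simp: G)
      then show "perm_mat vs ?\<sigma> = ?P" using perm_mat_pow[OF vs(1)] by (simp add: SU3_A)
    qed (use n in simp)
  next
    case (SU3_D n)
    have n: "n \<ge> 5" "h = n" using assms(1,3) by (simp_all add: SU3_D)
    have G: "G = multigraph (D_verts n) D_mult" using assms(2) by (simp add: SU3_D D_graph_eq)
    show ?thesis
    proof (rule one[OF finite_D_verts G])
      fix i j assume "i \<in> D_verts n" "j \<in> D_verts n"
        and "\<And>u v. u \<in> D_verts n \<Longrightarrow> v \<in> D_verts n \<Longrightarrow>
          0 \<le> hop (push (D_verts n) D_mult) (pull (D_verts n) D_mult) (h - 3) 0 0 (unit u) v"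
      then show "hop (push (D_verts n) D_mult) (pull (D_verts n) D_mult) (h - 3) 0 0 (unit i) j = (if i = j then 1 else 0)"
        unfolding n(2) using n(1) by (intro D_hop) simp_all
    qed (use n in \<open>simp_all add: SU3_D\<close>)
  next
    case (SU3_Astar n)
    have n: "n \<ge> 5" "h = n" using assms(1,3) by (simp_all add: SU3_Astar)
    let ?V = "Num ` {1..Astar_size n}" and ?m = "num_mult (Astar_mult n)"
    have G: "G = multigraph ?V ?m" using assms(2) by (simp add: SU3_Astar numbered_def)
    show ?thesis
    proof (rule one[OF _ G])
      fix i j assume "i \<in> ?V"
      then show "hop (push ?V ?m) (pull ?V ?m) (h - 3) 0 0 (unit i) j = (if i = j then 1 else 0)"
        by (simp only: n(2) Astar_hop[OF n(1)] unit_eq)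
    qed (use n in \<open>simp_all add: SU3_Astar\<close>)
  next
    case (SU3_Dstar n)
    have n: "n \<ge> 5" "h = n" using assms(1,3) by (simp_all add: SU3_Dstar)
    have G: "G = coloured {1..Astar_size n} (Astar_mult n)" using assms(2) by (simp add: SU3_Dstar)
    \<comment> \<open>The shift by \<open>n - 3\<close> is undone by \<open>2 * n\<close> further
      steps, since together they make \<open>3 * (n - 1)\<close>.\<close>
    have k: "h - 3 + 2 * n = 3 * (n - 1)" using n by simp
    have z3: "z3_symmetry G (colour_rotation ^^ (2 * n))"
      unfolding G coloured_def by (rule colour_rotation_z3)
    show ?thesis
    proof (rule goal[OF z3 coloured_quotient[OF _ G _ k _ pf cells vs]])
      fix x assume "x \<in> {1..Astar_size n}"
      then show "hop (push (Num ` {1..Astar_size n}) (num_mult (Astar_mult n)))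
        (pull (Num ` {1..Astar_size n}) (num_mult (Astar_mult n))) (h - 3) 0 0 (unit (Num x)) = unit (Num x)"
        unfolding n(2) by (intro Astar_hop[OF n(1)] imageI)
    qed (use n perm_mat_pow[OF vs(1) rot[OF G]] in \<open>simp_all add: SU3_Dstar\<close>)
  next
    case SU3_E8star
    let ?V = "Num ` adj_verts E8star_adj" and ?m = "num_mult (adj_mult E8star_adj)"
    have G: "G = multigraph ?V ?m" and h8: "h = 8" using assms(2) h by (simp_all add: SU3_E8star numbered_adj_eq)
    show ?thesis
    proof (rule one[OF _ G])
      fix i j assume "i \<in> ?V"
      then have "hop (push ?V ?m) (pull ?V ?m) 5 0 0 (unit i) j = unit i j" by (simp only: E8star_hop)
      moreover have "h - 3 = 5" using h8 by simp
      ultimately show "hop (push ?V ?m) (pull ?V ?m) (h - 3) 0 0 (unit i) j = (if i = j then 1 else 0)"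
        by (simp only: unit_eq)
    qed (simp_all add: h8 SU3_E8star finite_adj_verts)
  next
    case SU3_E8
    have G: "G = coloured (adj_verts E8star_adj) (adj_mult E8star_adj)" and h8: "h = 8"
      using assms(2) h by (simp_all add: SU3_E8)
    \<comment> \<open>Degree 5 shifts the colour by 2 modulo 3, so a single further step undoes
      it.\<close>
    have k: "h - 3 + 1 = 3 * 2" using h8 by simp
    have z3: "z3_symmetry G (colour_rotation ^^ 1)" unfolding G coloured_def by (rule colour_rotation_z3)
    show ?thesis
    proof (rule goal[OF z3 coloured_quotient[OF _ G _ k _ pf cells vs]])
      fix x assume "x \<in> adj_verts E8star_adj"
      then show "hop (push (Num ` adj_verts E8star_adj) (num_mult (adj_mult E8star_adj)))
        (pull (Num ` adj_verts E8star_adj) (num_mult (adj_mult E8star_adj))) (h - 3) 0 0 (unit (Num x)) = unit (Num x)"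
        using E8star_hop[of "Num x"] h8 by simp
    qed (use h8 in \<open>simp_all add: SU3_E8 finite_adj_verts\<close>)
  next
    case SU3_E12_1
    have G: "G = multigraph (adj_verts E12_1_adj) (adj_mult E12_1_adj)" and h12: "h = 12" "h - 3 = 9"
      using assms(2) h by (simp_all add: SU3_E12_1 adj_graph_def)
    show ?thesis
      by (rule one[OF _ G _ adj_hop[OF adj_closed_graphs(2) E12_1_periodic[folded h12(2)]]])
        (simp_all add: h12 SU3_E12_1 finite_adj_verts)
  next
    case SU3_E12_2
    have G: "G = multigraph (adj_verts E12_2_adj) (adj_mult E12_2_adj)" and h12: "h = 12" "h - 3 = 9"
      using assms(2) h by (simp_all add: SU3_E12_2 adj_graph_def)
    show ?thesis
      by (rule one[OF _ G _ adj_hop[OF adj_closed_graphs(3) E12_2_periodic[folded h12(2)]]])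
        (simp_all add: h12 SU3_E12_2 finite_adj_verts)
  next
    case SU3_E12_4
    have G: "G = multigraph (adj_verts E12_4_adj) (adj_mult E12_4_adj)" and h12: "h = 12" "h - 3 = 9"
      using assms(2) h by (simp_all add: SU3_E12_4 adj_graph_def)
    show ?thesis
      by (rule one[OF _ G _ adj_hop[OF adj_closed_graphs(4) E12_4_periodic[folded h12(2)]]])
        (simp_all add: h12 SU3_E12_4 finite_adj_verts)
  next
    case SU3_E12_5
    have G: "G = multigraph (Num ` adj_verts E12_5_adj) (num_mult (adj_mult E12_5_adj))" and h12: "h = 12" "h - 3 = 9"
      using assms(2) h by (simp_all add: SU3_E12_5 numbered_adj_eq)
    show ?thesis
      by (rule one[OF _ G _ numbered_adj_hop[OF adj_closed_graphs(5) E12_5_periodic[folded h12(2)]]])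
        (simp_all add: h12 SU3_E12_5 finite_adj_verts)
  next
    case SU3_E24
    have G: "G = multigraph (Num ` adj_verts E24_adj) (num_mult (adj_mult E24_adj))" and h24: "h = 24" "h - 3 = 21"
      using assms(2) h by (simp_all add: SU3_E24 numbered_adj_eq)
    show ?thesis
      by (rule one[OF _ G _ numbered_adj_hop[OF adj_closed_graphs(6) E24_periodic[folded h24(2)]]])
        (simp_all add: h24 SU3_E24 finite_adj_verts)
  qed
qed

end
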